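(* Let $m>0$, let $V$ satisfy the standing assumptions on the potential listed in the context, and let $H$ be the Dirac operator in $L^2(\mathbb{R},\mathbb{C}^2)$ $$H=-i\partial_x\sigma_1+m\sigma_3+iVI_2,\qquad\mathrm{Dom}(H)=H^1(\mathbb{R},\mathbb{C}^2)\cap\mathrm{Dom}(VI_2).$$ For all sufficiently large $b>0$ let $x_b\in(0,\infty)$ be the unique solution of $V(x_b)=b$, and let $\lambda_b:=a(b)+ib$, $b>0$, with a real-valued function $a$ satisfying $a(b)V'(x_b)^{-\frac12}=\mathcal{O}(1)$ as $b\to+\infty$. (i) We have $$\|(H-ib)^{-1}\|=\frac1m\left(1+\mathcal{O}\big(x_b^{-\frac12}+b^{-\frac12}\big)\right),\qquad b\to+\infty.$$ (ii) Suppose in addition that $V'(x)\to+\infty$ as $x\to+\infty$. Then as $b\to+\infty$ $$\|(H-\lambda_b)^{-1}\|=\frac1m\exp\left(\frac{a(b)^2}{V'(x_b)}\right)\left(1+\mathcal{O}(x_b^{-\frac12})+\mathcal{O}(V'(x_b)^{-\frac12})\right).$$ Moreover, for the curve $b\mapsto\lambda_b=a(b)+ib$, where $$a(b)^2=V'(x_b)\log\frac m\varepsilon$$ with a fixed $\varepsilon>0$, we have as $b\to+\infty$ $$\|(H-\lambda_b)^{-1}\|=\frac1\varepsilon\left(1+\mathcal{O}(x_b^{-\frac12})+\mathcal{O}(V'(x_b)^{-\frac12})\right).$$ (iii) Suppose in addition that $V'(x)\approx1$ as $x\to+\infty$. Then $\|(H-\lambda_b)^{-1}\|\approx1$ as $b\to+\infty$.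 (In this case $a(b)=\mathcal{O}(1)$ as $b\to+\infty$.) (iv) Suppose in addition that $V'(x)\to0$ as $x\to+\infty$. Then $$\|(H-\lambda_b)^{-1}\|=\frac1m\left(1+\mathcal{O}(b^{-\frac12})+\mathcal{O}(V'(x_b)^{\frac12})\right),\qquad b\to+\infty.$$ (In this case $a(b)=o(1)$ as $b\to+\infty$.)
   Context: $\sigma_1=\begin{pmatrix}0&1\\1&0\end{pmatrix}$, $\sigma_3=\begin{pmatrix}1&0\\0&-1\end{pmatrix}$, $I_2$ is the $2\times2$ identity matrix; $\mathrm{Dom}(VI_2)=\{u\in L^2(\mathbb{R},\mathbb{C}^2):VI_2u\in L^2(\mathbb{R},\mathbb{C}^2)\}$. $\|\cdot\|$ is the operator norm on $L^2(\mathbb{R},\mathbb{C}^2)$. Standing assumptions on $V$: $V\in C^1(\mathbb{R},\mathbb{R})\cap C^2((x_0,\infty),\mathbb{R})$ for some $x_0\ge0$; there exist $\varepsilon_0\in(0,1)$ and $M_0>0$ such that $|V'(x)|\le\varepsilon_0|V(x)|^2+M_0$ for all $x\in\mathbb{R}$; and (i) $\lim_{x\to+\infty}V(x)=+\infty$ and $V'(x)>0$ for $x>x_0$; (ii) there exists $M\in\mathbb{R}$ such that $V(x)\le M$ for $x<0$; (iii) $V'(x)\approx V(x)x^{-1}$ and $|V''(x)|\lesssim V'(x)x^{-1}$ for $x>x_0$. Here $a\lesssim b$ means $a\le Cb$ with $C>0$ independent of the variables involved, and $a\approx b$ means $a\lesssim b$ and $b\lesssim a$. *)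

theory Defs
  imports "HOL-Analysis.Analysis" "HOL-Library.Landau_Symbols"
begin

section \<open>The space $L^2(\mathbb{R},\mathbb{C}^2)$ and its unbounded operators\<close>

text \<open>
  Elements of $L^2$ are represented by Borel functions; equality in $L^2$ is equality
  almost everywhere.
\<close>

type_synonym spinor = "real \<Rightarrow> complex ^ 2"

definition L2 :: "spinor set" where
  "L2 = {u \<in> borel_measurable lborel. integrable lborel (\<lambda>x. (norm (u x))\<^sup>2)}"

definition L2_norm :: "spinor \<Rightarrow> real" where
  "L2_norm u = sqrt (\<integral>x. (norm (u x))\<^sup>2 \<partial>lborel)"

text \<open>The supremum is formed as in \<^const>\<open>onorm\<close>: null functions contribute \<open>0\<close> since \<open>t / 0 = 0\<close>.\<close>

definition L2_onorm :: "(spinor \<Rightarrow> spinor) \<Rightarrow> real" where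
  "L2_onorm A = (SUP f\<in>L2. L2_norm (A f) / L2_norm f)"

text \<open>An unbounded operator is given by its domain and its action.\<close>

type_synonym operator = "spinor set \<times> (spinor \<Rightarrow> spinor)"

definition solves :: "operator \<Rightarrow> complex \<Rightarrow> spinor \<Rightarrow> spinor \<Rightarrow> bool" where
  "solves T z f u \<longleftrightarrow> u \<in> fst T \<and> (AE x in lborel. snd T u x - z *s u x = f x)"

definition resolvent :: "operator \<Rightarrow> complex \<Rightarrow> spinor \<Rightarrow> spinor" where
  "resolvent T z f = (SOME u. solves T z f u)"

text \<open>
  \<open>T - z\<close> is a bijection from its domain onto $L^2$ (modulo null sets) with bounded inverse.
\<close>

definition resolvent_set :: "operator \<Rightarrow> complex set" where
  "resolvent_set T = {z.
     (\<forall>f\<in>L2. \<exists>u. solves T z f u) \<and>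
     (\<forall>f\<in>L2. \<forall>u v. solves T z f u \<longrightarrow> solves T z f v \<longrightarrow> (AE x in lborel. u x = v x)) \<and>
     (\<exists>C. \<forall>f\<in>L2. L2_norm (resolvent T z f) \<le> C * L2_norm f)}"

section \<open>The Sobolev space $H^1(\mathbb{R},\mathbb{C}^2)$\<close>

text \<open>
  Test functions are real-valued and $C^1_c$. Testing with $C^\infty_c$ instead yields the same
  weak derivatives, by mollification.
\<close>

definition test_function :: "(real \<Rightarrow> real) \<Rightarrow> bool" where
  "test_function \<phi> \<longleftrightarrow> \<phi> C1_differentiable_on UNIV \<and> compact (closure {x. \<phi> x \<noteq> 0})"

definition is_weak_deriv :: "spinor \<Rightarrow> spinor \<Rightarrow> bool" where
  "is_weak_deriv u v \<longleftrightarrow> (\<forall>\<phi>. test_function \<phi> \<longrightarrow>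
     (\<integral>x. deriv \<phi> x *\<^sub>R u x \<partial>lborel) = - (\<integral>x. \<phi> x *\<^sub>R v x \<partial>lborel))"

definition H1 :: "spinor set" where
  "H1 = {u \<in> L2. \<exists>v\<in>L2. is_weak_deriv u v}"

text \<open>For \<open>u \<in> H1\<close> the chosen function is determined up to a null set.\<close>

definition weak_deriv :: "spinor \<Rightarrow> spinor" where
  "weak_deriv u = (SOME v. v \<in> L2 \<and> is_weak_deriv u v)"

section \<open>The Dirac operator\<close>

definition \<sigma>\<^sub>1 :: "complex ^ 2 ^ 2" where
  "\<sigma>\<^sub>1 = vector [vector [0, 1], vector [1, 0]]"

definition \<sigma>\<^sub>3 :: "complex ^ 2 ^ 2" where
  "\<sigma>\<^sub>3 = vector [vector [1, 0], vector [0, -1]]"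

definition mult_dom :: "(real \<Rightarrow> real) \<Rightarrow> spinor set" where
  "mult_dom V = {u \<in> L2. (\<lambda>x. complex_of_real (V x) *s u x) \<in> L2}"

definition dirac :: "real \<Rightarrow> (real \<Rightarrow> real) \<Rightarrow> operator" where
  "dirac m V = (H1 \<inter> mult_dom V,
     \<lambda>u x. - \<i> *s (\<sigma>\<^sub>1 *v weak_deriv u x) + complex_of_real m *s (\<sigma>\<^sub>3 *v u x)
           + (\<i> * complex_of_real (V x)) *s u x)"

definition resolvent_norm :: "real \<Rightarrow> (real \<Rightarrow> real) \<Rightarrow> complex \<Rightarrow> real" where
  "resolvent_norm m V z = L2_onorm (resolvent (dirac m V) z)"

section \<open>The potential\<close>

definition lesssim_on :: "real set \<Rightarrow> (real \<Rightarrow> real) \<Rightarrow> (real \<Rightarrow> real) \<Rightarrow> bool" where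
  "lesssim_on S f g \<longleftrightarrow> (\<exists>C>0. \<forall>x\<in>S. f x \<le> C * g x)"

definition approx_on :: "real set \<Rightarrow> (real \<Rightarrow> real) \<Rightarrow> (real \<Rightarrow> real) \<Rightarrow> bool" where
  "approx_on S f g \<longleftrightarrow> lesssim_on S f g \<and> lesssim_on S g f"

definition admissible_potential :: "(real \<Rightarrow> real) \<Rightarrow> bool" where
  "admissible_potential V \<longleftrightarrow>
     V C1_differentiable_on UNIV \<and>
     (\<exists>\<epsilon>\<^sub>0 M\<^sub>0. 0 < \<epsilon>\<^sub>0 \<and> \<epsilon>\<^sub>0 < 1 \<and> 0 < M\<^sub>0 \<and>
        (\<forall>x. \<bar>deriv V x\<bar> \<le> \<epsilon>\<^sub>0 * \<bar>V x\<bar>\<^sup>2 + M\<^sub>0)) \<and>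
     filterlim V at_top at_top \<and>
     (\<exists>M. \<forall>x<0. V x \<le> M) \<and>
     (\<exists>x\<^sub>0\<ge>0.
        deriv V C1_differentiable_on {x\<^sub>0<..} \<and>
        (\<forall>x>x\<^sub>0. 0 < deriv V x) \<and>
        approx_on {x\<^sub>0<..} (deriv V) (\<lambda>x. V x / x) \<and>
        lesssim_on {x\<^sub>0<..} (\<lambda>x. \<bar>deriv (deriv V) x\<bar>) (\<lambda>x. deriv V x / x))"

text \<open>The point $x_b$; meaningful for large \<open>b\<close> only.\<close>

definition turning_point :: "(real \<Rightarrow> real) \<Rightarrow> real \<Rightarrow> real" where
  "turning_point V b = (THE x. 0 < x \<and> V x = b)"

end

theory Submission
  imports Defs
begin

text \<open>
  Put \<open>B = V - b\<close>. In the eigenbasis of \<open>\<sigma>\<^sub>1\<close> the equation \<open>(H - \<lambda>\<^sub>b) u = f\<close> becomes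
  \<open>L\<^sub>- w\<^sub>1 - i m w\<^sub>2 = g\<^sub>1\<close>, \<open>L\<^sub>+ w\<^sub>2 - i m w\<^sub>1 = g\<^sub>2\<close> with \<open>L\<^sub>\<plusminus> = \<plusminus> d/dx + B + i a\<close>. For \<open>a = 0\<close> the cross terms
  of the norm of the left-hand side cancel:
  \<open>\<parallel>g\<parallel>\<^sup>2 = m\<^sup>2 \<parallel>w\<parallel>\<^sup>2 + \<parallel>L\<^sub>- w\<^sub>1\<parallel>\<^sup>2 + \<parallel>L\<^sub>+ w\<^sub>2\<parallel>\<^sup>2\<close>, and \<open>k = exp (- \<integral> B)\<close> satisfies \<open>L\<^sub>+ k = 0\<close>. So
  the resolvent norm at \<open>i b\<close> equals \<open>1 / m\<close> exactly, and it lies between \<open>1 / (m + |a|)\<close> and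
  \<open>1 / (m - |a|)\<close> when \<open>|a| < m\<close>, which gives (i) and (iv).

  For (ii) the gauge transformation \<open>w\<^sub>1 = e\<^sup>i\<^sup>a\<^sup>x v\<^sub>1\<close>, \<open>w\<^sub>2 = e\<^sup>-\<^sup>i\<^sup>a\<^sup>x v\<^sub>2\<close> moves \<open>a\<close> into the coupling. The
  operators \<open>\<plusminus> d/dx + B\<close> are bounded below by a multiple of \<open>V'(x\<^sub>b)\<^sup>1\<^sup>/\<^sup>2\<close> off the kernel spanned by
  \<open>k\<close>. Only the coupling of \<open>k\<close> to itself survives, so the norm is
  \<open>1 / (m q)\<close> up to a factor \<open>1 + O(V'(x\<^sub>b)\<^sup>-\<^sup>1\<^sup>/\<^sup>2)\<close> with \<open>q = |\<integral> e\<^sup>-\<^sup>2\<^sup>i\<^sup>a\<^sup>x k\<^sup>2| / \<integral> k\<^sup>2\<close>. Since \<open>k\<^sup>2\<close> is nearly a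
  Gaussian, \<open>q\<close> is close to \<open>exp (- a\<^sup>2 / V'(x\<^sub>b))\<close>.

  For (iii) the potential \<open>B\<close> is compared near \<open>x\<^sub>b\<close> with \<open>V'(x\<^sub>b) (x - x\<^sub>b)\<close>. Ladder operators raise the mass of
  the linear model until it dominates \<open>a\<close>, and away from \<open>x\<^sub>b\<close> the size of \<open>B\<close> controls the solution.
\<close>

section \<open>Square-integrable functions\<close>

text \<open>The a priori bounds say nothing about the range of \<open>H - \<lambda>\<close>;
  surjectivity is reached by continuation. The start is a triangular system, in which the free
  multiple of \<open>k\<close> in the kernel of \<open>L_+\<close> is spent on the one orthogonality
  condition for solving with \<open>L_-\<close>. From there the couplings, and then
  \<open>a\<close>, are moved in small steps, so each bound is proved uniformly along the whole
  segment from 0 to \<open>a\<close>. Limits are taken pointwise along continuous representatives,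
  with Fatou's lemma in the role of completeness. All cases share one fact:
  \<open>V'(x_b) x_b\<close> is at least \<open>b / C\<close> and tends to infinity for every
  admissible \<open>V\<close>. Hence \<open>V - b\<close> eventually fits the locale
  \<open>wall\<close>, with gap \<open>sqrt (V'(x_b) / L)\<close>, whatever the growth of
  \<open>V'\<close>. In case (iii) this gap stays bounded and the projection onto \<open>k\<close>
  offers no small parameter. There n ladder steps on a ball of radius R cost a factor of order R^(2
  n), while n + 1 successive doublings of the radius gain r^(-2 (n + 1)) on the exterior part, R
  being a fixed multiple of r; a large r closes the argument.\<close>

definition l2 :: "(real \<Rightarrow> 'a::euclidean_space) \<Rightarrow> bool" where
  "l2 f \<longleftrightarrow> f \<in> borel_measurable borel \<and> integrable lborel (\<lambda>x. (norm (f x))\<^sup>2)"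

definition l2n :: "(real \<Rightarrow> 'a::euclidean_space) \<Rightarrow> real" where
  "l2n f = sqrt (\<integral>x. (norm (f x))\<^sup>2 \<partial>lborel)"

lemma l2_meas [measurable_dest]: "l2 f \<Longrightarrow> f \<in> borel_measurable borel"
  by (simp add: l2_def)

lemma l2_int: "l2 f \<Longrightarrow> integrable lborel (\<lambda>x. (norm (f x))\<^sup>2)"
  by (simp add: l2_def)

lemma l2n_nonneg [simp]: "l2n f \<ge> 0"
  by (simp add: l2n_def)

lemma l2n_sq: "(l2n f)\<^sup>2 = (\<integral>x. (norm (f x))\<^sup>2 \<partial>lborel)"
  by (simp add: l2n_def)

lemma l2_bound:
  assumes "l2 f" "g \<in> borel_measurable borel" "\<And>x. norm (g x) \<le> C * norm (f x)" "C \<ge> 0"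
  shows "l2 g" "l2n g \<le> C * l2n f"
proof -
  have *: "(norm (g x))\<^sup>2 \<le> C\<^sup>2 * (norm (f x))\<^sup>2" for x
    using power_mono[OF assms(3)[of x], of 2] by (simp add: power_mult_distrib)
  have i: "integrable lborel (\<lambda>x. C\<^sup>2 * (norm (f x))\<^sup>2)"
    using l2_int[OF assms(1)] by simp
  have j: "integrable lborel (\<lambda>x. (norm (g x))\<^sup>2)"
    by (rule Bochner_Integration.integrable_bound[OF i]) (use assms(2) * in \<open>auto\<close>)
  then show "l2 g" using assms(2) by (simp add: l2_def)
  have "(l2n g)\<^sup>2 \<le> (C * l2n f)\<^sup>2"
    using integral_mono[OF j i *] by (simp add: l2n_sq power_mult_distrib)
  then show "l2n g \<le> C * l2n f" by (rule power2_le_imp_le) (simp add: assms(4))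
qed

lemma l2_scale: "l2 f \<Longrightarrow> l2 (\<lambda>x. c * f x)" for f :: "real \<Rightarrow> complex"
  by (rule l2_bound(1)[where C = "norm c"]) (auto simp: norm_mult l2_meas)

lemma l2n_scale: "l2n (\<lambda>x. c * f x) = norm c * l2n f" for f :: "real \<Rightarrow> complex"
  by (simp add: l2n_def norm_mult power_mult_distrib real_sqrt_mult)

lemma l2_minus: "l2 f \<Longrightarrow> l2 (\<lambda>x. - f x)"
  by (rule l2_bound(1)[where C = 1]) (auto simp: l2_meas)

lemma l2n_minus: "l2n (\<lambda>x. - f x) = l2n f"
  by (simp add: l2n_def)

lemma l2_add:
  assumes "l2 f" "l2 g" shows "l2 (\<lambda>x. f x + g x)"
proof -
  note [measurable] = l2_meas[OF assms(1)] l2_meas[OF assms(2)]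
  have *: "(norm (f x + g x))\<^sup>2 \<le> 2 * (norm (f x))\<^sup>2 + 2 * (norm (g x))\<^sup>2" for x
  proof -
    have "(norm (f x + g x))\<^sup>2 \<le> (norm (f x) + norm (g x))\<^sup>2"
      by (intro power_mono norm_triangle_ineq) auto
    also have "\<dots> \<le> 2 * (norm (f x))\<^sup>2 + 2 * (norm (g x))\<^sup>2"
      using sum_squares_bound[of "norm (f x)" "norm (g x)"] by (simp add: power2_sum)
    finally show ?thesis .
  qed
  have i: "integrable lborel (\<lambda>x. 2 * (norm (f x))\<^sup>2 + 2 * (norm (g x))\<^sup>2)"
    using l2_int[OF assms(1)] l2_int[OF assms(2)] by simp
  have "integrable lborel (\<lambda>x. (norm (f x + g x))\<^sup>2)"
    by (rule Bochner_Integration.integrable_bound[OF i]) (use * in \<open>auto\<close>)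
  then show ?thesis by (simp add: l2_def)
qed

lemma l2_diff: "l2 f \<Longrightarrow> l2 g \<Longrightarrow> l2 (\<lambda>x. f x - g x)"
  using l2_add[of f "\<lambda>x. - g x"] l2_minus[of g] by simp

lemma l2_mult_integrable:
  fixes f :: "real \<Rightarrow> 'a::euclidean_space" and g :: "real \<Rightarrow> 'b::euclidean_space"
  assumes "l2 f" "l2 g"
  shows "integrable lborel (\<lambda>x. norm (f x) * norm (g x))"
proof -
  note [measurable] = l2_meas[OF assms(1)] l2_meas[OF assms(2)]
  have i: "integrable lborel (\<lambda>x. (norm (f x))\<^sup>2 + (norm (g x))\<^sup>2)"
    using l2_int[OF assms(1)] l2_int[OF assms(2)] by simp
  have *: "norm (f x) * norm (g x) \<le> (norm (f x))\<^sup>2 + (norm (g x))\<^sup>2" for x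
  proof -
    have "0 \<le> norm (f x) * norm (g x)" by simp
    then show ?thesis
      using sum_squares_bound[of "norm (f x)" "norm (g x)"] by linarith
  qed
  show ?thesis
    by (rule Bochner_Integration.integrable_bound[OF i]) (use * in \<open>auto\<close>)
qed

lemma mult_divide_Suc_le:
  fixes e t :: real
  assumes "e > 0" "t \<ge> 0"
  shows "e / (t + 1) * t \<le> e"
proof -
  have "e * t \<le> e * (t + 1)" using assms by simp
  then show ?thesis using assms by (simp add: pos_divide_le_eq)
qed

text \<open>Integrates 2 f g <= s f^2 + g^2 / s and optimises in s, the optimum being
  \<open>l2n g / l2n f\<close>. If one of the norms vanishes there is no optimum, and s is sent to
  infinity or to 0 instead.\<close>

lemma l2_Cauchy_Schwarz:
  fixes f :: "real \<Rightarrow> 'a::euclidean_space" and g :: "real \<Rightarrow> 'b::euclidean_space"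
  assumes "l2 f" "l2 g"
  shows "(\<integral>x. norm (f x) * norm (g x) \<partial>lborel) \<le> l2n f * l2n g"
proof -
  note fg = l2_mult_integrable[OF assms]
  let ?I = "\<integral>x. norm (f x) * norm (g x) \<partial>lborel"
  have *: "2 * ?I \<le> s * (l2n f)\<^sup>2 + (l2n g)\<^sup>2 / s" if "s > 0" for s
  proof -
    have "2 * (norm (f x) * norm (g x)) \<le> s * (norm (f x))\<^sup>2 + (norm (g x))\<^sup>2 / s" for x
    proof -
      have "0 \<le> (s * norm (f x) - norm (g x))\<^sup>2 / s" using that by simp
      also have "\<dots> = s * (norm (f x))\<^sup>2 + (norm (g x))\<^sup>2 / s - 2 * (norm (f x) * norm (g x))"
        using that by (simp add: power2_eq_square field_simps)
      finally show ?thesis by simp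
    qed
    then have "(\<integral>x. 2 * (norm (f x) * norm (g x)) \<partial>lborel)
        \<le> (\<integral>x. s * (norm (f x))\<^sup>2 + (norm (g x))\<^sup>2 / s \<partial>lborel)"
      using fg l2_int[OF assms(1)] l2_int[OF assms(2)] by (intro integral_mono) auto
    then show ?thesis
      using fg l2_int[OF assms(1)] l2_int[OF assms(2)] by (simp add: l2n_sq)
  qed
  consider "l2n f = 0" | "l2n g = 0" | "l2n f > 0" "l2n g > 0"
    by (metis l2n_nonneg less_eq_real_def)
  then show ?thesis
  proof cases
    case 1
    have "?I \<le> e" if "e > 0" for e
    proof -
      have "2 * ?I \<le> (l2n g)\<^sup>2 / (((l2n g)\<^sup>2 + 1) / e)"
        using *[of "((l2n g)\<^sup>2 + 1) / e"] that 1 by (simp add: add_nonneg_pos)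
      also have "\<dots> \<le> e" using mult_divide_Suc_le[OF that, of "(l2n g)\<^sup>2"] by (simp add: mult.commute)
      finally show ?thesis using that by simp
    qed
    then show ?thesis using 1 field_le_epsilon[of ?I 0] by simp
  next
    case 2
    have "?I \<le> e" if "e > 0" for e
    proof -
      have "2 * ?I \<le> e / ((l2n f)\<^sup>2 + 1) * (l2n f)\<^sup>2"
        using *[of "e / ((l2n f)\<^sup>2 + 1)"] that 2 by (simp add: add_nonneg_pos)
      also have "\<dots> \<le> e" using mult_divide_Suc_le[OF that, of "(l2n f)\<^sup>2"] by simp
      finally show ?thesis using that by simp
    qed
    then show ?thesis using 2 field_le_epsilon[of ?I 0] by simp
  next
    case 3
    then show ?thesis using *[of "l2n g / l2n f"]
      by (simp add: power2_eq_square field_simps)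
  qed
qed

lemma l2n_triangle:
  assumes "l2 f" "l2 g"
  shows "l2n (\<lambda>x. f x + g x) \<le> l2n f + l2n g"
proof -
  have i: "integrable lborel (\<lambda>x. (norm (f x))\<^sup>2 + (norm (g x))\<^sup>2 + 2 * (norm (f x) * norm (g x)))"
    using l2_int[OF assms(1)] l2_int[OF assms(2)] l2_mult_integrable[OF assms] by simp
  have "(l2n (\<lambda>x. f x + g x))\<^sup>2 \<le> (\<integral>x. (norm (f x))\<^sup>2 + (norm (g x))\<^sup>2 + 2 * (norm (f x) * norm (g x)) \<partial>lborel)"
    unfolding l2n_sq
  proof (rule integral_mono[OF l2_int[OF l2_add[OF assms]] i])
    fix x show "(norm (f x + g x))\<^sup>2 \<le> (norm (f x))\<^sup>2 + (norm (g x))\<^sup>2 + 2 * (norm (f x) * norm (g x))"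
      using power_mono[OF norm_triangle_ineq[of "f x" "g x"], of 2] by (simp add: power2_sum)
  qed
  also have "\<dots> = (l2n f)\<^sup>2 + (l2n g)\<^sup>2 + 2 * (\<integral>x. norm (f x) * norm (g x) \<partial>lborel)"
    using l2_int[OF assms(1)] l2_int[OF assms(2)] l2_mult_integrable[OF assms] by (simp add: l2n_sq)
  also have "\<dots> \<le> (l2n f + l2n g)\<^sup>2"
    using l2_Cauchy_Schwarz[OF assms] by (simp add: power2_sum)
  finally show ?thesis by (rule power2_le_imp_le) simp
qed

lemma l2n_triangle_diff: "l2 f \<Longrightarrow> l2 g \<Longrightarrow> l2n (\<lambda>x. f x - g x) \<le> l2n f + l2n g"
  using l2n_triangle[of f "\<lambda>x. - g x"] l2_minus[of g] by (simp add: l2n_minus)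

lemma l2n_mono:
  assumes "l2 f" "g \<in> borel_measurable borel" "\<And>x. norm (g x) \<le> norm (f x)"
  shows "l2n g \<le> l2n f"
  using l2_bound(2)[OF assms(1,2), of 1] assms(3) by simp

lemma l2_Pair:
  fixes f g :: "real \<Rightarrow> complex"
  assumes "l2 f" "l2 g"
  shows "l2 (\<lambda>x. (f x, g x))"
  using assms unfolding l2_def by (auto simp: norm_prod_def borel_measurable_Pair)

lemma l2n_Pair:
  fixes f g :: "real \<Rightarrow> complex"
  assumes "l2 f" "l2 g"
  shows "(l2n (\<lambda>x. (f x, g x)))\<^sup>2 = (l2n f)\<^sup>2 + (l2n g)\<^sup>2"
  using l2_int[OF assms(1)] l2_int[OF assms(2)] by (simp add: l2n_sq norm_prod_def)

text \<open>Takes the place of completeness of L2: solutions are built as pointwise limits whose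
  approximants are known only through a uniform norm bound. Convergence at every point makes the
  limit a definite Borel function.\<close>

lemma l2_Fatou:
  assumes "\<And>n. l2 (f n)" "\<And>n. l2n (f n) \<le> C" "\<And>x. (\<lambda>n. f n x) \<longlonglongrightarrow> g x" 
  shows "l2 g" "l2n g \<le> C"
proof -
  have C: "C \<ge> 0" using assms(2)[of 0] l2n_nonneg[of "f 0"] by linarith
  have m: "g \<in> borel_measurable borel"
    by (rule borel_measurable_LIMSEQ_metric[where f = f]) (simp_all add: assms(1)[THEN l2_meas] assms(3))
  have mf: "f n \<in> borel_measurable borel" for n by (rule l2_meas) (rule assms(1))
  have eq: "(\<integral>\<^sup>+x. ennreal ((norm (f n x))\<^sup>2) \<partial>lborel) \<le> ennreal (C\<^sup>2)" for n
  proof -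
    have "(\<integral>\<^sup>+x. ennreal ((norm (f n x))\<^sup>2) \<partial>lborel) = ennreal ((l2n (f n))\<^sup>2)"
      unfolding l2n_sq using l2_int[OF assms(1)[of n]] by (intro nn_integral_eq_integral) auto
    also have "\<dots> \<le> ennreal (C\<^sup>2)" using power_mono[OF assms(2)[of n], of 2] by (intro ennreal_leI) simp
    finally show ?thesis .
  qed
  have "(\<integral>\<^sup>+x. ennreal ((norm (g x))\<^sup>2) \<partial>lborel) = (\<integral>\<^sup>+x. liminf (\<lambda>n. ennreal ((norm (f n x))\<^sup>2)) \<partial>lborel)"
  proof (rule nn_integral_cong)
    fix x
    have "(\<lambda>n. ennreal ((norm (f n x))\<^sup>2)) \<longlonglongrightarrow> ennreal ((norm (g x))\<^sup>2)"
      by (intro tendsto_ennrealI tendsto_intros assms(3))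
    then show "ennreal ((norm (g x))\<^sup>2) = liminf (\<lambda>n. ennreal ((norm (f n x))\<^sup>2))"
      by (intro lim_imp_Liminf[symmetric]) auto
  qed
  also have "\<dots> \<le> liminf (\<lambda>n. \<integral>\<^sup>+x. ennreal ((norm (f n x))\<^sup>2) \<partial>lborel)"
    by (intro nn_integral_liminf) (use mf in auto)
  also have "\<dots> \<le> liminf (\<lambda>n. ennreal (C\<^sup>2))"
    by (intro Liminf_mono) (use eq in auto)
  also have "\<dots> = ennreal (C\<^sup>2)" by (simp add: Liminf_const)
  finally have le: "(\<integral>\<^sup>+x. ennreal ((norm (g x))\<^sup>2) \<partial>lborel) \<le> ennreal (C\<^sup>2)" .
  then have i: "integrable lborel (\<lambda>x. (norm (g x))\<^sup>2)"
    using m by (intro integrableI_nonneg) (auto simp: top.not_eq_extremum le_less_trans)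
  then show "l2 g" using m by (simp add: l2_def)
  have "ennreal ((l2n g)\<^sup>2) \<le> ennreal (C\<^sup>2)"
    using le i unfolding l2n_sq by (subst (asm) nn_integral_eq_integral) auto
  then have "(l2n g)\<^sup>2 \<le> C\<^sup>2" by simp
  then show "l2n g \<le> C" using C by (rule power2_le_imp_le)
qed

lemma l2n_zero_AE: "l2 f \<Longrightarrow> l2n f = 0 \<Longrightarrow> AE x in lborel. f x = 0"
  using integral_nonneg_eq_0_iff_AE[of lborel "\<lambda>x. (norm (f x))\<^sup>2"]
  by (simp add: l2n_def l2_int)

lemma l2n_cong_AE:
  assumes "f \<in> borel_measurable borel" "g \<in> borel_measurable borel" "AE x in lborel. f x = g x"
  shows "l2n f = l2n g"
  unfolding l2n_def using assms by (intro arg_cong[where f = sqrt] integral_cong_AE) auto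

lemma l2_cong_AE:
  assumes "f \<in> borel_measurable borel" "l2 g" "AE x in lborel. f x = g x"
  shows "l2 f"
proof -
  have "integrable lborel (\<lambda>x. (norm (f x))\<^sup>2) \<longleftrightarrow> integrable lborel (\<lambda>x. (norm (g x))\<^sup>2)"
    using assms l2_meas[OF assms(2)] by (intro integrable_cong_AE) auto
  then show ?thesis using assms by (simp add: l2_def)
qed

lemma l2_mult_integrable_complex:
  fixes f g :: "real \<Rightarrow> complex"
  assumes "l2 f" "l2 g"
  shows "integrable lborel (\<lambda>x. f x * g x)"
proof (rule Bochner_Integration.integrable_bound[OF l2_mult_integrable[OF assms]])
  show "(\<lambda>x. f x * g x) \<in> borel_measurable lborel"
    using l2_meas[OF assms(1)] l2_meas[OF assms(2)] by simp
qed (simp add: norm_mult)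

lemma borel_measurable_cnj [measurable (raw)]:
  "f \<in> borel_measurable M \<Longrightarrow> (\<lambda>x. cnj (f x)) \<in> borel_measurable M"
  by (rule borel_measurable_continuous_on[where f = cnj]) (intro continuous_intros)

lemma l2_cnj: "l2 f \<Longrightarrow> l2 (\<lambda>x. cnj (f x))"
  by (rule l2_bound(1)[where C = 1 and f = f]) (simp_all add: l2_meas borel_measurable_cnj)

lemma l2_inner_bound:
  fixes f g :: "real \<Rightarrow> complex"
  assumes "l2 f" "l2 g"
  shows "cmod (\<integral>x. f x * cnj (g x) \<partial>lborel) \<le> l2n f * l2n g"
proof -
  have "cmod (\<integral>x. f x * cnj (g x) \<partial>lborel) \<le> (\<integral>x. cmod (f x * cnj (g x)) \<partial>lborel)"
    by (rule integral_norm_bound)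
  also have "\<dots> \<le> l2n f * l2n g" using l2_Cauchy_Schwarz[OF assms] by (simp add: norm_mult)
  finally show ?thesis .
qed

section \<open>Locally absolutely continuous functions\<close>

text \<open>\<open>u\<close> is the continuous representative and \<open>v\<close> a chosen Borel
  representative of its derivative, fixed only up to null sets. Taking the fundamental theorem of
  calculus as the definition avoids differentiation almost everywhere.\<close>

definition ac :: "(real \<Rightarrow> complex) \<Rightarrow> (real \<Rightarrow> complex) \<Rightarrow> bool" where
  "ac u v \<longleftrightarrow> v \<in> borel_measurable borel \<and>
     (\<forall>x y. x \<le> y \<longrightarrow> set_integrable lborel {x..y} v \<and> u y = u x + (LBINT t:{x..y}. v t))"

lemma ac_meas_deriv: "ac u v \<Longrightarrow> v \<in> borel_measurable borel"
  by (simp add: ac_def)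

lemma ac_set_integrable: "ac u v \<Longrightarrow> set_integrable lborel {x..y} v"
  by (cases "x \<le> y") (auto simp: ac_def set_integrable_def)

lemma ac_eq: "ac u v \<Longrightarrow> x \<le> y \<Longrightarrow> u y = u x + (LBINT t:{x..y}. v t)"
  by (simp add: ac_def)

lemma set_lebesgue_integral_Icc_combine:
  fixes f :: "real \<Rightarrow> 'a::euclidean_space"
  assumes "x \<le> c" "c \<le> y" "set_integrable lborel {x..y} f"
  shows "(LBINT t:{x..y}. f t) = (LBINT t:{x..c}. f t) + (LBINT t:{c..y}. f t)"
proof -
  have i: "set_integrable lborel {x..c} f" "set_integrable lborel {c..y} f"
    using assms by (auto intro: set_integrable_subset)
  show ?thesis
    using Henstock_Kurzweil_Integration.integral_combine[OF assms(1,2) set_borel_integral_eq_integral(1)[OF assms(3)]]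
    by (simp add: set_borel_integral_eq_integral(2) i assms(3))
qed

lemma ac_indefinite:
  fixes v :: "real \<Rightarrow> complex"
  assumes "v \<in> borel_measurable borel" "\<And>x y. set_integrable lborel {x..y} v"
  shows "ac (\<lambda>x. c + (LBINT t:{0..x}. v t) - (LBINT t:{x..0}. v t)) v"
proof -
  \<comment> \<open>At every x one of the two integrals of the primitive runs over an empty or
    one-point interval. For a single point additivity gives I = I + I.\<close>
  have z: "(LBINT t:{p..q}. v t) = 0" if "q \<le> p" for p q
  proof (cases "q = p")
    case True
    then show ?thesis using set_lebesgue_integral_Icc_combine[of p p p v] assms(2)[of p p] by simp
  qed (use that in \<open>simp add: set_lebesgue_integral_def\<close>)
  have "c + (LBINT t:{0..y}. v t) - (LBINT t:{y..0}. v t)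
      = c + (LBINT t:{0..x}. v t) - (LBINT t:{x..0}. v t) + (LBINT t:{x..y}. v t)" if "x \<le> y" for x y
  proof -
    consider "0 \<le> x" | "x < 0" "0 \<le> y" | "y < 0" by linarith
    then show ?thesis
    proof cases
      case 1
      then show ?thesis
        using set_lebesgue_integral_Icc_combine[OF 1 that assms(2)] z[of 0 x] z[of 0 y] that by simp
    next
      case 2
      then show ?thesis
        using set_lebesgue_integral_Icc_combine[of x 0 y, OF _ _ assms(2)] z[of x 0] z[of 0 y] by simp
    next
      case 3
      then show ?thesis
        using set_lebesgue_integral_Icc_combine[of x y 0, OF that _ assms(2)] z[of x 0] z[of y 0] that by simp
    qed
  qed
  then show ?thesis using assms unfolding ac_def by blast
qed

lemma ac_continuous:
  assumes "ac u v" shows "continuous_on A u"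
proof -
  have "isCont u x" for x
  proof -
    have "continuous_on {x-1..x+1} (\<lambda>y. u (x-1) + integral {x-1..y} v)"
      by (intro continuous_intros indefinite_integral_continuous_1
            set_borel_integral_eq_integral(1) ac_set_integrable[OF assms])
    then have "continuous_on {x-1..x+1} u"
      by (rule continuous_on_eq)
         (use ac_eq[OF assms] set_borel_integral_eq_integral(2)[OF ac_set_integrable[OF assms]] in auto)
    then show ?thesis by (rule continuous_on_interior) auto
  qed
  then show ?thesis by (simp add: continuous_at_imp_continuous_on)
qed

lemma ac_meas: "ac u v \<Longrightarrow> u \<in> borel_measurable borel"
  by (rule borel_measurable_continuous_onI) (rule ac_continuous)

lemma ac_C1:
  fixes F :: "real \<Rightarrow> complex"
  assumes "\<And>x. (F has_vector_derivative f x) (at x)" "continuous_on UNIV f"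
  shows "ac F f"
  unfolding ac_def
proof (intro conjI allI impI)
  show "f \<in> borel_measurable borel" using assms(2) by (rule borel_measurable_continuous_onI)
  fix x y :: real assume "x \<le> y"
  have c: "continuous_on {x..y} f" using assms(2) continuous_on_subset by blast
  then show "set_integrable lborel {x..y} f" by (rule borel_integrable_atLeastAtMost')
  show "F y = F x + (LBINT t:{x..y}. f t)"
    using integral_FTC_atLeastAtMost[OF \<open>x \<le> y\<close> has_vector_derivative_at_within[OF assms(1)] c]
    by (simp add: set_lebesgue_integral_def)
qed

lemma ac_const: "ac (\<lambda>x. c) (\<lambda>x. 0)"
  by (rule ac_C1) (auto intro: has_vector_derivative_const)

lemma ac_add:
  assumes "ac u v" "ac p q" shows "ac (\<lambda>x. u x + p x) (\<lambda>x. v x + q x)"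
  using assms unfolding ac_def by (auto simp: set_integral_add)

lemma ac_cmult:
  assumes "ac u v" shows "ac (\<lambda>x. c * u x) (\<lambda>x. c * v x)"
  using assms unfolding ac_def by (auto simp: algebra_simps)

lemma ac_minus: "ac u v \<Longrightarrow> ac (\<lambda>x. - u x) (\<lambda>x. - v x)"
  using ac_cmult[of u v "-1"] by simp

lemma ac_diff: "ac u v \<Longrightarrow> ac p q \<Longrightarrow> ac (\<lambda>x. u x - p x) (\<lambda>x. v x - q x)"
  using ac_add[of u v "\<lambda>x. - p x" "\<lambda>x. - q x"] ac_minus[of p q] by simp

lemma ac_cnj:
  assumes "ac u v" shows "ac (\<lambda>x. cnj (u x)) (\<lambda>x. cnj (v x))"
  unfolding ac_def
proof (intro conjI allI impI)
  show "(\<lambda>x. cnj (v x)) \<in> borel_measurable borel" using ac_meas_deriv[OF assms] by measurable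
  fix x y :: real assume "x \<le> y"
  have i: "integrable lborel (\<lambda>t. indicator {x..y} t *\<^sub>R v t)"
    using ac_set_integrable[OF assms, of x y] by (simp add: set_integrable_def)
  show "set_integrable lborel {x..y} (\<lambda>x. cnj (v x))"
    using integrable_bounded_linear[OF bounded_linear_cnj i] by (simp add: set_integrable_def)
  show "cnj (u y) = cnj (u x) + (LBINT t:{x..y}. cnj (v t))"
    using integral_bounded_linear[OF bounded_linear_cnj i] ac_eq[OF assms \<open>x \<le> y\<close>]
    by (simp add: set_lebesgue_integral_def)
qed

lemma ac_reflect:
  assumes "ac u v" shows "ac (\<lambda>x. u (- x)) (\<lambda>x. - v (- x))"
  unfolding ac_def
proof (intro conjI allI impI)
  show "(\<lambda>x. - v (- x)) \<in> borel_measurable borel" using ac_meas_deriv[OF assms] by measurable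
  fix x y :: real assume xy: "x \<le> y"
  have i: "integrable lborel (\<lambda>t. indicator {-y..-x} t *\<^sub>R v t)"
    using ac_set_integrable[OF assms, of "-y" "-x"] by (simp add: set_integrable_def)
  have e: "indicator {-y..-x} (0 + (-1) * t) *\<^sub>R v (0 + (-1) * t) = indicator {x..y} t *\<^sub>R v (- t)" for t
    by (auto simp: indicator_def)
  have j: "set_integrable lborel {x..y} (\<lambda>t. v (- t))"
    using lborel_integrable_real_affine[OF i, of "-1" 0] unfolding e by (simp add: set_integrable_def)
  then show "set_integrable lborel {x..y} (\<lambda>t. - v (- t))"
    unfolding set_integrable_def by simp
  have "(LBINT t:{-y..-x}. v t) = (LBINT t:{x..y}. v (- t))"
    using lborel_integral_real_affine[of "-1" "\<lambda>t. indicator {-y..-x} t *\<^sub>R v t" 0] unfolding e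
    by (simp add: set_lebesgue_integral_def)
  then show "u (- y) = u (- x) + (LBINT t:{x..y}. - v (- t))"
    using ac_eq[OF assms, of "-y" "-x"] xy by (simp add: set_lebesgue_integral_def)
qed

lemma set_integrable_continuous_mult:
  fixes f g :: "real \<Rightarrow> complex"
  assumes "set_integrable lborel {x..y} f" "continuous_on UNIV g" "f \<in> borel_measurable borel"
  shows "set_integrable lborel {x..y} (\<lambda>t. f t * g t)"
proof -
  have "compact (g ` {x..y})"
    using assms(2) by (intro compact_continuous_image) (auto intro: continuous_on_subset)
  then obtain C where C: "\<And>t. t \<in> {x..y} \<Longrightarrow> norm (g t) \<le> C"
    using compact_imp_bounded bounded_iff by (metis imageI)
  have [measurable]: "g \<in> borel_measurable borel" "f \<in> borel_measurable borel"
    using assms by (auto intro: borel_measurable_continuous_onI)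
  have "integrable lborel (\<lambda>t. C * norm (indicator {x..y} t *\<^sub>R f t))"
    using assms(1) unfolding set_integrable_def by (intro integrable_mult_right integrable_norm)
  then show ?thesis unfolding set_integrable_def
  proof (rule Bochner_Integration.integrable_bound)
    show "AE t in lborel. norm (indicator {x..y} t *\<^sub>R (f t * g t))
        \<le> norm (C * norm (indicator {x..y} t *\<^sub>R f t))"
    proof (rule AE_I2)
      fix t show "norm (indicator {x..y} t *\<^sub>R (f t * g t)) \<le> norm (C * norm (indicator {x..y} t *\<^sub>R f t))"
        using mult_left_mono[OF order_trans[OF C abs_ge_self], of t "norm (f t)"]
        by (cases "t \<in> {x..y}") (auto simp: norm_mult abs_mult mult.commute)
    qed
  qed simp
qed

lemma ac_norm_diff_le:
  assumes "ac u v" "x \<le> t" "t \<le> y"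
  shows "norm (u t - u x) \<le> (LBINT s:{x..y}. norm (v s))" "norm (u y - u t) \<le> (LBINT s:{x..y}. norm (v s))"
proof -
  have n: "set_integrable lborel {p..q} (\<lambda>s. norm (v s))" for p q
    using ac_set_integrable[OF assms(1), of p q] by (rule set_integrable_norm)
  have sub: "(LBINT s:{p..q}. norm (v s)) \<le> (LBINT s:{x..y}. norm (v s))" if "x \<le> p" "q \<le> y" for p q
    unfolding set_lebesgue_integral_def
    by (rule integral_mono)
       (use n that in \<open>auto simp: set_integrable_def indicator_def\<close>)
  have b: "norm (u q - u p) \<le> (LBINT s:{p..q}. norm (v s))" if "p \<le> q" for p q
    using ac_eq[OF assms(1) that] set_integral_norm_bound[OF ac_set_integrable[OF assms(1), of p q]] by simp
  show "norm (u t - u x) \<le> (LBINT s:{x..y}. norm (v s))"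
    using b[of x t] sub[of x t] assms by simp
  show "norm (u y - u t) \<le> (LBINT s:{x..y}. norm (v s))"
    using b[of t y] sub[of t y] assms by simp
qed

text \<open>The defect of the product rule on \<open>{x..y}\<close> is quadratic in the mass of the derivatives, so that
  halving the mass halves the bound.\<close>

lemma ac_mult:
  assumes "ac u v" "ac p q"
  shows "ac (\<lambda>x. u x * p x) (\<lambda>x. v x * p x + u x * q x)"
proof -
  note cu = ac_continuous[OF assms(1), of UNIV] and cp = ac_continuous[OF assms(2), of UNIV]
  note mv = ac_meas_deriv[OF assms(1)] and mq = ac_meas_deriv[OF assms(2)]
  have i1: "set_integrable lborel {x..y} (\<lambda>t. v t * p t)" for x y
    by (rule set_integrable_continuous_mult[OF ac_set_integrable[OF assms(1)] cp mv])
  have i2: "set_integrable lborel {x..y} (\<lambda>t. u t * q t)" for x y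
    using set_integrable_continuous_mult[OF ac_set_integrable[OF assms(2)] cu mq] by (simp add: mult.commute)
  let ?w = "\<lambda>t. v t * p t + u t * q t"
  have iw: "set_integrable lborel {x..y} ?w" for x y
    using set_integral_add(1)[OF i1 i2] .
  define D where "D x y = u y * p y - u x * p x - (LBINT t:{x..y}. ?w t)" for x y
  define h where "h x y = (LBINT s:{x..y}. norm (v s)) + (LBINT s:{x..y}. norm (q s))" for x y
  have nv: "set_integrable lborel {x..y} (\<lambda>s. norm (v s))"
   and nq: "set_integrable lborel {x..y} (\<lambda>s. norm (q s))" for x y
    using ac_set_integrable[OF assms(1), of x y] ac_set_integrable[OF assms(2), of x y]
    by (auto intro: set_integrable_norm)
  have h0: "h x y \<ge> 0" for x y
    unfolding h_def set_lebesgue_integral_def by (intro add_nonneg_nonneg integral_nonneg_AE) auto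
  \<comment> \<open>Expanding the increment of \<open>u p\<close> around the endpoints turns the
    defect into the integral of \<open>v t * (p y - p t) - (u t - u x) * q t\<close>. Each increment
    is at most the mass \<open>h\<close>, and a second factor \<open>h\<close> comes from
    integrating \<open>v\<close> and \<open>q\<close>.\<close>
  have base: "norm (D x y) \<le> (h x y)\<^sup>2" if "x \<le> y" for x y
  proof -
    have "D x y = (u y - u x) * (p y - p x) + (u y - u x) * p x + u x * (p y - p x) - (LBINT t:{x..y}. ?w t)"
      by (simp add: D_def algebra_simps)
    also have "(u y - u x) * p x = (LBINT t:{x..y}. v t * p x)"
      using ac_eq[OF assms(1) that] by simp
    also have "u x * (p y - p x) = (LBINT t:{x..y}. u x * q t)"
      using ac_eq[OF assms(2) that] by simp
    also have "(u y - u x) * (p y - p x) = (LBINT t:{x..y}. v t * (p y - p x))"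
      using ac_eq[OF assms(1) that] by simp
    also have "(LBINT t:{x..y}. v t * (p y - p x)) + (LBINT t:{x..y}. v t * p x) + (LBINT t:{x..y}. u x * q t)
        - (LBINT t:{x..y}. ?w t) = (LBINT t:{x..y}. v t * (p y - p t) - (u t - u x) * q t)"
    proof -
      have j: "set_integrable lborel {x..y} (\<lambda>t. v t * c)" "set_integrable lborel {x..y} (\<lambda>t. c * q t)" for c
        using ac_set_integrable[OF assms(1), of x y] ac_set_integrable[OF assms(2), of x y] by auto
      have "(LBINT t:{x..y}. v t * (p y - p x)) + (LBINT t:{x..y}. v t * p x) + (LBINT t:{x..y}. u x * q t)
          - (LBINT t:{x..y}. ?w t) = (LBINT t:{x..y}. v t * (p y - p x) + v t * p x + u x * q t - ?w t)"
        using j iw by (simp only: set_integral_add set_integral_diff)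
      then show ?thesis by (simp add: algebra_simps)
    qed
    finally have D: "D x y = (LBINT t:{x..y}. v t * (p y - p t) - (u t - u x) * q t)" .
    have k: "set_integrable lborel {x..y} (\<lambda>t. v t * (p y - p t) - (u t - u x) * q t)"
    proof -
      have "set_integrable lborel {x..y} (\<lambda>t. v t * (p y - p t))"
        by (rule set_integrable_continuous_mult[OF ac_set_integrable[OF assms(1)] _ mv]) (intro continuous_intros cp)
      moreover have "set_integrable lborel {x..y} (\<lambda>t. q t * (u t - u x))"
        by (rule set_integrable_continuous_mult[OF ac_set_integrable[OF assms(2)] _ mq]) (intro continuous_intros cu)
      ultimately show ?thesis by (auto simp: mult.commute intro: set_integral_diff)
    qed
    have m: "set_integrable lborel {x..y} (\<lambda>t. norm (v t) * h x y + h x y * norm (q t))"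
      using nv nq by auto
    have hv: "(LBINT s:{x..y}. norm (v s)) \<le> h x y" "(LBINT s:{x..y}. norm (q s)) \<le> h x y"
      unfolding h_def set_lebesgue_integral_def by (auto intro!: integral_nonneg_AE)
    have "norm (D x y) \<le> (LBINT t:{x..y}. norm (v t * (p y - p t) - (u t - u x) * q t))"
      unfolding D by (rule set_integral_norm_bound[OF k])
    also have "\<dots> \<le> (LBINT t:{x..y}. norm (v t) * h x y + h x y * norm (q t))"
    proof (rule set_integral_mono[OF set_integrable_norm[OF k] m])
      fix t assume t: "t \<in> {x..y}"
      have "norm (v t * (p y - p t) - (u t - u x) * q t) \<le> norm (v t) * norm (p y - p t) + norm (u t - u x) * norm (q t)"
        by (metis norm_mult norm_triangle_ineq4)
      also have "\<dots> \<le> norm (v t) * h x y + h x y * norm (q t)"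
        using ac_norm_diff_le(1)[OF assms(1), of x t y] ac_norm_diff_le(2)[OF assms(2), of x t y] t hv
        by (intro add_mono mult_left_mono mult_right_mono) auto
      finally show "norm (v t * (p y - p t) - (u t - u x) * q t) \<le> norm (v t) * h x y + h x y * norm (q t)" .
    qed
    also have "\<dots> = h x y * h x y"
      using nv nq by (simp add: set_integral_add h_def algebra_simps)
    finally show ?thesis by (simp add: power2_eq_square)
  qed
  have add: "D x y = D x c + D c y" "h x y = h x c + h c y" if "x \<le> c" "c \<le> y" for x c y
    using set_lebesgue_integral_Icc_combine[OF that iw] set_lebesgue_integral_Icc_combine[OF that nv]
      set_lebesgue_integral_Icc_combine[OF that nq] by (auto simp: D_def h_def)
  \<comment> \<open>The mass is continuous in the right endpoint, so some point splits it evenly.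
    Two halves then contribute 2 (h / 2)^2, half of the previous bound.\<close>
  have half: "\<exists>c. x \<le> c \<and> c \<le> y \<and> h x c = h x y / 2" if "x \<le> y" for x y
  proof -
    have "continuous_on {x..y} (\<lambda>c. integral {x..c} (\<lambda>s. norm (v s)) + integral {x..c} (\<lambda>s. norm (q s)))"
      by (intro continuous_intros indefinite_integral_continuous_1 set_borel_integral_eq_integral(1) nv nq)
    then have c: "continuous_on {x..y} (h x)"
      unfolding h_def using set_borel_integral_eq_integral(2)[OF nv] set_borel_integral_eq_integral(2)[OF nq] by simp
    have "h x x = 0" using add(2)[of x x x] by simp
    then show ?thesis using IVT'[of "h x" x "h x y / 2" y] h0[of x y] that c by auto
  qed
  have bd: "x \<le> y \<Longrightarrow> norm (D x y) \<le> (h x y)\<^sup>2 / 2 ^ n" for n x y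
  proof (induction n arbitrary: x y)
    case 0 then show ?case using base by simp
  next
    case (Suc n)
    obtain c where c: "x \<le> c" "c \<le> y" "h x c = h x y / 2" using half Suc.prems by blast
    then have c2: "h c y = h x y / 2" using add(2)[OF c(1,2)] by simp
    have "norm (D x y) \<le> norm (D x c) + norm (D c y)" unfolding add(1)[OF c(1,2)] by (rule norm_triangle_ineq)
    also have "\<dots> \<le> (h x y / 2)\<^sup>2 / 2 ^ n + (h x y / 2)\<^sup>2 / 2 ^ n"
      using Suc.IH[OF c(1)] Suc.IH[OF c(2)] c(3) c2 by simp
    also have "\<dots> = (h x y)\<^sup>2 / 2 ^ Suc n" by (simp add: power_divide field_simps)
    finally show ?case .
  qed
  have "D x y = 0" if "x \<le> y" for x y
  proof -
    have "(\<lambda>n. (h x y)\<^sup>2 / 2 ^ n) \<longlonglongrightarrow> 0"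
      using LIMSEQ_divide_realpow_zero[of 2 "(h x y)\<^sup>2"] by simp
    then have "norm (D x y) \<le> 0"
      by (rule LIMSEQ_le_const) (use bd[OF that] in auto)
    then show ?thesis by simp
  qed
  then show ?thesis
    using iw mv mq ac_meas[OF assms(1)] ac_meas[OF assms(2)] unfolding ac_def D_def
    by (auto simp: algebra_simps)
qed

text \<open>Integrability of \<open>f\<close> gives \<open>F\<close> a limit; a nonzero limit would
  keep \<open>norm F\<close> bounded below on a half-line of infinite measure.\<close>

lemma ac_tendsto_0_at_top:
  assumes "ac F f" "integrable lborel F" "integrable lborel f"
  shows "(F \<longlongrightarrow> 0) at_top"
proof -
  have i: "integrable lborel (\<lambda>x. indicator {0..} x *\<^sub>R f x)"
    using assms(3) by (intro integrable_mult_indicator) auto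
  define L where "L = F 0 + (\<integral>x. indicator {0..} x *\<^sub>R f x \<partial>lborel)"
  have e: "indicator {..y} x *\<^sub>R indicator {0..} x *\<^sub>R f x = indicator {0..y} x *\<^sub>R f x" for x y :: real
    by (auto simp: indicator_def)
  have "((\<lambda>y. F 0 + (\<integral>x. indicator {0..y} x *\<^sub>R f x \<partial>lborel)) \<longlongrightarrow> L) at_top"
    unfolding L_def using tendsto_integral_at_top[OF _ i] unfolding e by (intro tendsto_intros) auto
  moreover have "\<forall>\<^sub>F y in at_top. F 0 + (\<integral>x. indicator {0..y} x *\<^sub>R f x \<partial>lborel) = F y"
    using eventually_ge_at_top[of 0]
    by eventually_elim (use ac_eq[OF assms(1)] in \<open>simp add: set_lebesgue_integral_def\<close>)
  ultimately have lim: "(F \<longlongrightarrow> L) at_top" by (rule Lim_transform_eventually)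
  have "L = 0"
  proof (rule ccontr)
    assume "L \<noteq> 0"
    then have "\<forall>\<^sub>F y in at_top. dist (F y) L < norm L / 2"
      using tendstoD[OF lim, of "norm L / 2"] by simp
    then obtain N where N: "\<And>y. y \<ge> N \<Longrightarrow> dist (F y) L < norm L / 2"
      by (auto simp: eventually_at_top_linorder)
    have ge: "norm (F y) \<ge> norm L / 2" if "y \<ge> N" for y
      using N[OF that] norm_triangle_sub[of L "F y"] by (simp add: dist_norm norm_minus_commute)
    have "integrable lborel (\<lambda>y. indicator {N..} y *\<^sub>R (norm L / 2))"
    proof (rule Bochner_Integration.integrable_bound[OF assms(2)])
      show "AE y in lborel. norm (indicator {N..} y *\<^sub>R (norm L / 2)) \<le> norm (F y)"
        using ge by (auto simp: indicator_def)
    qed auto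
    then have "integrable lborel (indicator {N..} :: real \<Rightarrow> real)"
      using \<open>L \<noteq> 0\<close> integrable_mult_right[of "2 / norm L" lborel "\<lambda>y. indicator {N..} y *\<^sub>R (norm L / 2)"]
      by simp
    then have "emeasure lborel {N..} < \<infinity>" by (simp add: integrable_indicator_iff)
    moreover have "emeasure lborel {N..} \<ge> emeasure lborel {N..N + n}" for n
      by (rule emeasure_mono) auto
    then have "emeasure lborel {N..} \<ge> ennreal n" if "n \<ge> 0" for n :: real
      using that by (metis add_diff_cancel_left' emeasure_lborel_Icc le_add_same_cancel1)
    moreover have "emeasure lborel {N..} = ennreal (measure lborel {N..})"
      using calculation(1) by (simp add: emeasure_eq_ennreal_measure)
    ultimately show False
      by (metis ennreal_le_iff measure_nonneg linorder_not_le less_add_one add_nonneg_nonneg zero_le_one)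
  qed
  then show ?thesis using lim by simp
qed

text \<open>The source of the integrations by parts over the line: boundary terms vanish because
  \<open>F\<close> itself is integrable. The limit at minus infinity is that of the reflected
  function at plus infinity.\<close>

lemma ac_integral_0:
  assumes "ac F f" "integrable lborel F" "integrable lborel f"
  shows "(\<integral>x. f x \<partial>lborel) = 0"
proof -
  have 1: "(F \<longlongrightarrow> 0) at_top" using ac_tendsto_0_at_top assms by blast
  have "integrable lborel (\<lambda>x. F (- x))" "integrable lborel (\<lambda>x. - f (- x))"
    using lborel_integrable_real_affine[OF assms(2), of "-1" 0] lborel_integrable_real_affine[OF assms(3), of "-1" 0] by auto
  then have 2: "((\<lambda>x. F (- x)) \<longlongrightarrow> 0) at_top"
    using ac_tendsto_0_at_top[OF ac_reflect[OF assms(1)]] by blast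
  have 3: "(\<lambda>n. F (real n) - F (- real n)) \<longlonglongrightarrow> 0 - 0"
    using filterlim_compose[OF 1 filterlim_real_sequentially] filterlim_compose[OF 2 filterlim_real_sequentially]
    by (rule tendsto_diff)
  have e: "F (real n) - F (- real n) = (\<integral>x. indicator {-real n..real n} x *\<^sub>R f x \<partial>lborel)" for n
    using ac_eq[OF assms(1), of "-real n" "real n"] by (simp add: set_lebesgue_integral_def)
  have "(\<lambda>n. \<integral>x. indicator {-real n..real n} x *\<^sub>R f x \<partial>lborel) \<longlonglongrightarrow> (\<integral>x. f x \<partial>lborel)"
  proof (rule integral_dominated_convergence[where w = "\<lambda>x. norm (f x)"])
    show "AE x in lborel. (\<lambda>n. indicator {-real n..real n} x *\<^sub>R f x) \<longlonglongrightarrow> f x"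
    proof (rule AE_I2)
      fix x :: real
      obtain N where N: "\<bar>x\<bar> \<le> real N" using real_arch_simple by blast
      show "(\<lambda>n. indicator {-real n..real n} x *\<^sub>R f x) \<longlonglongrightarrow> f x"
        by (rule tendsto_eventually, rule eventually_sequentiallyI[of N]) (use N in \<open>auto simp: indicator_def\<close>)
    qed
  qed (use assms in \<open>auto simp: indicator_def\<close>)
  then show ?thesis using 3 unfolding e using LIMSEQ_unique by fastforce
qed

lemma ac_unique_deriv:
  assumes "ac u v" "ac u v'" "x \<le> y"
  shows "(LBINT t:{x..y}. v t) = (LBINT t:{x..y}. v' t)"
  using ac_eq[OF assms(1,3)] ac_eq[OF assms(2,3)] by simp

lemma ac_of_real:
  fixes F f :: "real \<Rightarrow> real"
  assumes "\<And>x. (F has_real_derivative f x) (at x)" "continuous_on UNIV f"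
  shows "ac (\<lambda>x. of_real (F x)) (\<lambda>x. of_real (f x))"
proof (rule ac_C1)
  show "((\<lambda>x. complex_of_real (F x)) has_vector_derivative of_real (f x)) (at x)" for x
    using has_vector_derivative_of_real[of F "f x" "at x"] assms(1)[of x]
    by (simp add: has_real_derivative_iff_has_vector_derivative)
  show "continuous_on UNIV (\<lambda>x. complex_of_real (f x))"
    using assms(2) by (intro continuous_intros)
qed

lemma integrable_compact_support:
  fixes f :: "real \<Rightarrow> 'a::euclidean_space"
  assumes "set_integrable lborel {-r..r} f" "\<And>x. \<bar>x\<bar> > r \<Longrightarrow> f x = 0"
  shows "integrable lborel f"
proof -
  have "(\<lambda>x. indicator {-r..r} x *\<^sub>R f x) = f"
    using assms(2) by (force simp: indicator_def)
  then show ?thesis using assms(1) by (simp add: set_integrable_def)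
qed

lemma ac_integral_0_compact:
  assumes "ac F f" "\<And>x. \<bar>x\<bar> > r \<Longrightarrow> F x = 0" "\<And>x. \<bar>x\<bar> > r \<Longrightarrow> f x = 0"
  shows "integrable lborel f" "(\<integral>x. f x \<partial>lborel) = 0"
proof -
  show i: "integrable lborel f"
    using ac_set_integrable[OF assms(1)] assms(3) by (rule integrable_compact_support)
  have "integrable lborel F"
    by (rule integrable_compact_support[OF borel_integrable_atLeastAtMost'[OF ac_continuous[OF assms(1)]] assms(2)])
  then show "(\<integral>x. f x \<partial>lborel) = 0" using ac_integral_0[OF assms(1) _ i] by simp
qed

lemma l2_continuous_compact:
  fixes f :: "real \<Rightarrow> complex"
  assumes "continuous_on UNIV f" "\<And>x. \<bar>x\<bar> > r \<Longrightarrow> f x = 0"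
  shows "l2 f"
proof -
  have "integrable lborel (\<lambda>x. (norm (f x))\<^sup>2)"
    by (rule integrable_compact_support[of r], rule borel_integrable_atLeastAtMost',
        rule continuous_on_subset[of UNIV]) (auto intro!: continuous_intros assms)
  then show ?thesis using borel_measurable_continuous_onI[OF assms(1)] by (simp add: l2_def)
qed

section \<open>Cutoff functions of class C^1\<close>

definition pp :: "real \<Rightarrow> real" where "pp x = (max 0 x)\<^sup>2"

lemma pp_deriv: "(pp has_real_derivative 2 * max 0 x) (at x)"
proof -
  consider "x > 0" | "x < 0" | "x = 0" by linarith
  then show ?thesis
  proof cases
    case 1
    have "((\<lambda>y. y\<^sup>2) has_real_derivative 2 * max 0 x) (at x)"
      using 1 by (auto intro!: derivative_eq_intros)
    then show ?thesis
      by (rule has_field_derivative_transform_within_open[of _ _ _ "{0<..}"]) (use 1 in \<open>auto simp: pp_def\<close>)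
  next
    case 2
    have "((\<lambda>y. 0) has_real_derivative 2 * max 0 x) (at x)"
      using 2 by (auto intro!: derivative_eq_intros)
    then show ?thesis
      by (rule has_field_derivative_transform_within_open[of _ _ _ "{..<0}"]) (use 2 in \<open>auto simp: pp_def\<close>)
  next
    case 3
    have "((\<lambda>h. pp h / h) \<longlongrightarrow> 0) (at 0)"
    proof (rule Lim_null_comparison[where g = abs])
      show "\<forall>\<^sub>F h in at 0. norm (pp h / h) \<le> \<bar>h\<bar>"
        by (rule always_eventually) (auto simp: pp_def max_def power2_eq_square)
      show "((\<lambda>h::real. \<bar>h\<bar>) \<longlongrightarrow> 0) (at 0)"
        using tendsto_rabs_zero[OF tendsto_ident_at[of "0::real" UNIV]] by simp
    qed
    then show ?thesis using 3 by (simp add: DERIV_def pp_def)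
  qed
qed

lemma continuous_on_pp [continuous_intros]: "continuous_on A f \<Longrightarrow> continuous_on A (\<lambda>x. pp (f x))"
  unfolding pp_def by (intro continuous_intros)

text \<open>Equals 1 on [-1, 1] and 0 outside [-2, 2]. The outer square makes the squared derivative
  at most a multiple of \<open>cut\<close> itself (\<open>dcut_sq_le\<close>), so that a cutoff
  error can be absorbed by a term that carries only the factor \<open>cut\<close>.\<close>

definition cut :: "real \<Rightarrow> real" where "cut x = pp (1 - pp (x\<^sup>2 - 1))"
definition dcut :: "real \<Rightarrow> real" where
  "dcut x = - (8 * x * max 0 (1 - pp (x\<^sup>2 - 1)) * max 0 (x\<^sup>2 - 1))"

lemma cut_deriv: "(cut has_real_derivative dcut x) (at x)"
proof -
  have "((\<lambda>x. pp (x\<^sup>2 - 1)) has_real_derivative 2 * max 0 (x\<^sup>2 - 1) * (2 * x)) (at x)"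
    by (rule DERIV_chain2[OF pp_deriv]) (auto intro!: derivative_eq_intros)
  then have "((\<lambda>x. 1 - pp (x\<^sup>2 - 1)) has_real_derivative - (2 * max 0 (x\<^sup>2 - 1) * (2 * x))) (at x)"
    by (auto intro!: derivative_eq_intros)
  from DERIV_chain2[OF pp_deriv this] show ?thesis
    unfolding cut_def[abs_def] dcut_def by (simp add: algebra_simps)
qed

lemma continuous_on_dcut [continuous_intros]: "continuous_on A f \<Longrightarrow> continuous_on A (\<lambda>x. dcut (f x))"
  unfolding dcut_def by (intro continuous_intros)

lemma cut_nonneg: "cut x \<ge> 0" and cut_le_1: "cut x \<le> 1"
proof -
  have "pp y \<ge> 0" for y by (simp add: pp_def)
  then show "cut x \<ge> 0" "cut x \<le> 1"
    unfolding cut_def by (auto simp: pp_def[of "1 - _"] power_le_one max_def)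
qed

lemma cut_eq_1: "\<bar>x\<bar> \<le> 1 \<Longrightarrow> cut x = 1"
  using abs_square_le_1[of x] by (simp add: cut_def pp_def)

lemma dcut_eq_0: "\<bar>x\<bar> \<le> 1 \<Longrightarrow> dcut x = 0"
  using abs_square_le_1[of x] by (simp add: dcut_def)

lemma cut_eq_0: assumes "\<bar>x\<bar> \<ge> 2" shows "cut x = 0" "dcut x = 0"
proof -
  have "x\<^sup>2 \<ge> 2\<^sup>2" using assms by (subst abs_le_square_iff[symmetric]) auto
  then have "pp (x\<^sup>2 - 1) \<ge> 1" by (simp add: pp_def one_le_power)
  then show "cut x = 0" "dcut x = 0" by (auto simp: cut_def dcut_def pp_def)
qed

text \<open>With y = x^2 - 1 in (0, 1) the ratio of the squared derivative to \<open>cut x\<close>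
  is 64 (y + 1) y^2, below 128. The constant is rounded up to 144 = 12^2, which suits
  \<open>abs_dcut_le\<close>.\<close>

lemma dcut_sq_le: "(dcut x)\<^sup>2 \<le> 144 * cut x"
proof (cases "0 < x\<^sup>2 - 1 \<and> pp (x\<^sup>2 - 1) < 1")
  case False
  then have "dcut x = 0" by (auto simp: dcut_def max_def)
  then show ?thesis using cut_nonneg[of x] by simp
next
  case True
  define y where "y = x\<^sup>2 - 1"
  have y: "0 < y" "y < 1"
  proof -
    show "0 < y" using True y_def by simp
    have "max 0 y = y" using \<open>0 < y\<close> by simp
    then have "y\<^sup>2 < 1\<^sup>2" using True by (simp add: y_def[symmetric] pp_def)
    then show "y < 1" by (rule power2_less_imp_less) simp
  qed
  have "(dcut x)\<^sup>2 = 64 * (y + 1) * y\<^sup>2 * cut x"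
    using True y by (simp add: dcut_def cut_def pp_def[of "1 - _"] y_def[symmetric] power_mult_distrib)
       (simp add: y_def)
  also have "\<dots> \<le> 144 * cut x"
  proof -
    have "(y + 1) * y\<^sup>2 \<le> 2 * 1" using y by (intro mult_mono) (auto simp: power_le_one)
    then have "64 * (y + 1) * y\<^sup>2 \<le> 144" by (simp add: algebra_simps)
    then show ?thesis using cut_nonneg[of x] by (intro mult_right_mono) auto
  qed
  finally show ?thesis .
qed

lemma abs_dcut_le: "\<bar>dcut x\<bar> \<le> 12"
proof -
  have "(dcut x)\<^sup>2 \<le> 12\<^sup>2" using dcut_sq_le[of x] cut_le_1[of x] by simp
  then have "\<bar>dcut x\<bar> \<le> \<bar>12\<bar>" by (simp only: abs_le_square_iff)
  then show ?thesis by simp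
qed

lemma cut_scaled_deriv: "r \<noteq> 0 \<Longrightarrow> ((\<lambda>x. cut ((x - p) / r)) has_real_derivative dcut ((x - p) / r) / r) (at x)"
proof -
  assume "r \<noteq> 0"
  then have "((\<lambda>x. (x - p) / r) has_real_derivative 1 / r) (at x)"
    by (auto intro!: derivative_eq_intros)
  from DERIV_chain2[OF cut_deriv this] show ?thesis by simp
qed

section \<open>A priori estimates for first-order scalar equations\<close>

locale C1_potential =
  fixes B B' :: "real \<Rightarrow> real" and eps M1 :: real
  assumes B_deriv: "\<And>x. (B has_real_derivative B' x) (at x)"
    and B'_cont: "continuous_on UNIV B'"
    and eps: "0 \<le> eps" "eps < 1" and M1: "0 \<le> M1"
    and B'_bound: "\<And>x. \<bar>B' x\<bar> \<le> eps * (B x)\<^sup>2 + M1"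
begin

lemma B_cont: "continuous_on A B"
  using B_deriv by (meson DERIV_isCont continuous_at_imp_continuous_on)

lemma B_meas [measurable]: "B \<in> borel_measurable borel"
  by (rule borel_measurable_continuous_onI) (rule B_cont)

lemma B'_meas [measurable]: "B' \<in> borel_measurable borel"
  by (rule borel_measurable_continuous_onI) (rule B'_cont)

lemma ac_B: "ac (\<lambda>x. of_real (B x)) (\<lambda>x. of_real (B' x))"
  by (rule ac_of_real[OF B_deriv B'_cont])

lemma Re_mult_cnj_bound: "\<bar>Re (g * cnj w)\<bar> \<le> cmod g * cmod w"
  by (metis abs_Re_le_cmod complex_mod_cnj norm_mult)

text \<open>As \<open>B w\<close> is not yet known to be in L2, the identity for the derivative of
  \<open>\<sigma> B |w|^2\<close> is used with a cutoff \<open>ct n\<close>. Its main term is 2 ct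
  B^2 |w|^2; the term with \<open>B'\<close> costs at most half of it, the cutoff and
  \<open>g\<close> an eighth each, and Fatou removes the cutoff.\<close>

lemma l2_potential_mult:
  fixes w g :: "real \<Rightarrow> complex" and \<sigma> :: real
  assumes "\<sigma>\<^sup>2 = 1" "ac w (\<lambda>x. of_real (\<sigma> * B x) * w x - g x)" "l2 w" "l2 g"
  shows "l2 (\<lambda>x. of_real (B x) * w x)"
proof -
  \<comment> \<open>144 comes from the cutoff, \<open>M1\<close> from the bound on
    \<open>B'\<close>, 4 from the mixed term with \<open>g\<close>. The factor 2 makes up for the
    coefficient 1/2 with which \<open>X b^2 W^2\<close> survives.\<close>
  define K where "K = 2 * (144 + M1 + 4)"
  define ct where "ct n x = cut ((x - 0) / real (Suc n))" for n x
  define ct' where "ct' n x = dcut ((x - 0) / real (Suc n)) / real (Suc n)" for n x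
  have mw: "w \<in> borel_measurable borel" and mg: "g \<in> borel_measurable borel"
    using assms(3,4) l2_meas by auto
  have contw: "continuous_on UNIV w" using ac_continuous[OF assms(2)] .
  have ct_deriv: "(ct n has_real_derivative ct' n x) (at x)" for n x
    unfolding ct_def[abs_def] ct'_def by (rule cut_scaled_deriv) simp
  have ct_cont: "continuous_on UNIV (ct n)" "continuous_on UNIV (ct' n)" for n
    using ct_deriv[of n] unfolding ct'_def
    by (blast intro: DERIV_isCont continuous_at_imp_continuous_on, auto intro!: continuous_intros)
  have ct_0: "ct n x = 0 \<and> ct' n x = 0" if "\<bar>x\<bar> > 2 * real (Suc n)" for n x
    using that cut_eq_0[of "x / real (Suc n)"] by (simp add: ct_def ct'_def pos_le_divide_eq)
  have ct_b: "0 \<le> ct n x" "ct n x \<le> 1" for n x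
    by (simp_all add: ct_def cut_nonneg cut_le_1)
  have ct'_b: "(ct' n x)\<^sup>2 \<le> 144 * ct n x" for n x
  proof -
    have "(ct' n x)\<^sup>2 \<le> (dcut ((x - 0) / real (Suc n)))\<^sup>2 / 1"
      unfolding ct'_def power_divide by (intro divide_left_mono) auto
    then show ?thesis using dcut_sq_le[of "(x - 0) / real (Suc n)"] by (simp add: ct_def)
  qed
  define f where "f n x = of_real (ct n x * B x) * w x" for n x
  define F where "F n x = of_real (\<sigma> * (ct n x * B x)) * (w x * cnj (w x))" for n x
  define F' where "F' n x = of_real (\<sigma> * (ct' n x * B x + ct n x * B' x)) * (w x * cnj (w x))
      + of_real (\<sigma> * (ct n x * B x)) * ((of_real (\<sigma> * B x) * w x - g x) * cnj (w x)
          + w x * cnj (of_real (\<sigma> * B x) * w x - g x))" for n x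
  have acF: "ac (F n) (F' n)" for n
    unfolding F_def F'_def
    by (intro ac_mult ac_cnj assms(2) ac_of_real)
       (auto intro!: derivative_eq_intros ct_deriv B_deriv continuous_intros B_cont B'_cont ct_cont)
  have F0: "F n x = 0" "F' n x = 0" if "\<bar>x\<bar> > 2 * real (Suc n)" for n x
    using ct_0[OF that] by (simp_all add: F_def F'_def)
  have iF: "integrable lborel (F' n)" "(\<integral>x. F' n x \<partial>lborel) = 0" for n
    using ac_integral_0_compact[OF acF F0] by blast+
  have pw: "(cmod (f n x))\<^sup>2 \<le> 2 * Re (F' n x) + K * ((cmod (w x))\<^sup>2 + (cmod (g x))\<^sup>2)" for n x
  proof -
    define W G t b X where "W = cmod (w x)" and "G = cmod (g x)" and "t = Re (g x * cnj (w x))"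
      and "b = \<bar>B x\<bar>" and "X = ct n x"
    have s: "\<bar>\<sigma>\<bar> = 1" using assms(1) by (metis abs_one power2_eq_1_iff abs_minus)
    have "Re (F' n x) = \<sigma> * (ct' n x * B x) * W\<^sup>2 + \<sigma> * X * B' x * W\<^sup>2 + \<sigma>\<^sup>2 * (2 * X * b\<^sup>2 * W\<^sup>2) - \<sigma> * X * B x * (2 * t)"
      unfolding F'_def W_def t_def b_def X_def cmod_power2
      by (simp add: power2_eq_square algebra_simps)
    then have eq: "Re (F' n x) = \<sigma> * (ct' n x * B x) * W\<^sup>2 + \<sigma> * X * B' x * W\<^sup>2 + 2 * X * b\<^sup>2 * W\<^sup>2 - \<sigma> * X * B x * (2 * t)"
      using assms(1) by simp
    have X: "0 \<le> X" "X \<le> 1" using ct_b by (auto simp: X_def)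
    have W: "W \<ge> 0" "G \<ge> 0" "b \<ge> 0" by (auto simp: W_def G_def b_def)
    \<comment> \<open>Uses 4 s t <= (s + t)^2 with s = X b^2 / 4 and t = 144, after bounding the
      square of \<open>ct'\<close> by 144 \<open>ct\<close>.\<close>
    have e1: "\<bar>ct' n x * B x\<bar> \<le> X * b\<^sup>2 / 4 + 144"
    proof (rule power2_le_imp_le)
      have "\<bar>ct' n x * B x\<bar>\<^sup>2 \<le> 144 * X * b\<^sup>2"
        using ct'_b[of n x] by (simp add: power_mult_distrib X_def b_def mult_right_mono)
      also have "\<dots> \<le> (X * b\<^sup>2 / 4 + 144)\<^sup>2"
        using sum_squares_bound[of "X * b\<^sup>2 / 4" 144] by (simp add: power2_sum)
      finally show "\<bar>ct' n x * B x\<bar>\<^sup>2 \<le> (X * b\<^sup>2 / 4 + 144)\<^sup>2" .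
    qed (use X in simp)
    have a1: "\<sigma> * (ct' n x * B x) * W\<^sup>2 \<ge> - ((X * b\<^sup>2 / 4 + 144) * W\<^sup>2)"
    proof -
      have "\<bar>\<sigma> * (ct' n x * B x) * W\<^sup>2\<bar> \<le> (X * b\<^sup>2 / 4 + 144) * W\<^sup>2"
        using mult_right_mono[OF e1, of "W\<^sup>2"] s by (simp add: abs_mult)
      then show ?thesis by linarith
    qed
    have a2: "\<sigma> * X * B' x * W\<^sup>2 \<ge> - (X * (eps * b\<^sup>2 + M1) * W\<^sup>2)"
    proof -
      have "\<bar>\<sigma> * X * B' x * W\<^sup>2\<bar> \<le> X * (eps * b\<^sup>2 + M1) * W\<^sup>2"
        using mult_left_mono[OF B'_bound[of x], of "X * W\<^sup>2"] s X by (simp add: abs_mult b_def mult_ac)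
      then show ?thesis by linarith
    qed
    have a3: "\<sigma> * X * B x * (2 * t) \<le> X * b\<^sup>2 * W\<^sup>2 / 4 + 4 * G\<^sup>2"
    proof -
      have "\<bar>\<sigma> * X * B x * (2 * t)\<bar> = X * (2 * b * \<bar>t\<bar>)"
        using s X by (simp add: abs_mult b_def mult_ac)
      also have "\<dots> \<le> X * (2 * b * (G * W))"
        using Re_mult_cnj_bound[of "g x" "w x"] X W by (intro mult_left_mono) (auto simp: t_def G_def W_def)
      also have "\<dots> \<le> X * (b\<^sup>2 * W\<^sup>2 / 4 + 4 * G\<^sup>2)"
        using sum_squares_bound[of "b * W / 2" "2 * G"] X
        by (intro mult_left_mono) (auto simp: power_mult_distrib power_divide algebra_simps)
      also have "\<dots> \<le> X * b\<^sup>2 * W\<^sup>2 / 4 + 4 * G\<^sup>2"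
        using mult_right_mono[OF X(2), of "4 * G\<^sup>2"] by (simp add: algebra_simps)
      finally show ?thesis by linarith
    qed
    have Y: "X * (eps * (b\<^sup>2 * W\<^sup>2)) \<le> X * (b\<^sup>2 * W\<^sup>2)" "X * (M1 * W\<^sup>2) \<le> M1 * W\<^sup>2"
    proof -
      have "eps * (b\<^sup>2 * W\<^sup>2) \<le> 1 * (b\<^sup>2 * W\<^sup>2)" using eps by (intro mult_right_mono) auto
      then show "X * (eps * (b\<^sup>2 * W\<^sup>2)) \<le> X * (b\<^sup>2 * W\<^sup>2)" using X by (intro mult_left_mono) auto
      show "X * (M1 * W\<^sup>2) \<le> M1 * W\<^sup>2" using X M1 by (intro mult_left_le_one_le) auto
    qed
    have "Re (F' n x) \<ge> X * (b\<^sup>2 * W\<^sup>2) / 2 - (144 + M1) * W\<^sup>2 - 4 * G\<^sup>2"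
      using eq a1 a2 a3 Y by (simp add: algebra_simps)
    moreover have "(144 + M1) * W\<^sup>2 + 4 * G\<^sup>2 \<le> (K / 2) * (W\<^sup>2 + G\<^sup>2)"
      using M1 by (simp add: K_def algebra_simps)
    moreover have "(cmod (f n x))\<^sup>2 \<le> X * (b\<^sup>2 * W\<^sup>2)"
    proof -
      have "(cmod (f n x))\<^sup>2 = X * (X * (b\<^sup>2 * W\<^sup>2))"
        using X(1) by (simp add: f_def norm_mult power_mult_distrib b_def W_def X_def[symmetric])
           (simp add: power2_eq_square)
      also have "\<dots> \<le> 1 * (X * (b\<^sup>2 * W\<^sup>2))" using X by (intro mult_right_mono) auto
      finally show ?thesis by simp
    qed
    ultimately show ?thesis unfolding W_def G_def by (simp add: algebra_simps)
  qed
  have l2f: "l2 (f n)" for n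
  proof (rule l2_continuous_compact)
    show "continuous_on UNIV (f n)"
      unfolding f_def by (intro continuous_intros ct_cont B_cont contw)
    show "\<bar>x\<bar> > 2 * real (Suc n) \<Longrightarrow> f n x = 0" for x using ct_0[of n x] by (simp add: f_def)
  qed
  have bd: "l2n (f n) \<le> sqrt (K * ((l2n w)\<^sup>2 + (l2n g)\<^sup>2))" for n
  proof -
    have iR: "integrable lborel (\<lambda>x. Re (F' n x))" using iF(1)[of n] by simp
    have "(l2n (f n))\<^sup>2 \<le> (\<integral>x. 2 * Re (F' n x) + K * ((cmod (w x))\<^sup>2 + (cmod (g x))\<^sup>2) \<partial>lborel)"
      unfolding l2n_sq
      by (rule integral_mono[OF l2_int[OF l2f] _ pw])
         (use iR l2_int[OF assms(3)] l2_int[OF assms(4)] in auto)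
    also have "\<dots> = 2 * Re (\<integral>x. F' n x \<partial>lborel) + K * ((l2n w)\<^sup>2 + (l2n g)\<^sup>2)"
      using iR iF(1)[of n] l2_int[OF assms(3)] l2_int[OF assms(4)] by (simp add: l2n_sq)
    finally have "(l2n (f n))\<^sup>2 \<le> K * ((l2n w)\<^sup>2 + (l2n g)\<^sup>2)" using iF(2) by simp
    then show ?thesis by (rule real_le_rsqrt)
  qed
  show ?thesis
  proof (rule l2_Fatou(1)[OF l2f bd])
    fix x
    obtain N where N: "\<bar>x\<bar> \<le> real N" using real_arch_simple by blast
    have "f n x = of_real (B x) * w x" if "n \<ge> N" for n
      using N that by (auto simp: f_def ct_def cut_eq_1)
    then show "(\<lambda>n. f n x) \<longlonglongrightarrow> of_real (B x) * w x"
      by (intro tendsto_eventually eventually_sequentiallyI[of N])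
  qed
qed

text \<open>For \<open>w' = \<sigma> B w - g\<close> one has pointwise \<open>|g|\<^sup>2 = |w'|\<^sup>2 + (B\<^sup>2 + \<sigma> B') |w|\<^sup>2 - (\<sigma> B |w|\<^sup>2)'\<close>.\<close>

lemma gap:
  fixes w g :: "real \<Rightarrow> complex" and \<sigma> \<gamma> :: real
  assumes "\<sigma>\<^sup>2 = 1" "ac w (\<lambda>x. of_real (\<sigma> * B x) * w x - g x)" "l2 w" "l2 g"
    and "\<gamma> \<ge> 0" "\<And>x. w x \<noteq> 0 \<Longrightarrow> \<gamma>\<^sup>2 \<le> (B x)\<^sup>2 + \<sigma> * B' x"
  shows "\<gamma> * l2n w \<le> l2n g"
proof -
  note Bw = l2_potential_mult[OF assms(1-4)]
  define d where "d x = of_real (\<sigma> * B x) * w x - g x" for x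
  have l2d: "l2 d"
    using l2_diff[OF l2_scale[OF Bw, of "of_real \<sigma>"] assms(4)] by (simp add: d_def[abs_def] mult.assoc)
  define F where "F x = of_real \<sigma> * (of_real (B x) * (w x * cnj (w x)))" for x
  define F' where "F' x = of_real \<sigma> * (of_real (B' x) * (w x * cnj (w x)) + of_real (B x) * (d x * cnj (w x) + w x * cnj (d x)))" for x
  have acF: "ac F F'"
    unfolding F_def F'_def d_def by (intro ac_cmult ac_mult ac_cnj assms(2) ac_B)
  have mw [measurable]: "w \<in> borel_measurable borel" using assms(3) l2_meas by auto
  have iF: "integrable lborel F"
    using l2_mult_integrable_complex[OF Bw l2_cnj[OF assms(3)]] by (simp add: F_def[abs_def] mult.assoc)
  have i1: "integrable lborel (\<lambda>x. of_real (B' x) * (w x * cnj (w x)))"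
  proof (rule Bochner_Integration.integrable_bound)
    show "integrable lborel (\<lambda>x. eps * (cmod (of_real (B x) * w x))\<^sup>2 + M1 * (cmod (w x))\<^sup>2)"
      using l2_int[OF Bw] l2_int[OF assms(3)] by simp
    show "AE x in lborel. norm (of_real (B' x) * (w x * cnj (w x))) \<le> norm (eps * (cmod (of_real (B x) * w x))\<^sup>2 + M1 * (cmod (w x))\<^sup>2)"
    proof (rule AE_I2)
      fix x
      have "norm (of_real (B' x) * (w x * cnj (w x))) = \<bar>B' x\<bar> * (cmod (w x))\<^sup>2"
        by (simp add: norm_mult power2_eq_square)
      also have "\<dots> \<le> (eps * (B x)\<^sup>2 + M1) * (cmod (w x))\<^sup>2"
        using B'_bound by (intro mult_right_mono) auto
      finally show "norm (of_real (B' x) * (w x * cnj (w x))) \<le> norm (eps * (cmod (of_real (B x) * w x))\<^sup>2 + M1 * (cmod (w x))\<^sup>2)"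
        by (simp add: norm_mult power_mult_distrib algebra_simps)
    qed
  qed simp
  have i2: "integrable lborel (\<lambda>x. of_real (B x) * (d x * cnj (w x) + w x * cnj (d x)))"
  proof -
    have "integrable lborel (\<lambda>x. d x * cnj (of_real (B x) * w x) + (of_real (B x) * w x) * cnj (d x))"
      by (intro Bochner_Integration.integrable_add l2_mult_integrable_complex l2_cnj Bw l2d)
    then show ?thesis by (simp add: algebra_simps)
  qed
  have iF': "integrable lborel F'"
    unfolding F'_def[abs_def] using i1 i2 by (intro integrable_mult_right Bochner_Integration.integrable_add)
  have z: "(\<integral>x. F' x \<partial>lborel) = 0" by (rule ac_integral_0[OF acF iF iF'])
  have pw: "\<gamma>\<^sup>2 * (cmod (w x))\<^sup>2 \<le> (cmod (g x))\<^sup>2 + Re (F' x)" for x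
  \<comment> \<open>The bound on \<open>B\<close> is asked for only where \<open>w\<close> does not
    vanish, so functions that are cut off around the turning point qualify for both signs \<sigma>.
    At a zero of \<open>w\<close> the term \<open>F'\<close> is 0.\<close>
  proof (cases "w x = 0")
    case True then show ?thesis by (simp add: F'_def)
  next
    case False
    have ge: "g x = of_real (\<sigma> * B x) * w x - d x" by (simp add: d_def)
    have "(cmod (g x))\<^sup>2 + Re (F' x) = (cmod (d x))\<^sup>2 + (\<sigma>\<^sup>2 * (B x)\<^sup>2 + \<sigma> * B' x) * (cmod (w x))\<^sup>2"
      unfolding ge F'_def cmod_power2 by (simp add: power2_eq_square algebra_simps)
    moreover have "\<gamma>\<^sup>2 * (cmod (w x))\<^sup>2 \<le> (\<sigma>\<^sup>2 * (B x)\<^sup>2 + \<sigma> * B' x) * (cmod (w x))\<^sup>2"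
      using mult_right_mono[OF assms(6)[OF False], of "(cmod (w x))\<^sup>2"] assms(1) by simp
    moreover have "0 \<le> (cmod (d x))\<^sup>2" by simp
    ultimately show ?thesis by linarith
  qed
  have iR: "integrable lborel (\<lambda>x. Re (F' x))" using iF' by simp
  have "(\<integral>x. \<gamma>\<^sup>2 * (cmod (w x))\<^sup>2 \<partial>lborel) \<le> (\<integral>x. (cmod (g x))\<^sup>2 + Re (F' x) \<partial>lborel)"
    by (rule integral_mono) (use pw iR l2_int[OF assms(3)] l2_int[OF assms(4)] in auto)
  also have "\<dots> = (l2n g)\<^sup>2" using iR l2_int[OF assms(4)] iF' z by (simp add: l2n_sq)
  finally have "(\<gamma> * l2n w)\<^sup>2 \<le> (l2n g)\<^sup>2" using l2_int[OF assms(3)] by (simp add: l2n_sq power_mult_distrib)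
  then show ?thesis by (rule power2_le_imp_le) simp
qed

end

section \<open>Solvability of the scalar equations in L2\<close>

lemma integrable_exp_abs:
  fixes c :: real assumes "c > 0"
  shows "integrable lborel (\<lambda>x. exp (- c * \<bar>x\<bar>))"
proof -
  have lim: "((\<lambda>x. - exp (- c * x) / c) \<longlongrightarrow> 0) at_top"
    using assms by real_asymp
  have "(\<integral>\<^sup>+x. ennreal (exp (- c * x)) * indicator {0..} x \<partial>lborel) = 0 - (- exp (- c * 0) / c)"
    by (rule nn_integral_FTC_atLeast[OF _ _ _ lim])
       (use assms in \<open>auto intro!: derivative_eq_intros simp: field_simps\<close>)
  then have "(\<integral>\<^sup>+x. ennreal (indicator {0..} x * exp (- c * x)) \<partial>lborel) < \<infinity>"
    by (simp add: ennreal_mult'' ennreal_indicator mult.commute)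
  then have i: "integrable lborel (\<lambda>x. indicator {0..} x * exp (- c * x))"
    by (intro integrableI_nonneg) auto
  have j: "integrable lborel (\<lambda>x. indicator {0..} (-x) * exp (- c * (-x)))"
    using lborel_integrable_real_affine[OF i, of "-1" 0] by simp
  show ?thesis
  proof (rule Bochner_Integration.integrable_bound[OF Bochner_Integration.integrable_add[OF i j]])
    show "AE x in lborel. norm (exp (- c * \<bar>x\<bar>)) \<le> norm (indicator {0..} x * exp (- c * x) + indicator {0..} (- x) * exp (- c * - x))"
      by (auto simp: indicator_def)
  qed auto
qed

text \<open>The factor x^2 is traded for half of the exponent, by t <= exp t at t = c |x| /
  4.\<close>

lemma integrable_power2_exp_abs:
  fixes c :: real assumes "c > 0"
  shows "integrable lborel (\<lambda>x. x\<^sup>2 * exp (- c * \<bar>x\<bar>))"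
proof (rule Bochner_Integration.integrable_bound)
  show "integrable lborel (\<lambda>x. (16 / c\<^sup>2) * exp (- (c / 2) * \<bar>x\<bar>))"
    using integrable_exp_abs[of "c / 2"] assms by simp
  show "AE x in lborel. norm (x\<^sup>2 * exp (- c * \<bar>x\<bar>)) \<le> norm ((16 / c\<^sup>2) * exp (- (c / 2) * \<bar>x\<bar>))"
  proof (rule AE_I2)
    fix x :: real
    have "c * \<bar>x\<bar> / 4 \<le> exp (c * \<bar>x\<bar> / 4)"
      using exp_ge_add_one_self[of "c * \<bar>x\<bar> / 4"] by linarith
    then have "(c * \<bar>x\<bar> / 4)\<^sup>2 \<le> (exp (c * \<bar>x\<bar> / 4))\<^sup>2" using assms by (intro power_mono) auto
    also have "\<dots> = exp (c * \<bar>x\<bar> / 2)" by (simp add: power2_eq_square exp_add[symmetric])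
    finally have "x\<^sup>2 \<le> (16 / c\<^sup>2) * exp (c * \<bar>x\<bar> / 2)"
      using assms by (simp add: power_mult_distrib power_divide field_simps)
    then have "x\<^sup>2 * exp (- c * \<bar>x\<bar>) \<le> (16 / c\<^sup>2) * exp (c * \<bar>x\<bar> / 2) * exp (- c * \<bar>x\<bar>)"
      by (intro mult_right_mono) auto
    also have "\<dots> = (16 / c\<^sup>2) * exp (- (c / 2) * \<bar>x\<bar>)"
      by (simp add: mult.assoc exp_add[symmetric])
    finally show "norm (x\<^sup>2 * exp (- c * \<bar>x\<bar>)) \<le> norm ((16 / c\<^sup>2) * exp (- (c / 2) * \<bar>x\<bar>))" by simp
  qed
qed auto

lemma l2_of_bounded_Icc:
  fixes z :: "real \<Rightarrow> complex"
  assumes "continuous_on UNIV z" "\<And>n::nat. n \<ge> N \<Longrightarrow> (LBINT t:{-real n..real n}. (norm (z t))\<^sup>2) \<le> C"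
  shows "l2 z"
proof -
  let ?f = "\<lambda>n x. indicator {-real (N + n)..real (N + n)} x *\<^sub>R z x"
  have mz [measurable]: "z \<in> borel_measurable borel" using assms(1) by (rule borel_measurable_continuous_onI)
  have i: "set_integrable lborel {-real n..real n} (\<lambda>t. (norm (z t))\<^sup>2)" for n
    by (rule borel_integrable_atLeastAtMost') (intro continuous_intros continuous_on_subset[OF assms(1)] subset_UNIV)
  have e: "(norm (?f n x))\<^sup>2 = indicator {-real (N + n)..real (N + n)} x *\<^sub>R (norm (z x))\<^sup>2" for n x
    by (simp add: indicator_def)
  have l: "l2 (?f n)" for n
    unfolding l2_def e using i[of "N + n"] by (simp add: set_integrable_def)
  have b: "l2n (?f n) \<le> sqrt C" for n
    unfolding l2n_def e using assms(2)[of "N + n"] by (simp add: set_lebesgue_integral_def)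
  show ?thesis
  proof (rule l2_Fatou(1)[OF l b])
    fix x
    obtain M where M: "\<bar>x\<bar> \<le> real M" using real_arch_simple by blast
    show "(\<lambda>n. ?f n x) \<longlonglongrightarrow> z x"
      by (rule tendsto_eventually, rule eventually_sequentiallyI[of M]) (use M in \<open>auto simp: indicator_def\<close>)
  qed
qed

lemma l2_reflect:
  assumes "l2 f" shows "l2 (\<lambda>x. f (- x))" "l2n (\<lambda>x. f (- x)) = l2n f"
proof -
  have "f \<in> borel_measurable borel" using assms l2_meas by auto
  then have m: "(\<lambda>x. f (- x)) \<in> borel_measurable borel" by measurable
  show "l2 (\<lambda>x. f (- x))"
    using lborel_integrable_real_affine[OF l2_int[OF assms], of "-1" 0] m by (simp add: l2_def)
  show "l2n (\<lambda>x. f (- x)) = l2n f"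
    using lborel_integral_real_affine[of "-1" "\<lambda>x. (norm (f x))\<^sup>2" 0] by (simp add: l2n_def)
qed

text \<open>Integrates the derivative of |z|^2 over [p, q] and drops the nonnegative value at q, so
  the bound does not depend on q. The pointwise hypothesis is what Young's inequality leaves of z' =
  h - B z where B >= c.\<close>

lemma energy_bound:
  fixes z d :: "real \<Rightarrow> complex" and h :: "real \<Rightarrow> complex"
  assumes "ac z d" "p \<le> q" "c > 0" "l2 h"
    and "\<And>x. p \<le> x \<Longrightarrow> x \<le> q \<Longrightarrow> 2 * Re (d x * cnj (z x)) \<le> (cmod (h x))\<^sup>2 / c - c * (cmod (z x))\<^sup>2"
  shows "c * (LBINT t:{p..q}. (cmod (z t))\<^sup>2) \<le> (cmod (z p))\<^sup>2 + (l2n h)\<^sup>2 / c"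
proof -
  let ?F = "\<lambda>x. d x * cnj (z x) + z x * cnj (d x)"
  have F: "ac (\<lambda>x. z x * cnj (z x)) ?F" by (intro ac_mult ac_cnj assms(1))
  have iF: "integrable lborel (\<lambda>t. indicator {p..q} t *\<^sub>R ?F t)"
    using ac_set_integrable[OF F, of p q] by (simp add: set_integrable_def)
  have iz: "set_integrable lborel {p..q} (\<lambda>t. (cmod (z t))\<^sup>2)"
    by (rule borel_integrable_atLeastAtMost') (intro continuous_intros ac_continuous[OF assms(1)])
  have ih: "set_integrable lborel {p..q} (\<lambda>t. (cmod (h t))\<^sup>2)"
    using l2_int[OF assms(4)] unfolding set_integrable_def by (intro integrable_mult_indicator) auto
  have "(cmod (z q))\<^sup>2 = Re (z q * cnj (z q))" by (simp add: complex_mult_cnj cmod_power2)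
  also have "\<dots> = (cmod (z p))\<^sup>2 + Re (\<integral>t. indicator {p..q} t *\<^sub>R ?F t \<partial>lborel)"
    using ac_eq[OF F assms(2)] by (simp add: set_lebesgue_integral_def complex_mult_cnj cmod_power2)
  also have "Re (\<integral>t. indicator {p..q} t *\<^sub>R ?F t \<partial>lborel) = (\<integral>t. Re (indicator {p..q} t *\<^sub>R ?F t) \<partial>lborel)"
    by (rule integral_bounded_linear[OF bounded_linear_Re iF, symmetric])
  also have "\<dots> \<le> (LBINT t:{p..q}. (cmod (h t))\<^sup>2 / c - c * (cmod (z t))\<^sup>2)"
    unfolding set_lebesgue_integral_def
  proof (rule integral_mono)
    show "integrable lborel (\<lambda>t. Re (indicator {p..q} t *\<^sub>R ?F t))" using iF by (rule integrable_Re)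
    show "integrable lborel (\<lambda>t. indicator {p..q} t *\<^sub>R ((cmod (h t))\<^sup>2 / c - c * (cmod (z t))\<^sup>2))"
      unfolding set_integrable_def[symmetric]
      by (intro set_integral_diff(1) set_integrable_mult_right set_integrable_divide ih iz)
    show "Re (indicator {p..q} t *\<^sub>R ?F t) \<le> indicator {p..q} t *\<^sub>R ((cmod (h t))\<^sup>2 / c - c * (cmod (z t))\<^sup>2)" for t
      using assms(5)[of t] by (auto simp: indicator_def mult.commute)
  qed
  also have "\<dots> = (LBINT t:{p..q}. (cmod (h t))\<^sup>2) / c - c * (LBINT t:{p..q}. (cmod (z t))\<^sup>2)"
    using ih iz by (subst set_integral_diff(2)) auto
  also have "(LBINT t:{p..q}. (cmod (h t))\<^sup>2) / c \<le> (l2n h)\<^sup>2 / c"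
    unfolding l2n_sq set_lebesgue_integral_def
    by (intro divide_right_mono integral_mono)
       (use assms(3) ih l2_int[OF assms(4)] in \<open>auto simp: set_integrable_def indicator_def\<close>)
  finally show ?thesis using zero_le_power2[of "cmod (z q)"] by linarith
qed

lemma ac_from_minus_infinity:
  fixes f :: "real \<Rightarrow> complex"
  assumes "integrable lborel f"
  shows "ac (\<lambda>x. \<integral>t. indicator {..x} t *\<^sub>R f t \<partial>lborel) f"
  unfolding ac_def
proof (intro conjI allI impI)
  show "f \<in> borel_measurable borel" using assms by auto
  fix x y :: real assume "x \<le> y"
  have i: "integrable lborel (\<lambda>t. indicator A t *\<^sub>R f t)" if "A \<in> sets borel" for A
    using assms that by (intro integrable_mult_indicator) auto
  then show "set_integrable lborel {x..y} f" by (simp add: set_integrable_def)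
  have "(\<integral>t. indicator {..x} t *\<^sub>R f t \<partial>lborel) + (LBINT t:{x..y}. f t)
     = (\<integral>t. indicator {..x} t *\<^sub>R f t + indicator {x..y} t *\<^sub>R f t \<partial>lborel)"
    unfolding set_lebesgue_integral_def by (rule Bochner_Integration.integral_add[symmetric]) (auto intro: i)
  also have "\<dots> = (\<integral>t. indicator {..y} t *\<^sub>R f t \<partial>lborel)"
  proof (rule integral_cong_AE)
    show "(\<lambda>t. indicator {..x} t *\<^sub>R f t + indicator {x..y} t *\<^sub>R f t) \<in> borel_measurable lborel"
      "(\<lambda>t. indicator {..y} t *\<^sub>R f t) \<in> borel_measurable lborel"
      using assms by auto
    have "AE t in lborel. t \<noteq> x" by (rule AE_lborel_singleton)
    then show "AE t in lborel. indicator {..x} t *\<^sub>R f t + indicator {x..y} t *\<^sub>R f t = indicator {..y} t *\<^sub>R f t"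
      by eventually_elim (use \<open>x \<le> y\<close> in \<open>auto simp: indicator_def\<close>)
  qed
  finally show "(\<integral>t. indicator {..y} t *\<^sub>R f t \<partial>lborel) = (\<integral>t. indicator {..x} t *\<^sub>R f t \<partial>lborel) + (LBINT t:{x..y}. f t)"
    by simp
qed

text \<open>-d/dx + \<sigma> B and d/dx + \<sigma> B are formal adjoints: in the derivative of
  \<open>w x * cnj (z x)\<close> the potential terms cancel.\<close>

lemma ac_adjoint:
  fixes \<sigma> :: real
  assumes "ac w (\<lambda>x. of_real (\<sigma> * B x) * w x - g x)" "ac z (\<lambda>x. h x - of_real (\<sigma> * B x) * z x)"
    and "l2 w" "l2 g" "l2 z" "l2 h"
  shows "(\<integral>x. g x * cnj (z x) \<partial>lborel) = (\<integral>x. w x * cnj (h x) \<partial>lborel)"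
proof -
  have i: "integrable lborel (\<lambda>x. w x * cnj (h x))" "integrable lborel (\<lambda>x. g x * cnj (z x))"
    by (intro l2_mult_integrable_complex l2_cnj assms)+
  have "ac (\<lambda>x. w x * cnj (z x)) (\<lambda>x. w x * cnj (h x) - g x * cnj (z x))"
    using ac_mult[OF assms(1) ac_cnj[OF assms(2)]] by (simp add: algebra_simps)
  moreover have "integrable lborel (\<lambda>x. w x * cnj (z x))"
    by (intro l2_mult_integrable_complex l2_cnj assms)
  ultimately have "(\<integral>x. w x * cnj (h x) - g x * cnj (z x) \<partial>lborel) = 0"
    using i by (intro ac_integral_0) auto
  then show ?thesis using i by simp
qed

text \<open>The sign change of \<open>B\<close> makes \<open>exp (- \<Phi>)\<close> decay at both
  ends, which is what gives \<open>L_+\<close> a kernel. \<open>B\<^sup>2 + B'\<close> is the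
  potential of \<open>L_-\<close> composed with its adjoint, so \<gamma> bounds \<open>L_-\<close>
  from below; for \<open>L_+\<close> the bound is regained by duality off the kernel.\<close>

locale wall = C1_potential +
  fixes c R \<gamma> :: real
  assumes c: "c > 0"
    and B_right: "\<And>x. x \<ge> R \<Longrightarrow> B x \<ge> c"
    and B_left: "\<And>x. x \<le> - R \<Longrightarrow> B x \<le> - c"
    and \<gamma>: "\<gamma> > 0" and gap_pos: "\<And>x. \<gamma>\<^sup>2 \<le> (B x)\<^sup>2 + B' x"
begin

text \<open>Another antiderivative would only multiply \<open>k\<close> by a positive constant;
  later quantities are normalised by the norm of \<open>k\<close>.\<close>

definition \<Phi> :: "real \<Rightarrow> real" where
  "\<Phi> = (SOME F. \<forall>x. (F has_real_derivative B x) (at x))"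

lemma \<Phi>_deriv: "(\<Phi> has_real_derivative B x) (at x)"
proof -
  have "\<exists>F. \<forall>x::real. -\<infinity> < ereal x \<longrightarrow> ereal x < \<infinity> \<longrightarrow> (F has_vector_derivative B x) (at x)"
    by (rule einterval_antiderivative) (use B_deriv DERIV_isCont in auto)
  then have "\<exists>F. \<forall>x. (F has_real_derivative B x) (at x)"
    by (auto simp: has_real_derivative_iff_has_vector_derivative)
  then have "\<forall>x. (\<Phi> has_real_derivative B x) (at x)"
    unfolding \<Phi>_def by (rule someI_ex)
  then show ?thesis ..
qed

lemma R_nonneg: "R \<ge> 0"
  using B_right[of 0] B_left[of 0] c by (cases "R \<ge> 0") auto

definition k :: "real \<Rightarrow> real" where "k x = exp (- \<Phi> x)"

lemma k_pos: "k x > 0" by (simp add: k_def)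

lemma k_deriv: "(k has_real_derivative - B x * k x) (at x)"
  unfolding k_def[abs_def] by (auto intro!: derivative_eq_intros \<Phi>_deriv)

lemma k_cont: "continuous_on A k"
  using k_deriv by (meson DERIV_isCont continuous_at_imp_continuous_on)

lemma k_meas [measurable]: "k \<in> borel_measurable borel"
  by (rule borel_measurable_continuous_onI) (rule k_cont)

lemma ac_k: "ac (\<lambda>x. of_real (k x)) (\<lambda>x. - of_real (B x) * of_real (k x))"
  using ac_of_real[OF k_deriv] by (simp add: continuous_intros B_cont k_cont)

lemma ac_inverse_k: "ac (\<lambda>x. of_real (exp (\<Phi> x))) (\<lambda>x. of_real (B x) * of_real (exp (\<Phi> x)))"
proof -
  have "((\<lambda>x. exp (\<Phi> x)) has_real_derivative B x * exp (\<Phi> x)) (at x)" for x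
    by (auto intro!: derivative_eq_intros \<Phi>_deriv)
  moreover have "continuous_on UNIV \<Phi>"
    using \<Phi>_deriv by (meson DERIV_isCont continuous_at_imp_continuous_on)
  ultimately show ?thesis
    using ac_of_real[of "\<lambda>x. exp (\<Phi> x)" "\<lambda>x. B x * exp (\<Phi> x)"] by (simp add: continuous_intros B_cont)
qed

text \<open>The function \<open>- \<Phi> x + c * \<bar>x\<bar>\<close> decreases to the right of R
  and increases to the left of -R, so its maximum over [-R, R] bounds it everywhere.\<close>

lemma k_decay: "\<exists>K>0. \<forall>x. k x \<le> K * exp (- c * \<bar>x\<bar>)"
proof -
  have cont: "continuous_on {-R..R} (\<lambda>x. - \<Phi> x + c * \<bar>x\<bar>)"
    using \<Phi>_deriv by (intro continuous_intros) (meson DERIV_isCont continuous_at_imp_continuous_on)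
  obtain C where C: "\<And>x. x \<in> {-R..R} \<Longrightarrow> - \<Phi> x + c * \<bar>x\<bar> \<le> C"
    using continuous_attains_sup[OF compact_Icc _ cont] R_nonneg by (metis atLeastAtMost_iff empty_iff neg_le_iff_le order_trans neg_le_0_iff_le)
  have "- \<Phi> x + c * \<bar>x\<bar> \<le> C" for x
  proof -
    consider "x \<in> {-R..R}" | "x > R" | "x < - R" by force
    then show ?thesis
    proof cases
      case 1 then show ?thesis by (rule C)
    next
      case 2
      have "((\<lambda>x. - \<Phi> x + c * x) has_real_derivative - B y + c) (at y)" for y
        by (auto intro!: derivative_eq_intros \<Phi>_deriv)
      then have "- \<Phi> x + c * x \<le> - \<Phi> R + c * R"
        using 2 B_right by (intro DERIV_nonpos_imp_nonincreasing[of R x "\<lambda>x. - \<Phi> x + c * x"]) force+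
      then show ?thesis using C[of R] 2 R_nonneg by simp
    next
      case 3
      have "((\<lambda>x. - \<Phi> x - c * x) has_real_derivative - B y - c) (at y)" for y
        by (auto intro!: derivative_eq_intros \<Phi>_deriv)
      then have "- \<Phi> x - c * x \<le> - \<Phi> (-R) - c * (-R)"
        using 3 B_left by (intro DERIV_nonneg_imp_nondecreasing[of x "-R" "\<lambda>x. - \<Phi> x - c * x"]) force+
      then show ?thesis using C[of "-R"] 3 R_nonneg by simp
    qed
  qed
  then have "k x \<le> exp C * exp (- c * \<bar>x\<bar>)" for x
    by (simp add: k_def exp_add[symmetric] algebra_simps)
  then show ?thesis by (intro exI[of _ "exp C"]) auto
qed

lemma l2_k: "l2 (\<lambda>x. complex_of_real (k x))"
  and l2_tk: "l2 (\<lambda>x. complex_of_real (x * k x))"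
proof -
  obtain K where K: "K > 0" "\<And>x. k x \<le> K * exp (- c * \<bar>x\<bar>)" using k_decay by blast
  have b: "(k x)\<^sup>2 \<le> K\<^sup>2 * exp (- (2 * c) * \<bar>x\<bar>)" for x
  proof -
    have "(exp (- c * \<bar>x\<bar>))\<^sup>2 = exp (- (2 * c) * \<bar>x\<bar>)"
      by (simp add: exp_double[symmetric] mult.assoc)
    then show ?thesis using power_mono[OF K(2)[of x], of 2] k_pos[of x]
      by (simp add: power_mult_distrib less_imp_le)
  qed
  have "integrable lborel (\<lambda>x. K\<^sup>2 * exp (- (2 * c) * \<bar>x\<bar>))"
    using integrable_exp_abs[of "2 * c"] c by simp
  then have "integrable lborel (\<lambda>x. (k x)\<^sup>2)"
    by (rule Bochner_Integration.integrable_bound) (use b in auto)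
  then show "l2 (\<lambda>x. complex_of_real (k x))" by (simp add: l2_def)
  have "integrable lborel (\<lambda>x. K\<^sup>2 * (x\<^sup>2 * exp (- (2 * c) * \<bar>x\<bar>)))"
    using integrable_power2_exp_abs[of "2 * c"] c by simp
  then have "integrable lborel (\<lambda>x. (x * k x)\<^sup>2)"
    by (rule Bochner_Integration.integrable_bound)
       (use mult_left_mono[OF b zero_le_power2] in \<open>auto simp: power_mult_distrib mult_ac\<close>)
  then show "l2 (\<lambda>x. complex_of_real (x * k x))" by (simp add: l2_def norm_mult power_mult_distrib)
qed

lemma l2_Bk: "l2 (\<lambda>x. of_real (B x) * complex_of_real (k x))"
  using l2_potential_mult[of "-1" "\<lambda>x. complex_of_real (k x)" "\<lambda>x. 0"] ac_k l2_k
  by (simp add: l2_def)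

lemma l2n_k_pos: "l2n (\<lambda>x. complex_of_real (k x)) > 0"
proof (rule ccontr)
  assume "\<not> ?thesis"
  then have "AE x in lborel. complex_of_real (k x) = 0"
    using l2n_zero_AE[OF l2_k] l2n_nonneg[of "\<lambda>x. complex_of_real (k x)"] by simp
  then have "AE x in (lborel :: real measure). False" using k_pos by (auto simp: less_le)
  then show False by (simp add: eventually_False ae_filter_eq_bot_iff)
qed

text \<open>Variation of constants: z = k G with G' = h / k. Every primitive G works, because the
  equation is damped to the right, where B >= c, and, read backwards, to the left, where B <=
  -c.\<close>

lemma Lp_solve:
  assumes "l2 h"
  shows "\<exists>z. ac z (\<lambda>x. h x - of_real (B x) * z x) \<and> l2 z"
proof -
  have mh: "h \<in> borel_measurable borel" using assms l2_meas by auto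
  have cE: "continuous_on UNIV (\<lambda>x. complex_of_real (exp (\<Phi> x)))" by (rule ac_continuous[OF ac_inverse_k])
  have ih: "set_integrable lborel {x..y} h" for x y
  proof -
    have "integrable lborel (\<lambda>t. norm (h t) * norm (indicator {x..y} t :: real))"
    proof (rule l2_mult_integrable[OF assms])
      have "(\<lambda>t. (norm (indicator {x..y} t :: real))\<^sup>2) = indicator {x..y}"
        by (auto simp: indicator_def)
      moreover have "integrable lborel (indicator {x..y} :: real \<Rightarrow> real)"
        by (rule integrable_real_indicator) (auto simp: emeasure_lborel_Icc_eq)
      ultimately show "l2 (\<lambda>t. indicator {x..y} t :: real)" unfolding l2_def by auto
    qed
    then show ?thesis unfolding set_integrable_def
      by (rule Bochner_Integration.integrable_bound) (use mh in \<open>auto simp: indicator_def\<close>)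
  qed
  let ?v = "\<lambda>t. h t * of_real (exp (\<Phi> t))"
  have mv: "?v \<in> borel_measurable borel" using mh borel_measurable_continuous_onI[OF cE] by simp
  obtain G where G: "ac G ?v"
    using ac_indefinite[OF mv set_integrable_continuous_mult[OF ih cE mh]] by blast
  define z where "z x = of_real (k x) * G x" for x
  have ek: "complex_of_real (k x) * (h x * of_real (exp (\<Phi> x))) = h x" for x
    by (simp add: k_def exp_minus field_simps)
  have acz: "ac z (\<lambda>x. h x - of_real (B x) * z x)"
    using ac_mult[OF ac_k G] unfolding z_def ek by (simp add: algebra_simps)
  have cz: "continuous_on UNIV z" by (rule ac_continuous[OF acz])
  define d where "d x = h x - of_real (B x) * z x" for x
  have acd: "ac z d" using acz by (simp add: d_def[abs_def])
  have t: "\<bar>2 * Re (h x * cnj (z x))\<bar> \<le> c * (cmod (z x))\<^sup>2 + (cmod (h x))\<^sup>2 / c" for x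
  proof -
    have "\<bar>2 * Re (h x * cnj (z x))\<bar> \<le> 2 * (cmod (h x) * cmod (z x))"
      using Re_mult_cnj_bound[of "h x" "z x"] by simp
    also have "\<dots> \<le> c * (cmod (z x))\<^sup>2 + (cmod (h x))\<^sup>2 / c"
    proof -
      have "0 \<le> (c * cmod (z x) - cmod (h x))\<^sup>2 / c" using c by simp
      also have "\<dots> = c * (cmod (z x))\<^sup>2 + (cmod (h x))\<^sup>2 / c - 2 * (cmod (h x) * cmod (z x))"
        using c by (simp add: power2_eq_square field_simps)
      finally show ?thesis by simp
    qed
    finally show ?thesis .
  qed
  have de: "2 * Re (d x * cnj (z x)) = 2 * Re (h x * cnj (z x)) - 2 * B x * (cmod (z x))\<^sup>2" for x
    unfolding d_def cmod_power2 by (simp add: power2_eq_square algebra_simps)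
  have right: "c * (LBINT t:{R..q}. (cmod (z t))\<^sup>2) \<le> (cmod (z R))\<^sup>2 + (l2n h)\<^sup>2 / c" if "R \<le> q" for q
  proof (rule energy_bound[OF acd that c assms])
    fix x assume "R \<le> x" "x \<le> q"
    then have "c * (cmod (z x))\<^sup>2 \<le> B x * (cmod (z x))\<^sup>2" using B_right by (intro mult_right_mono) auto
    then show "2 * Re (d x * cnj (z x)) \<le> (cmod (h x))\<^sup>2 / c - c * (cmod (z x))\<^sup>2"
      unfolding de using t[of x] by linarith
  qed
  \<comment> \<open>Under reflection both d/dx and the sign of \<open>B\<close> at the end turn
    around, so the left half-line obeys the same energy estimate.\<close>
  have left: "c * (LBINT t:{-q..-R}. (cmod (z t))\<^sup>2) \<le> (cmod (z (-R)))\<^sup>2 + (l2n h)\<^sup>2 / c" if "R \<le> q" for q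
  proof -
    have "c * (LBINT t:{R..q}. (cmod (z (-t)))\<^sup>2) \<le> (cmod (z (-R)))\<^sup>2 + (l2n (\<lambda>x. h (- x)))\<^sup>2 / c"
    proof (rule energy_bound[OF ac_reflect[OF acd] that c l2_reflect(1)[OF assms]])
      fix x assume "R \<le> x" "x \<le> q"
      then have "B (-x) * (cmod (z (-x)))\<^sup>2 \<le> - c * (cmod (z (-x)))\<^sup>2" using B_left[of "-x"] by (intro mult_right_mono) auto
      then show "2 * Re (- d (- x) * cnj (z (- x))) \<le> (cmod (h (- x)))\<^sup>2 / c - c * (cmod (z (- x)))\<^sup>2"
        using de[of "-x"] t[of "-x"] by simp
    qed
    moreover have "(LBINT t:{R..q}. (cmod (z (-t)))\<^sup>2) = (LBINT t:{-q..-R}. (cmod (z t))\<^sup>2)"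
    proof -
      have e: "indicator {-q..-R} (0 + (-1) * t) *\<^sub>R (cmod (z (0 + (-1) * t)))\<^sup>2 = indicator {R..q} t *\<^sub>R (cmod (z (- t)))\<^sup>2" for t
        by (auto simp: indicator_def)
      show ?thesis
        using lborel_integral_real_affine[of "-1" "\<lambda>t. indicator {-q..-R} t *\<^sub>R (cmod (z t))\<^sup>2" 0]
        unfolding e by (simp add: set_lebesgue_integral_def)
    qed
    ultimately show ?thesis using l2_reflect(2)[OF assms] by simp
  qed
  obtain N where N: "R \<le> real N" using real_arch_simple by blast
  define C where "C = ((cmod (z R))\<^sup>2 + (l2n h)\<^sup>2 / c) / c + ((cmod (z (-R)))\<^sup>2 + (l2n h)\<^sup>2 / c) / c
       + (LBINT t:{-R..R}. (cmod (z t))\<^sup>2)"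
  have "l2 z"
  proof (rule l2_of_bounded_Icc[OF cz])
    fix n :: nat assume "n \<ge> N"
    then have n: "R \<le> real n" using N by simp
    have i: "set_integrable lborel {p..q} (\<lambda>t. (cmod (z t))\<^sup>2)" for p q
      by (rule borel_integrable_atLeastAtMost') (intro continuous_intros continuous_on_subset[OF cz] subset_UNIV)
    have "(LBINT t:{-real n..real n}. (cmod (z t))\<^sup>2)
        = (LBINT t:{-real n..-R}. (cmod (z t))\<^sup>2) + (LBINT t:{-R..R}. (cmod (z t))\<^sup>2) + (LBINT t:{R..real n}. (cmod (z t))\<^sup>2)"
      using set_lebesgue_integral_Icc_combine[OF _ _ i, of "-real n" "-R" "real n"]
        set_lebesgue_integral_Icc_combine[OF _ _ i, of "-R" R "real n"] n R_nonneg by simp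
    also have "\<dots> \<le> C"
      using right[OF n] left[OF n] c by (simp add: C_def pos_le_divide_eq mult.commute)
         (smt (verit) pos_le_divide_eq mult.commute)
    finally show "(LBINT t:{-real n..real n}. (cmod (z t))\<^sup>2) \<le> C" .
  qed
  then show ?thesis using acz by blast
qed

end

context wall
begin

text \<open>The solution \<open>- exp \<Phi>\<close> times the integral of \<open>h k\<close> from
  minus infinity can only decay on the right if the total integral is 0, and even then its square
  integrability is not visible from the formula. It is therefore approximated by solutions of
  compact support, which \<open>gap\<close> bounds uniformly.\<close>

lemma Lm_solve:
  assumes "l2 h" "(\<integral>x. h x * of_real (k x) \<partial>lborel) = 0"
  shows "\<exists>v. ac v (\<lambda>x. of_real (B x) * v x - h x) \<and> l2 v"
proof -
  note ihk = l2_mult_integrable_complex[OF assms(1) l2_k]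
  have ikk: "integrable lborel (\<lambda>x. complex_of_real (k x) * of_real (k x))"
    by (rule l2_mult_integrable_complex[OF l2_k l2_k])
  have mh [measurable]: "h \<in> borel_measurable borel" using assms(1) l2_meas by auto
  define ind :: "nat \<Rightarrow> real \<Rightarrow> complex" where "ind n x = indicator {-real n..real n} x" for n x
  have m_ind [measurable]: "ind n \<in> borel_measurable borel" for n unfolding ind_def[abs_def] by measurable
  have ind_lim: "(\<lambda>n. ind n x) \<longlonglongrightarrow> 1" for x
  proof -
    obtain M where M: "\<bar>x\<bar> \<le> real M" using real_arch_simple by blast
    show ?thesis
      by (rule tendsto_eventually, rule eventually_sequentiallyI[of M]) (use M in \<open>auto simp: ind_def indicator_def\<close>)
  qed
  have ind_le: "norm (ind n x) \<le> 1" for n x by (simp add: ind_def indicator_def)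
  define K where "K = (\<integral>x. complex_of_real (k x) * of_real (k x) \<partial>lborel)"
  have K: "K = of_real ((l2n (\<lambda>x. complex_of_real (k x)))\<^sup>2)"
    unfolding K_def l2n_sq integral_complex_of_real[symmetric] by (simp add: power2_eq_square)
  then have K0: "K \<noteq> 0" using l2n_k_pos by simp
  define an where "an n = (\<integral>x. ind n x * (h x * of_real (k x)) \<partial>lborel)" for n
  define Kn where "Kn n = (\<integral>x. ind n x * (complex_of_real (k x) * of_real (k x)) \<partial>lborel)" for n
  have lim_ind: "(\<lambda>n. \<integral>x. ind n x * f x \<partial>lborel) \<longlonglongrightarrow> (\<integral>x. f x \<partial>lborel)" if "integrable lborel f" for f
  proof (rule integral_dominated_convergence[where w = "\<lambda>x. norm (f x)"])
    show "AE x in lborel. (\<lambda>n. ind n x * f x) \<longlonglongrightarrow> f x"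
      using tendsto_mult[OF ind_lim tendsto_const] by simp
    show "AE x in lborel. norm (ind n x * f x) \<le> norm (f x)" for n
      by (intro AE_I2) (simp add: norm_mult mult_left_le_one_le ind_le)
  qed (use that in auto)
  have an0: "an \<longlonglongrightarrow> 0" using lim_ind[OF ihk] assms(2) by (simp add: an_def[abs_def])
  have Kn0: "Kn \<longlonglongrightarrow> K" using lim_ind[OF ikk] by (simp add: Kn_def[abs_def] K_def)
  \<comment> \<open>Truncation to [-n, n] destroys the orthogonality to \<open>k\<close>;
    subtracting \<open>cn n\<close> times the truncated \<open>k\<close> restores it, and
    \<open>cn n\<close> tends to 0. The index \<open>N\<close> below marks where the denominators
    are nonzero.\<close>
  define cn where "cn n = an n / Kn n" for n
  have cn0: "cn \<longlonglongrightarrow> 0" unfolding cn_def[abs_def] using tendsto_divide[OF an0 Kn0 K0] by simp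
  have "\<forall>\<^sub>F n in sequentially. Kn n \<noteq> 0" using tendsto_imp_eventually_ne[OF Kn0 K0] .
  then obtain N where N: "\<And>n. n \<ge> N \<Longrightarrow> Kn n \<noteq> 0" by (auto simp: eventually_sequentially)
  obtain Cb where Cb: "\<And>n. norm (cn n) \<le> Cb" using convergent_imp_Bseq[of cn] cn0
    unfolding convergent_def Bseq_def by blast
  define hn where "hn n x = ind n x * (h x - cn n * of_real (k x))" for n x
  define fn where "fn n x = hn n x * of_real (k x)" for n x
  have l2hn: "l2 (hn n)" "l2n (hn n) \<le> l2n h + Cb * l2n (\<lambda>x. complex_of_real (k x))" for n
  proof -
    have d: "l2 (\<lambda>x. h x - cn n * of_real (k x))" by (intro l2_diff l2_scale assms(1) l2_k)
    have m: "hn n \<in> borel_measurable borel" unfolding hn_def by measurable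
    have b: "norm (hn n x) \<le> 1 * norm (h x - cn n * of_real (k x))" for x
      unfolding hn_def norm_mult by (rule mult_right_mono[OF ind_le norm_ge_zero])
    show "l2 (hn n)" by (rule l2_bound(1)[OF d m b]) simp
    have "l2n (hn n) \<le> 1 * l2n (\<lambda>x. h x - cn n * of_real (k x))" by (rule l2_bound(2)[OF d m b]) simp
    also have "\<dots> \<le> l2n h + norm (cn n) * l2n (\<lambda>x. complex_of_real (k x))"
      using l2n_triangle_diff[OF assms(1) l2_scale[OF l2_k, of "cn n"]] by (simp add: l2n_scale)
    also have "\<dots> \<le> l2n h + Cb * l2n (\<lambda>x. complex_of_real (k x))"
      using Cb[of n] by (intro add_left_mono mult_right_mono) auto
    finally show "l2n (hn n) \<le> l2n h + Cb * l2n (\<lambda>x. complex_of_real (k x))" .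
  qed
  have ifn: "integrable lborel (fn n)" for n
    unfolding fn_def[abs_def] by (rule l2_mult_integrable_complex[OF l2hn(1) l2_k])
  have fn_int: "(\<integral>x. fn n x \<partial>lborel) = 0" if "n \<ge> N" for n
  proof -
    have i: "integrable lborel (\<lambda>x. ind n x * f x)" if "integrable lborel f" for f :: "real \<Rightarrow> complex"
      by (rule Bochner_Integration.integrable_bound[OF that])
         (use that mult_right_mono[OF ind_le norm_ge_zero] in \<open>auto simp: norm_mult\<close>)
    have "fn n = (\<lambda>x. ind n x * (h x * of_real (k x)) - cn n * (ind n x * (of_real (k x) * of_real (k x))))"
      by (auto simp: fn_def hn_def algebra_simps)
    then have "(\<integral>x. fn n x \<partial>lborel) = an n - cn n * Kn n"
      using i[OF ihk] i[OF ikk] by (simp add: an_def Kn_def)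
    then show ?thesis using N[OF that] by (simp add: cn_def)
  qed
  define G where "G n x = (\<integral>t. indicator {..x} t *\<^sub>R fn n t \<partial>lborel)" for n x
  have acG: "ac (G n) (fn n)" for n unfolding G_def[abs_def] by (rule ac_from_minus_infinity[OF ifn])
  define E where "E x = complex_of_real (exp (\<Phi> x))" for x
  have Ek: "of_real (k x) * E x = 1" for x
    by (simp add: E_def k_def exp_minus flip: of_real_mult)
  have acE: "ac E (\<lambda>x. of_real (B x) * E x)" unfolding E_def[abs_def] by (rule ac_inverse_k)
  have eq: "- (H x * of_real (k x) * E x + g * (of_real (B x) * E x)) = of_real (B x) * (- (g * E x)) - H x"
    for H :: "real \<Rightarrow> complex" and x g
    using Ek[of x] by (simp add: algebra_simps)
  define vn where "vn n x = - (G n x * E x)" for n x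
  have acv: "ac (vn n) (\<lambda>x. of_real (B x) * vn n x - hn n x)" for n
    using ac_minus[OF ac_mult[OF acG acE]] unfolding vn_def[abs_def] fn_def eq .
  \<comment> \<open>Left of the truncation interval nothing has been integrated yet; right of it
    everything has, and the total is 0.\<close>
  have vn0: "vn n x = 0" if "n \<ge> N" "\<bar>x\<bar> > real n" for n x
  proof -
    have "G n x = 0"
    proof (cases "x > 0")
      case True
      have "(\<lambda>t. indicator {..x} t *\<^sub>R fn n t) = fn n"
        using that True by (fastforce simp: fn_def hn_def ind_def indicator_def)
      then show ?thesis using fn_int[OF that(1)] by (simp add: G_def)
    next
      case False
      have "(\<lambda>t. indicator {..x} t *\<^sub>R fn n t) = (\<lambda>t. 0)"
        using that False by (fastforce simp: fn_def hn_def ind_def indicator_def)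
      then show ?thesis by (simp add: G_def)
    qed
    then show ?thesis by (simp add: vn_def)
  qed
  have l2v: "l2 (vn n)" if "n \<ge> N" for n
    by (rule l2_continuous_compact[OF ac_continuous[OF acv] vn0[OF that]])
  have bv: "l2n (vn n) \<le> (l2n h + Cb * l2n (\<lambda>x. complex_of_real (k x))) / \<gamma>" if "n \<ge> N" for n
  proof -
    have "\<gamma> * l2n (vn n) \<le> l2n (hn n)"
      by (rule gap[of 1]) (use acv l2v[OF that] l2hn \<gamma> gap_pos in \<open>auto simp: less_imp_le\<close>)
    then show ?thesis using l2hn(2)[of n] \<gamma> by (simp add: pos_le_divide_eq mult.commute)
  qed
  define G' where "G' x = (\<integral>t. indicator {..x} t *\<^sub>R (h t * of_real (k t)) \<partial>lborel)" for x
  define v where "v x = - (G' x * E x)" for x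
  have acv': "ac v (\<lambda>x. of_real (B x) * v x - h x)"
    using ac_minus[OF ac_mult[OF ac_from_minus_infinity[OF ihk] acE]] unfolding v_def[abs_def] G'_def eq .
  have lim: "(\<lambda>n. G n x) \<longlonglongrightarrow> G' x" for x
    unfolding G_def G'_def
  proof (rule integral_dominated_convergence[where w = "\<lambda>t. norm (h t * of_real (k t)) + Cb * norm (complex_of_real (k t) * of_real (k t))"])
    show "integrable lborel (\<lambda>t. norm (h t * of_real (k t)) + Cb * norm (complex_of_real (k t) * of_real (k t)))"
      using ihk ikk by (intro Bochner_Integration.integrable_add integrable_mult_right integrable_norm)
    show "AE t in lborel. (\<lambda>n. indicator {..x} t *\<^sub>R fn n t) \<longlonglongrightarrow> indicator {..x} t *\<^sub>R (h t * of_real (k t))"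
    proof (rule AE_I2)
      fix t
      have "(\<lambda>n. fn n t) \<longlonglongrightarrow> 1 * (h t - 0 * of_real (k t)) * of_real (k t)"
        unfolding fn_def hn_def by (intro tendsto_intros ind_lim cn0)
      then show "(\<lambda>n. indicator {..x} t *\<^sub>R fn n t) \<longlonglongrightarrow> indicator {..x} t *\<^sub>R (h t * of_real (k t))"
        by (intro tendsto_intros) simp
    qed
    show "AE t in lborel. norm (indicator {..x} t *\<^sub>R fn n t) \<le> norm (h t * of_real (k t)) + Cb * norm (complex_of_real (k t) * of_real (k t))" for n
    proof (rule AE_I2)
      fix t
      have "norm (indicator {..x} t *\<^sub>R fn n t) \<le> norm (fn n t)" by (simp add: indicator_def)
      also have "\<dots> \<le> 1 * norm (h t - cn n * of_real (k t)) * norm (complex_of_real (k t))"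
        unfolding fn_def hn_def norm_mult using ind_le[of n t] by (intro mult_right_mono) auto
      also have "\<dots> \<le> 1 * (norm (h t) + Cb * norm (complex_of_real (k t))) * norm (complex_of_real (k t))"
        using norm_triangle_ineq4[of "h t" "cn n * of_real (k t)"] mult_right_mono[OF Cb[of n], of "norm (complex_of_real (k t))"]
        by (intro mult_right_mono mult_left_mono) (auto simp: norm_mult)
      finally show "norm (indicator {..x} t *\<^sub>R fn n t) \<le> norm (h t * of_real (k t)) + Cb * norm (complex_of_real (k t) * of_real (k t))"
        by (simp add: norm_mult algebra_simps)
    qed
  qed (use ihk ifn in auto)
  have "l2 v"
  proof (rule l2_Fatou(1)[where f = "\<lambda>n. vn (n + N)"])
    show "l2 (vn (n + N))" for n by (rule l2v) simp
    show "l2n (vn (n + N)) \<le> (l2n h + Cb * l2n (\<lambda>x. complex_of_real (k x))) / \<gamma>" for n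
      by (rule bv) simp
    show "(\<lambda>n. vn (n + N) x) \<longlonglongrightarrow> v x" for x
      unfolding vn_def v_def using LIMSEQ_ignore_initial_segment[OF lim] by (intro tendsto_intros)
  qed
  then show ?thesis using acv' by blast
qed

text \<open>Duality: if \<open>L_- v = z\<close>, then the square norm of z is the inner product of
  v and g, and \<open>gap\<close> bounds v by z. Applied to \<open>L_+\<close> directly,
  \<open>gap\<close> would involve \<open>B\<^sup>2 - B'\<close>, which is negative where
  \<open>B\<close> vanishes.\<close>

lemma Lp_gap:
  assumes "ac z (\<lambda>x. g x - of_real (B x) * z x)" "l2 z" "l2 g" "(\<integral>x. z x * of_real (k x) \<partial>lborel) = 0"
  shows "\<gamma> * l2n z \<le> l2n g"
proof -
  obtain v where v: "ac v (\<lambda>x. of_real (B x) * v x - z x)" "l2 v" using Lm_solve[OF assms(2,4)] by blast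
  have "\<gamma> * l2n v \<le> l2n z"
    by (rule gap[of 1]) (use v assms(2) \<gamma> gap_pos in \<open>auto simp: less_imp_le\<close>)
  have "of_real ((l2n z)\<^sup>2) = (\<integral>x. z x * cnj (z x) \<partial>lborel)"
    unfolding l2n_sq integral_complex_of_real[symmetric] by (simp only: complex_mult_cnj cmod_power2)
  also have "\<dots> = (\<integral>x. v x * cnj (g x) \<partial>lborel)"
    using ac_adjoint[of v 1 B z z g] v assms by simp
  finally have "(l2n z)\<^sup>2 = cmod (\<integral>x. v x * cnj (g x) \<partial>lborel)"
    by (metis abs_power2 norm_of_real)
  also have "\<dots> \<le> l2n v * l2n g" by (rule l2_inner_bound[OF v(2) assms(3)])
  finally have "\<gamma> * (l2n z)\<^sup>2 \<le> (\<gamma> * l2n v) * l2n g" using \<gamma> by simp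
  also have "\<dots> \<le> l2n z * l2n g" using \<open>\<gamma> * l2n v \<le> l2n z\<close> by (intro mult_right_mono) auto
  finally have "(\<gamma> * l2n z) * l2n z \<le> l2n g * l2n z" by (simp add: power2_eq_square mult_ac)
  then show ?thesis using l2n_nonneg[of z] l2n_nonneg[of g]
    by (cases "l2n z = 0") (auto simp: mult_le_cancel_right less_le)
qed

end

section \<open>The two-component system and its exactly solvable cases\<close>

definition dsys :: "(real \<Rightarrow> real) \<Rightarrow> complex \<Rightarrow> complex \<Rightarrow> complex \<Rightarrow> (real \<Rightarrow> complex) \<Rightarrow> (real \<Rightarrow> complex) \<Rightarrow>
    (real \<Rightarrow> complex) \<Rightarrow> (real \<Rightarrow> complex) \<Rightarrow> bool" where
  "dsys B \<alpha> p q w1 w2 g1 g2 \<longleftrightarrow>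
     ac w1 (\<lambda>x. (of_real (B x) + \<alpha>) * w1 x + p * w2 x - g1 x) \<and>
     ac w2 (\<lambda>x. g2 x - (of_real (B x) + \<alpha>) * w2 x - q * w1 x)"

definition nrm :: "(real \<Rightarrow> complex) \<Rightarrow> (real \<Rightarrow> complex) \<Rightarrow> real" where
  "nrm w1 w2 = l2n (\<lambda>x. (w1 x, w2 x))"

definition dsys_surj where
  "dsys_surj B \<alpha> p q \<longleftrightarrow> (\<forall>g1 g2. l2 g1 \<longrightarrow> l2 g2 \<longrightarrow> (\<exists>w1 w2. l2 w1 \<and> l2 w2 \<and> dsys B \<alpha> p q w1 w2 g1 g2))"

text \<open>Kept apart from \<open>dsys_surj\<close>: this is an estimate for solutions already
  given, and applied to differences it yields uniqueness.\<close>

definition dsys_bound where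
  "dsys_bound B \<alpha> p q C \<longleftrightarrow> (\<forall>w1 w2 g1 g2. l2 w1 \<longrightarrow> l2 w2 \<longrightarrow> l2 g1 \<longrightarrow> l2 g2 \<longrightarrow>
      dsys B \<alpha> p q w1 w2 g1 g2 \<longrightarrow> nrm w1 w2 \<le> C * nrm g1 g2)"

lemma nrm_nonneg [simp]: "nrm w1 w2 \<ge> 0" by (simp add: nrm_def)

lemma nrm_sq: "l2 w1 \<Longrightarrow> l2 w2 \<Longrightarrow> (nrm w1 w2)\<^sup>2 = (l2n w1)\<^sup>2 + (l2n w2)\<^sup>2"
  unfolding nrm_def by (rule l2n_Pair)

lemma l2n_le_nrm:
  assumes "l2 w1" "l2 w2" shows "l2n w1 \<le> nrm w1 w2" "l2n w2 \<le> nrm w1 w2"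
  using nrm_sq[OF assms] by (auto intro: power2_le_imp_le)

lemma nrm_le_add: assumes "l2 w1" "l2 w2" shows "nrm w1 w2 \<le> l2n w1 + l2n w2"
proof (rule power2_le_imp_le)
  show "(nrm w1 w2)\<^sup>2 \<le> (l2n w1 + l2n w2)\<^sup>2" using nrm_sq[OF assms] by (simp add: power2_sum)
qed simp

lemma nrm_triangle:
  assumes "l2 w1" "l2 w2" "l2 z1" "l2 z2"
  shows "nrm (\<lambda>x. w1 x + z1 x) (\<lambda>x. w2 x + z2 x) \<le> nrm w1 w2 + nrm z1 z2"
  using l2n_triangle[OF l2_Pair[OF assms(1,2)] l2_Pair[OF assms(3,4)]] by (simp add: nrm_def)

lemma nrm_minus: "nrm (\<lambda>x. - w1 x) (\<lambda>x. - w2 x) = nrm w1 w2"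
  using l2n_minus[of "\<lambda>x. (w1 x, w2 x)"] by (simp add: nrm_def)

text \<open>The cross terms of \<open>\<parallel>D w\<parallel>\<^sup>2\<close> add up to \<open>2 \<mu> Im (w\<^sub>1 cnj w\<^sub>2)'\<close>.\<close>

lemma dsys_bound_diag:
  assumes "\<mu> > 0"
  shows "dsys_bound B 0 (- \<i> * of_real \<mu>) (- \<i> * of_real \<mu>) (1 / \<mu>)"
  unfolding dsys_bound_def
proof (intro allI impI)
  fix w1 w2 g1 g2 assume l: "l2 w1" "l2 w2" "l2 g1" "l2 g2"
    and "dsys B 0 (- \<i> * of_real \<mu>) (- \<i> * of_real \<mu>) w1 w2 g1 g2"
  then have a: "ac w1 (\<lambda>x. of_real (B x) * w1 x - \<i> * of_real \<mu> * w2 x - g1 x)"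
      "ac w2 (\<lambda>x. g2 x - of_real (B x) * w2 x + \<i> * of_real \<mu> * w1 x)"
    by (simp_all add: dsys_def)
  let ?F = "\<lambda>x. w1 x * cnj (w2 x)"
  let ?F' = "\<lambda>x. - (g1 x + \<i> * of_real \<mu> * w2 x) * cnj (w2 x) + w1 x * cnj (g2 x + \<i> * of_real \<mu> * w1 x)"
  have "(\<lambda>x. (of_real (B x) * w1 x - \<i> * of_real \<mu> * w2 x - g1 x) * cnj (w2 x)
      + w1 x * cnj (g2 x - of_real (B x) * w2 x + \<i> * of_real \<mu> * w1 x)) = ?F'"
    by (simp add: fun_eq_iff algebra_simps)
  with ac_mult[OF a(1) ac_cnj[OF a(2)]] have F: "ac ?F ?F'" by (simp only:)
  have m: "l2 (\<lambda>x. - (g1 x + \<i> * of_real \<mu> * w2 x))" "l2 (\<lambda>x. g2 x + \<i> * of_real \<mu> * w1 x)"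
    by (intro l2_minus l2_add l2_scale l)+
  have iF: "integrable lborel ?F" "integrable lborel ?F'"
    by (intro Bochner_Integration.integrable_add l2_mult_integrable_complex l2_cnj l m)+
  have z: "(\<integral>x. ?F' x \<partial>lborel) = 0" by (rule ac_integral_0[OF F iF])
  \<comment> \<open>The two squares left over are those of \<open>L_- w1\<close> and
    \<open>L_+ w2\<close>, read off from the equations.\<close>
  have pw: "\<mu>\<^sup>2 * (norm (w1 x, w2 x))\<^sup>2 \<le> (norm (g1 x, g2 x))\<^sup>2 - 2 * \<mu> * Im (?F' x)" for x
  proof -
    have "(norm (g1 x, g2 x))\<^sup>2 - 2 * \<mu> * Im (?F' x) - \<mu>\<^sup>2 * (norm (w1 x, w2 x))\<^sup>2
      = (cmod (g1 x + \<i> * of_real \<mu> * w2 x))\<^sup>2 + (cmod (g2 x + \<i> * of_real \<mu> * w1 x))\<^sup>2"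
      unfolding norm_prod_def cmod_power2
      by (simp add: cmod_power2 power2_eq_square algebra_simps)
    moreover have "0 \<le> \<dots>" by simp
    ultimately show ?thesis by linarith
  qed
  have iI: "integrable lborel (\<lambda>x. Im (?F' x))" using iF(2) by (rule integrable_Im)
  have zI: "(\<integral>x. Im (?F' x) \<partial>lborel) = 0"
    using integral_bounded_linear[OF bounded_linear_Im iF(2)] z by simp
  have ig: "integrable lborel (\<lambda>x. (norm (g1 x, g2 x))\<^sup>2)" and iw: "integrable lborel (\<lambda>x. (norm (w1 x, w2 x))\<^sup>2)"
    using l2_int l2_Pair l by blast+
  have "(\<integral>x. \<mu>\<^sup>2 * (norm (w1 x, w2 x))\<^sup>2 \<partial>lborel) \<le> (\<integral>x. (norm (g1 x, g2 x))\<^sup>2 - 2 * \<mu> * Im (?F' x) \<partial>lborel)"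
    by (rule integral_mono[OF _ _ pw]) (intro integrable_mult_right Bochner_Integration.integrable_diff ig iw iI)+
  also have "\<dots> = (nrm g1 g2)\<^sup>2"
    unfolding nrm_def l2n_sq
    by (subst Bochner_Integration.integral_diff[OF ig integrable_mult_right[OF iI]]) (use zI in simp)
  finally have "(\<mu> * nrm w1 w2)\<^sup>2 \<le> (nrm g1 g2)\<^sup>2"
    using iw by (simp add: nrm_def l2n_sq power_mult_distrib)
  then have "\<mu> * nrm w1 w2 \<le> nrm g1 g2" by (rule power2_le_imp_le) simp
  then show "nrm w1 w2 \<le> 1 / \<mu> * nrm g1 g2" using assms by (simp add: pos_le_divide_eq mult.commute)
qed

text \<open>With the second coupling switched off the equation for w2 stands alone and leaves a free
  multiple of \<open>k\<close>. It is spent on the solvability condition for w1: the kernel of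
  \<open>L_+\<close> compensates the cokernel of \<open>L_-\<close>. All existence results start
  here.\<close>

lemma (in wall) dsys_triangular:
  "\<exists>C. \<forall>g1 g2. l2 g1 \<longrightarrow> l2 g2 \<longrightarrow>
     (\<exists>w1 w2. l2 w1 \<and> l2 w2 \<and> dsys B 0 (- \<i>) 0 w1 w2 g1 g2 \<and> nrm w1 w2 \<le> C * nrm g1 g2)"
proof (intro exI[of _ "(1 + 1 / \<gamma>) + (1 / \<gamma>) * (2 + 1 / \<gamma>)"] allI impI)
  fix g1 g2 :: "real \<Rightarrow> complex" assume l: "l2 g1" "l2 g2"
  let ?kc = "\<lambda>x. complex_of_real (k x)"
  define K where "K = (\<integral>x. ?kc x * ?kc x \<partial>lborel)"
  have K: "K = of_real ((l2n ?kc)\<^sup>2)"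
    unfolding K_def l2n_sq integral_complex_of_real[symmetric] by (simp add: power2_eq_square)
  then have K0: "K \<noteq> 0" using l2n_k_pos by simp
  obtain z0 where z0: "ac z0 (\<lambda>x. g2 x - of_real (B x) * z0 x)" "l2 z0" using Lp_solve[OF l(2)] by blast
  \<comment> \<open>Removes the component along \<open>k\<close>, so that \<open>Lp_gap\<close>
    provides the quantitative bound which \<open>Lp_solve\<close> lacks.\<close>
  define c0 where "c0 = (\<integral>x. z0 x * ?kc x \<partial>lborel) / K"
  define z where "z x = z0 x - c0 * ?kc x" for x
  have lz: "l2 z" unfolding z_def[abs_def] by (intro l2_diff l2_scale z0 l2_k)
  have az: "ac z (\<lambda>x. g2 x - of_real (B x) * z x)"
    using ac_diff[OF z0(1) ac_cmult[OF ac_k, of c0]] unfolding z_def[abs_def] by (simp add: algebra_simps)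
  have zk: "(\<integral>x. z x * ?kc x \<partial>lborel) = 0"
  proof -
    have "(\<integral>x. z x * ?kc x \<partial>lborel) = (\<integral>x. z0 x * ?kc x - c0 * (?kc x * ?kc x) \<partial>lborel)"
      by (simp add: z_def algebra_simps)
    also have "\<dots> = (\<integral>x. z0 x * ?kc x \<partial>lborel) - c0 * K"
      unfolding K_def using l2_mult_integrable_complex[OF z0(2) l2_k] l2_mult_integrable_complex[OF l2_k l2_k] by simp
    finally show ?thesis using K0 by (simp add: c0_def)
  qed
  have bz: "\<gamma> * l2n z \<le> l2n g2" by (rule Lp_gap[OF az lz l(2) zk])
  \<comment> \<open>The multiple of \<open>k\<close> that makes \<open>g1 + \<i> w2\<close>
    orthogonal to \<open>k\<close>; z is already orthogonal to it and drops out.\<close>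
  define c1 where "c1 = \<i> * (\<integral>x. g1 x * ?kc x \<partial>lborel) / K"
  define w2 where "w2 x = z x + c1 * ?kc x" for x
  have lw2: "l2 w2" unfolding w2_def[abs_def] by (intro l2_add l2_scale lz l2_k)
  have aw2: "ac w2 (\<lambda>x. g2 x - of_real (B x) * w2 x)"
    using ac_add[OF az ac_cmult[OF ac_k, of c1]] unfolding w2_def[abs_def] by (simp add: algebra_simps)
  define h where "h x = g1 x + \<i> * w2 x" for x
  have lh: "l2 h" unfolding h_def[abs_def] by (intro l2_add l2_scale l lw2)
  have hk: "(\<integral>x. h x * ?kc x \<partial>lborel) = 0"
  proof -
    have "(\<integral>x. h x * ?kc x \<partial>lborel) = (\<integral>x. g1 x * ?kc x + (\<i> * (z x * ?kc x) + \<i> * c1 * (?kc x * ?kc x)) \<partial>lborel)"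
      by (simp add: h_def w2_def algebra_simps)
    also have "\<dots> = (\<integral>x. g1 x * ?kc x \<partial>lborel) + (\<i> * (\<integral>x. z x * ?kc x \<partial>lborel) + \<i> * c1 * K)"
      unfolding K_def using l2_mult_integrable_complex[OF l(1) l2_k] l2_mult_integrable_complex[OF lz l2_k] l2_mult_integrable_complex[OF l2_k l2_k] by simp
    finally show ?thesis using K0 zk by (simp add: c1_def)
  qed
  obtain w1 where w1: "ac w1 (\<lambda>x. of_real (B x) * w1 x - h x)" "l2 w1" using Lm_solve[OF lh hk] by blast
  have bw1: "\<gamma> * l2n w1 \<le> l2n h"
    by (rule gap[of 1]) (use w1 lh \<gamma> gap_pos in \<open>auto simp: less_imp_le\<close>)
  have "dsys B 0 (- \<i>) 0 w1 w2 g1 g2"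
    unfolding dsys_def using w1(1) aw2 by (simp add: h_def algebra_simps)
  moreover have "nrm w1 w2 \<le> ((1 + 1 / \<gamma>) + (1 / \<gamma>) * (2 + 1 / \<gamma>)) * nrm g1 g2"
  proof -
    let ?G = "nrm g1 g2"
    have G: "l2n g1 \<le> ?G" "l2n g2 \<le> ?G" using l2n_le_nrm[OF l] by auto
    have "cmod c1 * l2n ?kc \<le> l2n g1"
    proof -
      have "cmod (\<integral>x. g1 x * ?kc x \<partial>lborel) \<le> l2n g1 * l2n ?kc"
        using l2_inner_bound[OF l(1) l2_k] by simp
      then show ?thesis using l2n_k_pos
        by (simp add: c1_def norm_mult norm_divide K power2_eq_square divide_le_eq mult.commute)
    qed
    moreover have "l2n w2 \<le> l2n z + cmod c1 * l2n ?kc"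
      unfolding w2_def[abs_def] using l2n_triangle[OF lz l2_scale[OF l2_k, of c1]] by (simp add: l2n_scale)
    moreover have "l2n z \<le> (1 / \<gamma>) * ?G" using bz G(2) \<gamma> by (simp add: pos_le_divide_eq mult.commute)
    ultimately have w2b: "l2n w2 \<le> (1 + 1 / \<gamma>) * ?G" using G(1) by (simp add: algebra_simps)
    have "l2n h \<le> l2n g1 + l2n w2"
      unfolding h_def[abs_def] using l2n_triangle[OF l(1) l2_scale[OF lw2, of \<i>]] by (simp add: l2n_scale)
    then have "l2n h \<le> (2 + 1 / \<gamma>) * ?G" using w2b G(1) by (simp add: algebra_simps)
    then have "\<gamma> * l2n w1 \<le> (2 + 1 / \<gamma>) * ?G" using bw1 by linarith
    then have "l2n w1 \<le> (1 / \<gamma>) * ((2 + 1 / \<gamma>) * ?G)" using \<gamma> by (simp add: pos_le_divide_eq mult.commute)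
    then show ?thesis using nrm_le_add[OF w1(2) lw2] w2b by (simp add: algebra_simps)
  qed
  ultimately show "\<exists>w1 w2. l2 w1 \<and> l2 w2 \<and> dsys B 0 (- \<i>) 0 w1 w2 g1 g2
      \<and> nrm w1 w2 \<le> ((1 + 1 / \<gamma>) + (1 / \<gamma>) * (2 + 1 / \<gamma>)) * nrm g1 g2"
    using w1(2) lw2 by blast
qed

section \<open>Existence for the system by Neumann series and continuation\<close>

lemma continuous_bounded_Icc:
  fixes A :: "real \<Rightarrow> 'a::real_normed_vector"
  assumes "continuous_on UNIV A"
  obtains C where "C \<ge> 0" "\<And>t. t \<in> {x..y} \<Longrightarrow> norm (A t) \<le> C"
proof -
  have "compact (A ` {x..y})"
    by (intro compact_continuous_image continuous_on_subset[OF assms]) auto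
  then have "bounded (A ` {x..y})" by (rule compact_imp_bounded)
  then obtain C where "\<forall>z\<in>A ` {x..y}. norm z \<le> C" unfolding bounded_iff by blast
  then have "norm (A t) \<le> max C 0" if "t \<in> {x..y}" for t using that by (auto simp: le_max_iff_disj)
  then show ?thesis using that[of "max C 0"] by auto
qed

lemma dsys_add:
  assumes "dsys B \<alpha> p q w1 w2 g1 g2" "dsys B \<alpha> p q z1 z2 h1 h2"
  shows "dsys B \<alpha> p q (\<lambda>x. w1 x + z1 x) (\<lambda>x. w2 x + z2 x) (\<lambda>x. g1 x + h1 x) (\<lambda>x. g2 x + h2 x)"
proof -
  have "ac (\<lambda>x. w1 x + z1 x) (\<lambda>x. ((of_real (B x) + \<alpha>) * w1 x + p * w2 x - g1 x) + ((of_real (B x) + \<alpha>) * z1 x + p * z2 x - h1 x))"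
    "ac (\<lambda>x. w2 x + z2 x) (\<lambda>x. (g2 x - (of_real (B x) + \<alpha>) * w2 x - q * w1 x) + (h2 x - (of_real (B x) + \<alpha>) * z2 x - q * z1 x))"
    using assms unfolding dsys_def by (simp_all only: ac_add)
  then show ?thesis unfolding dsys_def by (simp add: algebra_simps)
qed

text \<open>Dominated convergence on each compact interval. The majorant may depend on the interval,
  as suits bounds that are uniform only locally.\<close>

lemma ac_limit:
  assumes "\<And>n. ac (u n) (f n)" "\<And>x. (\<lambda>n. u n x) \<longlonglongrightarrow> U x" "\<And>x. (\<lambda>n. f n x) \<longlonglongrightarrow> F x"
    and "\<And>x y. \<exists>h. set_integrable lborel {x..y} h \<and> (\<forall>n. \<forall>t\<in>{x..y}. norm (f n t) \<le> h t)"
  shows "ac U F"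
  unfolding ac_def
proof (intro conjI allI impI)
  have mf: "f n \<in> borel_measurable borel" for n using assms(1) ac_meas_deriv by blast
  show mF: "F \<in> borel_measurable borel"
    by (rule borel_measurable_LIMSEQ_metric[OF mf assms(3)])
  fix x y :: real assume xy: "x \<le> y"
  obtain h :: "real \<Rightarrow> real" where h: "set_integrable lborel {x..y} h" "\<And>n t. t \<in> {x..y} \<Longrightarrow> norm (f n t) \<le> h t"
    using assms(4)[of x y] by blast
  have dom: "integrable lborel (\<lambda>t. indicator {x..y} t *\<^sub>R F t)
      \<and> (\<lambda>n. \<integral>t. indicator {x..y} t *\<^sub>R f n t \<partial>lborel) \<longlonglongrightarrow> (\<integral>t. indicator {x..y} t *\<^sub>R F t \<partial>lborel)"
  proof (rule conjI)
    have a: "AE t in lborel. (\<lambda>n. indicator {x..y} t *\<^sub>R f n t) \<longlonglongrightarrow> indicator {x..y} t *\<^sub>R F t"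
      by (intro AE_I2 tendsto_intros assms(3))
    have b: "AE t in lborel. norm (indicator {x..y} t *\<^sub>R f n t) \<le> indicator {x..y} t *\<^sub>R h t" for n
      using h(2)[of _ n] by (intro AE_I2) (auto simp: indicator_def)
    have m: "(\<lambda>t. indicator {x..y} t *\<^sub>R F t) \<in> borel_measurable lborel"
      "\<And>n. (\<lambda>t. indicator {x..y} t *\<^sub>R f n t) \<in> borel_measurable lborel"
      using mF mf by auto
    have i: "integrable lborel (\<lambda>t. indicator {x..y} t *\<^sub>R h t)" using h(1) by (simp add: set_integrable_def)
    show "integrable lborel (\<lambda>t. indicator {x..y} t *\<^sub>R F t)"
      by (rule integrable_dominated_convergence[OF m i a b])
    show "(\<lambda>n. \<integral>t. indicator {x..y} t *\<^sub>R f n t \<partial>lborel) \<longlonglongrightarrow> (\<integral>t. indicator {x..y} t *\<^sub>R F t \<partial>lborel)"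
      by (rule integral_dominated_convergence[OF m i a b])
  qed
  then show "set_integrable lborel {x..y} F" by (simp add: set_integrable_def)
  have "(\<lambda>n. u n x + (\<integral>t. indicator {x..y} t *\<^sub>R f n t \<partial>lborel)) \<longlonglongrightarrow> U x + (\<integral>t. indicator {x..y} t *\<^sub>R F t \<partial>lborel)"
    using dom by (intro tendsto_intros assms(2)) auto
  moreover have "u n x + (\<integral>t. indicator {x..y} t *\<^sub>R f n t \<partial>lborel) = u n y" for n
    using ac_eq[OF assms(1) xy] by (simp add: set_lebesgue_integral_def)
  ultimately have "(\<lambda>n. u n y) \<longlonglongrightarrow> U x + (\<integral>t. indicator {x..y} t *\<^sub>R F t \<partial>lborel)" by simp
  then show "U y = U x + (LBINT t:{x..y}. F t)"
    using LIMSEQ_unique[OF assms(2)[of y]] by (simp add: set_lebesgue_integral_def)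
qed

lemma l2_indicator_Icc: "l2 (indicator {x..y} :: real \<Rightarrow> real)" "x \<le> y \<Longrightarrow> l2n (indicator {x..y} :: real \<Rightarrow> real) = sqrt (y - x)"
proof -
  have e: "(\<lambda>t. (norm (indicator {x..y} t :: real))\<^sup>2) = indicator {x..y}"
    by (auto simp: indicator_def)
  have "integrable lborel (indicator {x..y} :: real \<Rightarrow> real)"
    by (rule integrable_real_indicator) (auto simp: emeasure_lborel_Icc_eq)
  then show "l2 (indicator {x..y} :: real \<Rightarrow> real)" unfolding l2_def e by simp
  show "x \<le> y \<Longrightarrow> l2n (indicator {x..y} :: real \<Rightarrow> real) = sqrt (y - x)" unfolding l2n_def e by simp
qed

lemma l2_set_integrable_Icc:
  fixes f :: "real \<Rightarrow> complex"
  assumes "l2 f"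
  shows "set_integrable lborel {x..y} f" "set_integrable lborel {x..y} (\<lambda>t. norm (f t))"
    "(LBINT t:{x..x+1}. norm (f t)) \<le> l2n f"
proof -
  have m: "f \<in> borel_measurable borel" using assms l2_meas by auto
  have i: "integrable lborel (\<lambda>t. norm (f t) * norm (indicator {x..y} t :: real))" for x y :: real
    by (rule l2_mult_integrable[OF assms l2_indicator_Icc(1)])
  then show a: "set_integrable lborel {x..y} f" unfolding set_integrable_def
    by (rule Bochner_Integration.integrable_bound) (use m in \<open>auto simp: indicator_def\<close>)
  then show "set_integrable lborel {x..y} (\<lambda>t. norm (f t))" by (rule set_integrable_norm)
  show "(LBINT t:{x..x+1}. norm (f t)) \<le> l2n f"
    using l2_Cauchy_Schwarz[OF assms l2_indicator_Icc(1)[of x "x+1"]] l2_indicator_Icc(2)[of x "x+1"]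
    by (simp add: set_lebesgue_integral_def mult.commute)
qed

text \<open>Averages \<open>v x = v t - (v t - v x)\<close> over t in the unit interval to the right
  of x.\<close>

lemma ac_pointwise_bound:
  assumes "ac v v'"
  shows "norm (v x) \<le> (LBINT t:{x..x+1}. norm (v t)) + (LBINT t:{x..x+1}. norm (v' t))"
proof -
  have i: "set_integrable lborel {x..x+1} (\<lambda>t. norm (v t))"
    by (rule borel_integrable_atLeastAtMost') (intro continuous_intros ac_continuous[OF assms])
  let ?J = "LBINT t:{x..x+1}. norm (v' t)"
  have "norm (v x) = (LBINT t:{x..x+1}. norm (v x))" by (simp add: set_lebesgue_integral_def)
  also have "\<dots> \<le> (LBINT t:{x..x+1}. norm (v t) + ?J)"
  proof (rule set_integral_mono)
    show "set_integrable lborel {x..x+1} (\<lambda>t. norm (v x))" "set_integrable lborel {x..x+1} (\<lambda>t. norm (v t) + ?J)"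
      by (rule borel_integrable_atLeastAtMost', intro continuous_intros ac_continuous[OF assms])+
    fix t assume "t \<in> {x..x+1}"
    then show "norm (v x) \<le> norm (v t) + ?J"
      using ac_norm_diff_le(1)[OF assms, of x t "x+1"] norm_triangle_sub[of "v x" "v t"]
      by (simp add: norm_minus_commute)
  qed
  also have "\<dots> = (LBINT t:{x..x+1}. norm (v t)) + ?J"
    by (subst set_integral_add(2)[OF i]) (auto intro: borel_integrable_atLeastAtMost' simp: set_lebesgue_integral_def)
  finally show ?thesis .
qed

text \<open>Inserting the equation into the averaged bound turns L2 norms of solution and data into
  a bound at a point. It converts geometric decay in L2 into geometric decay that is locally
  uniform.\<close>

lemma ac_first_order_bound:
  fixes v g :: "real \<Rightarrow> complex" and A :: "real \<Rightarrow> complex"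
  assumes "ac v (\<lambda>x. A x * v x + p * z x - g x)" "l2 v" "l2 z" "l2 g"
    and "\<And>t. t \<in> {x..x+1} \<Longrightarrow> norm (A t) \<le> Am"
  shows "norm (v x) \<le> (1 + Am) * l2n v + norm p * l2n z + l2n g"
proof -
  let ?I = "\<lambda>f. (LBINT t:{x..x+1}. norm (f t :: complex))"
  note iv = l2_set_integrable_Icc(2)[OF assms(2)] and iz = l2_set_integrable_Icc(2)[OF assms(3)]
    and ig = l2_set_integrable_Icc(2)[OF assms(4)]
  have "(LBINT t:{x..x+1}. norm (A t * v t + p * z t - g t))
      \<le> (LBINT t:{x..x+1}. Am * norm (v t) + norm p * norm (z t) + norm (g t))"
  proof (rule set_integral_mono)
    show "set_integrable lborel {x..x+1} (\<lambda>t. norm (A t * v t + p * z t - g t))"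
      by (rule set_integrable_norm[OF ac_set_integrable[OF assms(1)]])
    show "set_integrable lborel {x..x+1} (\<lambda>t. Am * norm (v t) + norm p * norm (z t) + norm (g t))"
      by (intro set_integral_add(1) set_integrable_mult_right iv iz ig)
    fix t assume t: "t \<in> {x..x+1}"
    have "norm (A t * v t + p * z t - g t) \<le> norm (A t * v t) + norm (p * z t) + norm (g t)"
      using norm_triangle_ineq4[of "A t * v t + p * z t" "g t"] norm_triangle_ineq[of "A t * v t" "p * z t"] by linarith
    then show "norm (A t * v t + p * z t - g t) \<le> Am * norm (v t) + norm p * norm (z t) + norm (g t)"
      using mult_right_mono[OF assms(5)[OF t], of "norm (v t)"] by (simp add: norm_mult)
  qed
  also have "\<dots> = Am * ?I v + norm p * ?I z + ?I g"
    using iv iz ig by (simp add: set_integral_add)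
  finally have "norm (v x) \<le> ?I v + (Am * ?I v + norm p * ?I z + ?I g)"
    using ac_pointwise_bound[OF assms(1), of x] by linarith
  also have "\<dots> \<le> l2n v + (Am * l2n v + norm p * l2n z + l2n g)"
  proof -
    have "Am \<ge> 0" using order_trans[OF norm_ge_zero assms(5)[of x]] by simp
    then show ?thesis
      using l2_set_integrable_Icc(3)[OF assms(2), of x] l2_set_integrable_Icc(3)[OF assms(3), of x]
        l2_set_integrable_Icc(3)[OF assms(4), of x]
      by (intro add_mono mult_left_mono) auto
  qed
  finally show ?thesis by (simp add: algebra_simps)
qed

lemma nrm_perturbation:
  assumes "l2 w1" "l2 w2"
  shows "nrm (\<lambda>x. a * w1 x + b * w2 x) (\<lambda>x. a * w2 x + c * w1 x) \<le> (norm a + norm b + norm c) * nrm w1 w2"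
  unfolding nrm_def
proof (rule l2_bound(2)[OF l2_Pair[OF assms]])
  have [measurable]: "w1 \<in> borel_measurable borel" "w2 \<in> borel_measurable borel" using assms l2_meas by auto
  show "(\<lambda>x. (a * w1 x + b * w2 x, a * w2 x + c * w1 x)) \<in> borel_measurable borel"
    by (intro borel_measurable_Pair) measurable
  fix x
  have "norm (a * w1 x + b * w2 x, a * w2 x + c * w1 x) = norm ((a * w1 x, a * w2 x) + ((b * w2 x, 0) + (0, c * w1 x)))"
    by simp
  also have "\<dots> \<le> norm (a * w1 x, a * w2 x) + (norm (b * w2 x, 0::complex) + norm (0::complex, c * w1 x))"
    by (intro norm_triangle_mono norm_triangle_ineq order_refl)
  also have "norm (a * w1 x, a * w2 x) = norm a * norm (w1 x, w2 x)"
    by (simp add: norm_prod_def norm_mult power_mult_distrib real_sqrt_mult flip: distrib_left)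
  also have "norm (b * w2 x, 0::complex) \<le> norm b * norm (w1 x, w2 x)"
    by (simp add: norm_prod_def norm_mult mult_left_mono real_le_rsqrt)
  also have "norm (0::complex, c * w1 x) \<le> norm c * norm (w1 x, w2 x)"
    by (simp add: norm_prod_def norm_mult mult_left_mono real_le_rsqrt)
  finally show "norm (a * w1 x + b * w2 x, a * w2 x + c * w1 x) \<le> (norm a + norm b + norm c) * norm (w1 x, w2 x)"
    by (simp add: algebra_simps)
qed simp

text \<open>Neumann series. Instead of completeness of \<open>L\<^sup>2\<close> one uses that its terms are summable locally
  uniformly.\<close>

lemma dsys_surj_perturb:
  fixes B :: "real \<Rightarrow> real"
  assumes cont: "continuous_on UNIV B"
    and solv: "\<And>g1 g2. l2 g1 \<Longrightarrow> l2 g2 \<Longrightarrow>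
       \<exists>w1 w2. l2 w1 \<and> l2 w2 \<and> dsys B \<alpha> p q w1 w2 g1 g2 \<and> nrm w1 w2 \<le> C * nrm g1 g2"
    and small: "C \<ge> 0" "C * (norm (\<alpha>' - \<alpha>) + norm (p' - p) + norm (q' - q)) < 1"
  shows "dsys_surj B \<alpha>' p' q'"
  unfolding dsys_surj_def
proof (intro allI impI)
  fix g1 g2 :: "real \<Rightarrow> complex" assume lg: "l2 g1" "l2 g2"
  define a b c \<kappa> where "a = \<alpha>' - \<alpha>" and "b = p' - p" and "c = q' - q" and "\<kappa> = norm a + norm b + norm c"
  define \<theta> where "\<theta> = C * \<kappa>"
  have \<kappa>: "\<kappa> \<ge> 0" by (simp add: \<kappa>_def)
  have \<theta>: "0 \<le> \<theta>" "\<theta> < 1" using small by (auto simp: \<theta>_def \<kappa>_def a_def b_def c_def)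
  \<comment> \<open>One solution is selected for each pair of data; linearity of the selection is
    not claimed, only its bound by C.\<close>
  obtain S where S: "\<And>h. l2 (fst h) \<Longrightarrow> l2 (snd h) \<Longrightarrow> l2 (fst (S h)) \<and> l2 (snd (S h)) \<and>
      dsys B \<alpha> p q (fst (S h)) (snd (S h)) (fst h) (snd h) \<and> nrm (fst (S h)) (snd (S h)) \<le> C * nrm (fst h) (snd h)"
  proof -
    have "\<exists>w. l2 (fst h) \<longrightarrow> l2 (snd h) \<longrightarrow> l2 (fst w) \<and> l2 (snd w) \<and>
      dsys B \<alpha> p q (fst w) (snd w) (fst h) (snd h) \<and> nrm (fst w) (snd w) \<le> C * nrm (fst h) (snd h)" for h
      using solv[of "fst h" "snd h"] by (metis fst_conv snd_conv)
    then show ?thesis using that by metis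
  qed
  define K1 where "K1 = (\<lambda>w1 w2 (x::real). a * w1 x + b * w2 x :: complex)"
  define K2 where "K2 = (\<lambda>w1 w2 (x::real). a * w2 x + c * w1 x :: complex)"
  \<comment> \<open>Residuals: the sequence starts with the data, and each further member is the
    error made when the solution of the old system for the previous residual is put into the new
    one. The sought solution is the sum of these corrections.\<close>
  define r where "r = rec_nat (g1, g2) (\<lambda>n h. ((\<lambda>x. - K1 (fst (S h)) (snd (S h)) x), (\<lambda>x. - K2 (fst (S h)) (snd (S h)) x)))"
  define d1 where "d1 n = fst (S (r n))" for n
  define d2 where "d2 n = snd (S (r n))" for n
  define r1 where "r1 n = fst (r n)" for n
  define r2 where "r2 n = snd (r n)" for n
  have r0: "r1 0 = g1" "r2 0 = g2" by (simp_all add: r1_def r2_def r_def)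
  have rS: "r1 (Suc n) = (\<lambda>x. - K1 (d1 n) (d2 n) x)" "r2 (Suc n) = (\<lambda>x. - K2 (d1 n) (d2 n) x)" for n
    by (simp_all add: r1_def r2_def r_def d1_def d2_def)
  have lK: "l2 (K1 w1 w2)" "l2 (K2 w1 w2)" if "l2 w1" "l2 w2" for w1 w2
    unfolding K1_def K2_def by (intro l2_add l2_scale that)+
  have nK: "nrm (\<lambda>x. - K1 w1 w2 x) (\<lambda>x. - K2 w1 w2 x) \<le> \<kappa> * nrm w1 w2" if "l2 w1" "l2 w2" for w1 w2
    using nrm_perturbation[OF that, of a b c] unfolding nrm_minus K1_def K2_def \<kappa>_def .
  have lr: "l2 (r1 n) \<and> l2 (r2 n)" for n
  proof (induction n)
    case (Suc n)
    then have "l2 (d1 n)" "l2 (d2 n)" using S[of "r n"] by (auto simp: r1_def r2_def d1_def d2_def)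
    then show ?case unfolding rS using l2_minus lK by blast
  qed (simp add: r0 lg)
  have ld: "l2 (d1 n)" "l2 (d2 n)" and dd: "dsys B \<alpha> p q (d1 n) (d2 n) (r1 n) (r2 n)"
    and nd: "nrm (d1 n) (d2 n) \<le> C * nrm (r1 n) (r2 n)" for n
    using S[of "r n"] lr[of n] by (auto simp: r1_def r2_def d1_def d2_def)
  have nr: "nrm (r1 n) (r2 n) \<le> \<theta> ^ n * nrm g1 g2" for n
  proof (induction n)
    case (Suc n)
    have "nrm (r1 (Suc n)) (r2 (Suc n)) \<le> \<kappa> * nrm (d1 n) (d2 n)" unfolding rS by (rule nK[OF ld])
    also have "\<dots> \<le> \<kappa> * (C * nrm (r1 n) (r2 n))" using nd \<kappa> by (intro mult_left_mono) auto
    also have "\<dots> \<le> \<kappa> * (C * (\<theta> ^ n * nrm g1 g2))" using Suc \<kappa> small(1) by (intro mult_left_mono) auto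
    finally show ?case by (simp add: \<theta>_def mult_ac)
  qed (simp add: r0)
  have nd': "nrm (d1 n) (d2 n) \<le> C * (\<theta> ^ n * nrm g1 g2)" for n
    using nd[of n] mult_left_mono[OF nr small(1)] by (rule order_trans)
  define v1 where "v1 n x = (\<Sum>j<n. d1 j x)" for n x
  define v2 where "v2 n x = (\<Sum>j<n. d2 j x)" for n x
  have lv: "l2 (v1 n) \<and> l2 (v2 n)" for n
  proof (induction n)
    case (Suc n)
    then show ?case using l2_add[of "v1 n" "d1 n"] l2_add[of "v2 n" "d2 n"] ld[of n] by (simp add: v1_def[abs_def] v2_def[abs_def])
  qed (simp add: v1_def[abs_def] v2_def[abs_def] l2_def)
  have nv: "l2n (v1 n) \<le> (\<Sum>j<n. C * (\<theta> ^ j * nrm g1 g2)) \<and> l2n (v2 n) \<le> (\<Sum>j<n. C * (\<theta> ^ j * nrm g1 g2))" for n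
  proof (induction n)
    case (Suc n)
    have "l2n (v1 (Suc n)) \<le> l2n (v1 n) + l2n (d1 n)" "l2n (v2 (Suc n)) \<le> l2n (v2 n) + l2n (d2 n)"
      using l2n_triangle[of "v1 n" "d1 n"] l2n_triangle[of "v2 n" "d2 n"] ld[of n] lv[of n] by (simp_all add: v1_def[abs_def] v2_def[abs_def])
    moreover have "l2n (d1 n) \<le> C * (\<theta> ^ n * nrm g1 g2)" "l2n (d2 n) \<le> C * (\<theta> ^ n * nrm g1 g2)"
      using l2n_le_nrm[OF ld(1)[of n] ld(2)[of n]] nd'[of n] by auto
    ultimately show ?case using Suc by simp
  qed (simp add: v1_def[abs_def] v2_def[abs_def] l2n_def)
  have geo: "(\<Sum>j<n. D * \<theta> ^ j) \<le> D / (1 - \<theta>)" if "D \<ge> 0" for n D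
  proof -
    have "(\<Sum>j<n. D * \<theta> ^ j) \<le> (\<Sum>j. D * \<theta> ^ j)"
      by (intro sum_le_suminf summable_mult summable_geometric) (use \<theta> that in auto)
    also have "\<dots> = D / (1 - \<theta>)" using \<theta> by (subst suminf_mult) (auto simp: suminf_geometric)
    finally show ?thesis .
  qed
  have pt: "\<exists>D\<ge>0. \<forall>x\<in>{-N..N}. \<forall>n. norm (d1 n x) \<le> D * \<theta> ^ n \<and> norm (d2 n x) \<le> D * \<theta> ^ n" for N :: real
  proof -
    obtain Am' where A0: "Am' \<ge> 0" and Am: "\<And>t. t \<in> {-N..N+1} \<Longrightarrow> norm (of_real (B t) + \<alpha>) \<le> Am'"
      by (rule continuous_bounded_Icc[of "\<lambda>t. of_real (B t) + \<alpha>"]) (intro continuous_intros cont, blast)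
    define P where "P = (1 + Am' + norm p + norm q) * C + 1"
    have P0: "P \<ge> 0" using small(1) A0 by (simp add: P_def)
    show ?thesis
    proof (intro exI[of _ "P * nrm g1 g2"] conjI ballI allI)
      show "P * nrm g1 g2 \<ge> 0" using P0 by simp
      fix x n assume x: "x \<in> {-N..N}"
      have A: "norm (of_real (B t) + \<alpha>) \<le> Am'" if "t \<in> {x..x+1}" for t
        using Am[of t] that x by auto
      let ?T = "\<theta> ^ n * nrm g1 g2"
      have T: "l2n (d1 n) \<le> C * ?T" "l2n (d2 n) \<le> C * ?T" "l2n (r1 n) \<le> ?T" "l2n (r2 n) \<le> ?T"
        using l2n_le_nrm[OF ld(1)[of n] ld(2)[of n]] nd'[of n] l2n_le_nrm[of "r1 n" "r2 n"] lr[of n] nr[of n] by auto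
      have CT: "C * ?T \<ge> 0" using small(1) \<theta> by simp
      have e: "(1 + Am') * (C * ?T) + s * (C * ?T) + ?T \<le> P * ?T" if "s \<le> norm p + norm q" for s
        using mult_right_mono[OF that CT] by (simp add: P_def algebra_simps)
      have "norm (d1 n x) \<le> (1 + Am') * l2n (d1 n) + norm p * l2n (d2 n) + l2n (r1 n)"
        using ac_first_order_bound[of "d1 n" "\<lambda>x. of_real (B x) + \<alpha>" p "d2 n" "r1 n" x Am'] dd[of n] ld lr A
        by (auto simp: dsys_def)
      also have "\<dots> \<le> (1 + Am') * (C * ?T) + norm p * (C * ?T) + ?T"
        using T A0 by (intro add_mono mult_left_mono) auto
      also have "\<dots> \<le> P * ?T" by (rule e) simp
      finally show "norm (d1 n x) \<le> P * nrm g1 g2 * \<theta> ^ n" by (simp add: mult_ac)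
      have m: "ac (d2 n) (\<lambda>x. - (of_real (B x) + \<alpha>) * d2 n x + (-q) * d1 n x - (- r2 n x))"
        using dd[of n] by (simp add: dsys_def algebra_simps)
      have "norm (d2 n x) \<le> (1 + Am') * l2n (d2 n) + norm (-q) * l2n (d1 n) + l2n (\<lambda>x. - r2 n x)"
      proof (rule ac_first_order_bound[where A = "\<lambda>x. - (of_real (B x) + \<alpha>)", OF m ld(2) ld(1)])
        show "l2 (\<lambda>x. - r2 n x)" using lr by (intro l2_minus) blast
        show "norm (- (of_real (B t) + \<alpha>)) \<le> Am'" if "t \<in> {x..x+1}" for t
          using A[OF that] by (simp only: norm_minus_cancel)
      qed
      also have "\<dots> = (1 + Am') * l2n (d2 n) + norm q * l2n (d1 n) + l2n (r2 n)" by (simp add: l2n_minus)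
      also have "\<dots> \<le> (1 + Am') * (C * ?T) + norm q * (C * ?T) + ?T"
        using T A0 by (intro add_mono mult_left_mono) auto
      also have "\<dots> \<le> P * ?T" by (rule e) simp
      finally show "norm (d2 n x) \<le> P * nrm g1 g2 * \<theta> ^ n" by (simp add: mult_ac)
    qed
  qed
  have sumb: "summable (\<lambda>n. d1 n x)" "summable (\<lambda>n. d2 n x)" for x
  proof -
    obtain D where D: "D \<ge> 0" "\<forall>t\<in>{-\<bar>x\<bar>..\<bar>x\<bar>}. \<forall>n. norm (d1 n t) \<le> D * \<theta> ^ n \<and> norm (d2 n t) \<le> D * \<theta> ^ n"
      using pt by blast
    have x: "x \<in> {-\<bar>x\<bar>..\<bar>x\<bar>}" by auto
    have s: "summable (\<lambda>n. D * \<theta> ^ n)" using \<theta> by (intro summable_mult summable_geometric) auto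
    show "summable (\<lambda>n. d1 n x)" "summable (\<lambda>n. d2 n x)"
      using D(2) x by (auto intro!: summable_comparison_test'[OF s, of 0])
  qed
  have vb: "\<exists>L. \<forall>x\<in>{-N..N}. \<forall>n. norm (v1 n x) \<le> L \<and> norm (v2 n x) \<le> L" for N :: real
  proof -
    obtain D where D: "D \<ge> 0" "\<forall>x\<in>{-N..N}. \<forall>n. norm (d1 n x) \<le> D * \<theta> ^ n \<and> norm (d2 n x) \<le> D * \<theta> ^ n"
      using pt by blast
    have "norm (v1 n x) \<le> D / (1 - \<theta>) \<and> norm (v2 n x) \<le> D / (1 - \<theta>)" if "x \<in> {-N..N}" for x n
    proof
      show "norm (v1 n x) \<le> D / (1 - \<theta>)"
        unfolding v1_def using D(2) that by (intro order_trans[OF sum_norm_le geo[OF D(1)]]) auto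
      show "norm (v2 n x) \<le> D / (1 - \<theta>)"
        unfolding v2_def using D(2) that by (intro order_trans[OF sum_norm_le geo[OF D(1)]]) auto
    qed
    then show ?thesis by blast
  qed
  define w1 where "w1 x = (\<Sum>n. d1 n x)" for x
  define w2 where "w2 x = (\<Sum>n. d2 n x)" for x
  have lim: "(\<lambda>n. v1 n x) \<longlonglongrightarrow> w1 x" "(\<lambda>n. v2 n x) \<longlonglongrightarrow> w2 x" for x
    unfolding v1_def v2_def w1_def w2_def by (intro summable_LIMSEQ sumb)+
  \<comment> \<open>The offset by one is essential: the partial sum at \<open>Suc n\<close> solves
    the old system with the perturbation applied to the partial sum at n. Both have the same limit,
    which therefore solves the new system.\<close>
  have dv: "dsys B \<alpha> p q (v1 (Suc n)) (v2 (Suc n)) (\<lambda>x. g1 x - K1 (v1 n) (v2 n) x) (\<lambda>x. g2 x - K2 (v1 n) (v2 n) x)" for n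
  proof (induction n)
    case 0
    show ?case using dd[of 0] unfolding r0 by (simp add: v1_def[abs_def] v2_def[abs_def] K1_def K2_def)
  next
    case (Suc n)
    have "dsys B \<alpha> p q (\<lambda>x. v1 (Suc n) x + d1 (Suc n) x) (\<lambda>x. v2 (Suc n) x + d2 (Suc n) x)
       (\<lambda>x. (g1 x - K1 (v1 n) (v2 n) x) + r1 (Suc n) x) (\<lambda>x. (g2 x - K2 (v1 n) (v2 n) x) + r2 (Suc n) x)"
      by (rule dsys_add[OF Suc dd])
    moreover have "(\<lambda>x. v1 (Suc n) x + d1 (Suc n) x) = v1 (Suc (Suc n))" "(\<lambda>x. v2 (Suc n) x + d2 (Suc n) x) = v2 (Suc (Suc n))"
      by (auto simp: v1_def v2_def)
    moreover have "(\<lambda>x. (g1 x - K1 (v1 n) (v2 n) x) + r1 (Suc n) x) = (\<lambda>x. g1 x - K1 (v1 (Suc n)) (v2 (Suc n)) x)"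
      "(\<lambda>x. (g2 x - K2 (v1 n) (v2 n) x) + r2 (Suc n) x) = (\<lambda>x. g2 x - K2 (v1 (Suc n)) (v2 (Suc n)) x)"
      unfolding rS by (auto simp: K1_def K2_def v1_def v2_def algebra_simps)
    ultimately show ?case by simp
  qed
  \<comment> \<open>One majorant for both components: constants from the locally uniform bounds on
    the partial sums, plus the modulus of the datum, which is integrable on compact
    intervals.\<close>
  have dom: "\<exists>h. set_integrable lborel {x..y} h \<and> (\<forall>n. \<forall>t\<in>{x..y}.
      norm (A t * vA (Suc n) t + e1 * vB (Suc n) t + (e2 * vA n t + e3 * vB n t) + g t) \<le> h t)"
    if A: "continuous_on UNIV A" and g: "l2 g"
      and vA: "\<And>N. \<exists>L. \<forall>x\<in>{-N..N}. \<forall>n. norm (vA n x) \<le> L" and vB: "\<And>N. \<exists>L. \<forall>x\<in>{-N..N}. \<forall>n. norm (vB n x) \<le> L"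
    for A g :: "real \<Rightarrow> complex" and vA vB :: "nat \<Rightarrow> real \<Rightarrow> complex" and e1 e2 e3 x y
  proof -
    define N where "N = max \<bar>x\<bar> \<bar>y\<bar>"
    have N: "{x..y} \<subseteq> {-N..N}" by (auto simp: N_def)
    obtain LA LB where LA: "\<And>x n. x \<in> {-N..N} \<Longrightarrow> norm (vA n x) \<le> LA" and LB: "\<And>x n. x \<in> {-N..N} \<Longrightarrow> norm (vB n x) \<le> LB"
      using vA[of N] vB[of N] by metis
    obtain Am where Am: "\<And>x. x \<in> {-N..N} \<Longrightarrow> norm (A x) \<le> Am"
      using continuous_bounded_Icc[OF A] by blast
    let ?c = "Am * LA + norm e1 * LB + (norm e2 * LA + norm e3 * LB)"
    show ?thesis
    proof (intro exI[of _ "\<lambda>t. ?c + norm (g t)"] conjI allI ballI)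
      show "set_integrable lborel {x..y} (\<lambda>t. ?c + norm (g t))"
        by (intro set_integral_add(1) l2_set_integrable_Icc(2)[OF g] borel_integrable_atLeastAtMost' continuous_intros)
      fix n t assume "t \<in> {x..y}"
      then have t: "t \<in> {-N..N}" using N by auto
      have "norm (A t * vA (Suc n) t + e1 * vB (Suc n) t + (e2 * vA n t + e3 * vB n t) + g t)
        \<le> norm (A t * vA (Suc n) t) + norm (e1 * vB (Suc n) t) + (norm (e2 * vA n t) + norm (e3 * vB n t)) + norm (g t)"
        by (intro norm_triangle_mono order_refl)
      also have "\<dots> \<le> ?c + norm (g t)"
        unfolding norm_mult using Am[OF t] LA[OF t] LB[OF t] order_trans[OF norm_ge_zero Am[OF t]]
        by (intro add_mono mult_mono) auto
      finally show "norm (A t * vA (Suc n) t + e1 * vB (Suc n) t + (e2 * vA n t + e3 * vB n t) + g t) \<le> ?c + norm (g t)" .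
    qed
  qed
  have vb1: "\<exists>L. \<forall>x\<in>{-N..N}. \<forall>n. norm (v1 n x) \<le> L" and vb2: "\<exists>L. \<forall>x\<in>{-N..N}. \<forall>n. norm (v2 n x) \<le> L" for N
    using vb by blast+
  have a1: "ac w1 (\<lambda>x. (of_real (B x) + \<alpha>') * w1 x + p' * w2 x - g1 x)"
  proof (rule ac_limit[where u = "\<lambda>n. v1 (Suc n)" and f = "\<lambda>n x. (of_real (B x) + \<alpha>) * v1 (Suc n) x + p * v2 (Suc n) x + (a * v1 n x + b * v2 n x) + - g1 x"])
    show "ac (v1 (Suc n)) (\<lambda>x. (of_real (B x) + \<alpha>) * v1 (Suc n) x + p * v2 (Suc n) x + (a * v1 n x + b * v2 n x) + - g1 x)" for n
      using dv[of n] unfolding dsys_def K1_def by (simp add: algebra_simps)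
    show "(\<lambda>n. v1 (Suc n) x) \<longlonglongrightarrow> w1 x" for x using lim by (intro LIMSEQ_Suc)
    have "(\<lambda>n. (of_real (B x) + \<alpha>) * v1 (Suc n) x + p * v2 (Suc n) x + (a * v1 n x + b * v2 n x) + - g1 x)
       \<longlonglongrightarrow> (of_real (B x) + \<alpha>) * w1 x + p * w2 x + (a * w1 x + b * w2 x) + - g1 x" for x
      by (intro tendsto_intros LIMSEQ_Suc lim)
    then show "(\<lambda>n. (of_real (B x) + \<alpha>) * v1 (Suc n) x + p * v2 (Suc n) x + (a * v1 n x + b * v2 n x) + - g1 x)
       \<longlonglongrightarrow> (of_real (B x) + \<alpha>') * w1 x + p' * w2 x - g1 x" for x
      by (simp add: a_def b_def algebra_simps)
    show "\<exists>h. set_integrable lborel {x..y} h \<and> (\<forall>n. \<forall>t\<in>{x..y}.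
        norm ((of_real (B t) + \<alpha>) * v1 (Suc n) t + p * v2 (Suc n) t + (a * v1 n t + b * v2 n t) + - g1 t) \<le> h t)" for x y
      by (rule dom) (auto intro!: continuous_intros cont l2_minus lg vb1 vb2)
  qed
  have a2: "ac w2 (\<lambda>x. g2 x - (of_real (B x) + \<alpha>') * w2 x - q' * w1 x)"
  proof (rule ac_limit[where u = "\<lambda>n. v2 (Suc n)" and f = "\<lambda>n x. (- (of_real (B x) + \<alpha>)) * v2 (Suc n) x + (-q) * v1 (Suc n) x + ((-a) * v2 n x + (-c) * v1 n x) + g2 x"])
    show "ac (v2 (Suc n)) (\<lambda>x. (- (of_real (B x) + \<alpha>)) * v2 (Suc n) x + (-q) * v1 (Suc n) x + ((-a) * v2 n x + (-c) * v1 n x) + g2 x)" for n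
      using dv[of n] unfolding dsys_def K2_def by (simp add: algebra_simps)
    show "(\<lambda>n. v2 (Suc n) x) \<longlonglongrightarrow> w2 x" for x using lim by (intro LIMSEQ_Suc)
    have "(\<lambda>n. (- (of_real (B x) + \<alpha>)) * v2 (Suc n) x + (-q) * v1 (Suc n) x + ((-a) * v2 n x + (-c) * v1 n x) + g2 x)
       \<longlonglongrightarrow> (- (of_real (B x) + \<alpha>)) * w2 x + (-q) * w1 x + ((-a) * w2 x + (-c) * w1 x) + g2 x" for x
      by (intro tendsto_intros LIMSEQ_Suc lim)
    then show "(\<lambda>n. (- (of_real (B x) + \<alpha>)) * v2 (Suc n) x + (-q) * v1 (Suc n) x + ((-a) * v2 n x + (-c) * v1 n x) + g2 x)
       \<longlonglongrightarrow> g2 x - (of_real (B x) + \<alpha>') * w2 x - q' * w1 x" for x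
      by (simp add: a_def c_def algebra_simps)
    show "\<exists>h. set_integrable lborel {x..y} h \<and> (\<forall>n. \<forall>t\<in>{x..y}.
        norm ((- (of_real (B t) + \<alpha>)) * v2 (Suc n) t + (-q) * v1 (Suc n) t + ((-a) * v2 n t + (-c) * v1 n t) + g2 t) \<le> h t)" for x y
      by (rule dom) (auto intro!: continuous_intros cont lg vb1 vb2)
  qed
  have "l2n (v1 n) \<le> C * nrm g1 g2 / (1 - \<theta>)" "l2n (v2 n) \<le> C * nrm g1 g2 / (1 - \<theta>)" for n
    using nv[of n] geo[of "C * nrm g1 g2" n] small(1) by (auto simp: mult_ac)
  then have "l2 w1" "l2 w2"
    using l2_Fatou(1)[of v1 _ w1] l2_Fatou(1)[of v2 _ w2] lv lim by blast+
  then show "\<exists>w1 w2. l2 w1 \<and> l2 w2 \<and> dsys B \<alpha>' p' q' w1 w2 g1 g2"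
    using a1 a2 unfolding dsys_def by blast
qed

lemma dsys_surj_solves:
  assumes "dsys_surj B \<alpha> p q" "dsys_bound B \<alpha> p q C" "l2 g1" "l2 g2"
  shows "\<exists>w1 w2. l2 w1 \<and> l2 w2 \<and> dsys B \<alpha> p q w1 w2 g1 g2 \<and> nrm w1 w2 \<le> C * nrm g1 g2"
  using assms unfolding dsys_surj_def dsys_bound_def by metis

text \<open>Method of continuity: a common C along the path permits perturbation steps of one fixed
  length 1 / n, where n exceeds C |L|.\<close>

lemma dsys_surj_continuation:
  fixes \<alpha> :: "real \<Rightarrow> complex"
  assumes "continuous_on UNIV B" "C > 0" "dsys_surj B (\<alpha> 0) p q"
    and "\<And>s. 0 \<le> s \<Longrightarrow> s \<le> 1 \<Longrightarrow> dsys_bound B (\<alpha> s) p q C"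
    and "\<And>s t. norm (\<alpha> s - \<alpha> t) \<le> L * \<bar>s - t\<bar>"
  shows "dsys_surj B (\<alpha> 1) p q"
proof -
  obtain n :: nat where n: "C * \<bar>L\<bar> < real n" using reals_Archimedean2 by blast
  then have n0: "n > 0" using assms(2) by (cases n) (auto simp: mult_less_0_iff)
  have "j \<le> n \<Longrightarrow> dsys_surj B (\<alpha> (real j / real n)) p q" for j
  proof (induction j)
    case 0 then show ?case using assms(3) by simp
  next
    case (Suc j)
    have IH: "dsys_surj B (\<alpha> (real j / real n)) p q" using Suc by simp
    have bd: "dsys_bound B (\<alpha> (real j / real n)) p q C" using Suc.prems n0 by (intro assms(4)) auto
    show ?case
    proof (rule dsys_surj_perturb[OF assms(1) dsys_surj_solves[OF IH bd]])
      have "norm (\<alpha> (real (Suc j) / real n) - \<alpha> (real j / real n)) \<le> L * (1 / real n)"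
        using assms(5)[of "real (Suc j) / real n" "real j / real n"] n0 by (simp add: diff_divide_distrib[symmetric])
      also have "\<dots> \<le> \<bar>L\<bar> * (1 / real n)" by (intro mult_right_mono) auto
      finally have "C * norm (\<alpha> (real (Suc j) / real n) - \<alpha> (real j / real n)) \<le> C * (\<bar>L\<bar> * (1 / real n))"
        using assms(2) by (intro mult_left_mono) auto
      also have "\<dots> < 1" using n n0 by (simp add: field_simps)
      finally show "C * (norm (\<alpha> (real (Suc j) / real n) - \<alpha> (real j / real n)) + norm (p - p) + norm (q - q)) < 1" by simp
    qed (use assms(2) in auto)
  qed
  from this[of n] show ?thesis using n0 by simp
qed

text \<open>From the couplings (-i, 0) only (-i, -i r^2) with small r is in reach; multiplying the
  first component by r turns both into -i r. Since the bound at r is 1 / r, r may then grow by the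
  factor 5/4, and finitely many such steps lead from \<open>\<mu>\<close> (4/5)^n to
  \<open>\<mu>\<close>.\<close>

lemma (in wall) dsys_surj_diag:
  assumes "\<mu> > 0"
  shows "dsys_surj B 0 (- \<i> * of_real \<mu>) (- \<i> * of_real \<mu>)"
proof -
  obtain C0 where C0: "\<And>g1 g2. l2 g1 \<Longrightarrow> l2 g2 \<Longrightarrow>
     \<exists>w1 w2. l2 w1 \<and> l2 w2 \<and> dsys B 0 (- \<i>) 0 w1 w2 g1 g2 \<and> nrm w1 w2 \<le> C0 * nrm g1 g2"
    using dsys_triangular by blast
  define C where "C = max C0 1"
  have C: "\<exists>w1 w2. l2 w1 \<and> l2 w2 \<and> dsys B 0 (- \<i>) 0 w1 w2 g1 g2 \<and> nrm w1 w2 \<le> C * nrm g1 g2"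
    if lg: "l2 g1" "l2 g2" for g1 g2
  proof -
    obtain w1 w2 where w: "l2 w1" "l2 w2" "dsys B 0 (- \<i>) 0 w1 w2 g1 g2" "nrm w1 w2 \<le> C0 * nrm g1 g2"
      using C0[OF lg] by blast
    have "C0 * nrm g1 g2 \<le> C * nrm g1 g2" by (intro mult_right_mono) (auto simp: C_def)
    then show ?thesis using w by force
  qed
  have small: "dsys_surj B 0 (- \<i> * of_real r) (- \<i> * of_real r)" if r: "r > 0" "C * r\<^sup>2 < 1" for r
  proof -
    have S: "dsys_surj B 0 (- \<i>) (- \<i> * of_real (r\<^sup>2))"
      by (rule dsys_surj_perturb[OF B_cont C]) (use r in \<open>auto simp: C_def norm_mult norm_power\<close>)
    show ?thesis unfolding dsys_surj_def
    proof (intro allI impI)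
      fix g1 g2 :: "real \<Rightarrow> complex" assume l: "l2 g1" "l2 g2"
      have "l2 (\<lambda>x. of_real (1 / r) * g1 x)" using l2_scale[OF l(1)] .
      then obtain y1 y2 where y: "l2 y1" "l2 y2" "dsys B 0 (- \<i>) (- \<i> * of_real (r\<^sup>2)) y1 y2 (\<lambda>x. of_real (1 / r) * g1 x) g2"
        using S l(2) unfolding dsys_surj_def by blast
      have "ac (\<lambda>x. of_real r * y1 x) (\<lambda>x. of_real r * (of_real (B x) * y1 x - \<i> * y2 x - of_real (1 / r) * g1 x))"
        using y(3) unfolding dsys_def by (intro ac_cmult) simp
      moreover have "of_real r * (of_real (1 / r) * g1 x) = g1 x" for x
        using r(1) by (simp add: mult.assoc[symmetric] flip: of_real_mult)
      ultimately have "ac (\<lambda>x. of_real r * y1 x) (\<lambda>x. of_real (B x) * (of_real r * y1 x) - \<i> * of_real r * y2 x - g1 x)"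
        by (simp add: algebra_simps)
      moreover have "ac y2 (\<lambda>x. g2 x - of_real (B x) * y2 x + \<i> * of_real r * (of_real r * y1 x))"
        using y(3) by (simp add: dsys_def power2_eq_square algebra_simps)
      ultimately have "dsys B 0 (- \<i> * of_real r) (- \<i> * of_real r) (\<lambda>x. of_real r * y1 x) y2 g1 g2"
        by (simp add: dsys_def algebra_simps)
      then show "\<exists>w1 w2. l2 w1 \<and> l2 w2 \<and> dsys B 0 (- \<i> * of_real r) (- \<i> * of_real r) w1 w2 g1 g2"
        using l2_scale[OF y(1)] y(2) by blast
    qed
  qed
  \<comment> \<open>Each of the two couplings moves by r / 4, so the perturbation times the bound 1
    / r is 1/2.\<close>
  have step: "dsys_surj B 0 (- \<i> * of_real (5/4 * r)) (- \<i> * of_real (5/4 * r))"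
    if "r > 0" "dsys_surj B 0 (- \<i> * of_real r) (- \<i> * of_real r)" for r
  proof (rule dsys_surj_perturb[OF B_cont dsys_surj_solves[OF that(2) dsys_bound_diag[OF that(1)]]])
    have "- \<i> * of_real (5/4 * r) - - \<i> * of_real r = - \<i> * of_real (r / 4)"
      by (simp add: field_simps)
    then have "norm (- \<i> * of_real (5/4 * r) - - \<i> * of_real r) = r / 4"
      using that(1) by (simp only: norm_mult) simp
    then show "1 / r * (norm (0 - 0 :: complex) + norm (- \<i> * of_real (5/4 * r) - - \<i> * of_real r)
       + norm (- \<i> * of_real (5/4 * r) - - \<i> * of_real r)) < 1"
      using that(1) by simp
  qed (use that in auto)
  have iter: "r > 0 \<Longrightarrow> dsys_surj B 0 (- \<i> * of_real r) (- \<i> * of_real r) \<Longrightarrow>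
     dsys_surj B 0 (- \<i> * of_real ((5/4) ^ n * r)) (- \<i> * of_real ((5/4) ^ n * r))" for n r
  proof (induction n)
    case (Suc n)
    then show ?case using step[of "(5/4) ^ n * r"] by (simp add: mult.assoc)
  qed simp
  have "(\<lambda>n. C * (\<mu> * inverse ((5/4) ^ n))\<^sup>2) \<longlonglongrightarrow> C * (\<mu> * 0)\<^sup>2"
    by (intro tendsto_intros LIMSEQ_inverse_realpow_zero) simp
  then have "\<forall>\<^sub>F n in sequentially. C * (\<mu> * inverse ((5/4) ^ n))\<^sup>2 < 1"
    by (rule order_tendstoD) simp
  then obtain n where n: "C * (\<mu> * inverse ((5/4) ^ n))\<^sup>2 < 1" by (auto simp: eventually_sequentially)
  have "dsys_surj B 0 (- \<i> * of_real (\<mu> * inverse ((5/4) ^ n))) (- \<i> * of_real (\<mu> * inverse ((5/4) ^ n)))"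
    by (rule small) (use n assms in auto)
  moreover have "(5/4) ^ n * (\<mu> * inverse ((5/4) ^ n)) = \<mu>" by (simp add: field_simps)
  ultimately show ?thesis using iter[of "\<mu> * inverse ((5/4) ^ n)" n] assms by (simp only:) simp
qed

section \<open>Weak derivatives\<close>

text \<open>Intervals generate the Borel sets, so vanishing integrals pass from intervals to all
  Borel sets by complements and countable disjoint unions. Truncation to [-n, n] provides the
  integrability that this induction needs.\<close>

lemma AE_zero_of_integral_Icc:
  fixes f :: "real \<Rightarrow> complex"
  assumes "\<And>x y. set_integrable lborel {x..y} f" "\<And>x y. x \<le> y \<Longrightarrow> (LBINT t:{x..y}. f t) = 0"
  shows "AE x in lborel. f x = 0"
proof -
  have z: "(LBINT t:{x..y}. f t) = 0" for x y
    using assms(2)[of x y] by (cases "x \<le> y") (auto simp: set_lebesgue_integral_def)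
  have "AE x in lborel. indicator {-real n..real n} x *\<^sub>R f x = 0" for n
  proof (rule sigma_finite_measure.density_zero[OF sigma_finite_lborel])
    let ?g = "\<lambda>x. indicator {-real n..real n} x *\<^sub>R f x"
    show ig: "integrable lborel ?g" using assms(1)[of "-real n" "real n"] by (simp add: set_integrable_def)
    have iA: "set_integrable lborel A ?g" if "A \<in> sets borel" for A
      unfolding set_integrable_def by (rule integrable_mult_indicator[OF _ ig]) (use that in simp)
    fix A :: "real set" assume "A \<in> sets lborel"
    then have "A \<in> sets borel" by simp
    then show "set_lebesgue_integral lborel A ?g = 0"
    proof (induction A rule: borel_set_induct)
      case empty then show ?case by (simp add: set_lebesgue_integral_def)
    next
      case (interval a b)
      have "indicator {a..b} x *\<^sub>R ?g x = indicator {max a (-real n)..min b (real n)} x *\<^sub>R f x" for x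
        by (auto simp: indicator_def)
      then show ?case using z[of "max a (-real n)" "min b (real n)"] unfolding set_lebesgue_integral_def by (simp only:)
    next
      case (compl A)
      have "(LBINT x:A. ?g x) + (LBINT x:-A. ?g x) = (LBINT x:A \<union> -A. ?g x)"
        using compl by (intro set_integral_Un[symmetric] iA) auto
      also have "\<dots> = (LBINT t:{-real n..real n}. f t)" by (simp add: set_lebesgue_integral_def)
      finally show ?case using compl z by simp
    next
      case (union F)
      have "(LBINT x:(\<Union>i. F i). ?g x) = (\<Sum>i. LBINT x:F i. ?g x)"
        using union by (intro lebesgue_integral_countable_add iA) (auto simp: disjoint_family_on_def)
      then show ?case using union by simp
    qed
  qed
  then have "AE x in lborel. \<forall>n. indicator {-real n..real n} x *\<^sub>R f x = 0"
    by (simp only: AE_all_countable) blast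
  then show ?thesis
  proof eventually_elim
    case (elim x)
    obtain n where "\<bar>x\<bar> \<le> real n" using real_arch_simple by blast
    then show ?case using elim[rule_format, of n] by (auto simp: indicator_def split: if_splits)
  qed
qed

lemma ac_cong_AE:
  assumes "ac u v" "v' \<in> borel_measurable borel" "AE x in lborel. v x = v' x"
  shows "ac u v'"
proof -
  note mv = ac_meas_deriv[OF assms(1)]
  have m: "(\<lambda>t. indicator {x..y} t *\<^sub>R v t) \<in> borel_measurable lborel"
    "(\<lambda>t. indicator {x..y} t *\<^sub>R v' t) \<in> borel_measurable lborel" for x y :: real
    using mv assms(2) by auto
  have e: "AE t in lborel. indicator {x..y} t *\<^sub>R v t = indicator {x..y} t *\<^sub>R v' t" for x y :: real
    using assms(3) by eventually_elim simp
  have "set_integrable lborel {x..y} v'" "(LBINT t:{x..y}. v t) = (LBINT t:{x..y}. v' t)" for x y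
    using integrable_cong_AE[OF m(1)[of x y] m(2)[of x y] e[of x y]]
      integral_cong_AE[OF m(1)[of x y] m(2)[of x y] e[of x y]] ac_set_integrable[OF assms(1), of x y]
    by (auto simp: set_integrable_def set_lebesgue_integral_def)
  then show ?thesis using assms unfolding ac_def by simp
qed

lemma test_function_D:
  assumes "test_function \<phi>"
  shows "(\<phi> has_real_derivative deriv \<phi> x) (at x)" "continuous_on UNIV (deriv \<phi>)" "continuous_on UNIV \<phi>"
    "\<exists>r. \<forall>x. \<bar>x\<bar> > r \<longrightarrow> \<phi> x = 0 \<and> deriv \<phi> x = 0"
proof -
  obtain D where D: "\<And>x. (\<phi> has_vector_derivative D x) (at x)" "continuous_on UNIV D"
    using assms unfolding test_function_def C1_differentiable_on_def by auto
  then have d: "deriv \<phi> = D"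
    by (auto simp: has_real_derivative_iff_has_vector_derivative intro!: DERIV_imp_deriv)
  show 1: "(\<phi> has_real_derivative deriv \<phi> x) (at x)" for x
    using D(1) by (simp add: d has_real_derivative_iff_has_vector_derivative)
  show "continuous_on UNIV (deriv \<phi>)" using D(2) d by simp
  show "continuous_on UNIV \<phi>" using 1 by (meson DERIV_isCont continuous_at_imp_continuous_on)
  have "bounded (closure {x. \<phi> x \<noteq> 0})" using assms compact_imp_bounded unfolding test_function_def by blast
  then obtain r where r: "\<And>x. \<phi> x \<noteq> 0 \<Longrightarrow> \<bar>x\<bar> \<le> r"
    unfolding bounded_iff using closure_subset by (metis (mono_tags, lifting) mem_Collect_eq real_norm_def subsetD)
  have "deriv \<phi> x = 0" if "\<bar>x\<bar> > r" for x
  proof -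
    have o: "open {x. \<bar>x\<bar> > r}" by (intro open_Collect_less continuous_intros)
    have "((\<lambda>_. 0) has_real_derivative 0) (at x)" by simp
    then have "(\<phi> has_real_derivative 0) (at x)"
      by (rule has_field_derivative_transform_within_open[OF _ o]) (use that r in force)+
    then show ?thesis by (rule DERIV_imp_deriv)
  qed
  then show "\<exists>r. \<forall>x. \<bar>x\<bar> > r \<longrightarrow> \<phi> x = 0 \<and> deriv \<phi> x = 0" using r by force
qed

lemma ac_test_function:
  assumes "ac u v" "test_function \<phi>"
  shows "integrable lborel (\<lambda>x. of_real (deriv \<phi> x) * u x)" "integrable lborel (\<lambda>x. of_real (\<phi> x) * v x)"
    "(\<integral>x. of_real (deriv \<phi> x) * u x \<partial>lborel) = - (\<integral>x. of_real (\<phi> x) * v x \<partial>lborel)"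
proof -
  note t = test_function_D[OF assms(2)]
  obtain r where r: "\<And>x. \<bar>x\<bar> > r \<Longrightarrow> \<phi> x = 0 \<and> deriv \<phi> x = 0" using t(4) by blast
  note cu = ac_continuous[OF assms(1)]
  show 1: "integrable lborel (\<lambda>x. of_real (deriv \<phi> x) * u x)"
    by (rule integrable_compact_support[of r], rule borel_integrable_atLeastAtMost')
       (use r cu in \<open>auto intro!: continuous_intros intro: continuous_on_subset[OF t(2)]\<close>)
  have "set_integrable lborel {-r..r} (\<lambda>x. v x * of_real (\<phi> x))"
    by (rule set_integrable_continuous_mult[OF ac_set_integrable[OF assms(1)] _ ac_meas_deriv[OF assms(1)]])
       (intro continuous_intros t(3))
  then show 2: "integrable lborel (\<lambda>x. of_real (\<phi> x) * v x)"
    by (intro integrable_compact_support[of r]) (use r in \<open>auto simp: mult.commute\<close>)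
  have F: "ac (\<lambda>x. of_real (\<phi> x) * u x) (\<lambda>x. of_real (deriv \<phi> x) * u x + of_real (\<phi> x) * v x)"
    by (intro ac_mult ac_of_real t assms(1))
  have "(\<integral>x. of_real (deriv \<phi> x) * u x + of_real (\<phi> x) * v x \<partial>lborel) = 0"
    by (rule ac_integral_0_compact(2)[OF F, of r]) (use r in auto)
  then show "(\<integral>x. of_real (deriv \<phi> x) * u x \<partial>lborel) = - (\<integral>x. of_real (\<phi> x) * v x \<partial>lborel)"
    using 1 2 by (simp add: add_eq_0_iff)
qed

text \<open>The primitive that vanishes at -r is 0 again beyond r because the mean is 0, so it has
  compact support.\<close>

lemma test_function_of_mean_zero:
  fixes \<theta> :: "real \<Rightarrow> real"
  assumes "continuous_on UNIV \<theta>" "\<And>x. \<bar>x\<bar> \<ge> r \<Longrightarrow> \<theta> x = 0" "(\<integral>x. \<theta> x \<partial>lborel) = 0" "r > 0"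
  shows "\<exists>\<phi>. test_function \<phi> \<and> deriv \<phi> = \<theta>"
proof -
  have "\<exists>F. \<forall>x::real. -\<infinity> < ereal x \<longrightarrow> ereal x < \<infinity> \<longrightarrow> (F has_vector_derivative \<theta> x) (at x)"
    by (rule einterval_antiderivative) (use assms(1) in \<open>auto simp: continuous_on_eq_continuous_at\<close>)
  then obtain F where F: "\<And>x. (F has_vector_derivative \<theta> x) (at x)" by auto
  define \<phi> where "\<phi> x = F x - F (- r)" for x
  have d: "(\<phi> has_vector_derivative \<theta> x) (at x)" for x
    unfolding \<phi>_def[abs_def] using F[of x] by (auto intro!: derivative_eq_intros)
  have ftc: "F y - F x = (LBINT t:{x..y}. \<theta> t)" if "x \<le> y" for x y
    using integral_FTC_atLeastAtMost[OF that has_vector_derivative_at_within[OF F] continuous_on_subset[OF assms(1)]]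
    by (simp add: set_lebesgue_integral_def)
  have z: "\<phi> x = 0" if "\<bar>x\<bar> > r" for x
  proof (cases "x > 0")
    case True
    have "(\<lambda>t. indicator {-r..x} t *\<^sub>R \<theta> t) = \<theta>"
      using that True assms(2) by (force simp: indicator_def)
    then show ?thesis using ftc[of "-r" x] that True assms(3,4) by (simp add: \<phi>_def set_lebesgue_integral_def)
  next
    case False
    have "(\<lambda>t. indicator {x..-r} t *\<^sub>R \<theta> t) = (\<lambda>t. 0)"
      using that False assms(2,4) by (force simp: indicator_def)
    then show ?thesis using ftc[of x "-r"] that False assms(4) by (simp add: \<phi>_def set_lebesgue_integral_def)
  qed
  have "{x. \<phi> x \<noteq> 0} \<subseteq> {-r..r}" using z by force
  then have "bounded {x. \<phi> x \<noteq> 0}" using bounded_subset bounded_closed_interval by blast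
  then have "compact (closure {x. \<phi> x \<noteq> 0})" using compact_closure by blast
  moreover have "\<phi> C1_differentiable_on UNIV"
    unfolding C1_differentiable_on_def using d assms(1) by blast
  moreover have "deriv \<phi> = \<theta>"
    using d by (auto simp: has_real_derivative_iff_has_vector_derivative intro!: DERIV_imp_deriv)
  ultimately show ?thesis unfolding test_function_def by blast
qed

text \<open>A trapezoid equal to 1 on [x, y] with sides of width 1 / (n + 1): a continuous stand-in
  for the indicator of [x, y], which becomes the derivative of a test function once its mean is
  corrected.\<close>

definition trap :: "real \<Rightarrow> real \<Rightarrow> nat \<Rightarrow> real \<Rightarrow> real" where
  "trap x y n t = max 0 (1 - real (Suc n) * max 0 (max (x - t) (t - y)))"

lemma trap_props:
  shows "continuous_on UNIV (trap x y n)" "0 \<le> trap x y n t" "trap x y n t \<le> 1"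
    "t \<in> {x..y} \<Longrightarrow> trap x y n t = 1" "t \<notin> {x-1..y+1} \<Longrightarrow> trap x y n t = 0"
    "(\<lambda>n. trap x y n t) \<longlonglongrightarrow> indicator {x..y} t"
proof -
  show "continuous_on UNIV (trap x y n)" unfolding trap_def by (intro continuous_intros)
  show "0 \<le> trap x y n t" "trap x y n t \<le> 1" by (simp_all add: trap_def)
  show 1: "trap x y n t = 1" if "t \<in> {x..y}" for n
  proof -
    have "max 0 (max (x - t) (t - y)) = 0" using that by auto
    then show ?thesis by (simp add: trap_def)
  qed
  define s where "s = max 0 (max (x - t) (t - y))"
  have z: "trap x y n t = 0" if "real (Suc n) * s \<ge> 1" for n using that by (simp add: trap_def s_def)
  show "trap x y n t = 0" if "t \<notin> {x-1..y+1}"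
  proof (rule z)
    have "s \<ge> 1" using that by (auto simp: s_def)
    then show "real (Suc n) * s \<ge> 1" using mult_mono[of 1 "real (Suc n)" 1 s] by simp
  qed
  show "(\<lambda>n. trap x y n t) \<longlonglongrightarrow> indicator {x..y} t"
  proof (cases "t \<in> {x..y}")
    case True then show ?thesis using 1 by simp
  next
    case False
    then have s: "s > 0" by (auto simp: s_def)
    obtain N where N: "1 / s < real N" using reals_Archimedean2 by blast
    have "trap x y n t = 0" if "n \<ge> N" for n
    proof (rule z)
      have "1 / s < real (Suc n)" using N that by linarith
      then show "real (Suc n) * s \<ge> 1" using s by (simp add: pos_divide_less_eq less_imp_le)
    qed
    then show ?thesis using False by (intro tendsto_eventually eventually_sequentiallyI[of N]) auto
  qed
qed

text \<open>The lemma of du Bois-Reymond: the difference \<open>d\<close> of \<open>u\<close> and a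
  primitive of \<open>v\<close> has weak derivative 0, hence integrates to 0 against every
  continuous function of compact support and mean 0. This forces \<open>d\<close> to be
  constant.\<close>

lemma weak_deriv_imp_ac:
  fixes u v :: "real \<Rightarrow> complex"
  assumes "l2 u" "l2 v"
    and weak: "\<And>\<phi>. test_function \<phi> \<Longrightarrow> (\<integral>x. of_real (deriv \<phi> x) * u x \<partial>lborel) = - (\<integral>x. of_real (\<phi> x) * v x \<partial>lborel)"
  shows "\<exists>w. ac w v \<and> (AE x in lborel. u x = w x)"
proof -
  have mu: "u \<in> borel_measurable borel" and mv: "v \<in> borel_measurable borel" using assms l2_meas by auto
  obtain U where U: "ac U v" using ac_indefinite[OF mv l2_set_integrable_Icc(1)[OF assms(2)]] by blast
  define d where "d x = u x - U x" for x
  have md: "d \<in> borel_measurable borel" unfolding d_def[abs_def] using mu ac_meas[OF U] by measurable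
  have id: "set_integrable lborel {x..y} d" for x y
    unfolding d_def[abs_def]
    by (intro set_integral_diff(1) l2_set_integrable_Icc(1)[OF assms(1)] borel_integrable_atLeastAtMost' ac_continuous[OF U])
  have ipd: "integrable lborel (\<lambda>x. of_real (\<psi> x) * d x)" if "continuous_on UNIV \<psi>" "\<And>x. \<bar>x\<bar> > r \<Longrightarrow> \<psi> x = 0" for \<psi> r
  proof (rule integrable_compact_support[of r])
    show "set_integrable lborel {-r..r} (\<lambda>x. of_real (\<psi> x) * d x)"
      using set_integrable_continuous_mult[OF id _ md, of "\<lambda>x. of_real (\<psi> x)" "-r" r] that(1)
      by (simp add: continuous_intros mult.commute)
  qed (use that in auto)
  have dz: "(\<integral>x. of_real (\<theta> x) * d x \<partial>lborel) = 0"
    if \<theta>: "continuous_on UNIV \<theta>" "\<And>x. \<bar>x\<bar> \<ge> r \<Longrightarrow> \<theta> x = 0" "(\<integral>x. \<theta> x \<partial>lborel) = 0" "r > 0" for \<theta> r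
  proof -
    obtain \<phi> where \<phi>: "test_function \<phi>" "deriv \<phi> = \<theta>" using test_function_of_mean_zero[OF \<theta>] by blast
    have i: "integrable lborel (\<lambda>x. of_real (deriv \<phi> x) * d x)" unfolding \<phi> by (rule ipd[of _ r]) (use \<theta> in auto)
    have "(\<integral>x. of_real (deriv \<phi> x) * u x \<partial>lborel) = (\<integral>x. of_real (deriv \<phi> x) * d x + of_real (deriv \<phi> x) * U x \<partial>lborel)"
      by (simp add: d_def algebra_simps)
    also have "\<dots> = (\<integral>x. of_real (deriv \<phi> x) * d x \<partial>lborel) + (\<integral>x. of_real (deriv \<phi> x) * U x \<partial>lborel)"
      by (rule Bochner_Integration.integral_add[OF i ac_test_function(1)[OF U \<phi>(1)]])
    finally show ?thesis using weak[OF \<phi>(1)] ac_test_function(3)[OF U \<phi>(1)] \<phi>(2) by simp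
  qed
  have itrap: "integrable lborel (trap x y n)" for x y n
  proof (rule integrable_compact_support[of "max \<bar>x\<bar> \<bar>y\<bar> + 1"])
    show "set_integrable lborel {- (max \<bar>x\<bar> \<bar>y\<bar> + 1)..max \<bar>x\<bar> \<bar>y\<bar> + 1} (trap x y n)"
      by (rule borel_integrable_atLeastAtMost', rule continuous_on_subset[OF trap_props(1)]) simp
    show "trap x y n t = 0" if "\<bar>t\<bar> > max \<bar>x\<bar> \<bar>y\<bar> + 1" for t using that by (intro trap_props(5)) auto
  qed
  define \<psi> where "\<psi> = trap 0 1 0"
  define J where "J = (\<integral>x. \<psi> x \<partial>lborel)"
  have J: "J > 0"
  proof -
    have "(\<integral>x. indicator {0..1::real} x \<partial>lborel) \<le> J" unfolding J_def \<psi>_def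
    proof (rule integral_mono[OF _ itrap])
      show "integrable lborel (indicator {0..1} :: real \<Rightarrow> real)"
        by (rule integrable_real_indicator) (auto simp: emeasure_lborel_Icc_eq)
      show "indicator {0..1} t \<le> trap 0 1 0 t" for t
        using trap_props(2)[of 0 1 0 t] trap_props(4)[of t 0 1 0] by (auto simp: indicator_def)
    qed
    then show ?thesis by simp
  qed
  \<comment> \<open>The expected constant, read off from one fixed bump \<psi>. Any other trapezoid
    is reduced to \<psi> by subtracting the multiple of \<psi> that removes its mean.\<close>
  define \<kappa> where "\<kappa> = (\<integral>x. of_real (\<psi> x) * d x \<partial>lborel) / of_real J"
  have tr: "(\<integral>t. of_real (trap x y n t) * d t \<partial>lborel) = \<kappa> * of_real (\<integral>t. trap x y n t \<partial>lborel)" for x y n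
  proof -
    define s where "s = (\<integral>t. trap x y n t \<partial>lborel) / J"
    define \<theta> where "\<theta> t = trap x y n t - s * \<psi> t" for t
    define r where "r = max \<bar>x\<bar> \<bar>y\<bar> + 4"
    have tz: "trap x y n t = 0" "\<psi> t = 0" if "\<bar>t\<bar> \<ge> r - 1" for t
      using that unfolding \<psi>_def by (auto intro!: trap_props(5) simp: r_def)
    have i: "integrable lborel (\<lambda>t. of_real (trap x y n t) * d t)" "integrable lborel (\<lambda>t. of_real (\<psi> t) * d t)"
      by (rule ipd[of _ r]; use tz trap_props(1) in \<open>auto simp: \<psi>_def\<close>)+
    have "(\<integral>t. of_real (\<theta> t) * d t \<partial>lborel) = 0"
    proof (rule dz[of _ r])
      show "continuous_on UNIV \<theta>" unfolding \<theta>_def \<psi>_def by (intro continuous_intros trap_props(1))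
      show "(\<integral>t. \<theta> t \<partial>lborel) = 0"
        unfolding \<theta>_def using itrap[of x y n] itrap[of 0 1 0] J by (simp add: s_def J_def \<psi>_def)
    qed (use tz in \<open>auto simp: \<theta>_def r_def\<close>)
    also have "(\<integral>t. of_real (\<theta> t) * d t \<partial>lborel) = (\<integral>t. of_real (trap x y n t) * d t - of_real s * (of_real (\<psi> t) * d t) \<partial>lborel)"
      by (simp add: \<theta>_def algebra_simps)
    also have "\<dots> = (\<integral>t. of_real (trap x y n t) * d t \<partial>lborel) - of_real s * (\<integral>t. of_real (\<psi> t) * d t \<partial>lborel)"
      using i by simp
    finally show ?thesis using J by (simp add: s_def \<kappa>_def field_simps)
  qed
  have Icc: "(LBINT t:{x..y}. d t) = \<kappa> * of_real (y - x)" if "x \<le> y" for x y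
  proof -
    have L1: "(\<lambda>n. \<integral>t. of_real (trap x y n t) * d t \<partial>lborel) \<longlonglongrightarrow> (\<integral>t. indicator {x..y} t *\<^sub>R d t \<partial>lborel)"
    proof (rule integral_dominated_convergence[where w = "\<lambda>t. norm (indicator {x-1..y+1} t *\<^sub>R d t)"])
      show "integrable lborel (\<lambda>t. norm (indicator {x-1..y+1} t *\<^sub>R d t))"
        using id[of "x-1" "y+1"] unfolding set_integrable_def by (rule integrable_norm)
      show "AE t in lborel. (\<lambda>n. of_real (trap x y n t) * d t) \<longlonglongrightarrow> indicator {x..y} t *\<^sub>R d t"
        unfolding scaleR_conv_of_real[symmetric]
        by (intro AE_I2 tendsto_scaleR trap_props(6) tendsto_const)
      show "AE t in lborel. norm (of_real (trap x y n t) * d t) \<le> norm (indicator {x-1..y+1} t *\<^sub>R d t)" for n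
      proof (rule AE_I2)
        fix t
        show "norm (of_real (trap x y n t) * d t) \<le> norm (indicator {x-1..y+1} t *\<^sub>R d t)"
          using trap_props(5)[of t x y n] trap_props(2,3)[of x y n t]
          by (cases "t \<in> {x-1..y+1}") (auto simp: norm_mult mult_left_le_one_le)
      qed
      show "(\<lambda>t. indicator {x..y} t *\<^sub>R d t) \<in> borel_measurable lborel" using md by simp
      show "(\<lambda>t. of_real (trap x y n t) * d t) \<in> borel_measurable lborel" for n
        using md borel_measurable_continuous_onI[OF trap_props(1)] by simp
    qed
    have L2: "(\<lambda>n. \<integral>t. trap x y n t \<partial>lborel) \<longlonglongrightarrow> (\<integral>t. indicator {x..y} t \<partial>lborel)"
    proof (rule integral_dominated_convergence[where w = "indicator {x-1..y+1}"])
      show "integrable lborel (indicator {x-1..y+1} :: real \<Rightarrow> real)"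
        by (rule integrable_real_indicator) (auto simp: emeasure_lborel_Icc_eq)
      show "AE t in lborel. (\<lambda>n. trap x y n t) \<longlonglongrightarrow> indicator {x..y} t" using trap_props(6) by (intro AE_I2)
      show "AE t in lborel. norm (trap x y n t) \<le> indicator {x-1..y+1} t" for n
      proof (rule AE_I2)
        fix t show "norm (trap x y n t) \<le> indicator {x-1..y+1} t"
          using trap_props(5)[of t x y n] trap_props(2,3)[of x y n t] by (auto simp: indicator_def)
      qed
      show "trap x y n \<in> borel_measurable lborel" for n
        using borel_measurable_continuous_onI[OF trap_props(1)] by simp
    qed simp
    have "(\<lambda>n. \<kappa> * of_real (\<integral>t. trap x y n t \<partial>lborel)) \<longlonglongrightarrow> \<kappa> * of_real (\<integral>t. indicator {x..y} t \<partial>lborel)"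
      by (intro tendsto_mult tendsto_const tendsto_of_real L2)
    from LIMSEQ_unique[OF L1[unfolded tr] this]
    have "(\<integral>t. indicator {x..y} t *\<^sub>R d t \<partial>lborel) = \<kappa> * of_real (\<integral>t. indicator {x..y} t \<partial>lborel)"
      .
    then show ?thesis using that by (simp add: set_lebesgue_integral_def)
  qed
  have ic: "set_integrable lborel {x..y} (\<lambda>t. \<kappa>)" for x y :: real
    by (rule borel_integrable_atLeastAtMost') (intro continuous_intros)
  have "AE x in lborel. d x - \<kappa> = 0"
  proof (rule AE_zero_of_integral_Icc)
    show "set_integrable lborel {x..y} (\<lambda>t. d t - \<kappa>)" for x y by (intro set_integral_diff(1) id ic)
    show "x \<le> y \<Longrightarrow> (LBINT t:{x..y}. d t - \<kappa>) = 0" for x y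
      using Icc[of x y] by (subst set_integral_diff(2)[OF id ic]) (simp add: set_lebesgue_integral_def scaleR_conv_of_real)
  qed
  then have "AE x in lborel. u x = U x + \<kappa>" by eventually_elim (simp add: d_def algebra_simps)
  moreover have "ac (\<lambda>x. U x + \<kappa>) v" using ac_add[OF U ac_const, of \<kappa>] by simp
  ultimately show ?thesis by blast
qed

section \<open>The Dirac operator in the eigenbasis of \<open>\<sigma>\<^sub>1\<close>\<close>

text \<open>Coordinates in the orthonormal eigenbasis (1, 1) / sqrt 2, (1, -1) / sqrt 2 of
  \<open>\<sigma>\<^sub>1\<close>, with eigenvalues 1 and -1; \<open>p1\<close> and
  \<open>p2\<close> recover them.\<close>

definition sp :: "complex \<Rightarrow> complex \<Rightarrow> complex ^ 2" where
  "sp a b = (\<chi> i. if i = 1 then (a + b) / of_real (sqrt 2) else (a - b) / of_real (sqrt 2))"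

definition p1 :: "complex ^ 2 \<Rightarrow> complex" where "p1 u = (u $ 1 + u $ 2) / of_real (sqrt 2)"
definition p2 :: "complex ^ 2 \<Rightarrow> complex" where "p2 u = (u $ 1 - u $ 2) / of_real (sqrt 2)"

lemma sqrt2_sq: "complex_of_real (sqrt 2) * complex_of_real (sqrt 2) = 2"
  by (simp flip: of_real_mult)

lemma sp_nth: "sp a b $ 1 = (a + b) / of_real (sqrt 2)" "sp a b $ 2 = (a - b) / of_real (sqrt 2)"
  by (simp_all add: sp_def)

lemma p_sp [simp]: "p1 (sp a b) = a" "p2 (sp a b) = b"
  by (simp_all add: p1_def p2_def sp_nth add_divide_distrib[symmetric] diff_divide_distrib[symmetric] sqrt2_sq)

lemma sp_p [simp]: "sp (p1 u) (p2 u) = u"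
  by (simp add: vec_eq_iff forall_2 sp_nth p1_def p2_def add_divide_distrib[symmetric] diff_divide_distrib[symmetric] sqrt2_sq)

lemma sp_inject: "sp a b = sp c d \<longleftrightarrow> a = c \<and> b = d"
  by (metis p_sp)

lemma p_eqI: "p1 u = p1 v \<Longrightarrow> p2 u = p2 v \<Longrightarrow> u = v"
  by (metis sp_p)

lemma norm_sp: "norm (sp a b) = norm (a, b)"
proof -
  have "(cmod ((a + b) / of_real (sqrt 2)))\<^sup>2 + (cmod ((a - b) / of_real (sqrt 2)))\<^sup>2 = (cmod a)\<^sup>2 + (cmod b)\<^sup>2"
  proof -
    have "(cmod (a + b))\<^sup>2 + (cmod (a - b))\<^sup>2 = 2 * ((cmod a)\<^sup>2 + (cmod b)\<^sup>2)"
      unfolding cmod_power2 by (simp add: power2_eq_square algebra_simps)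
    then show ?thesis by (simp add: norm_divide power_divide field_simps)
  qed
  then show ?thesis by (simp add: norm_vec_def L2_set_def sum_2 sp_nth norm_prod_def)
qed

lemma bounded_linear_p: "bounded_linear p1" "bounded_linear p2"
  unfolding p1_def[abs_def] p2_def[abs_def]
  by (intro bounded_linear_divide[THEN bounded_linear_compose] bounded_linear_add bounded_linear_sub bounded_linear_vec_nth)+

lemma p_scaleR:
  fixes p :: "complex ^ 2 \<Rightarrow> complex"
  assumes "bounded_linear p" shows "p (c *\<^sub>R u) = of_real c * p u"
  using linear_scale[OF bounded_linear.linear[OF assms], of c u] scaleR_conv_of_real[of c "p u"] by (rule trans)

lemma p_le_norm: "cmod (p1 u) \<le> norm u" "cmod (p2 u) \<le> norm u"
  using norm_sp[of "p1 u" "p2 u"] norm_fst_le[of "p1 u" "p2 u"] norm_snd_le[of "p2 u" "p1 u"] by auto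

lemma continuous_on_sp: "continuous_on UNIV (\<lambda>z. sp (fst z) (snd z))"
  unfolding sp_def
proof (rule continuous_on_vec_lambda)
  fix i :: 2
  show "continuous_on UNIV (\<lambda>z. if i = 1 then (fst z + snd z) / of_real (sqrt 2) else (fst z - snd z) / complex_of_real (sqrt 2))"
    by (cases "i = 1") (auto intro!: continuous_intros)
qed

lemma l2_sp:
  assumes "l2 w1" "l2 w2"
  shows "l2 (\<lambda>x. sp (w1 x) (w2 x))" "l2n (\<lambda>x. sp (w1 x) (w2 x)) = nrm w1 w2"
proof -
  have "(\<lambda>x. sp (w1 x) (w2 x)) \<in> borel_measurable borel"
    using borel_measurable_continuous_on[OF continuous_on_sp l2_meas[OF l2_Pair[OF assms]]] by simp
  then show "l2 (\<lambda>x. sp (w1 x) (w2 x))"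
    by (rule l2_bound(1)[OF l2_Pair[OF assms], where C = 1]) (simp_all add: norm_sp)
  show "l2n (\<lambda>x. sp (w1 x) (w2 x)) = nrm w1 w2" by (simp add: l2n_def nrm_def norm_sp)
qed

lemma l2_p:
  assumes "l2 u" shows "l2 (\<lambda>x. p1 (u x))" "l2 (\<lambda>x. p2 (u x))"
proof -
  have "(\<lambda>x. p1 (u x)) \<in> borel_measurable borel" "(\<lambda>x. p2 (u x)) \<in> borel_measurable borel"
    by (rule borel_measurable_continuous_on[OF linear_continuous_on[OF bounded_linear_p(1)] l2_meas[OF assms]],
        rule borel_measurable_continuous_on[OF linear_continuous_on[OF bounded_linear_p(2)] l2_meas[OF assms]])
  then show "l2 (\<lambda>x. p1 (u x))" "l2 (\<lambda>x. p2 (u x))"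
    by (simp_all add: l2_bound(1)[OF assms, where C = 1] p_le_norm)
qed

lemma L2_iff: "u \<in> L2 \<longleftrightarrow> l2 u" by (simp add: L2_def l2_def)

lemma L2_norm_eq: "L2_norm u = l2n u" by (simp add: L2_norm_def l2n_def)

lemma integrable_test_scaleR:
  fixes u :: spinor
  assumes "continuous_on UNIV \<psi>" "\<And>x. \<bar>x\<bar> > r \<Longrightarrow> \<psi> x = 0" "l2 u"
  shows "integrable lborel (\<lambda>x. \<psi> x *\<^sub>R u x)"
proof -
  have "l2 (\<lambda>x. complex_of_real (\<psi> x))"
    by (rule l2_continuous_compact[of _ r]) (use assms in \<open>auto intro!: continuous_intros\<close>)
  then have "integrable lborel (\<lambda>x. norm (complex_of_real (\<psi> x)) * norm (u x))"
    by (rule l2_mult_integrable[OF _ assms(3)])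
  then show ?thesis
    by (rule Bochner_Integration.integrable_bound)
       (use borel_measurable_continuous_onI[OF assms(1)] l2_meas[OF assms(3)] in auto)
qed

lemma is_weak_deriv_of_ac:
  assumes "ac w1 d1" "ac w2 d2" "l2 w1" "l2 w2" "l2 d1" "l2 d2"
  shows "is_weak_deriv (\<lambda>x. sp (w1 x) (w2 x)) (\<lambda>x. sp (d1 x) (d2 x))"
  unfolding is_weak_deriv_def
proof (intro allI impI)
  fix \<phi> assume t: "test_function \<phi>"
  obtain r where r: "\<And>x. \<bar>x\<bar> > r \<Longrightarrow> \<phi> x = 0 \<and> deriv \<phi> x = 0" using test_function_D(4)[OF t] by blast
  have i1: "integrable lborel (\<lambda>x. deriv \<phi> x *\<^sub>R sp (w1 x) (w2 x))"
    by (rule integrable_test_scaleR[OF test_function_D(2)[OF t] _ l2_sp(1)]) (use r assms in auto)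
  have i2: "integrable lborel (\<lambda>x. \<phi> x *\<^sub>R sp (d1 x) (d2 x))"
    by (rule integrable_test_scaleR[OF test_function_D(3)[OF t] _ l2_sp(1)]) (use r assms in auto)
  have sc: "p1 (c *\<^sub>R u) = of_real c * p1 u" "p2 (c *\<^sub>R u) = of_real c * p2 u" for c u
    by (simp_all add: p_scaleR bounded_linear_p)
  have "p1 (\<integral>x. deriv \<phi> x *\<^sub>R sp (w1 x) (w2 x) \<partial>lborel) = - p1 (\<integral>x. \<phi> x *\<^sub>R sp (d1 x) (d2 x) \<partial>lborel)"
    using integral_bounded_linear[OF bounded_linear_p(1) i1] integral_bounded_linear[OF bounded_linear_p(1) i2]
      ac_test_function(3)[OF assms(1) t] by (simp add: sc)
  moreover have "p2 (\<integral>x. deriv \<phi> x *\<^sub>R sp (w1 x) (w2 x) \<partial>lborel) = - p2 (\<integral>x. \<phi> x *\<^sub>R sp (d1 x) (d2 x) \<partial>lborel)"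
    using integral_bounded_linear[OF bounded_linear_p(2) i1] integral_bounded_linear[OF bounded_linear_p(2) i2]
      ac_test_function(3)[OF assms(2) t] by (simp add: sc)
  moreover have "p1 (- u) = - p1 u" "p2 (- u) = - p2 u" for u
    using sc[of "-1" u] by simp_all
  ultimately show "(\<integral>x. deriv \<phi> x *\<^sub>R sp (w1 x) (w2 x) \<partial>lborel) = - (\<integral>x. \<phi> x *\<^sub>R sp (d1 x) (d2 x) \<partial>lborel)"
    by (intro p_eqI) simp_all
qed

lemma weak_deriv_ac:
  assumes "l2 u" "l2 v" "is_weak_deriv u v"
  shows "\<exists>w1 w2. ac w1 (\<lambda>x. p1 (v x)) \<and> ac w2 (\<lambda>x. p2 (v x)) \<and> (AE x in lborel. u x = sp (w1 x) (w2 x))"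
proof -
  have weak: "(\<integral>x. of_real (deriv \<phi> x) * p (u x) \<partial>lborel) = - (\<integral>x. of_real (\<phi> x) * p (v x) \<partial>lborel)"
    if t: "test_function \<phi>" and p: "bounded_linear p" for \<phi> and p :: "complex ^ 2 \<Rightarrow> complex"
  proof -
    obtain r where r: "\<And>x. \<bar>x\<bar> > r \<Longrightarrow> \<phi> x = 0 \<and> deriv \<phi> x = 0" using test_function_D(4)[OF t] by blast
    have i1: "integrable lborel (\<lambda>x. deriv \<phi> x *\<^sub>R u x)"
      by (rule integrable_test_scaleR[OF test_function_D(2)[OF t] _ assms(1)]) (use r in auto)
    have i2: "integrable lborel (\<lambda>x. \<phi> x *\<^sub>R v x)"
      by (rule integrable_test_scaleR[OF test_function_D(3)[OF t] _ assms(2)]) (use r in auto)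
    have sc: "p (c *\<^sub>R u) = of_real c * p u" for c u
      by (rule p_scaleR[OF p])
    have "p (\<integral>x. deriv \<phi> x *\<^sub>R u x \<partial>lborel) = p (- (\<integral>x. \<phi> x *\<^sub>R v x \<partial>lborel))"
      using assms(3) t unfolding is_weak_deriv_def by simp
    also have "\<dots> = - p (\<integral>x. \<phi> x *\<^sub>R v x \<partial>lborel)" using sc[of "-1"] by simp
    finally show ?thesis
      using integral_bounded_linear[OF p i1] integral_bounded_linear[OF p i2] by (simp add: sc)
  qed
  obtain w1 where w1: "ac w1 (\<lambda>x. p1 (v x))" "AE x in lborel. p1 (u x) = w1 x"
    using weak_deriv_imp_ac[OF l2_p(1)[OF assms(1)] l2_p(1)[OF assms(2)] weak[OF _ bounded_linear_p(1)]] by blast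
  obtain w2 where w2: "ac w2 (\<lambda>x. p2 (v x))" "AE x in lborel. p2 (u x) = w2 x"
    using weak_deriv_imp_ac[OF l2_p(2)[OF assms(1)] l2_p(2)[OF assms(2)] weak[OF _ bounded_linear_p(2)]] by blast
  have "AE x in lborel. u x = sp (w1 x) (w2 x)"
    using w1(2) w2(2)
  proof eventually_elim
    case (elim x) then show ?case using sp_p[of "u x"] by simp
  qed
  then show ?thesis using w1(1) w2(1) by blast
qed

lemma AE_continuous_eq:
  fixes f g :: "real \<Rightarrow> complex"
  assumes "continuous_on UNIV f" "continuous_on UNIV g" "AE x in lborel. f x = g x"
  shows "f = g"
proof (rule ccontr)
  assume "f \<noteq> g"
  then obtain x0 where "f x0 \<noteq> g x0" by auto
  have o: "open {x. f x \<noteq> g x}" using assms(1,2) by (rule open_Collect_neq)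
  then obtain e where e: "e > 0" "ball x0 e \<subseteq> {x. f x \<noteq> g x}"
    using \<open>f x0 \<noteq> g x0\<close> openE by blast
  have "{x. f x \<noteq> g x} \<in> null_sets lborel"
    using assms(3) borel_open[OF o] by (simp add: AE_iff_null_sets)
  then have "emeasure lborel {x. f x \<noteq> g x} = 0" by auto
  moreover have "emeasure lborel {x0..x0 + e/2} \<le> emeasure lborel {x. f x \<noteq> g x}"
    using e borel_open[OF o] by (intro emeasure_mono) (auto simp: dist_real_def subset_iff)
  ultimately show False using e by simp
qed

text \<open>The absolutely continuous representatives agree almost everywhere, hence everywhere by
  continuity, so their derivatives have equal integrals over intervals. This makes the arbitrary
  choice in \<open>weak_deriv\<close> harmless.\<close>

lemma weak_deriv_unique:
  assumes "l2 u" "l2 v" "l2 v'" "is_weak_deriv u v" "is_weak_deriv u v'"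
  shows "AE x in lborel. v x = v' x"
proof -
  obtain w1 w2 where w: "ac w1 (\<lambda>x. p1 (v x))" "ac w2 (\<lambda>x. p2 (v x))" "AE x in lborel. u x = sp (w1 x) (w2 x)"
    using weak_deriv_ac[OF assms(1,2,4)] by blast
  obtain z1 z2 where z: "ac z1 (\<lambda>x. p1 (v' x))" "ac z2 (\<lambda>x. p2 (v' x))" "AE x in lborel. u x = sp (z1 x) (z2 x)"
    using weak_deriv_ac[OF assms(1,3,5)] by blast
  have ae: "AE x in lborel. w1 x = z1 x" "AE x in lborel. w2 x = z2 x"
    using w(3) z(3) by (eventually_elim, simp add: sp_inject)+
  have wz: "w1 = z1" "w2 = z2"
    by (intro AE_continuous_eq ac_continuous[OF w(1)] ac_continuous[OF w(2)] ac_continuous[OF z(1)] ac_continuous[OF z(2)] ae)+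
  have "AE x in lborel. p x = q x" if "ac w p" "ac w q" for w p q
  proof -
    have "AE x in lborel. p x - q x = 0"
    proof (rule AE_zero_of_integral_Icc)
      show "set_integrable lborel {x..y} (\<lambda>t. p t - q t)" for x y
        using ac_set_integrable[OF that(1)] ac_set_integrable[OF that(2)] by (rule set_integral_diff(1))
      show "x \<le> y \<Longrightarrow> (LBINT t:{x..y}. p t - q t) = 0" for x y
        using ac_unique_deriv[OF that] by (subst set_integral_diff(2)) (auto simp: ac_set_integrable[OF that(1)] ac_set_integrable[OF that(2)])
    qed
    then show ?thesis by simp
  qed
  from this[OF w(1) z(1)[folded wz]] this[OF w(2) z(2)[folded wz]]
  show ?thesis by eventually_elim (metis sp_p)
qed

lemma H1_weak_deriv:
  assumes "u \<in> H1" shows "l2 (weak_deriv u)" "is_weak_deriv u (weak_deriv u)"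
proof -
  have "\<exists>v. v \<in> L2 \<and> is_weak_deriv u v" using assms by (auto simp: H1_def)
  then have "weak_deriv u \<in> L2 \<and> is_weak_deriv u (weak_deriv u)"
    unfolding weak_deriv_def by (rule someI_ex)
  then show "l2 (weak_deriv u)" "is_weak_deriv u (weak_deriv u)" by (auto simp: L2_iff)
qed

lemma sigma_mult: "(\<sigma>\<^sub>1 *v u) $ 1 = u $ 2" "(\<sigma>\<^sub>1 *v u) $ 2 = u $ 1"
    "(\<sigma>\<^sub>3 *v u) $ 1 = u $ 1" "(\<sigma>\<^sub>3 *v u) $ 2 = - u $ 2"
  by (simp_all add: \<sigma>\<^sub>1_def \<sigma>\<^sub>3_def matrix_vector_mult_def sum_2 vector_2)

text \<open>In the eigenbasis \<open>\<sigma>\<^sub>1\<close> is diagonal and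
  \<open>\<sigma>\<^sub>3\<close> exchanges the coordinates, whence the off-diagonal mass. The
  common factor i is the reason why \<open>f\<close> corresponds to i times the data of the
  system.\<close>

lemma dirac_symbol:
  "- \<i> *s (\<sigma>\<^sub>1 *v sp d1 d2) + complex_of_real m *s (\<sigma>\<^sub>3 *v sp w1 w2)
     + (\<i> * complex_of_real (b + B)) *s sp w1 w2 - Complex a b *s sp w1 w2
   = sp (\<i> * ((of_real B + \<i> * of_real a) * w1 - \<i> * of_real m * w2 - d1))
        (\<i> * (d2 + (of_real B + \<i> * of_real a) * w2 - \<i> * of_real m * w1))"
  unfolding vec_eq_iff forall_2
  by (simp add: sigma_mult sp_nth Complex_eq add_divide_distrib diff_divide_distrib algebra_simps)

section \<open>From the system to the resolvent of the Dirac operator\<close>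

context C1_potential
begin

definition msys :: "real \<Rightarrow> real \<Rightarrow> (real \<Rightarrow> complex) \<Rightarrow> (real \<Rightarrow> complex) \<Rightarrow> (real \<Rightarrow> complex) \<Rightarrow> (real \<Rightarrow> complex) \<Rightarrow> bool" where
  "msys m a = dsys B (\<i> * of_real a) (- \<i> * of_real m) (- \<i> * of_real m)"

text \<open>Shift and coupling are moved to the data, where they are square integrable, so that
  \<open>l2_potential_mult\<close> applies with \<sigma> = 1 and \<sigma> = -1. This is what places
  solutions of the system in the operator domain.\<close>

lemma msys_l2_derivs:
  assumes "msys m a w1 w2 g1 g2" "l2 w1" "l2 w2" "l2 g1" "l2 g2"
  shows "l2 (\<lambda>x. of_real (B x) * w1 x)" "l2 (\<lambda>x. of_real (B x) * w2 x)"
    "l2 (\<lambda>x. (of_real (B x) + \<i> * of_real a) * w1 x - \<i> * of_real m * w2 x - g1 x)"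
    "l2 (\<lambda>x. g2 x - (of_real (B x) + \<i> * of_real a) * w2 x + \<i> * of_real m * w1 x)"
proof -
  have a1: "ac w1 (\<lambda>x. of_real (1 * B x) * w1 x - (g1 x - \<i> * of_real a * w1 x + \<i> * of_real m * w2 x))"
    and a2: "ac w2 (\<lambda>x. of_real ((-1) * B x) * w2 x - (- g2 x + \<i> * of_real a * w2 x - \<i> * of_real m * w1 x))"
    using assms(1) by (simp_all add: msys_def dsys_def algebra_simps)
  show B1: "l2 (\<lambda>x. of_real (B x) * w1 x)"
    by (rule l2_potential_mult[OF _ a1]) (auto intro!: l2_add l2_diff l2_scale assms)
  show B2: "l2 (\<lambda>x. of_real (B x) * w2 x)"
    by (rule l2_potential_mult[OF _ a2]) (auto intro!: l2_add l2_diff l2_scale l2_minus assms)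
  show "l2 (\<lambda>x. (of_real (B x) + \<i> * of_real a) * w1 x - \<i> * of_real m * w2 x - g1 x)"
    "l2 (\<lambda>x. g2 x - (of_real (B x) + \<i> * of_real a) * w2 x + \<i> * of_real m * w1 x)"
    unfolding distrib_right by (intro l2_add l2_diff l2_scale B1 B2 assms)+
qed

lemma solves_of_msys:
  assumes V: "\<And>x. V x = b + B x"
    and "msys m a w1 w2 g1 g2" "l2 w1" "l2 w2" "l2 g1" "l2 g2"
  shows "solves (dirac m V) (Complex a b) (\<lambda>x. sp (\<i> * g1 x) (\<i> * g2 x)) (\<lambda>x. sp (w1 x) (w2 x))"
proof -
  note D = msys_l2_derivs[OF assms(2-6)]
  define d1 where "d1 x = (of_real (B x) + \<i> * of_real a) * w1 x - \<i> * of_real m * w2 x - g1 x" for x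
  define d2 where "d2 x = g2 x - (of_real (B x) + \<i> * of_real a) * w2 x + \<i> * of_real m * w1 x" for x
  have ac: "ac w1 d1" "ac w2 d2" using assms(2) by (simp_all add: msys_def dsys_def d1_def[abs_def] d2_def[abs_def])
  have ld: "l2 d1" "l2 d2" using D(3,4) by (simp_all add: d1_def[abs_def] d2_def[abs_def])
  let ?u = "\<lambda>x. sp (w1 x) (w2 x)" and ?v = "\<lambda>x. sp (d1 x) (d2 x)"
  have lu: "l2 ?u" and lv: "l2 ?v" using l2_sp(1) assms ld by blast+
  have wd: "is_weak_deriv ?u ?v" by (rule is_weak_deriv_of_ac[OF ac assms(3,4) ld])
  have H1: "?u \<in> H1" unfolding H1_def L2_iff using lu lv wd L2_iff by blast
  have "(\<lambda>x. complex_of_real (V x) *s ?u x) = (\<lambda>x. sp (of_real b * w1 x + of_real (B x) * w1 x) (of_real b * w2 x + of_real (B x) * w2 x))"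
    by (simp add: V vec_eq_iff forall_2 sp_nth fun_eq_iff algebra_simps add_divide_distrib diff_divide_distrib)
  then have dom: "?u \<in> mult_dom V"
    unfolding mult_dom_def L2_iff using lu by (auto intro!: l2_sp(1) l2_add l2_scale D assms)
  have "AE x in lborel. weak_deriv ?u x = ?v x"
    by (rule weak_deriv_unique[OF lu H1_weak_deriv(1)[OF H1] lv H1_weak_deriv(2)[OF H1] wd])
  then have "AE x in lborel. snd (dirac m V) ?u x - Complex a b *s ?u x = sp (\<i> * g1 x) (\<i> * g2 x)"
  proof eventually_elim
    case (elim x)
    show ?case unfolding dirac_def snd_conv elim V dirac_symbol by (simp add: d1_def d2_def algebra_simps)
  qed
  then show ?thesis unfolding solves_def using H1 dom by (simp add: dirac_def)
qed

text \<open>The operator equation holds only almost everywhere. It is transferred to the continuous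
  representatives by altering the derivative in \<open>ac\<close> on a null set.\<close>

lemma msys_of_solves:
  assumes V: "\<And>x. V x = b + B x"
    and "solves (dirac m V) (Complex a b) f u" "l2 f"
  shows "\<exists>w1 w2. l2 w1 \<and> l2 w2 \<and> (AE x in lborel. u x = sp (w1 x) (w2 x)) \<and>
     msys m a w1 w2 (\<lambda>x. - \<i> * p1 (f x)) (\<lambda>x. - \<i> * p2 (f x))"
proof -
  have u: "u \<in> H1" and eq: "AE x in lborel. snd (dirac m V) u x - Complex a b *s u x = f x"
    using assms(2) by (auto simp: solves_def dirac_def)
  have lu: "l2 u" using u by (simp add: H1_def L2_iff)
  note wd = H1_weak_deriv[OF u]
  let ?v = "weak_deriv u"
  obtain w1 w2 where w: "ac w1 (\<lambda>x. p1 (?v x))" "ac w2 (\<lambda>x. p2 (?v x))" "AE x in lborel. u x = sp (w1 x) (w2 x)"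
    using weak_deriv_ac[OF lu wd] by blast
  have mw: "w1 \<in> borel_measurable borel" "w2 \<in> borel_measurable borel" using ac_meas w(1,2) by blast+
  have mf: "(\<lambda>x. p1 (f x)) \<in> borel_measurable borel" "(\<lambda>x. p2 (f x)) \<in> borel_measurable borel"
    using l2_p[OF assms(3)] l2_meas by auto
  have lw: "l2 w1" "l2 w2"
  proof -
    have "AE x in lborel. w1 x = p1 (u x)" "AE x in lborel. w2 x = p2 (u x)"
      using w(3) by (eventually_elim, simp)+
    then show "l2 w1" "l2 w2" using l2_cong_AE mw l2_p[OF lu] by blast+
  qed
  have key: "AE x in lborel. p1 (?v x) = (of_real (B x) + \<i> * of_real a) * w1 x + (- \<i> * of_real m) * w2 x - (- \<i> * p1 (f x))
     \<and> p2 (?v x) = - \<i> * p2 (f x) - (of_real (B x) + \<i> * of_real a) * w2 x - (- \<i> * of_real m) * w1 x"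
    using eq w(3)
  proof eventually_elim
    case (elim x)
    have "f x = sp (\<i> * ((of_real (B x) + \<i> * of_real a) * w1 x - \<i> * of_real m * w2 x - p1 (?v x)))
        (\<i> * (p2 (?v x) + (of_real (B x) + \<i> * of_real a) * w2 x - \<i> * of_real m * w1 x))"
      using elim(1) dirac_symbol[of "p1 (?v x)" "p2 (?v x)" m "w1 x" "w2 x" b "B x" a] elim(2)
      by (simp add: dirac_def V)
    then have e: "p1 (f x) = \<i> * ((of_real (B x) + \<i> * of_real a) * w1 x - \<i> * of_real m * w2 x - p1 (?v x))"
      "p2 (f x) = \<i> * (p2 (?v x) + (of_real (B x) + \<i> * of_real a) * w2 x - \<i> * of_real m * w1 x)"
      by simp_all
    have ii: "- \<i> * (\<i> * z) = z" for z by (simp add: mult.assoc[symmetric])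
    show ?case unfolding e ii by simp
  qed
  have "ac w1 (\<lambda>x. (of_real (B x) + \<i> * of_real a) * w1 x + (- \<i> * of_real m) * w2 x - (- \<i> * p1 (f x)))"
  proof (rule ac_cong_AE[OF w(1)])
    show "(\<lambda>x. (of_real (B x) + \<i> * of_real a) * w1 x + (- \<i> * of_real m) * w2 x - (- \<i> * p1 (f x))) \<in> borel_measurable borel"
      using mw mf by measurable
  qed (use key in eventually_elim, blast)
  moreover have "ac w2 (\<lambda>x. - \<i> * p2 (f x) - (of_real (B x) + \<i> * of_real a) * w2 x - (- \<i> * of_real m) * w1 x)"
  proof (rule ac_cong_AE[OF w(2)])
    show "(\<lambda>x. - \<i> * p2 (f x) - (of_real (B x) + \<i> * of_real a) * w2 x - (- \<i> * of_real m) * w1 x) \<in> borel_measurable borel"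
      using mw mf by measurable
  qed (use key in eventually_elim, blast)
  ultimately have "msys m a w1 w2 (\<lambda>x. - \<i> * p1 (f x)) (\<lambda>x. - \<i> * p2 (f x))"
    unfolding msys_def dsys_def by blast
  then show ?thesis using lw w(3) by blast
qed

lemma msys_diff:
  assumes "msys m a w1 w2 g1 g2" "msys m a z1 z2 g1 g2"
  shows "msys m a (\<lambda>x. w1 x - z1 x) (\<lambda>x. w2 x - z2 x) (\<lambda>x. 0) (\<lambda>x. 0)"
proof -
  have "ac (\<lambda>x. - z1 x) (\<lambda>x. (of_real (B x) + \<i> * of_real a) * (- z1 x) + (- \<i> * of_real m) * (- z2 x) - (- g1 x))"
    "ac (\<lambda>x. - z2 x) (\<lambda>x. (- g2 x) - (of_real (B x) + \<i> * of_real a) * (- z2 x) - (- \<i> * of_real m) * (- z1 x))"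
    using assms(2) ac_minus unfolding msys_def dsys_def by (force simp: algebra_simps dest: ac_minus)+
  then have "msys m a (\<lambda>x. - z1 x) (\<lambda>x. - z2 x) (\<lambda>x. - g1 x) (\<lambda>x. - g2 x)"
    unfolding msys_def dsys_def by blast
  from dsys_add[OF assms(1)[unfolded msys_def] this[unfolded msys_def]] show ?thesis
    by (simp add: msys_def)
qed

text \<open>Existence and the a priori bound control the resolvent from above, while every single
  solution of the system bounds its norm from below. Lower bounds on the resolvent norm therefore
  require just one test pair.\<close>

theorem resolvent_bounds:
  assumes V: "\<And>x. V x = b + B x"
    and surj: "dsys_surj B (\<i> * of_real a) (- \<i> * of_real m) (- \<i> * of_real m)"
    and bound: "dsys_bound B (\<i> * of_real a) (- \<i> * of_real m) (- \<i> * of_real m) C" and C: "C \<ge> 0"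
  shows "Complex a b \<in> resolvent_set (dirac m V)" "resolvent_norm m V (Complex a b) \<le> C"
    "\<And>w1 w2 g1 g2. msys m a w1 w2 g1 g2 \<Longrightarrow> l2 w1 \<Longrightarrow> l2 w2 \<Longrightarrow> l2 g1 \<Longrightarrow> l2 g2 \<Longrightarrow>
       nrm w1 w2 \<le> resolvent_norm m V (Complex a b) * nrm g1 g2"
proof -
  let ?T = "dirac m V" and ?z = "Complex a b"
  have ii: "\<i> * (- \<i> * z) = z" for z by (simp add: mult.assoc[symmetric])
  have ex: "\<exists>w1 w2. l2 w1 \<and> l2 w2 \<and> solves ?T ?z f (\<lambda>x. sp (w1 x) (w2 x)) \<and> nrm w1 w2 \<le> C * l2n f" if f: "l2 f" for f
  proof -
    have lg: "l2 (\<lambda>x. - \<i> * p1 (f x))" "l2 (\<lambda>x. - \<i> * p2 (f x))" by (intro l2_scale l2_p[OF f])+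
    obtain w1 w2 where w: "l2 w1" "l2 w2" "msys m a w1 w2 (\<lambda>x. - \<i> * p1 (f x)) (\<lambda>x. - \<i> * p2 (f x))"
      "nrm w1 w2 \<le> C * nrm (\<lambda>x. - \<i> * p1 (f x)) (\<lambda>x. - \<i> * p2 (f x))"
      using dsys_surj_solves[OF surj bound lg] unfolding msys_def by blast
    have "nrm (\<lambda>x. - \<i> * p1 (f x)) (\<lambda>x. - \<i> * p2 (f x)) = l2n (\<lambda>x. sp (- \<i> * p1 (f x)) (- \<i> * p2 (f x)))"
      using l2_sp(2)[OF lg] by simp
    also have "\<dots> = l2n f"
    proof -
      have "norm (sp (- \<i> * p1 (f x)) (- \<i> * p2 (f x))) = norm (f x)" for x
        using norm_sp[of "p1 (f x)" "p2 (f x)"] by (simp add: norm_sp norm_prod_def norm_mult)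
      then show ?thesis by (simp add: l2n_def)
    qed
    finally have "nrm w1 w2 \<le> C * l2n f" using w(4) by simp
    moreover have "solves ?T ?z f (\<lambda>x. sp (w1 x) (w2 x))"
      using solves_of_msys[OF V w(3,1,2) lg] by (simp only: ii sp_p)
    ultimately show ?thesis using w(1,2) by blast
  qed
  \<comment> \<open>The bound with zero data gives uniqueness, which identifies the function chosen
    by \<open>resolvent\<close> with the solution obtained from the system.\<close>
  have uniq: "AE x in lborel. u x = v x" if f: "l2 f" "solves ?T ?z f u" "solves ?T ?z f v" for f u v
  proof -
    obtain w1 w2 where w: "l2 w1" "l2 w2" "AE x in lborel. u x = sp (w1 x) (w2 x)"
      "msys m a w1 w2 (\<lambda>x. - \<i> * p1 (f x)) (\<lambda>x. - \<i> * p2 (f x))" using msys_of_solves[OF V f(2,1)] by blast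
    obtain y1 y2 where y: "l2 y1" "l2 y2" "AE x in lborel. v x = sp (y1 x) (y2 x)"
      "msys m a y1 y2 (\<lambda>x. - \<i> * p1 (f x)) (\<lambda>x. - \<i> * p2 (f x))" using msys_of_solves[OF V f(3,1)] by blast
    let ?d1 = "\<lambda>x. w1 x - y1 x" and ?d2 = "\<lambda>x. w2 x - y2 x"
    have l: "l2 ?d1" "l2 ?d2" by (intro l2_diff w y)+
    have l0: "l2 (\<lambda>x::real. 0::complex)" by (simp add: l2_def)
    have n0: "nrm (\<lambda>x. 0) (\<lambda>x. 0) = 0" by (simp add: nrm_def l2n_def)
    have "nrm ?d1 ?d2 \<le> C * nrm (\<lambda>x. 0) (\<lambda>x. 0)"
      using bound l l0 msys_diff[OF w(4) y(4)] unfolding dsys_bound_def msys_def by blast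
    then have n: "nrm ?d1 ?d2 = 0" using n0 nrm_nonneg[of ?d1 ?d2] by simp
    then have "l2n ?d1 = 0" "l2n ?d2 = 0" using l2n_le_nrm[OF l] l2n_nonneg[of ?d1] l2n_nonneg[of ?d2] by linarith+
    then have "AE x in lborel. ?d1 x = 0" "AE x in lborel. ?d2 x = 0" using l2n_zero_AE l by blast+
    then show ?thesis using w(3) y(3) by eventually_elim simp
  qed
  have res: "solves ?T ?z f (resolvent ?T ?z f)" if "l2 f" for f
    unfolding resolvent_def using ex[OF that] by (metis someI_ex)
  have res_l2: "l2 (resolvent ?T ?z f)" if "l2 f" for f
    using res[OF that] by (simp add: solves_def dirac_def H1_def L2_iff)
  have res_norm: "l2n (resolvent ?T ?z f) \<le> C * l2n f" if f: "l2 f" for f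
  proof -
    obtain w1 w2 where w: "l2 w1" "l2 w2" "solves ?T ?z f (\<lambda>x. sp (w1 x) (w2 x))" "nrm w1 w2 \<le> C * l2n f"
      using ex[OF f] by blast
    have "l2n (resolvent ?T ?z f) = l2n (\<lambda>x. sp (w1 x) (w2 x))"
      by (rule l2n_cong_AE[OF l2_meas[OF res_l2[OF f]] l2_meas[OF l2_sp(1)[OF w(1,2)]] uniq[OF f res[OF f] w(3)]])
    then show ?thesis using w(4) l2_sp(2)[OF w(1,2)] by simp
  qed
  show "Complex a b \<in> resolvent_set (dirac m V)"
    unfolding resolvent_set_def L2_iff mem_Collect_eq Ball_def L2_norm_eq
    using ex uniq res_norm by blast
  \<comment> \<open>For a null function f the quotient is 0 by the convention t / 0 = 0, which is
    covered by C >= 0.\<close>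
  have ratio: "l2n (resolvent ?T ?z f) / l2n f \<le> C" if "l2 f" for f
  proof (cases "l2n f = 0")
    case False
    then have "l2n f > 0" using l2n_nonneg[of f] by linarith
    then show ?thesis using res_norm[OF that] by (simp add: pos_divide_le_eq)
  qed (use C in simp)
  have l0: "l2 (\<lambda>x::real. 0::complex ^ 2)" by (simp add: l2_def)
  show "resolvent_norm m V (Complex a b) \<le> C"
    unfolding resolvent_norm_def L2_onorm_def L2_norm_eq
    by (rule cSUP_least) (use ratio l0 in \<open>auto simp: L2_iff\<close>)
  have bdd: "bdd_above ((\<lambda>f. l2n (resolvent ?T ?z f) / l2n f) ` L2)"
    using ratio by (intro bdd_aboveI2[where M = C]) (auto simp: L2_iff)
  fix w1 w2 g1 g2 assume s: "msys m a w1 w2 g1 g2" and l: "l2 w1" "l2 w2" "l2 g1" "l2 g2"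
  let ?f = "\<lambda>x. sp (\<i> * g1 x) (\<i> * g2 x)"
  have lf: "l2 ?f" by (intro l2_sp(1) l2_scale l)
  have nf: "l2n ?f = nrm g1 g2"
    unfolding nrm_def l2n_def by (simp add: norm_sp norm_prod_def norm_mult)
  have sol: "solves ?T ?z ?f (\<lambda>x. sp (w1 x) (w2 x))" by (rule solves_of_msys[OF V s l])
  have "l2n (resolvent ?T ?z ?f) = l2n (\<lambda>x. sp (w1 x) (w2 x))"
    by (rule l2n_cong_AE[OF l2_meas[OF res_l2[OF lf]] l2_meas[OF l2_sp(1)[OF l(1,2)]] uniq[OF lf res[OF lf] sol]])
  then have nw: "l2n (resolvent ?T ?z ?f) = nrm w1 w2" using l2_sp(2)[OF l(1,2)] by simp
  show "nrm w1 w2 \<le> resolvent_norm m V (Complex a b) * nrm g1 g2"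
  proof (cases "nrm g1 g2 = 0")
    case True
    then show ?thesis using res_norm[OF lf] nf nw by simp
  next
    case False
    then have p: "nrm g1 g2 > 0" using nrm_nonneg[of g1 g2] by linarith
    have "l2n (resolvent ?T ?z ?f) / l2n ?f \<le> resolvent_norm m V (Complex a b)"
      unfolding resolvent_norm_def L2_onorm_def L2_norm_eq
      by (rule cSUP_upper[OF _ bdd]) (use lf L2_iff in auto)
    then show ?thesis using p nf nw by (simp add: pos_divide_le_eq)
  qed
qed

end

section \<open>Large spectral gap\<close>

lemma integrable_mult_unimodular:
  fixes f E :: "real \<Rightarrow> complex"
  assumes "integrable lborel f" "E \<in> borel_measurable borel" "\<And>x. norm (E x) = 1"
  shows "integrable lborel (\<lambda>x. E x * f x)"
  by (rule Bochner_Integration.integrable_bound[OF assms(1)]) (use assms in \<open>auto simp: norm_mult\<close>)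

lemma l2_mult_unimodular:
  fixes f E :: "real \<Rightarrow> complex"
  assumes "E \<in> borel_measurable borel" "\<And>x. norm (E x) = 1"
  shows "l2 f \<Longrightarrow> l2 (\<lambda>x. E x * f x)" "l2n (\<lambda>x. E x * f x) = l2n f"
proof -
  show "l2n (\<lambda>x. E x * f x) = l2n f" by (simp add: l2n_def norm_mult assms(2))
  assume f: "l2 f"
  show "l2 (\<lambda>x. E x * f x)"
    by (rule l2_bound(1)[OF f, where C = 1]) (use assms l2_meas[OF f] in \<open>auto simp: norm_mult\<close>)
qed

text \<open>The phase is centred at p, the turning point in the application; the transform of
  \<open>k\<^sup>2\<close> can then be compared with a real Gaussian.\<close>

definition wave :: "real \<Rightarrow> real \<Rightarrow> real \<Rightarrow> complex" where
  "wave p s x = exp (\<i> * of_real (s * (x - p)))"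

lemma norm_wave [simp]: "norm (wave p s x) = 1"
  by (simp add: wave_def)

lemma wave_add: "wave p s x * wave p r x = wave p (s + r) x"
  by (simp add: wave_def exp_add[symmetric] algebra_simps)

lemma ac_wave: "ac (wave p s) (\<lambda>x. \<i> * of_real s * wave p s x)"
proof (rule ac_C1)
  show "(wave p s has_vector_derivative \<i> * of_real s * wave p s x) (at x)" for x
  proof -
    have "((\<lambda>x. \<i> * of_real (s * (x - p))) has_vector_derivative \<i> * of_real s) (at x)"
      by (auto intro!: derivative_eq_intros has_vector_derivative_mult_right has_vector_derivative_of_real)
    from field_vector_diff_chain_at[OF this DERIV_exp] show ?thesis
      unfolding wave_def[abs_def] by (simp add: o_def mult.commute)
  qed
  show "continuous_on UNIV (\<lambda>x. \<i> * of_real s * wave p s x)"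
    unfolding wave_def by (intro continuous_intros)
qed

lemma wave_meas [measurable]: "wave p s \<in> borel_measurable borel"
  using ac_meas[OF ac_wave] .

context wall
begin

abbreviation kc :: "real \<Rightarrow> complex" where "kc x \<equiv> of_real (k x)"

definition knorm :: real where "knorm = l2n kc"

lemma knorm_pos: "knorm > 0" unfolding knorm_def by (rule l2n_k_pos)

lemma knorm_sq: "(\<integral>x. kc x * kc x \<partial>lborel) = of_real (knorm\<^sup>2)"
  unfolding knorm_def l2n_sq integral_complex_of_real[symmetric] by (simp add: power2_eq_square)

text \<open>Fourier transform of \<open>k\<^sup>2\<close> at frequency 2 s, and the coupling of
  \<open>k\<close> to itself after the gauge transformation. The number q of the overview is
  \<open>overlap\<close>, its modulus divided by the value at s = 0.\<close>

definition osc :: "real \<Rightarrow> real \<Rightarrow> complex" where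
  "osc p s = (\<integral>x. wave p (- (2 * s)) x * (kc x * kc x) \<partial>lborel)"

definition overlap :: "real \<Rightarrow> real \<Rightarrow> real" where
  "overlap p s = cmod (osc p s) / knorm\<^sup>2"

lemma osc_bound: "cmod (osc p s) \<le> knorm\<^sup>2"
proof -
  have "cmod (osc p s) \<le> (\<integral>x. cmod (wave p (- (2 * s)) x * (kc x * kc x)) \<partial>lborel)"
    unfolding osc_def by (rule integral_norm_bound)
  also have "\<dots> = knorm\<^sup>2"
    unfolding knorm_def l2n_sq by (simp add: norm_mult power2_eq_square)
  finally show ?thesis .
qed

lemma overlap_le_1: "overlap p s \<le> 1"
  using osc_bound[of p s] knorm_pos by (simp add: overlap_def)

text \<open>The counterpart of \<open>Lm_solve\<close>: solvability forces orthogonality, because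
  \<open>k\<close> is annihilated by the formal adjoint \<open>L_+\<close>.\<close>

lemma orth_kernel:
  assumes "ac v (\<lambda>x. of_real (B x) * v x - h x)" "l2 v" "l2 h"
  shows "(\<integral>x. h x * kc x \<partial>lborel) = 0"
proof -
  have "ac kc (\<lambda>x. 0 - of_real (1 * B x) * kc x)" using ac_k by simp
  moreover have "ac v (\<lambda>x. of_real (1 * B x) * v x - h x)" using assms(1) by simp
  ultimately show ?thesis
    using ac_adjoint[of v 1 B h kc "\<lambda>x. 0"] assms l2_k by (simp add: l2_def)
qed

lemma gauge:
  assumes "msys m a w1 w2 g1 g2"
  shows "ac (\<lambda>x. wave p (-a) x * w1 x) (\<lambda>x. of_real (B x) * (wave p (-a) x * w1 x)
            - (wave p (-a) x * g1 x + \<i> * of_real m * (wave p (- (2 * a)) x * (wave p a x * w2 x))))"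
    and "ac (\<lambda>x. wave p a x * w2 x) (\<lambda>x. (wave p a x * g2 x + \<i> * of_real m * (wave p (2 * a) x * (wave p (-a) x * w1 x)))
            - of_real (B x) * (wave p a x * w2 x))"
proof -
  have w: "wave p (- (2 * a)) x * (wave p a x * z) = wave p (-a) x * z"
     "wave p (2 * a) x * (wave p (-a) x * z) = wave p a x * z" for x z
    by (simp_all add: mult.assoc[symmetric] wave_add)
  show "ac (\<lambda>x. wave p (-a) x * w1 x) (\<lambda>x. of_real (B x) * (wave p (-a) x * w1 x)
            - (wave p (-a) x * g1 x + \<i> * of_real m * (wave p (- (2 * a)) x * (wave p a x * w2 x))))"
    using ac_mult[OF ac_wave[of p "-a"], of w1] assms unfolding w msys_def dsys_def
    by (auto simp: algebra_simps dest!: ac_mult[OF ac_wave[of p "-a"], of w1])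
  show "ac (\<lambda>x. wave p a x * w2 x) (\<lambda>x. (wave p a x * g2 x + \<i> * of_real m * (wave p (2 * a) x * (wave p (-a) x * w1 x)))
            - of_real (B x) * (wave p a x * w2 x))"
    using assms unfolding w msys_def dsys_def
    by (auto simp: algebra_simps dest!: ac_mult[OF ac_wave[of p "a"], of w2])
qed

text \<open>All but the component of v2 along \<open>k\<close> is at most 1 / \<gamma> times data
  plus m times solution. The coefficient c of \<open>k\<close> is found by testing the first
  equation with \<open>k\<close>, where it appears multiplied by m and \<open>osc p a\<close>; the
  terms of order 1 / \<gamma> are absorbed at the end.\<close>

lemma dsys_bound_gap:
  assumes m: "m > 0" and q: "overlap p a > 0"
    and small: "m * ((2 + 1 / overlap p a) / \<gamma>) \<le> 1/2"
  shows "dsys_bound B (\<i> * of_real a) (- \<i> * of_real m) (- \<i> * of_real m)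
     (1 / (m * overlap p a) * (1 + 4 * (m * ((2 + 1 / overlap p a) / \<gamma>))))"
  unfolding dsys_bound_def
proof (intro allI impI)
  fix w1 w2 g1 g2 assume l: "l2 w1" "l2 w2" "l2 g1" "l2 g2"
    and "dsys B (\<i> * of_real a) (- \<i> * of_real m) (- \<i> * of_real m) w1 w2 g1 g2"
  then have s: "msys m a w1 w2 g1 g2" by (simp add: msys_def)
  define q where "q = overlap p a"
  define N where "N = nrm w1 w2"
  define G where "G = nrm g1 g2"
  define v1 where "v1 x = wave p (-a) x * w1 x" for x
  define v2 where "v2 x = wave p a x * w2 x" for x
  define h1 where "h1 x = wave p (-a) x * g1 x" for x
  define h2 where "h2 x = wave p a x * g2 x" for x
  have lv: "l2 v1" "l2 v2" "l2 h1" "l2 h2"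
    unfolding v1_def[abs_def] v2_def[abs_def] h1_def[abs_def] h2_def[abs_def]
    by (intro l2_mult_unimodular(1) l wave_meas norm_wave)+
  have nv: "l2n v1 \<le> N" "l2n v2 \<le> N" "l2n h1 \<le> G" "l2n h2 \<le> G"
    unfolding v1_def[abs_def] v2_def[abs_def] h1_def[abs_def] h2_def[abs_def] N_def G_def
    using l2n_le_nrm[OF l(1,2)] l2n_le_nrm[OF l(3,4)] by (simp_all add: l2_mult_unimodular(2))
  define H1 where "H1 x = h1 x + \<i> * of_real m * (wave p (- (2 * a)) x * v2 x)" for x
  define H2 where "H2 x = h2 x + \<i> * of_real m * (wave p (2 * a) x * v1 x)" for x
  have lH: "l2 H1" "l2 H2"
    unfolding H1_def[abs_def] H2_def[abs_def]
    by (intro l2_add l2_scale l2_mult_unimodular(1) lv wave_meas norm_wave)+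
  have nH: "l2n H1 \<le> G + m * N" "l2n H2 \<le> G + m * N"
  proof -
    have "l2n H1 \<le> l2n h1 + m * l2n v2"
      unfolding H1_def[abs_def]
      using l2n_triangle[OF lv(3) l2_scale[OF l2_mult_unimodular(1)[OF wave_meas norm_wave lv(2)], of "\<i> * of_real m" p "- (2 * a)"]] m
      by (simp add: l2n_scale l2_mult_unimodular(2) norm_mult mult.assoc)
    also have "\<dots> \<le> G + m * N" using nv m by (intro add_mono mult_left_mono) auto
    finally show "l2n H1 \<le> G + m * N" .
    have "l2n H2 \<le> l2n h2 + m * l2n v1"
      unfolding H2_def[abs_def]
      using l2n_triangle[OF lv(4) l2_scale[OF l2_mult_unimodular(1)[OF wave_meas norm_wave lv(1)], of "\<i> * of_real m" p "2 * a"]] m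
      by (simp add: l2n_scale l2_mult_unimodular(2) norm_mult mult.assoc)
    also have "\<dots> \<le> G + m * N" using nv m by (intro add_mono mult_left_mono) auto
    finally show "l2n H2 \<le> G + m * N" .
  qed
  have a1: "ac v1 (\<lambda>x. of_real (B x) * v1 x - H1 x)" and a2: "ac v2 (\<lambda>x. H2 x - of_real (B x) * v2 x)"
    using gauge[OF s, of p] by (simp_all add: v1_def[abs_def] v2_def[abs_def] H1_def h1_def H2_def h2_def)
  have g1: "\<gamma> * l2n v1 \<le> G + m * N"
  proof -
    have "\<gamma> * l2n v1 \<le> l2n H1"
      by (rule gap[of 1]) (use a1 lv lH \<gamma> gap_pos in \<open>auto simp: less_imp_le\<close>)
    then show ?thesis using nH by simp
  qed
  define c where "c = (\<integral>x. v2 x * kc x \<partial>lborel) / of_real (knorm\<^sup>2)"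
  define z where "z x = v2 x - c * kc x" for x
  have kk0: "of_real (knorm\<^sup>2) \<noteq> (0::complex)" using knorm_pos by simp
  have lz: "l2 z" unfolding z_def[abs_def] by (intro l2_diff l2_scale lv l2_k)
  have az: "ac z (\<lambda>x. H2 x - of_real (B x) * z x)"
    using ac_diff[OF a2 ac_cmult[OF ac_k, of c]] unfolding z_def[abs_def] by (simp add: algebra_simps)
  have zk: "(\<integral>x. z x * kc x \<partial>lborel) = 0"
  proof -
    have "(\<integral>x. z x * kc x \<partial>lborel) = (\<integral>x. v2 x * kc x - c * (kc x * kc x) \<partial>lborel)"
      by (simp add: z_def algebra_simps)
    also have "\<dots> = (\<integral>x. v2 x * kc x \<partial>lborel) - c * of_real (knorm\<^sup>2)"
      using l2_mult_integrable_complex[OF lv(2) l2_k] l2_mult_integrable_complex[OF l2_k l2_k] knorm_sq by simp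
    finally show ?thesis using kk0 by (simp add: c_def)
  qed
  have gz: "\<gamma> * l2n z \<le> G + m * N" using Lp_gap[OF az lz lH(2) zk] nH by simp
  have "(\<integral>x. H1 x * kc x \<partial>lborel) = 0" by (rule orth_kernel[OF a1 lv(1) lH(1)])
  moreover have "(\<integral>x. H1 x * kc x \<partial>lborel) = (\<integral>x. h1 x * kc x \<partial>lborel)
      + (\<i> * of_real m * (c * osc p a) + \<i> * of_real m * (\<integral>x. (wave p (- (2 * a)) x * z x) * kc x \<partial>lborel))"
  proof -
    have "(\<integral>x. H1 x * kc x \<partial>lborel) = (\<integral>x. h1 x * kc x + (\<i> * of_real m * (c * (wave p (- (2 * a)) x * (kc x * kc x)))
        + \<i> * of_real m * ((wave p (- (2 * a)) x * z x) * kc x)) \<partial>lborel)"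
      by (simp add: H1_def z_def algebra_simps)
    also have "\<dots> = (\<integral>x. h1 x * kc x \<partial>lborel)
      + (\<i> * of_real m * (c * osc p a) + \<i> * of_real m * (\<integral>x. (wave p (- (2 * a)) x * z x) * kc x \<partial>lborel))"
    proof -
      have i1: "integrable lborel (\<lambda>x. h1 x * kc x)" by (rule l2_mult_integrable_complex[OF lv(3) l2_k])
      have i2: "integrable lborel (\<lambda>x. wave p (- (2 * a)) x * (kc x * kc x))"
        by (rule integrable_mult_unimodular[OF l2_mult_integrable_complex[OF l2_k l2_k]]) auto
      have i3: "integrable lborel (\<lambda>x. (wave p (- (2 * a)) x * z x) * kc x)"
        by (rule l2_mult_integrable_complex[OF l2_mult_unimodular(1)[OF wave_meas norm_wave lz] l2_k])
      show ?thesis using i1 i2 i3 by (simp add: osc_def del: mult.assoc)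
    qed
    finally show ?thesis .
  qed
  ultimately have "of_real m * (c * osc p a) = \<i> * (\<integral>x. h1 x * kc x \<partial>lborel) - of_real m * (\<integral>x. (wave p (- (2 * a)) x * z x) * kc x \<partial>lborel)"
    (is "?L = \<i> * ?X - of_real m * ?Y")
  proof -
    assume e1: "(\<integral>x. H1 x * kc x \<partial>lborel) = 0"
      and e2: "(\<integral>x. H1 x * kc x \<partial>lborel) = ?X + (\<i> * of_real m * (c * osc p a) + \<i> * of_real m * ?Y)"
    have "\<i> * (?X + (\<i> * of_real m * (c * osc p a) + \<i> * of_real m * ?Y)) = 0" using e1 e2 by simp
    then show ?thesis by (simp add: algebra_simps)
  qed
  then have "cmod (of_real m * (c * osc p a)) \<le> cmod (\<i> * ?X) + cmod (of_real m * ?Y)"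
    using norm_triangle_ineq4[of "\<i> * ?X" "of_real m * ?Y"] by (simp only:)
  then have "m * (cmod c * cmod (osc p a)) \<le> cmod ?X + m * cmod ?Y" using m by (simp add: norm_mult)
  also have "cmod ?X \<le> G * knorm"
    using l2_inner_bound[OF lv(3) l2_k] mult_right_mono[OF nv(3) less_imp_le[OF knorm_pos]]
    by (simp add: knorm_def)
  also have "m * cmod ?Y \<le> m * (l2n z * knorm)"
    using l2_inner_bound[OF l2_mult_unimodular(1)[OF wave_meas norm_wave lz, of p "- (2 * a)"] l2_k] m
    by (intro mult_left_mono) (auto simp: knorm_def l2_mult_unimodular(2))
  finally have "m * (cmod c * (q * knorm\<^sup>2)) \<le> (G + m * l2n z) * knorm"
    using knorm_pos by (simp add: q_def overlap_def algebra_simps)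
  then have "(m * q * (cmod c * knorm)) * knorm \<le> (G + m * l2n z) * knorm"
    by (simp add: power2_eq_square mult_ac)
  then have cb: "m * q * (cmod c * knorm) \<le> G + m * l2n z" using knorm_pos by simp
  have q0: "q > 0" "q \<le> 1" using q overlap_le_1 by (auto simp: q_def)
  define \<tau> where "\<tau> = (G + m * N) / \<gamma>"
  have t1: "l2n v1 \<le> \<tau>" "l2n z \<le> \<tau>"
    using g1 gz \<gamma> by (auto simp: \<tau>_def pos_le_divide_eq mult.commute)
  have GN: "G \<ge> 0" "N \<ge> 0" by (simp_all add: G_def N_def)
  have t2: "cmod c * knorm \<le> G / (m * q) + \<tau> / q"
  proof -
    have "m * q * (cmod c * knorm) \<le> G + m * \<tau>" using cb t1(2) m mult_left_mono[of "l2n z" \<tau> m] by linarith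
    then have "cmod c * knorm \<le> (G + m * \<tau>) / (m * q)" using m q0 by (simp add: pos_le_divide_eq mult.commute)
    also have "\<dots> = G / (m * q) + \<tau> / q" using m q0 by (simp add: field_simps)
    finally show ?thesis .
  qed
  have "N = nrm v1 v2"
  proof -
    have "l2n v1 = l2n w1" "l2n v2 = l2n w2"
      unfolding v1_def[abs_def] v2_def[abs_def] by (intro l2_mult_unimodular(2) wave_meas norm_wave)+
    then have "N\<^sup>2 = (nrm v1 v2)\<^sup>2" unfolding N_def nrm_sq[OF l(1,2)] nrm_sq[OF lv(1,2)] by simp
    then show ?thesis by (rule power2_eq_imp_eq) (simp_all add: N_def)
  qed
  also have "\<dots> \<le> l2n v1 + l2n v2" by (rule nrm_le_add[OF lv(1,2)])
  also have "l2n v2 \<le> l2n z + cmod c * knorm"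
  proof -
    have "v2 = (\<lambda>x. z x + c * kc x)" by (simp add: z_def)
    then show ?thesis using l2n_triangle[OF lz l2_scale[OF l2_k, of c]] by (simp add: l2n_scale knorm_def)
  qed
  finally have "N \<le> \<tau> + (\<tau> + (G / (m * q) + \<tau> / q))" using t1 t2 by linarith
  also have "\<dots> = G / (m * q) + (2 + 1 / q) * \<tau>" by (simp add: algebra_simps)
  \<comment> \<open>\<tau> is counted once for v1, once for z, and with weight 1 / q through the
    coefficient of \<open>k\<close>.\<close>
  finally have N1: "N \<le> G / (m * q) + (2 + 1 / q) * \<tau>" .
  define \<delta> where "\<delta> = m * ((2 + 1 / q) / \<gamma>)"
  have \<delta>: "0 \<le> \<delta>" "\<delta> \<le> 1/2" using small m q0 \<gamma> by (auto simp: \<delta>_def q_def)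
  have "(2 + 1 / q) * \<tau> = \<delta> * (G / m) + \<delta> * N" using m \<gamma> q0 by (simp add: \<delta>_def \<tau>_def field_simps)
  then have "N * (1 - \<delta>) \<le> G / (m * q) + \<delta> * (G / m)" using N1 by (simp add: algebra_simps)
  also have "\<dots> \<le> G / (m * q) + \<delta> * (G / (m * q))"
    using q0 m GN \<delta> by (intro add_left_mono mult_left_mono) (auto simp: field_simps mult_left_le)
  also have "\<dots> = (G / (m * q)) * (1 + \<delta>)" by (simp add: algebra_simps add_divide_distrib)
  \<comment> \<open>Origin of the factor 4: (1 + \<delta>) / (1 - \<delta>) is at most 1 + 4
    \<delta> for \<delta> up to 1/2.\<close>
  also have "\<dots> \<le> (G / (m * q)) * ((1 + 4 * \<delta>) * (1 - \<delta>))"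
  proof (rule mult_left_mono)
    have "\<delta> * \<delta> \<le> 1/2 * \<delta>" using \<delta> by (intro mult_right_mono) auto
    then show "1 + \<delta> \<le> (1 + 4 * \<delta>) * (1 - \<delta>)" by (simp add: algebra_simps)
  qed (use GN m q0 in auto)
  finally have "N * (1 - \<delta>) \<le> (G / (m * q) * (1 + 4 * \<delta>)) * (1 - \<delta>)" by (simp add: mult_ac)
  then have "N \<le> G / (m * q) * (1 + 4 * \<delta>)" by (rule mult_right_le_imp_le) (use \<delta> in simp)
  then show "nrm w1 w2 \<le> 1 / (m * overlap p a) * (1 + 4 * (m * ((2 + 1 / overlap p a) / \<gamma>))) * nrm g1 g2"
    by (simp add: N_def G_def q_def \<delta>_def mult_ac)
qed

text \<open>The second component is the gauged kernel function, on which \<open>L_+\<close>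
  contributes nothing. Its coupling into the first equation is split along \<open>k\<close>: the
  orthogonal part is solved away by a v1 of order 1 / \<gamma>, and the rest, of size m times the
  overlap, remains as data.\<close>

lemma gap_test_pair:
  assumes m: "m > 0"
  shows "\<exists>w1 w2 g1 g2. msys m a w1 w2 g1 g2 \<and> l2 w1 \<and> l2 w2 \<and> l2 g1 \<and> l2 g2 \<and>
     nrm w1 w2 \<ge> knorm \<and> nrm g1 g2 \<le> m * (overlap p a + 2 * m / \<gamma>) * knorm"
proof -
  define qc where "qc = osc p a / of_real (knorm\<^sup>2)"
  have kk0: "of_real (knorm\<^sup>2) \<noteq> (0::complex)" using knorm_pos by simp
  have nq: "cmod qc = overlap p a" by (simp add: qc_def overlap_def norm_divide norm_power)
  define h where "h x = \<i> * of_real m * (wave p (- (2 * a)) x * kc x) - \<i> * of_real m * qc * kc x" for x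
  have lt: "l2 (\<lambda>x. wave p (- (2 * a)) x * kc x)" by (intro l2_mult_unimodular(1) l2_k wave_meas norm_wave)
  have lh: "l2 h" unfolding h_def[abs_def] by (intro l2_diff l2_scale lt l2_k)
  have nh: "l2n h \<le> 2 * m * knorm"
  proof -
    have "l2n h \<le> m * knorm + m * overlap p a * knorm"
      unfolding h_def[abs_def]
      using l2n_triangle_diff[OF l2_scale[OF lt, of "\<i> * of_real m"] l2_scale[OF l2_k, of "\<i> * of_real m * qc"]] m
      by (simp add: l2n_scale l2_mult_unimodular(2) norm_mult nq knorm_def del: mult.assoc)
    also have "\<dots> \<le> m * knorm + m * 1 * knorm"
      using overlap_le_1 m knorm_pos by (intro add_left_mono mult_right_mono mult_left_mono) auto
    finally show ?thesis by simp
  qed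
  have "(\<integral>x. h x * kc x \<partial>lborel) = 0"
  proof -
    have i: "integrable lborel (\<lambda>x. kc x * kc x)" by (rule l2_mult_integrable_complex[OF l2_k l2_k])
    have "(\<integral>x. h x * kc x \<partial>lborel)
      = (\<integral>x. \<i> * of_real m * (wave p (- (2 * a)) x * (kc x * kc x)) - \<i> * of_real m * qc * (kc x * kc x) \<partial>lborel)"
      by (simp add: h_def algebra_simps)
    also have "\<dots> = \<i> * of_real m * osc p a - \<i> * of_real m * qc * of_real (knorm\<^sup>2)"
      using i integrable_mult_unimodular[OF i wave_meas norm_wave, of p "- (2 * a)"] knorm_sq by (simp add: osc_def)
    finally show ?thesis using kk0 by (simp add: qc_def)
  qed
  then obtain v1 where v1: "ac v1 (\<lambda>x. of_real (B x) * v1 x - h x)" "l2 v1" using Lm_solve[OF lh] by blast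
  have "\<gamma> * l2n v1 \<le> l2n h"
    by (rule gap[of 1]) (use v1 lh \<gamma> gap_pos in \<open>auto simp: less_imp_le\<close>)
  then have nv1: "l2n v1 \<le> 2 * m / \<gamma> * knorm" using nh \<gamma> by (simp add: pos_le_divide_eq mult.commute)
  let ?w1 = "\<lambda>x. wave p a x * v1 x" and ?w2 = "\<lambda>x. wave p (-a) x * kc x"
  let ?g1 = "\<lambda>x. - \<i> * of_real m * qc * (wave p a x * kc x)" and ?g2 = "\<lambda>x. - \<i> * of_real m * (wave p a x * v1 x)"
  have w: "wave p (-a) x = wave p a x * wave p (- (a * 2)) x" for x
    by (simp add: wave_add)
  have "msys m a ?w1 ?w2 ?g1 ?g2"
    unfolding msys_def dsys_def
  proof
    have "(\<lambda>x. \<i> * of_real a * wave p a x * v1 x + wave p a x * (of_real (B x) * v1 x - h x))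
        = (\<lambda>x. (of_real (B x) + \<i> * of_real a) * ?w1 x + - \<i> * of_real m * ?w2 x - ?g1 x)"
      by (simp add: fun_eq_iff h_def w algebra_simps)
    then show "ac ?w1 (\<lambda>x. (of_real (B x) + \<i> * of_real a) * ?w1 x + - \<i> * of_real m * ?w2 x - ?g1 x)"
      using ac_mult[OF ac_wave[of p a] v1(1)] by simp
    show "ac ?w2 (\<lambda>x. ?g2 x - (of_real (B x) + \<i> * of_real a) * ?w2 x - - \<i> * of_real m * ?w1 x)"
      using ac_mult[OF ac_wave[of p "-a"] ac_k] by (simp add: algebra_simps)
  qed
  moreover have l: "l2 ?w1" "l2 ?w2" "l2 ?g1" "l2 ?g2"
    by (intro l2_scale l2_mult_unimodular(1) v1(2) l2_k wave_meas norm_wave)+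
  moreover have "nrm ?w1 ?w2 \<ge> knorm"
    using l2n_le_nrm(2)[OF l(1,2)] by (simp add: l2_mult_unimodular(2) knorm_def)
  moreover have "nrm ?g1 ?g2 \<le> m * (overlap p a + 2 * m / \<gamma>) * knorm"
  proof -
    have "nrm ?g1 ?g2 \<le> l2n ?g1 + l2n ?g2" by (rule nrm_le_add[OF l(3,4)])
    also have "\<dots> = m * overlap p a * knorm + m * l2n v1"
      unfolding l2n_scale[of "- \<i> * of_real m * qc"] l2n_scale[of "- \<i> * of_real m"]
      using m by (simp add: l2_mult_unimodular(2) norm_mult nq knorm_def)
    also have "\<dots> \<le> m * overlap p a * knorm + m * (2 * m / \<gamma> * knorm)"
      using nv1 m by (intro add_left_mono mult_left_mono) auto
    finally show ?thesis by (simp add: algebra_simps)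
  qed
  ultimately show ?thesis by blast
qed

text \<open>For linear \<open>B\<close> the transform satisfies a first-order linear equation with a
  Gaussian solution. The deviation from linear is measured by (x - p) B because the integral of (x -
  p) B \<open>k\<^sup>2\<close> is exactly half the squared norm of \<open>k\<close> for every
  \<open>B\<close>, so the pointwise bound integrates to a known number.\<close>

lemma osc_estimate:
  fixes p \<rho> \<eta> a :: real
  assumes \<rho>: "\<rho> > 0" and \<eta>: "\<eta> \<ge> 0"
    and lin: "\<And>x. \<bar>B x - \<rho> * (x - p)\<bar> \<le> \<eta> * ((x - p) * B x)"
  shows "\<bar>overlap p a - exp (- (a\<^sup>2 / \<rho>))\<bar> \<le> \<bar>a\<bar> * \<eta> / \<rho>"
proof -
  let ?kk = "\<lambda>x. kc x * kc x" and ?t = "\<lambda>x. complex_of_real (x - p)"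
  have l2t: "l2 (\<lambda>x. ?t x * kc x)"
    using l2_diff[OF l2_tk l2_scale[OF l2_k, of "of_real p"]] by (simp add: algebra_simps)
  have i0: "integrable lborel ?kk" by (rule l2_mult_integrable_complex[OF l2_k l2_k])
  have i1: "integrable lborel (\<lambda>x. ?t x * ?kk x)"
    using l2_mult_integrable_complex[OF l2t l2_k] by (simp add: mult_ac)
  have i2: "integrable lborel (\<lambda>x. ?t x * ?t x * ?kk x)"
    using l2_mult_integrable_complex[OF l2t l2t] by (simp add: mult_ac)
  have iB: "integrable lborel (\<lambda>x. of_real (B x) * ?kk x)"
    using l2_mult_integrable_complex[OF l2_Bk l2_k] by (simp add: mult_ac)
  have itB: "integrable lborel (\<lambda>x. ?t x * of_real (B x) * ?kk x)"
    using l2_mult_integrable_complex[OF l2_Bk l2t] by (simp add: mult_ac)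
  define W where "W s = wave p (- (2 * s))" for s
  have iW: "integrable lborel (\<lambda>x. W s x * f x)" if "integrable lborel f" for f s
    unfolding W_def by (rule integrable_mult_unimodular[OF that wave_meas norm_wave])
  have ac_kk: "ac ?kk (\<lambda>x. - 2 * (of_real (B x) * ?kk x))"
    using ac_mult[OF ac_k ac_k] by (simp add: algebra_simps)
  text \<open>\<open>\<integral> (W k\<^sup>2)' = 0\<close> and \<open>\<integral> (t k\<^sup>2)' = 0\<close>\<close>
  have ibp1: "(\<integral>x. W s x * (of_real (B x) * ?kk x) \<partial>lborel) = - \<i> * of_real s * osc p s" for s
  proof -
    have "ac (\<lambda>x. W s x * ?kk x) (\<lambda>x. - 2 * \<i> * of_real s * (W s x * ?kk x) - 2 * (W s x * (of_real (B x) * ?kk x)))"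
    proof -
      have "(\<lambda>x. \<i> * of_real (- (2 * s)) * wave p (- (2 * s)) x * ?kk x + wave p (- (2 * s)) x * (- 2 * (of_real (B x) * ?kk x)))
         = (\<lambda>x. - 2 * \<i> * of_real s * (W s x * ?kk x) - 2 * (W s x * (of_real (B x) * ?kk x)))"
        by (simp add: fun_eq_iff W_def)
      then show ?thesis using ac_mult[OF ac_wave[of p "- (2 * s)"] ac_kk] unfolding W_def by simp
    qed
    then have "(\<integral>x. - 2 * \<i> * of_real s * (W s x * ?kk x) - 2 * (W s x * (of_real (B x) * ?kk x)) \<partial>lborel) = 0"
      by (rule ac_integral_0) (intro Bochner_Integration.integrable_diff integrable_mult_right iW i0 iB)+
    moreover have "(\<integral>x. - 2 * \<i> * of_real s * (W s x * ?kk x) - 2 * (W s x * (of_real (B x) * ?kk x)) \<partial>lborel)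
       = (\<integral>x. - 2 * \<i> * of_real s * (W s x * ?kk x) \<partial>lborel) - (\<integral>x. 2 * (W s x * (of_real (B x) * ?kk x)) \<partial>lborel)"
      by (intro Bochner_Integration.integral_diff integrable_mult_right iW i0 iB)
    moreover have "(\<integral>x. - 2 * \<i> * of_real s * (W s x * ?kk x) \<partial>lborel) = - 2 * \<i> * of_real s * osc p s"
      unfolding osc_def W_def by (rule integral_mult_right_zero)
    moreover have "(\<integral>x. 2 * (W s x * (of_real (B x) * ?kk x)) \<partial>lborel) = 2 * (\<integral>x. W s x * (of_real (B x) * ?kk x) \<partial>lborel)"
      by (rule integral_mult_right_zero)
    ultimately have "- 2 * \<i> * of_real s * osc p s - 2 * (\<integral>x. W s x * (of_real (B x) * ?kk x) \<partial>lborel) = 0"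
      by (simp only:)
    moreover have "X = - \<i> * of_real s * Y" if "- 2 * \<i> * of_real s * Y - 2 * X = 0" for X Y :: complex
    proof -
      have "2 * (- \<i> * of_real s * Y) = 2 * X" using that by simp
      then show ?thesis by (simp only: mult_cancel_left) simp
    qed
    ultimately show ?thesis by blast
  qed
  have ibp2: "(\<integral>x. (x - p) * B x * (k x)\<^sup>2 \<partial>lborel) = knorm\<^sup>2 / 2"
  proof -
    have "((\<lambda>x. x - p) has_real_derivative 1) (at x)" for x
      by (auto intro!: derivative_eq_intros)
    then have t: "ac ?t (\<lambda>x. of_real 1)" by (rule ac_of_real) simp
    have "(\<lambda>x. of_real 1 * ?kk x + ?t x * (- 2 * (of_real (B x) * ?kk x))) = (\<lambda>x. ?kk x - 2 * (?t x * of_real (B x) * ?kk x))"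
      by (simp add: fun_eq_iff)
    with ac_mult[OF t ac_kk] have "ac (\<lambda>x. ?t x * ?kk x) (\<lambda>x. ?kk x - 2 * (?t x * of_real (B x) * ?kk x))"
      by (simp only:)
    then have "(\<integral>x. ?kk x - 2 * (?t x * of_real (B x) * ?kk x) \<partial>lborel) = 0"
      by (rule ac_integral_0) (intro Bochner_Integration.integrable_diff integrable_mult_right i0 i1 itB)+
    then have "2 * (\<integral>x. ?t x * of_real (B x) * ?kk x \<partial>lborel) = of_real (knorm\<^sup>2)"
      using i0 itB knorm_sq by simp
    moreover have "(\<integral>x. ?t x * of_real (B x) * ?kk x \<partial>lborel) = of_real (\<integral>x. (x - p) * B x * (k x)\<^sup>2 \<partial>lborel)"
      unfolding integral_complex_of_real[symmetric] by (simp add: power2_eq_square)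
    ultimately have "complex_of_real (2 * (\<integral>x. (x - p) * B x * (k x)\<^sup>2 \<partial>lborel)) = of_real (knorm\<^sup>2)" by simp
    then show ?thesis by (simp only: of_real_eq_iff)
  qed
  define I1 where "I1 s = (\<integral>x. W s x * (?t x * ?kk x) \<partial>lborel)" for s
  define M2 where "M2 = (\<integral>x. cmod (?t x * ?t x * ?kk x) \<partial>lborel)"
  \<comment> \<open>Differentiation under the integral, done by hand: |exp y - 1 - y| <= |y|^2 for
    imaginary y leaves h^2 times the second moment of \<open>k\<^sup>2\<close>.\<close>
  have expand: "cmod (osc p (s + h) - osc p s - of_real h * (- 2 * \<i> * I1 s)) \<le> 4 * h\<^sup>2 * M2" for s h
  proof -
    have eq: "osc p (s + h) - osc p s - of_real h * (- 2 * \<i> * I1 s)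
       = (\<integral>x. W (s + h) x * ?kk x - W s x * ?kk x - of_real h * (- 2 * \<i>) * (W s x * (?t x * ?kk x)) \<partial>lborel)"
    proof -
      have "(\<integral>x. W (s + h) x * ?kk x - W s x * ?kk x - of_real h * (- 2 * \<i>) * (W s x * (?t x * ?kk x)) \<partial>lborel)
        = (\<integral>x. W (s + h) x * ?kk x - W s x * ?kk x \<partial>lborel) - (\<integral>x. of_real h * (- 2 * \<i>) * (W s x * (?t x * ?kk x)) \<partial>lborel)"
        by (intro Bochner_Integration.integral_diff Bochner_Integration.integrable_diff integrable_mult_right iW i0 i1)
      also have "(\<integral>x. W (s + h) x * ?kk x - W s x * ?kk x \<partial>lborel) = osc p (s + h) - osc p s"
        unfolding osc_def W_def[symmetric] by (intro Bochner_Integration.integral_diff iW i0)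
      also have "(\<integral>x. of_real h * (- 2 * \<i>) * (W s x * (?t x * ?kk x)) \<partial>lborel) = of_real h * (- 2 * \<i>) * I1 s"
        unfolding I1_def by (rule integral_mult_right_zero)
      finally show ?thesis by (simp only: mult.assoc)
    qed
    have "cmod (\<integral>x. W (s + h) x * ?kk x - W s x * ?kk x - of_real h * (- 2 * \<i>) * (W s x * (?t x * ?kk x)) \<partial>lborel) \<le> (\<integral>x. 4 * h\<^sup>2 * cmod (?t x * ?t x * ?kk x) \<partial>lborel)"
    proof (rule Bochner_Integration.integral_norm_bound_integral)
      show "integrable lborel (\<lambda>x. W (s + h) x * ?kk x - W s x * ?kk x - of_real h * (- 2 * \<i>) * (W s x * (?t x * ?kk x)))"
        by (intro Bochner_Integration.integrable_diff integrable_mult_right iW i0 i1)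
      show "integrable lborel (\<lambda>x. 4 * h\<^sup>2 * cmod (?t x * ?t x * ?kk x))"
        by (intro integrable_mult_right integrable_norm i2)
      fix x
      define y where "y = \<i> * of_real (- (2 * h) * (x - p))"
      have "W (s + h) x = W s x * exp y"
        by (simp add: W_def wave_def y_def exp_add[symmetric] algebra_simps)
      then have "W (s + h) x * ?kk x - W s x * ?kk x - of_real h * (- 2 * \<i>) * (W s x * (?t x * ?kk x))
         = W s x * (exp y - (1 + y)) * ?kk x"
        by (simp add: y_def algebra_simps)
      also have "cmod \<dots> = cmod (exp y - (1 + y)) * cmod (?kk x)" by (simp add: norm_mult W_def)
      also have "\<dots> \<le> (cmod y)\<^sup>2 * cmod (?kk x)"
      proof (rule mult_right_mono)
        show "cmod (exp y - (1 + y)) \<le> (cmod y)\<^sup>2"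
          using Taylor_exp[of y 1] by (simp add: y_def power2_eq_square)
      qed simp
      also have "\<dots> = 4 * h\<^sup>2 * cmod (?t x * ?t x * ?kk x)"
      proof -
        have "cmod y = \<bar>- (2 * h) * (x - p)\<bar>" unfolding y_def by (simp only: norm_mult norm_ii norm_of_real mult_1)
        then have "(cmod y)\<^sup>2 = 4 * h\<^sup>2 * (x - p)\<^sup>2" by (simp add: power_mult_distrib)
        moreover have "cmod (?t x * ?t x) = (x - p)\<^sup>2"
          by (simp only: norm_mult norm_of_real abs_mult_self_eq power2_eq_square)
        moreover have "cmod (?t x * ?t x * ?kk x) = cmod (?t x * ?t x) * cmod (?kk x)" by (rule norm_mult)
        ultimately show ?thesis by (simp only: mult.assoc)
      qed
      finally show "cmod (W (s + h) x * ?kk x - W s x * ?kk x - of_real h * (- 2 * \<i>) * (W s x * (?t x * ?kk x)))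
         \<le> 4 * h\<^sup>2 * cmod (?t x * ?t x * ?kk x)" .
    qed
    also have "\<dots> = 4 * h\<^sup>2 * M2" using i2 by (simp add: M2_def)
    finally show ?thesis unfolding eq .
  qed
  have osc_deriv: "(osc p has_vector_derivative - 2 * \<i> * I1 s) (at s)" for s
    unfolding has_vector_derivative_def has_derivative_at
  proof (intro conjI bounded_linear_scaleR_left)
    show "(\<lambda>h. norm (osc p (s + h) - osc p s - h *\<^sub>R (- 2 * \<i> * I1 s)) / norm h) \<midarrow>0\<rightarrow> 0"
    proof (rule Lim_null_comparison[where g = "\<lambda>h. 4 * M2 * \<bar>h\<bar>"])
      show "\<forall>\<^sub>F h in at 0. norm (norm (osc p (s + h) - osc p s - h *\<^sub>R (- 2 * \<i> * I1 s)) / norm h) \<le> 4 * M2 * \<bar>h\<bar>"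
      proof (rule always_eventually, rule allI)
        fix h
        show "norm (norm (osc p (s + h) - osc p s - h *\<^sub>R (- 2 * \<i> * I1 s)) / norm h) \<le> 4 * M2 * \<bar>h\<bar>"
          using expand[of s h]
          by (cases "h = 0") (auto simp: scaleR_conv_of_real divide_le_eq power2_eq_square mult_ac)
      qed
      show "((\<lambda>h. 4 * M2 * \<bar>h\<bar>) \<longlongrightarrow> 0) (at 0)"
        using tendsto_mult_right_zero[OF tendsto_rabs_zero[OF tendsto_ident_at[of "0::real" UNIV]]] by simp
    qed
  qed
  define E where "E s = (\<integral>x. W s x * ((of_real (B x) - of_real \<rho> * ?t x) * ?kk x) \<partial>lborel)" for s
  have iE: "integrable lborel (\<lambda>x. (of_real (B x) - of_real \<rho> * ?t x) * ?kk x)"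
  proof -
    have "integrable lborel (\<lambda>x. of_real (B x) * ?kk x - of_real \<rho> * (?t x * ?kk x))"
      by (intro Bochner_Integration.integrable_diff integrable_mult_right iB i1)
    then show ?thesis by (simp add: algebra_simps)
  qed
  \<comment> \<open>The first moment is exchanged for the transform of \<open>B k^2\<close>, known
    from the integration by parts; \<open>E\<close> collects the deviation of \<open>B\<close> from
    its linearization.\<close>
  have E_eq: "of_real \<rho> * I1 s = - \<i> * of_real s * osc p s - E s" for s
  proof -
    have "E s = (\<integral>x. W s x * (of_real (B x) * ?kk x) - of_real \<rho> * (W s x * (?t x * ?kk x)) \<partial>lborel)"
      by (simp add: E_def algebra_simps)
    also have "\<dots> = - \<i> * of_real s * osc p s - of_real \<rho> * I1 s"
      using iW[OF iB] iW[OF i1] ibp1[of s] by (simp add: I1_def)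
    finally show ?thesis by (simp add: algebra_simps)
  qed
  have E_le: "cmod (E s) \<le> \<eta> * (knorm\<^sup>2 / 2)" for s
  proof -
    have itB': "integrable lborel (\<lambda>x. (x - p) * B x * (k x)\<^sup>2)"
      using integrable_Re[OF itB] by (simp add: power2_eq_square mult_ac)
    have "cmod (E s) \<le> (\<integral>x. \<eta> * ((x - p) * B x * (k x)\<^sup>2) \<partial>lborel)"
      unfolding E_def
    proof (rule Bochner_Integration.integral_norm_bound_integral[OF iW[OF iE] integrable_mult_right[OF itB']])
      fix x
      have "cmod (W s x * ((of_real (B x) - of_real \<rho> * ?t x) * ?kk x)) = \<bar>B x - \<rho> * (x - p)\<bar> * (k x)\<^sup>2"
      proof -
        have "of_real (B x) - of_real \<rho> * ?t x = complex_of_real (B x - \<rho> * (x - p))" by simp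
        then have "cmod (of_real (B x) - of_real \<rho> * ?t x) = \<bar>B x - \<rho> * (x - p)\<bar>" by (simp only: norm_of_real)
        then show ?thesis by (simp add: norm_mult W_def power2_eq_square del: of_real_diff)
      qed
      also have "\<dots> \<le> \<eta> * ((x - p) * B x) * (k x)\<^sup>2" using lin by (intro mult_right_mono) auto
      finally show "cmod (W s x * ((of_real (B x) - of_real \<rho> * ?t x) * ?kk x)) \<le> \<eta> * ((x - p) * B x * (k x)\<^sup>2)"
        by (simp add: mult_ac)
    qed
    also have "\<dots> = \<eta> * (knorm\<^sup>2 / 2)" using ibp2 by simp
    finally show ?thesis .
  qed
  \<comment> \<open>Integrating factor for osc' = -(2 s / \<rho>) osc + (2 i / \<rho>) E.\<close>
  define J where "J s = exp (s\<^sup>2 / \<rho>) *\<^sub>R osc p s" for s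
  have J_deriv: "(J has_vector_derivative exp (s\<^sup>2 / \<rho>) *\<^sub>R (2 * \<i> / of_real \<rho> * E s)) (at s)" for s
  proof -
    have 1: "((\<lambda>s. exp (s\<^sup>2 / \<rho>)) has_real_derivative exp (s\<^sup>2 / \<rho>) * (2 * s / \<rho>)) (at s)"
      using \<rho> by (auto intro!: derivative_eq_intros)
    have "(J has_vector_derivative (exp (s\<^sup>2 / \<rho>) *\<^sub>R (- 2 * \<i> * I1 s) + (exp (s\<^sup>2 / \<rho>) * (2 * s / \<rho>)) *\<^sub>R osc p s)) (at s)"
      unfolding J_def[abs_def] by (rule has_vector_derivative_scaleR[OF 1 osc_deriv])
    moreover have "exp (s\<^sup>2 / \<rho>) *\<^sub>R (- 2 * \<i> * I1 s) + (exp (s\<^sup>2 / \<rho>) * (2 * s / \<rho>)) *\<^sub>R osc p s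
       = exp (s\<^sup>2 / \<rho>) *\<^sub>R (2 * \<i> / of_real \<rho> * E s)"
    proof -
      have "of_real \<rho> * (- 2 * \<i> * I1 s + of_real (2 * s / \<rho>) * osc p s) = - 2 * \<i> * (of_real \<rho> * I1 s) + 2 * of_real s * osc p s"
        using \<rho> by (simp add: algebra_simps)
      also have "\<dots> = 2 * \<i> * E s" unfolding E_eq by (simp add: algebra_simps)
      also have "\<dots> = of_real \<rho> * (2 * \<i> / of_real \<rho> * E s)" using \<rho> by simp
      finally have "- 2 * \<i> * I1 s + of_real (2 * s / \<rho>) * osc p s = 2 * \<i> / of_real \<rho> * E s"
        using \<rho> by (simp only: mult_cancel_left of_real_eq_0_iff) auto
      then show ?thesis
        by (simp only: scaleR_scaleR[symmetric] scaleR_conv_of_real[of "2 * s / \<rho>"] scaleR_add_right[symmetric])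
    qed
    ultimately show ?thesis by simp
  qed
  have "norm (J a - J 0) \<le> exp (a\<^sup>2 / \<rho>) * (\<eta> * knorm\<^sup>2 / \<rho>) * norm (a - 0)"
  proof (rule differentiable_bound[of "closed_segment 0 a" J "\<lambda>s h. h *\<^sub>R (exp (s\<^sup>2 / \<rho>) *\<^sub>R (2 * \<i> / of_real \<rho> * E s))"])
    show "(J has_derivative (\<lambda>h. h *\<^sub>R (exp (s\<^sup>2 / \<rho>) *\<^sub>R (2 * \<i> / of_real \<rho> * E s)))) (at s within closed_segment 0 a)" for s
      using J_deriv[of s] unfolding has_vector_derivative_def by (rule has_derivative_at_withinI)
    fix s assume s: "s \<in> closed_segment 0 a"
    show "onorm (\<lambda>h. h *\<^sub>R (exp (s\<^sup>2 / \<rho>) *\<^sub>R (2 * \<i> / of_real \<rho> * E s))) \<le> exp (a\<^sup>2 / \<rho>) * (\<eta> * knorm\<^sup>2 / \<rho>)"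
    proof (rule onorm_bound)
      show "0 \<le> exp (a\<^sup>2 / \<rho>) * (\<eta> * knorm\<^sup>2 / \<rho>)" using \<eta> \<rho> by simp
      fix h :: real
      have "\<bar>s\<bar> \<le> \<bar>a\<bar>" using s by (auto simp: closed_segment_eq_real_ivl split: if_splits)
      then have "s\<^sup>2 / \<rho> \<le> a\<^sup>2 / \<rho>" using \<rho> by (intro divide_right_mono) (auto simp: abs_le_square_iff)
      then have "exp (s\<^sup>2 / \<rho>) * (2 / \<rho> * cmod (E s)) \<le> exp (a\<^sup>2 / \<rho>) * (2 / \<rho> * (\<eta> * (knorm\<^sup>2 / 2)))"
        using E_le[of s] \<rho> by (intro mult_mono mult_left_mono) auto
      then have "exp (s\<^sup>2 / \<rho>) * (2 / \<rho> * cmod (E s)) \<le> exp (a\<^sup>2 / \<rho>) * (\<eta> * knorm\<^sup>2 / \<rho>)"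
        by (simp add: field_simps)
      then have "(exp (s\<^sup>2 / \<rho>) * (2 / \<rho> * cmod (E s))) * norm h \<le> exp (a\<^sup>2 / \<rho>) * (\<eta> * knorm\<^sup>2 / \<rho>) * norm h"
        by (rule mult_right_mono) simp
      moreover have "norm (h *\<^sub>R (exp (s\<^sup>2 / \<rho>) *\<^sub>R (2 * \<i> / of_real \<rho> * E s))) = (exp (s\<^sup>2 / \<rho>) * (2 / \<rho> * cmod (E s))) * norm h"
        using \<rho> by (simp add: norm_mult norm_divide abs_mult)
      ultimately show "norm (h *\<^sub>R (exp (s\<^sup>2 / \<rho>) *\<^sub>R (2 * \<i> / of_real \<rho> * E s))) \<le> exp (a\<^sup>2 / \<rho>) * (\<eta> * knorm\<^sup>2 / \<rho>) * norm h"
        by simp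
    qed
  qed auto
  moreover have J0: "J 0 = of_real (knorm\<^sup>2)"
    using knorm_sq by (simp add: J_def osc_def wave_def)
  ultimately have "\<bar>cmod (J a) - knorm\<^sup>2\<bar> \<le> exp (a\<^sup>2 / \<rho>) * (\<eta> * knorm\<^sup>2 / \<rho>) * \<bar>a\<bar>"
    using norm_triangle_ineq3[of "J a" "J 0"] by (simp add: norm_power)
  moreover have "cmod (J a) = exp (a\<^sup>2 / \<rho>) * (overlap p a * knorm\<^sup>2)"
    using knorm_pos by (simp add: J_def overlap_def)
  ultimately have "\<bar>exp (a\<^sup>2 / \<rho>) * (overlap p a * knorm\<^sup>2) - knorm\<^sup>2\<bar> * exp (- (a\<^sup>2 / \<rho>))
      \<le> exp (a\<^sup>2 / \<rho>) * (\<eta> * knorm\<^sup>2 / \<rho>) * \<bar>a\<bar> * exp (- (a\<^sup>2 / \<rho>))"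
    by (intro mult_right_mono) auto
  moreover have "\<bar>exp (a\<^sup>2 / \<rho>) * (overlap p a * knorm\<^sup>2) - knorm\<^sup>2\<bar> * exp (- (a\<^sup>2 / \<rho>))
     = \<bar>overlap p a - exp (- (a\<^sup>2 / \<rho>))\<bar> * knorm\<^sup>2"
  proof -
    have "\<bar>exp (a\<^sup>2 / \<rho>) * (overlap p a * knorm\<^sup>2) - knorm\<^sup>2\<bar> * exp (- (a\<^sup>2 / \<rho>))
      = \<bar>(exp (a\<^sup>2 / \<rho>) * (overlap p a * knorm\<^sup>2) - knorm\<^sup>2) * exp (- (a\<^sup>2 / \<rho>))\<bar>"
      by (simp add: abs_mult)
    also have "(exp (a\<^sup>2 / \<rho>) * (overlap p a * knorm\<^sup>2) - knorm\<^sup>2) * exp (- (a\<^sup>2 / \<rho>)) = (overlap p a - exp (- (a\<^sup>2 / \<rho>))) * knorm\<^sup>2"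
      by (simp add: algebra_simps exp_minus_inverse)
    finally show ?thesis by (simp add: abs_mult)
  qed
  moreover have "exp (a\<^sup>2 / \<rho>) * (\<eta> * knorm\<^sup>2 / \<rho>) * \<bar>a\<bar> * exp (- (a\<^sup>2 / \<rho>)) = (\<bar>a\<bar> * \<eta> / \<rho>) * knorm\<^sup>2"
    by (simp add: exp_minus field_simps)
  ultimately have "\<bar>overlap p a - exp (- (a\<^sup>2 / \<rho>))\<bar> * knorm\<^sup>2 \<le> (\<bar>a\<bar> * \<eta> / \<rho>) * knorm\<^sup>2" by (simp only:)
  then show ?thesis by (rule mult_right_le_imp_le) (use knorm_pos in simp)
qed

end

section \<open>Spectral gap of order one\<close>

text \<open>The shift i a is counted as data of the unshifted system, whose bound is 1 / \<mu>. This
  gives an estimate as soon as \<mu> exceeds |a|.\<close>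

lemma dsys_model_base:
  assumes "dsys B (\<i> * of_real a) (- \<i> * of_real \<mu>) (- \<i> * of_real \<mu>) w1 w2 g1 g2"
    and l: "l2 w1" "l2 w2" "l2 g1" "l2 g2" and \<mu>: "\<mu> > 0"
  shows "(\<mu> - \<bar>a\<bar>) * nrm w1 w2 \<le> nrm g1 g2"
proof -
  let ?h1 = "\<lambda>x. g1 x + (- \<i> * of_real a) * w1 x" and ?h2 = "\<lambda>x. g2 x + (- \<i> * of_real a) * w2 x"
  have "dsys B 0 (- \<i> * of_real \<mu>) (- \<i> * of_real \<mu>) w1 w2 ?h1 ?h2"
    using assms(1) unfolding dsys_def by (simp add: algebra_simps)
  moreover have lh: "l2 ?h1" "l2 ?h2" by (intro l2_add l2_scale l)+
  ultimately have "nrm w1 w2 \<le> 1 / \<mu> * nrm ?h1 ?h2"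
    using dsys_bound_diag[OF \<mu>, of B] l unfolding dsys_bound_def by blast
  then have "\<mu> * nrm w1 w2 \<le> nrm ?h1 ?h2" using \<mu> by (simp add: pos_le_divide_eq mult.commute)
  also have "\<dots> \<le> nrm g1 g2 + nrm (\<lambda>x. (- \<i> * of_real a) * w1 x) (\<lambda>x. (- \<i> * of_real a) * w2 x)"
    by (intro nrm_triangle l2_scale l)
  also have "nrm (\<lambda>x. (- \<i> * of_real a) * w1 x) (\<lambda>x. (- \<i> * of_real a) * w2 x) \<le> \<bar>a\<bar> * nrm w1 w2"
    using nrm_perturbation[OF l(1,2), of "- \<i> * of_real a" 0 0] by (simp add: norm_mult)
  finally show ?thesis by (simp add: algebra_simps)
qed

text \<open>The ladder operator of the model potential \<open>\<rho> (x - p)\<close>, which raises \<open>\<mu>\<^sup>2\<close> by \<open>2 \<rho>\<close>.\<close>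

lemma dsys_ladder:
  fixes p \<rho> a \<mu> \<mu>' :: real
  defines "W \<equiv> \<lambda>x. of_real (\<rho> * (x - p)) + \<i> * complex_of_real a"
  assumes "dsys (\<lambda>x. \<rho> * (x - p)) (\<i> * of_real a) (- \<i> * of_real \<mu>) (- \<i> * of_real \<mu>) w1 w2 g1 g2"
    and \<mu>': "\<mu>' > 0" "\<mu>'\<^sup>2 = \<mu>\<^sup>2 + 2 * \<rho>"
  shows "dsys (\<lambda>x. \<rho> * (x - p)) (\<i> * of_real a) (- \<i> * of_real \<mu>') (- \<i> * of_real \<mu>')
     (\<lambda>x. (2 * W x * w1 x - \<i> * of_real \<mu> * w2 x) / (\<i> * of_real \<mu>')) w1
     (\<lambda>x. (2 * W x * g1 x + \<i> * of_real \<mu> * g2 x) / (\<i> * of_real \<mu>')) (\<lambda>x. - g1 x)"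
  unfolding dsys_def
proof
  have a1: "ac w1 (\<lambda>x. W x * w1 x - \<i> * of_real \<mu> * w2 x - g1 x)"
    and a2: "ac w2 (\<lambda>x. g2 x - W x * w2 x + \<i> * of_real \<mu> * w1 x)"
    using assms(2) by (simp_all add: dsys_def W_def)
  have "((\<lambda>x. \<rho> * (x - p)) has_real_derivative \<rho>) (at x)" for x
    by (auto intro!: derivative_eq_intros)
  then have "ac (\<lambda>x. of_real (\<rho> * (x - p))) (\<lambda>x. of_real \<rho>)" by (rule ac_of_real) simp
  from ac_add[OF this ac_const, of "\<i> * of_real a"] have aW: "ac W (\<lambda>x. of_real \<rho>)" by (simp add: W_def)
  have Wx: "of_real (\<rho> * (x - p)) + \<i> * complex_of_real a = W x" for x by (simp add: W_def)
  have nz: "complex_of_real \<mu>' \<noteq> 0" using \<mu>'(1) by simp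
  have sq: "complex_of_real \<mu>' * of_real \<mu>' = of_real \<mu> * of_real \<mu> + 2 * of_real \<rho>"
    using arg_cong[OF \<mu>'(2), of complex_of_real] by (simp add: power2_eq_square)
  \<comment> \<open>Here \<open>\<mu>'\<^sup>2 = \<mu>\<^sup>2 + 2 \<rho>\<close> enters:
    differentiating \<open>W\<close> produces 2 \<rho> w1, which joins \<open>\<mu>\<^sup>2\<close>
    w1 from the coupling.\<close>
  have idt: "(1 / (\<i> * m')) * (2 * (r * x1 + w * (w * x1 - \<i> * m0 * x2 - y1)) - \<i> * m0 * (y2 - w * x2 + \<i> * m0 * x1))
      = w * ((2 * w * x1 - \<i> * m0 * x2) / (\<i> * m')) + - \<i> * m' * x1 - (2 * w * y1 + \<i> * m0 * y2) / (\<i> * m')"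
    if "m' \<noteq> 0" "m' * m' = m0 * m0 + 2 * r" for m' m0 r w x1 x2 y1 y2 :: complex
  proof -
    have i0: "\<i> * m' \<noteq> 0" using that(1) by simp
    have "2 * (r * x1 + w * (w * x1 - \<i> * m0 * x2 - y1)) - \<i> * m0 * (y2 - w * x2 + \<i> * m0 * x1)
      = w * (2 * w * x1 - \<i> * m0 * x2) + (m0 * m0 + 2 * r) * x1 - (2 * w * y1 + \<i> * m0 * y2)"
      by (simp add: algebra_simps)
    also have "(m0 * m0 + 2 * r) * x1 = (\<i> * m') * (- \<i> * m' * x1)"
      unfolding that(2)[symmetric] by (simp add: algebra_simps)
    finally have eq: "2 * (r * x1 + w * (w * x1 - \<i> * m0 * x2 - y1)) - \<i> * m0 * (y2 - w * x2 + \<i> * m0 * x1)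
      = w * (2 * w * x1 - \<i> * m0 * x2) + (\<i> * m') * (- \<i> * m' * x1) - (2 * w * y1 + \<i> * m0 * y2)" .
    have "(1 / q) * (w * Y + q * Z - U) = w * (Y / q) + Z - U / q" if "q \<noteq> 0" for q Y Z U :: complex
      using that by (simp add: field_simps)
    from this[OF i0] show ?thesis unfolding eq .
  qed
  have "ac (\<lambda>x. (1 / (\<i> * of_real \<mu>')) * (2 * (W x * w1 x) - (\<i> * of_real \<mu>) * w2 x))
     (\<lambda>x. (1 / (\<i> * of_real \<mu>')) * (2 * (of_real \<rho> * w1 x + W x * (W x * w1 x - \<i> * of_real \<mu> * w2 x - g1 x))
         - (\<i> * of_real \<mu>) * (g2 x - W x * w2 x + \<i> * of_real \<mu> * w1 x)))"
    by (intro ac_cmult ac_diff ac_mult aW a1 a2)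
  then show "ac (\<lambda>x. (2 * W x * w1 x - \<i> * of_real \<mu> * w2 x) / (\<i> * of_real \<mu>'))
     (\<lambda>x. (of_real (\<rho> * (x - p)) + \<i> * of_real a) * ((2 * W x * w1 x - \<i> * of_real \<mu> * w2 x) / (\<i> * of_real \<mu>'))
        + - \<i> * of_real \<mu>' * w1 x - (2 * W x * g1 x + \<i> * of_real \<mu> * g2 x) / (\<i> * of_real \<mu>'))"
    unfolding idt[OF nz sq] Wx by (simp add: mult.assoc)
  have "- (\<i> * of_real \<mu>') * ((2 * W x * w1 x - \<i> * of_real \<mu> * w2 x) / (\<i> * of_real \<mu>')) = - (2 * W x * w1 x - \<i> * of_real \<mu> * w2 x)" for x
    using nz by simp
  then have "(\<lambda>x. - g1 x - (of_real (\<rho> * (x - p)) + \<i> * of_real a) * w1 x - - \<i> * of_real \<mu>' * ((2 * W x * w1 x - \<i> * of_real \<mu> * w2 x) / (\<i> * of_real \<mu>')))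
     = (\<lambda>x. W x * w1 x - \<i> * of_real \<mu> * w2 x - g1 x)"
    unfolding Wx by (simp add: fun_eq_iff)
  then show "ac w1 (\<lambda>x. - g1 x - (of_real (\<rho> * (x - p)) + \<i> * of_real a) * w1 x - - \<i> * of_real \<mu>' * ((2 * W x * w1 x - \<i> * of_real \<mu> * w2 x) / (\<i> * of_real \<mu>')))"
    using a1 by (simp only:)
qed

text \<open>A step passes from (w1, w2) at \<mu> to (w0, w1) at \<mu>', with w0 the raised
  component, and afterwards recovers w2 from w0 and w1. Both directions multiply by
  \<open>W\<close>, of size R on the support, and cost a factor c1 R each. The ladder ends at \<mu>
  >= A + 1, where \<open>dsys_model_base\<close> gives the bound 1.\<close>

lemma dsys_model_bound:
  fixes m \<rho> \<rho>2 A R p a c1 :: real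
  assumes m: "m > 0" and \<rho>: "0 < \<rho>" "\<rho> \<le> \<rho>2" and a: "\<bar>a\<bar> \<le> A" and R: "R \<ge> 1"
    and c1: "c1 = 2 * (\<rho>2 + A) / m + 2 + 2 * \<rho>2 / m\<^sup>2"
  shows "\<mu> \<ge> m \<Longrightarrow> \<mu>\<^sup>2 + 2 * \<rho> * real n \<ge> (A + 1)\<^sup>2 \<Longrightarrow>
     dsys (\<lambda>x. \<rho> * (x - p)) (\<i> * of_real a) (- \<i> * of_real \<mu>) (- \<i> * of_real \<mu>) w1 w2 g1 g2 \<Longrightarrow>
     l2 w1 \<Longrightarrow> l2 w2 \<Longrightarrow> l2 g1 \<Longrightarrow> l2 g2 \<Longrightarrow>
     (\<And>x. \<bar>x - p\<bar> > R \<Longrightarrow> w1 x = 0 \<and> w2 x = 0 \<and> g1 x = 0 \<and> g2 x = 0) \<Longrightarrow>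
     nrm w1 w2 \<le> (c1\<^sup>2 * R\<^sup>2) ^ n * nrm g1 g2"
proof (induction n arbitrary: \<mu> w1 w2 g1 g2)
  case 0
  have "A \<ge> 0" using a by linarith
  then have "A + 1 \<le> \<mu>" using 0(1,2) m by (auto intro: power2_le_imp_le[of "A + 1" \<mu>])
  then have "1 * nrm w1 w2 \<le> (\<mu> - \<bar>a\<bar>) * nrm w1 w2" using a by (intro mult_right_mono) auto
  also have "\<dots> \<le> nrm g1 g2" by (rule dsys_model_base) (use 0 m in auto)
  finally show ?case by simp
next
  case (Suc n)
  define W where "W x = of_real (\<rho> * (x - p)) + \<i> * complex_of_real a" for x
  define \<mu>' where "\<mu>' = sqrt (\<mu>\<^sup>2 + 2 * \<rho>)"
  have \<mu>: "\<mu> > 0" using Suc.prems(1) m by linarith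
  have \<mu>'sq: "\<mu>'\<^sup>2 = \<mu>\<^sup>2 + 2 * \<rho>" using \<rho> by (simp add: \<mu>'_def)
  have \<mu>'ge: "\<mu> \<le> \<mu>'" unfolding \<mu>'_def using \<rho> \<mu> by (simp add: real_le_rsqrt)
  then have \<mu>'0: "\<mu>' > 0" using \<mu> by linarith
  have A: "A \<ge> 0" using a by linarith
  have c10: "c1 \<ge> 2" using m \<rho> A by (simp add: c1)
  define w0 where "w0 x = (2 * W x * w1 x - \<i> * of_real \<mu> * w2 x) / (\<i> * of_real \<mu>')" for x
  define h where "h x = (2 * W x * g1 x + \<i> * of_real \<mu> * g2 x) / (\<i> * of_real \<mu>')" for x
  have sys: "dsys (\<lambda>x. \<rho> * (x - p)) (\<i> * of_real a) (- \<i> * of_real \<mu>') (- \<i> * of_real \<mu>') w0 w1 h (\<lambda>x. - g1 x)"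
    using dsys_ladder[OF Suc.prems(3) \<mu>'0 \<mu>'sq] by (simp add: w0_def[abs_def] h_def[abs_def] W_def)
  have Wm: "W \<in> borel_measurable borel"
    unfolding W_def[abs_def] by (intro borel_measurable_continuous_onI continuous_intros)
  have Wb: "cmod (W x) \<le> (\<rho>2 + A) * R" if "\<bar>x - p\<bar> \<le> R" for x
  proof -
    have "cmod (W x) \<le> cmod (of_real (\<rho> * (x - p))) + cmod (\<i> * of_real a)" unfolding W_def by (rule norm_triangle_ineq)
    also have "\<dots> = \<rho> * \<bar>x - p\<bar> + \<bar>a\<bar>" using \<rho> by (simp add: norm_mult abs_mult flip: of_real_diff)
    also have "\<dots> \<le> \<rho>2 * R + A * R"
      using that \<rho> a A R mult_mono[of \<rho> \<rho>2 "\<bar>x - p\<bar>" R] mult_left_mono[of 1 R A] by linarith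
    finally show ?thesis by (simp add: algebra_simps)
  qed
  have lW: "l2 (\<lambda>x. W x * f x)" "l2n (\<lambda>x. W x * f x) \<le> (\<rho>2 + A) * R * l2n f"
    if f: "l2 f" "\<And>x. \<bar>x - p\<bar> > R \<Longrightarrow> f x = 0" for f
  proof -
    have b: "cmod (W x * f x) \<le> (\<rho>2 + A) * R * cmod (f x)" for x
      using mult_right_mono[OF Wb[of x] norm_ge_zero[of "f x"]] f(2)[of x]
      by (cases "\<bar>x - p\<bar> \<le> R") (auto simp: norm_mult)
    have me: "(\<lambda>x. W x * f x) \<in> borel_measurable borel" using Wm l2_meas[OF f(1)] by simp
    have nn: "(\<rho>2 + A) * R \<ge> 0" using \<rho> A R by simp
    show "l2 (\<lambda>x. W x * f x)" by (rule l2_bound(1)[OF f(1) me b nn])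
    show "l2n (\<lambda>x. W x * f x) \<le> (\<rho>2 + A) * R * l2n f" by (rule l2_bound(2)[OF f(1) me b nn])
  qed
  have lWw: "l2 (\<lambda>x. W x * w1 x)" "l2n (\<lambda>x. W x * w1 x) \<le> (\<rho>2 + A) * R * l2n w1"
    and lWg: "l2 (\<lambda>x. W x * g1 x)" "l2n (\<lambda>x. W x * g1 x) \<le> (\<rho>2 + A) * R * l2n g1"
    using lW[OF Suc.prems(4)] lW[OF Suc.prems(6)] Suc.prems(8) by blast+
  have w0': "w0 = (\<lambda>x. (2 / (\<i> * of_real \<mu>')) * (W x * w1 x) - (of_real (\<mu> / \<mu>')) * w2 x)"
    using \<mu>'0 by (simp add: fun_eq_iff w0_def diff_divide_distrib mult.assoc)
  have h': "h = (\<lambda>x. (2 / (\<i> * of_real \<mu>')) * (W x * g1 x) + (of_real (\<mu> / \<mu>')) * g2 x)"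
    using \<mu>'0 by (simp add: fun_eq_iff h_def add_divide_distrib mult.assoc)
  have lw0: "l2 w0" unfolding w0' by (intro l2_diff l2_scale lWw Suc.prems)
  have lh: "l2 h" unfolding h' by (intro l2_add l2_scale lWg Suc.prems)
  have IH: "nrm w0 w1 \<le> (c1\<^sup>2 * R\<^sup>2) ^ n * nrm h (\<lambda>x. - g1 x)"
  proof (rule Suc.IH[OF _ _ sys])
    show "m \<le> \<mu>'" using Suc.prems(1) \<mu>'ge by linarith
    show "(A + 1)\<^sup>2 \<le> \<mu>'\<^sup>2 + 2 * \<rho> * real n" using Suc.prems(2) \<mu>'sq by (simp add: algebra_simps)
    show "w0 x = 0 \<and> w1 x = 0 \<and> h x = 0 \<and> - g1 x = 0" if "\<bar>x - p\<bar> > R" for x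
      using Suc.prems(8)[OF that] by (simp add: w0_def h_def)
  qed (use lw0 lh Suc.prems l2_minus in auto)
  have q1: "\<mu> / \<mu>' \<le> 1" "\<mu> / \<mu>' \<ge> 0" using \<mu>'ge \<mu>'0 \<mu> by (simp_all add: pos_divide_le_eq)
  have q2: "2 / \<mu>' \<le> 2 / m" "2 / \<mu> \<le> 2 / m"
    using \<mu>'ge Suc.prems(1) m \<mu> by (auto intro!: divide_left_mono mult_pos_pos)
  have S: "(\<rho>2 + A) * R \<ge> 0" using \<rho> A R by simp
  have bh: "nrm h (\<lambda>x. - g1 x) \<le> c1 * R * nrm g1 g2"
  proof -
    note lg = l2n_le_nrm[OF Suc.prems(6,7)]
    have "l2n h \<le> 2 / \<mu>' * l2n (\<lambda>x. W x * g1 x) + \<mu> / \<mu>' * l2n g2"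
    proof -
      have "cmod (2 / (\<i> * of_real \<mu>')) = 2 / \<mu>'" "cmod (of_real (\<mu> / \<mu>')) = \<mu> / \<mu>'"
        using \<mu>'0 \<mu> by (simp_all only: norm_divide norm_mult norm_of_real) auto
      then show ?thesis
        unfolding h' using l2n_triangle[OF l2_scale[OF lWg(1), of "2 / (\<i> * of_real \<mu>')"] l2_scale[OF Suc.prems(7), of "of_real (\<mu> / \<mu>')"]]
        unfolding l2n_scale by (simp only:)
    qed
    also have "\<dots> \<le> 2 / m * ((\<rho>2 + A) * R * nrm g1 g2) + 1 * nrm g1 g2"
    proof (intro add_mono mult_mono)
      show "l2n (\<lambda>x. W x * g1 x) \<le> (\<rho>2 + A) * R * nrm g1 g2"
        using lWg(2) mult_left_mono[OF lg(1) S] by (rule order_trans)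
    qed (use q1 q2 lg m in auto)
    finally have "l2n h \<le> 2 / m * ((\<rho>2 + A) * R * nrm g1 g2) + nrm g1 g2" by simp
    moreover have "nrm h (\<lambda>x. - g1 x) \<le> l2n h + l2n g1"
      using nrm_le_add[OF lh l2_minus[OF Suc.prems(6)]] by (simp add: l2n_minus)
    ultimately have "nrm h (\<lambda>x. - g1 x) \<le> 2 / m * ((\<rho>2 + A) * R * nrm g1 g2) + 2 * nrm g1 g2" using lg by simp
    also have "\<dots> = (2 * (\<rho>2 + A) / m * R + 2) * nrm g1 g2" by (simp add: algebra_simps add_divide_distrib)
    also have "\<dots> \<le> (c1 * R) * nrm g1 g2"
    proof (rule mult_right_mono)
      have "2 * R \<ge> 2" "2 * \<rho>2 / m\<^sup>2 * R \<ge> 0" using R \<rho> by auto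
      then show "2 * (\<rho>2 + A) / m * R + 2 \<le> c1 * R" unfolding c1 by (simp add: distrib_right)
    qed simp
    finally show ?thesis by simp
  qed
  have bw: "nrm w1 w2 \<le> c1 * R * nrm w0 w1"
  proof -
    note lw = l2n_le_nrm[OF lw0 Suc.prems(4)]
    have w2e: "w2 = (\<lambda>x. (2 / (\<i> * of_real \<mu>)) * (W x * w1 x) - (of_real (\<mu>' / \<mu>)) * w0 x)"
    proof
      fix x
      have "\<i> * of_real \<mu>' * w0 x = 2 * W x * w1 x - \<i> * of_real \<mu> * w2 x" using \<mu>'0 by (simp add: w0_def)
      then have "\<i> * of_real \<mu> * w2 x = 2 * W x * w1 x - \<i> * of_real \<mu>' * w0 x" by simp
      then have "w2 x = (2 * W x * w1 x - \<i> * of_real \<mu>' * w0 x) / (\<i> * of_real \<mu>)"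
        using \<mu> by (simp add: nonzero_eq_divide_eq mult.commute)
      then show "w2 x = (2 / (\<i> * of_real \<mu>)) * (W x * w1 x) - (of_real (\<mu>' / \<mu>)) * w0 x"
        using \<mu> by (simp add: diff_divide_distrib mult.assoc)
    qed
    \<comment> \<open>The quotient is at least 1, so it is bounded by its square. Together with the
      plain summands this accounts for the term \<open>2 * \<rho>2 / m\<^sup>2\<close> of
      \<open>c1\<close>.\<close>
    have q3: "\<mu>' / \<mu> \<le> 1 + 2 * \<rho>2 / m\<^sup>2"
    proof -
      have "1 + 2 * \<rho> / \<mu>\<^sup>2 \<le> 1 + 2 * \<rho>2 / m\<^sup>2"
        using \<rho> m Suc.prems(1) \<mu> by (intro add_left_mono frac_le power_mono mult_left_mono) auto
      moreover have "(\<mu>' / \<mu>)\<^sup>2 = 1 + 2 * \<rho> / \<mu>\<^sup>2" using \<mu> by (simp add: power_divide \<mu>'sq add_divide_distrib)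
      moreover have "\<mu>' / \<mu> \<le> (\<mu>' / \<mu>)\<^sup>2"
        using \<mu>'ge \<mu> mult_left_mono[of 1 "\<mu>' / \<mu>" "\<mu>' / \<mu>"] by (simp add: power2_eq_square)
      ultimately show ?thesis by linarith
    qed
    have "l2n w2 \<le> 2 / \<mu> * l2n (\<lambda>x. W x * w1 x) + \<mu>' / \<mu> * l2n w0"
    proof -
      have "cmod (2 / (\<i> * of_real \<mu>)) = 2 / \<mu>" "cmod (of_real (\<mu>' / \<mu>)) = \<mu>' / \<mu>"
        using \<mu>'0 \<mu> by (simp_all only: norm_divide norm_mult norm_of_real) auto
      then have "l2n (\<lambda>x. (2 / (\<i> * of_real \<mu>)) * (W x * w1 x) - (of_real (\<mu>' / \<mu>)) * w0 x) \<le> 2 / \<mu> * l2n (\<lambda>x. W x * w1 x) + \<mu>' / \<mu> * l2n w0"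
        using l2n_triangle_diff[OF l2_scale[OF lWw(1), of "2 / (\<i> * of_real \<mu>)"] l2_scale[OF lw0, of "of_real (\<mu>' / \<mu>)"]]
        unfolding l2n_scale by (simp only:)
      then show ?thesis using w2e by simp
    qed
    also have "\<dots> \<le> 2 / m * ((\<rho>2 + A) * R * nrm w0 w1) + (1 + 2 * \<rho>2 / m\<^sup>2) * nrm w0 w1"
    proof (rule add_mono)
      have "l2n (\<lambda>x. W x * w1 x) \<le> (\<rho>2 + A) * R * nrm w0 w1"
        using lWw(2) mult_left_mono[OF lw(2) S] by (rule order_trans)
      then show "2 / \<mu> * l2n (\<lambda>x. W x * w1 x) \<le> 2 / m * ((\<rho>2 + A) * R * nrm w0 w1)"
        using q2(2) m by (intro mult_mono) auto
      show "\<mu>' / \<mu> * l2n w0 \<le> (1 + 2 * \<rho>2 / m\<^sup>2) * nrm w0 w1"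
        using q3 lw(1) \<rho> by (intro mult_mono) auto
    qed
    finally have w2b: "l2n w2 \<le> 2 / m * ((\<rho>2 + A) * R * nrm w0 w1) + (1 + 2 * \<rho>2 / m\<^sup>2) * nrm w0 w1" .
    have "nrm w1 w2 \<le> l2n w1 + l2n w2" by (rule nrm_le_add[OF Suc.prems(4,5)])
    also have "\<dots> \<le> nrm w0 w1 + (2 / m * ((\<rho>2 + A) * R * nrm w0 w1) + (1 + 2 * \<rho>2 / m\<^sup>2) * nrm w0 w1)"
      using lw(2) w2b by (rule add_mono)
    also have "\<dots> = (2 * (\<rho>2 + A) / m * R + (2 + 2 * \<rho>2 / m\<^sup>2)) * nrm w0 w1" by (simp add: algebra_simps add_divide_distrib)
    also have "\<dots> \<le> (c1 * R) * nrm w0 w1"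
    proof (rule mult_right_mono)
      have "(2 + 2 * \<rho>2 / m\<^sup>2) * 1 \<le> (2 + 2 * \<rho>2 / m\<^sup>2) * R" using R \<rho> by (intro mult_left_mono) auto
      then show "2 * (\<rho>2 + A) / m * R + (2 + 2 * \<rho>2 / m\<^sup>2) \<le> c1 * R" unfolding c1 by (simp add: distrib_right)
    qed simp
    finally show ?thesis by simp
  qed
  have cR: "c1 * R \<ge> 0" using c10 R by simp
  have "nrm w0 w1 \<le> (c1\<^sup>2 * R\<^sup>2) ^ n * (c1 * R * nrm g1 g2)"
    using IH mult_left_mono[OF bh, of "(c1\<^sup>2 * R\<^sup>2) ^ n"] by (rule order_trans) simp
  from order_trans[OF bw mult_left_mono[OF this cR]]
  have "nrm w1 w2 \<le> c1 * R * ((c1\<^sup>2 * R\<^sup>2) ^ n * (c1 * R * nrm g1 g2))" .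
  also have "\<dots> = (c1\<^sup>2 * R\<^sup>2) ^ Suc n * nrm g1 g2" by (simp add: power2_eq_square mult_ac)
  finally show ?case .
qed

section \<open>Decay of solutions away from the turning point\<close>

definition far :: "real \<Rightarrow> real \<Rightarrow> (real \<Rightarrow> complex) \<Rightarrow> real \<Rightarrow> complex" where
  "far p r w x = (if \<bar>x - p\<bar> \<ge> r then w x else 0)"

lemma l2_far:
  assumes "l2 w" shows "l2 (far p r w)" "l2n (far p r w) \<le> l2n w"
proof -
  have "w \<in> borel_measurable borel" using l2_meas[OF assms] .
  then have m: "far p r w \<in> borel_measurable borel"
    unfolding far_def[abs_def] by measurable
  show "l2 (far p r w)" by (rule l2_bound(1)[OF assms m, where C = 1]) (auto simp: far_def)
  show "l2n (far p r w) \<le> l2n w" by (rule l2n_mono[OF assms m]) (auto simp: far_def)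
qed

lemma l2_bounded_mult:
  fixes \<psi> :: "real \<Rightarrow> real" and f :: "real \<Rightarrow> complex"
  assumes "l2 f" "continuous_on UNIV \<psi>" "\<And>x. \<bar>\<psi> x\<bar> \<le> C"
  shows "l2 (\<lambda>x. of_real (\<psi> x) * f x)" "l2n (\<lambda>x. of_real (\<psi> x) * f x) \<le> C * l2n f"
proof -
  have m: "(\<lambda>x. of_real (\<psi> x) * f x) \<in> borel_measurable borel"
    using l2_meas[OF assms(1)] borel_measurable_continuous_onI[OF assms(2)] by simp
  have b: "norm (of_real (\<psi> x) * f x) \<le> C * norm (f x)" for x
    using mult_right_mono[OF assms(3)[of x] norm_ge_zero[of "f x"]] by (simp add: norm_mult)
  have c: "C \<ge> 0" using assms(3)[of 0] by linarith
  show "l2 (\<lambda>x. of_real (\<psi> x) * f x)" by (rule l2_bound(1)[OF assms(1) m b c])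
  show "l2n (\<lambda>x. of_real (\<psi> x) * f x) \<le> C * l2n f" by (rule l2_bound(2)[OF assms(1) m b c])
qed

lemma dsys_cutoff:
  fixes \<psi> \<psi>' :: "real \<Rightarrow> real"
  assumes "dsys B \<alpha> q1 q2 w1 w2 g1 g2"
    and "\<And>x. (\<psi> has_real_derivative \<psi>' x) (at x)" "continuous_on UNIV \<psi>'"
  shows "dsys B \<alpha> q1 q2 (\<lambda>x. of_real (\<psi> x) * w1 x) (\<lambda>x. of_real (\<psi> x) * w2 x)
     (\<lambda>x. of_real (\<psi> x) * g1 x - of_real (\<psi>' x) * w1 x) (\<lambda>x. of_real (\<psi> x) * g2 x + of_real (\<psi>' x) * w2 x)"
proof -
  have a: "ac w1 (\<lambda>x. (of_real (B x) + \<alpha>) * w1 x + q1 * w2 x - g1 x)"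
    "ac w2 (\<lambda>x. g2 x - (of_real (B x) + \<alpha>) * w2 x - q2 * w1 x)"
    using assms(1) by (simp_all add: dsys_def)
  show ?thesis
    using ac_mult[OF ac_of_real[OF assms(2,3)] a(1)] ac_mult[OF ac_of_real[OF assms(2,3)] a(2)]
    unfolding dsys_def by (simp add: algebra_simps)
qed

context C1_potential
begin

text \<open>Beyond distance r both \<open>L_-\<close> and \<open>L_+\<close> are bounded below by
  \<kappa> r, because \<open>B\<^sup>2\<close> dominates \<open>B'\<close> with either sign; half of
  this absorbs m + |a|. The cutoff between r and 2 r leaves a commutator of size 12 / r that sees
  only the solution beyond r, so the previous tail returns with a factor of order r^(-2).\<close>

lemma far_step:
  assumes s: "msys m a w1 w2 g1 g2" and l: "l2 w1" "l2 w2" "l2 g1" "l2 g2"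
    and pos: "m > 0" "\<kappa> > 0" "r > 0" and big: "2 * (m + \<bar>a\<bar>) \<le> \<kappa> * r"
    and ell: "\<And>x. \<bar>x - p\<bar> \<ge> r \<Longrightarrow> (\<kappa> * r)\<^sup>2 \<le> (B x)\<^sup>2 - \<bar>B' x\<bar>"
  shows "nrm (far p (2 * r) w1) (far p (2 * r) w2)
     \<le> 4 / (\<kappa> * r) * (nrm g1 g2 + 12 / r * nrm (far p r w1) (far p r w2))"
proof -
  define \<psi> where "\<psi> x = 1 - cut ((x - p) / r)" for x
  define \<psi>' where "\<psi>' x = - (dcut ((x - p) / r) / r)" for x
  have d: "(\<psi> has_real_derivative \<psi>' x) (at x)" for x
    unfolding \<psi>_def[abs_def] \<psi>'_def using cut_scaled_deriv[of r p x] pos by (auto intro!: derivative_eq_intros)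
  have cont: "continuous_on UNIV \<psi>'" "continuous_on UNIV \<psi>"
    using d pos unfolding \<psi>'_def by (auto intro!: continuous_intros) (meson DERIV_isCont continuous_at_imp_continuous_on)
  have \<psi>b: "\<bar>\<psi> x\<bar> \<le> 1" for x using cut_nonneg[of "(x - p) / r"] cut_le_1[of "(x - p) / r"] by (simp add: \<psi>_def)
  have \<psi>'b: "\<bar>\<psi>' x\<bar> \<le> 12 / r" for x
    using abs_dcut_le[of "(x - p) / r"] pos by (simp add: \<psi>'_def divide_right_mono)
  have in0: "\<psi> x = 0 \<and> \<psi>' x = 0" if "\<bar>x - p\<bar> \<le> r" for x
    using cut_eq_1[of "(x - p) / r"] dcut_eq_0[of "(x - p) / r"] that pos by (simp add: \<psi>_def \<psi>'_def)
  have out1: "\<psi> x = 1" if "\<bar>x - p\<bar> \<ge> 2 * r" for x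
    using cut_eq_0(1)[of "(x - p) / r"] that pos by (simp add: \<psi>_def pos_le_divide_eq)
  define v1 where "v1 x = of_real (\<psi> x) * w1 x" for x
  define v2 where "v2 x = of_real (\<psi> x) * w2 x" for x
  define h1 where "h1 x = of_real (\<psi> x) * g1 x - of_real (\<psi>' x) * w1 x" for x
  define h2 where "h2 x = of_real (\<psi> x) * g2 x + of_real (\<psi>' x) * w2 x" for x
  have sv: "msys m a v1 v2 h1 h2"
    using dsys_cutoff[OF s[unfolded msys_def] d cont(1)] unfolding msys_def v1_def[abs_def] v2_def[abs_def] h1_def[abs_def] h2_def[abs_def] .
  note b1 = l2_bounded_mult[OF _ cont(2) \<psi>b] and b2 = l2_bounded_mult[OF _ cont(1) \<psi>'b]
  have lv: "l2 v1" "l2 v2" unfolding v1_def[abs_def] v2_def[abs_def] by (intro b1 l)+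
  have lh: "l2 h1" "l2 h2" unfolding h1_def[abs_def] h2_def[abs_def] by (intro l2_diff l2_add b1 b2 l)+
  define G where "G = nrm g1 g2"
  define F where "F = nrm (far p r w1) (far p r w2)"
  have tail: "l2n (\<lambda>x. of_real (\<psi>' x) * w x) \<le> 12 / r * l2n (far p r w)" if "l2 w" for w
  proof -
    have e: "of_real (\<psi>' x) * w x = of_real (\<psi>' x) * far p r w x" for x
      using in0[of x] by (auto simp: far_def)
    show ?thesis using b2(2)[OF l2_far(1)[OF that, of p r]] by (simp only: e)
  qed
  have nh: "l2n h1 \<le> G + 12 / r * F" "l2n h2 \<le> G + 12 / r * F"
  proof -
    note G = l2n_le_nrm[OF l(3,4)] and F = l2n_le_nrm[OF l2_far(1)[OF l(1)] l2_far(1)[OF l(2)], of p r p r]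
    have r0: "12 / r \<ge> 0" using pos by simp
    have "l2n h1 \<le> 1 * l2n g1 + 12 / r * l2n (far p r w1)"
      unfolding h1_def[abs_def] using l2n_triangle_diff[OF b1(1)[OF l(3)] b2(1)[OF l(1)]] b1(2)[OF l(3)] tail[OF l(1)] by linarith
    then show "l2n h1 \<le> G + 12 / r * F"
      using G(1) mult_left_mono[OF F(1) r0] unfolding G_def F_def by linarith
    have "l2n h2 \<le> 1 * l2n g2 + 12 / r * l2n (far p r w2)"
      unfolding h2_def[abs_def] using l2n_triangle[OF b1(1)[OF l(4)] b2(1)[OF l(2)]] b1(2)[OF l(4)] tail[OF l(2)] by linarith
    then show "l2n h2 \<le> G + 12 / r * F"
      using G(2) mult_left_mono[OF F(2) r0] unfolding G_def F_def by linarith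
  qed
  have kr: "\<kappa> * r > 0" using pos by simp
  have nz: "\<bar>x - p\<bar> \<ge> r" if "v1 x \<noteq> 0 \<or> v2 x \<noteq> 0" for x
    using that in0[of x] by (force simp: v1_def v2_def)
  have l1: "\<kappa> * r * l2n v1 \<le> l2n h1 + (\<bar>a\<bar> * l2n v1 + m * l2n v2)"
  proof -
    let ?e = "\<lambda>x. h1 x + ((- \<i> * of_real a) * v1 x + (\<i> * of_real m) * v2 x)"
    have "\<kappa> * r * l2n v1 \<le> l2n ?e"
    proof (rule gap[of 1])
      show "ac v1 (\<lambda>x. of_real (1 * B x) * v1 x - ?e x)"
        using sv unfolding msys_def dsys_def by (simp add: algebra_simps)
      show "(\<kappa> * r)\<^sup>2 \<le> (B x)\<^sup>2 + 1 * B' x" if "v1 x \<noteq> 0" for x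
        using ell[OF nz, of x] that by linarith
    qed (use lv lh kr in \<open>auto intro!: l2_add l2_scale l2_diff\<close>)
    also have "\<dots> \<le> l2n h1 + (l2n (\<lambda>x. (- \<i> * of_real a) * v1 x) + l2n (\<lambda>x. (\<i> * of_real m) * v2 x))"
      by (intro order_trans[OF l2n_triangle] add_left_mono order_refl l2_add l2_scale lh lv)
    finally show ?thesis unfolding l2n_scale using pos by (simp add: norm_mult)
  qed
  have l2': "\<kappa> * r * l2n v2 \<le> l2n h2 + (\<bar>a\<bar> * l2n v2 + m * l2n v1)"
  proof -
    let ?e = "\<lambda>x. - h2 x + ((\<i> * of_real a) * v2 x + (- \<i> * of_real m) * v1 x)"
    have "\<kappa> * r * l2n v2 \<le> l2n ?e"
    proof (rule gap[of "-1"])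
      show "ac v2 (\<lambda>x. of_real (-1 * B x) * v2 x - ?e x)"
        using sv unfolding msys_def dsys_def by (simp add: algebra_simps)
      show "(\<kappa> * r)\<^sup>2 \<le> (B x)\<^sup>2 + -1 * B' x" if "v2 x \<noteq> 0" for x
        using ell[OF nz, of x] that by linarith
    qed (use lv lh kr in \<open>auto intro!: l2_add l2_scale l2_diff l2_minus\<close>)
    also have "\<dots> \<le> l2n (\<lambda>x. - h2 x) + (l2n (\<lambda>x. (\<i> * of_real a) * v2 x) + l2n (\<lambda>x. (- \<i> * of_real m) * v1 x))"
      by (intro order_trans[OF l2n_triangle] add_left_mono order_refl l2_add l2_scale l2_minus lh lv)
    finally show ?thesis unfolding l2n_scale l2n_minus using pos by (simp add: norm_mult)
  qed
  define S where "S = l2n v1 + l2n v2"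
  have "\<kappa> * r * S \<le> 2 * (G + 12 / r * F) + (m + \<bar>a\<bar>) * S"
  proof -
    define T where "T = G + 12 / r * F"
    have "\<kappa> * r * S = \<kappa> * r * l2n v1 + \<kappa> * r * l2n v2" "(m + \<bar>a\<bar>) * S = \<bar>a\<bar> * l2n v1 + m * l2n v2 + (\<bar>a\<bar> * l2n v2 + m * l2n v1)"
      by (simp_all add: S_def algebra_simps)
    then show ?thesis using l1 l2' nh unfolding T_def[symmetric] by linarith
  qed
  also have "\<dots> \<le> 2 * (G + 12 / r * F) + (\<kappa> * r / 2) * S"
    using big by (intro add_left_mono mult_right_mono) (auto simp: S_def)
  finally have "\<kappa> * r * S \<le> 4 * (G + 12 / r * F)" by simp
  then have "S \<le> 4 * (G + 12 / r * F) / (\<kappa> * r)" using kr by (simp add: pos_le_divide_eq mult.commute)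
  then have S: "S \<le> 4 / (\<kappa> * r) * (G + 12 / r * F)" by simp
  have f: "l2n (far p (2 * r) w1) \<le> l2n v1" "l2n (far p (2 * r) w2) \<le> l2n v2"
    using out1 by (auto intro!: l2n_mono lv l2_meas l2_far l simp: far_def v1_def v2_def)
  have "nrm (far p (2 * r) w1) (far p (2 * r) w2) \<le> S"
    using nrm_le_add[OF l2_far(1)[OF l(1)] l2_far(1)[OF l(2)], of p "2 * r" p "2 * r"] f by (simp add: S_def)
  then show ?thesis using S by (simp add: G_def F_def)
qed

text \<open>The constants obey K' = c (1 + K), the 1 for the data and K for the previous tail; c =
  48 / \<kappa> is the product of 4 / \<kappa> and 12 from \<open>far_step\<close>. Every gain is
  estimated at the first radius r, so j doublings yield r^(-2 j).\<close>

lemma far_iterate: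
  assumes s: "msys m a w1 w2 g1 g2" and l: "l2 w1" "l2 w2" "l2 g1" "l2 g2"
    and pos: "m > 0" "\<kappa> > 0" "r \<ge> 1" and big: "2 * (m + \<bar>a\<bar>) \<le> \<kappa> * r"
    and ell: "\<And>r' x. r \<le> r' \<Longrightarrow> r' \<le> 2 ^ J * r \<Longrightarrow> \<bar>x - p\<bar> \<ge> r' \<Longrightarrow> (\<kappa> * r')\<^sup>2 \<le> (B x)\<^sup>2 - \<bar>B' x\<bar>"
    and c: "c = 48 / \<kappa>"
  shows "j \<le> J \<Longrightarrow> nrm (far p (2 ^ j * r) w1) (far p (2 ^ j * r) w2)
     \<le> rec_nat 1 (\<lambda>_ K. c * (1 + K)) j * (nrm g1 g2 + nrm w1 w2 / r ^ (2 * j))"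
proof (induction j)
  case 0
  have "nrm (far p r w1) (far p r w2) \<le> nrm w1 w2"
  proof (rule power2_le_imp_le)
    show "(nrm (far p r w1) (far p r w2))\<^sup>2 \<le> (nrm w1 w2)\<^sup>2"
      unfolding nrm_sq[OF l(1,2)] nrm_sq[OF l2_far(1)[OF l(1)] l2_far(1)[OF l(2)]]
      by (intro add_mono power_mono l2_far(2) l) auto
  qed simp
  then have "nrm (far p r w1) (far p r w2) \<le> nrm g1 g2 + nrm w1 w2" using nrm_nonneg[of g1 g2] by linarith
  then show ?case by simp
next
  case (Suc j)
  define K where "K = rec_nat 1 (\<lambda>_ K. c * (1 + K)) j"
  define G N where "G = nrm g1 g2" and "N = nrm w1 w2"
  define r' where "r' = 2 ^ j * r"
  define F where "F = nrm (far p r' w1) (far p r' w2)"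
  have c0: "c > 0" using pos c by simp
  have K0: "rec_nat 1 (\<lambda>_ K. c * (1 + K)) i \<ge> (0::real)" for i
    by (induction i) (use c0 in auto)
  have GN: "G \<ge> 0" "N \<ge> 0" "F \<ge> 0" by (simp_all add: G_def N_def F_def)
  have r': "r \<le> r'" "r' \<ge> 1" "r' \<le> 2 ^ J * r"
  proof -
    have "1 * r \<le> 2 ^ j * r" using pos by (intro mult_right_mono) auto
    then show "r \<le> r'" by (simp add: r'_def)
    then show "r' \<ge> 1" using pos by linarith
    show "r' \<le> 2 ^ J * r" unfolding r'_def using Suc.prems pos by (intro mult_right_mono power_increasing) auto
  qed
  have IH: "F \<le> K * (G + N / r ^ (2 * j))" using Suc by (simp add: F_def K_def G_def N_def r'_def)
  have big': "2 * (m + \<bar>a\<bar>) \<le> \<kappa> * r'" using big mult_left_mono[OF r'(1), of \<kappa>] pos by linarith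
  have "nrm (far p (2 * r') w1) (far p (2 * r') w2) \<le> 4 / (\<kappa> * r') * (G + 12 / r' * F)"
    unfolding G_def F_def
    by (rule far_step[OF s l pos(1,2) _ big' ell]) (use r' in auto)
  also have "\<dots> = 4 / \<kappa> * (1 / r') * G + c * (F / r'\<^sup>2)" by (simp add: c power2_eq_square algebra_simps)
  also have "\<dots> \<le> c * G + c * (F / r\<^sup>2)"
  proof (rule add_mono)
    have "4 / \<kappa> * (1 / r') \<le> c * 1" unfolding c using r' pos by (intro mult_mono divide_right_mono) auto
    then show "4 / \<kappa> * (1 / r') * G \<le> c * G" using GN by (intro mult_right_mono) auto
    show "c * (F / r'\<^sup>2) \<le> c * (F / r\<^sup>2)"
      using c0 GN r' pos by (intro mult_left_mono divide_left_mono power_mono mult_pos_pos) auto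
  qed
  also have "\<dots> \<le> c * G + c * (K * (G + N / r ^ (2 * Suc j)))"
  proof -
    have "F / r\<^sup>2 \<le> K * (G + N / r ^ (2 * j)) / r\<^sup>2" using IH by (intro divide_right_mono) auto
    also have "\<dots> = K * (G / r\<^sup>2 + N / r ^ (2 * Suc j))"
      using pos by (simp add: field_simps power2_eq_square)
    also have "\<dots> \<le> K * (G + N / r ^ (2 * Suc j))"
    proof -
      have "G / r\<^sup>2 \<le> G / 1" using pos GN by (intro divide_left_mono) auto
      then show ?thesis using K0[of j] by (intro mult_left_mono add_right_mono) (auto simp: K_def)
    qed
    finally show ?thesis using c0 by (intro add_left_mono mult_left_mono) simp_all
  qed
  also have "\<dots> \<le> c * (1 + K) * (G + N / r ^ (2 * Suc j))"
  proof -
    have "G \<le> G + N / r ^ (2 * Suc j)" using GN pos by simp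
    from mult_left_mono[OF this less_imp_le[OF c0]] show ?thesis by (simp only: distrib_right distrib_left mult.assoc mult_1_left)
  qed
  finally show ?case by (simp add: K_def G_def N_def r'_def mult.assoc)
qed

end

text \<open>Inside, the comparison with the linear model costs \<open>Q\<close>, of order r^(2 n)
  for n ladder steps; outside, n + 1 doublings gain r^(-2 (n + 1)). The surplus r^(-2) is made small
  by r. C, R and \<delta> are fixed before \<open>B\<close>, p and a, so that one bound serves all
  large b.\<close>

lemma order_one_bound:
  fixes m A \<rho>1 \<rho>2 \<kappa> rmin :: real
  assumes pos: "m > 0" "A \<ge> 0" "\<rho>1 > 0" "\<kappa> > 0"
  shows "\<exists>C>0. \<exists>R\<ge>rmin. \<exists>\<delta>>0. \<forall>B B' eps M1 \<rho> p a. C1_potential B B' eps M1 \<longrightarrow> \<rho>1 \<le> \<rho> \<longrightarrow> \<rho> \<le> \<rho>2 \<longrightarrow> \<bar>a\<bar> \<le> A \<longrightarrow>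
     (\<forall>r x. rmin \<le> r \<longrightarrow> r \<le> R \<longrightarrow> r \<le> \<bar>x - p\<bar> \<longrightarrow> (\<kappa> * r)\<^sup>2 \<le> (B x)\<^sup>2 - \<bar>B' x\<bar>) \<longrightarrow>
     (\<forall>x. \<bar>x - p\<bar> \<le> 2 * R \<longrightarrow> \<bar>B x - \<rho> * (x - p)\<bar> \<le> \<delta>) \<longrightarrow>
     dsys_bound B (\<i> * of_real a) (- \<i> * of_real m) (- \<i> * of_real m) C"
proof -
  \<comment> \<open>Number of ladder steps that raise the mass to at least A + 1 even at the
    smallest slope \<rho>1.\<close>
  obtain n :: nat where n: "(A + 1)\<^sup>2 / (2 * \<rho>1) \<le> real n" using real_arch_simple by blast
  define J where "J = Suc n"
  define \<rho>2' where "\<rho>2' = max \<rho>2 \<rho>1"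
  define c1 where "c1 = 2 * (\<rho>2' + A) / m + 2 + 2 * \<rho>2' / m\<^sup>2"
  define c where "c = 48 / \<kappa>"
  define K where "K = rec_nat 1 (\<lambda>_ K. c * (1 + K)) J"
  define E where "E = (c1\<^sup>2 * (2 * 2 ^ J)\<^sup>2) ^ n"
  have c0: "c > 0" using pos by (simp add: c_def)
  have K0: "K > 0" unfolding K_def J_def using c0 by (induction n) auto
  have "c1 \<ge> 2" using pos by (simp add: c1_def \<rho>2'_def)
  then have E0: "E > 0" by (simp add: E_def)
  \<comment> \<open>The entries provide, in turn, r >= 1, r >= rmin, the absorption of m + A in
    \<open>far_step\<close>, and the inequality \<open>small\<close>, in which the powers r^(2 n)
    and r^(2 J) leave r^(-2).\<close>
  define r where "r = max (max 1 rmin) (max (2 * (m + A) / \<kappa>) (4 * (24 * E + 1) * K))"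
  have r: "r \<ge> 1" "r \<ge> rmin" "2 * (m + A) \<le> \<kappa> * r" "4 * (24 * E + 1) * K \<le> r"
  proof -
    have "2 * (m + A) / \<kappa> \<le> r" by (simp add: r_def)
    then show "2 * (m + A) \<le> \<kappa> * r" using pos by (simp add: pos_divide_le_eq mult.commute)
  qed (auto simp: r_def)
  define R where "R = 2 ^ J * r"
  have R1: "r \<le> R" using r mult_right_mono[of 1 "2 ^ J" r] by (simp add: R_def)
  define Q where "Q = (c1\<^sup>2 * (2 * R)\<^sup>2) ^ n"
  have QE: "Q = E * r ^ (2 * n)"
    by (simp add: Q_def E_def R_def power_mult_distrib power_mult[symmetric] mult_ac)
  have Q0: "Q > 0" using QE E0 r by simp
  \<comment> \<open>Chosen so that the deviation from the linear model contributes 2 Q \<delta> N =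
    N / 4. With another N / 4 from \<open>small\<close>, half of N is absorbed, hence the leading 2
    in \<open>C\<close>.\<close>
  define \<delta> where "\<delta> = 1 / (8 * Q)"
  define C where "C = 2 * ((24 * Q + 1) * K + 2 * Q)"
  have C0: "C > 0" using Q0 K0 by (simp add: C_def add_pos_pos)
  have small: "(24 * Q + 1) * (K * (1 / r ^ (2 * J))) \<le> 1 / 4"
  proof -
    have "24 * Q + 1 \<le> (24 * E + 1) * r ^ (2 * n)"
      using r by (simp add: QE distrib_right one_le_power)
    then have "(24 * Q + 1) * (K * (1 / r ^ (2 * J))) \<le> ((24 * E + 1) * r ^ (2 * n)) * (K * (1 / r ^ (2 * J)))"
      using K0 r by (intro mult_right_mono) auto
    also have "\<dots> = (24 * E + 1) * K / r\<^sup>2" using r by (simp add: J_def power_add power2_eq_square field_simps)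
    also have "\<dots> \<le> 1 / 4"
    proof -
      have "4 * (24 * E + 1) * K \<le> r * r" using r mult_left_mono[of 1 r r] by linarith
      then show ?thesis using r by (simp add: divide_le_eq power2_eq_square algebra_simps)
    qed
    finally show ?thesis .
  qed
  have main: "dsys_bound B (\<i> * of_real a) (- \<i> * of_real m) (- \<i> * of_real m) C"
    if pot: "C1_potential B B' eps M1" and \<rho>: "\<rho>1 \<le> \<rho>" "\<rho> \<le> \<rho>2" and a: "\<bar>a\<bar> \<le> A"
      and ell: "\<And>r x. rmin \<le> r \<Longrightarrow> r \<le> R \<Longrightarrow> r \<le> \<bar>x - p\<bar> \<Longrightarrow> (\<kappa> * r)\<^sup>2 \<le> (B x)\<^sup>2 - \<bar>B' x\<bar>"
      and near: "\<And>x. \<bar>x - p\<bar> \<le> 2 * R \<Longrightarrow> \<bar>B x - \<rho> * (x - p)\<bar> \<le> \<delta>" for B B' eps M1 \<rho> p a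
    unfolding dsys_bound_def
  proof (intro allI impI)
    interpret C1_potential B B' eps M1 by (rule pot)
    fix w1 w2 g1 g2 assume l: "l2 w1" "l2 w2" "l2 g1" "l2 g2"
      and s0: "dsys B (\<i> * of_real a) (- \<i> * of_real m) (- \<i> * of_real m) w1 w2 g1 g2"
    then have s: "msys m a w1 w2 g1 g2" by (simp add: msys_def)
    define G N where "G = nrm g1 g2" and "N = nrm w1 w2"
    define F where "F = nrm (far p R w1) (far p R w2)"
    have F: "F \<le> K * (G + N / r ^ (2 * J))"
      unfolding F_def K_def G_def N_def R_def
    proof (rule far_iterate[OF s l pos(1) pos(4) r(1) _ _ c_def order_refl])
      show "2 * (m + \<bar>a\<bar>) \<le> \<kappa> * r" using order_trans[OF _ r(3), of "2 * (m + \<bar>a\<bar>)"] a by simp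
      show "(\<kappa> * r')\<^sup>2 \<le> (B x)\<^sup>2 - \<bar>B' x\<bar>" if "r \<le> r'" "r' \<le> 2 ^ J * r" "r' \<le> \<bar>x - p\<bar>" for r' x
        using ell[of r' x] that r(2) by (simp add: R_def)
    qed
    define \<psi> where "\<psi> x = cut ((x - p) / R)" for x
    define \<psi>' where "\<psi>' x = dcut ((x - p) / R) / R" for x
    have R0: "R > 0" using R1 r by linarith
    have d: "(\<psi> has_real_derivative \<psi>' x) (at x)" for x
      unfolding \<psi>_def[abs_def] \<psi>'_def using cut_scaled_deriv[of R p x] R0 by simp
    have cont: "continuous_on UNIV \<psi>'" "continuous_on UNIV \<psi>"
      using d R0 unfolding \<psi>'_def by (auto intro!: continuous_intros) (meson DERIV_isCont continuous_at_imp_continuous_on)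
    have \<psi>b: "\<bar>\<psi> x\<bar> \<le> 1" for x using cut_nonneg[of "(x - p) / R"] cut_le_1[of "(x - p) / R"] by (simp add: \<psi>_def)
    have \<psi>'b: "\<bar>\<psi>' x\<bar> \<le> 12" for x
    proof -
      have "\<bar>\<psi>' x\<bar> \<le> 12 / R"
        using abs_dcut_le[of "(x - p) / R"] R0 by (simp add: \<psi>'_def divide_right_mono)
      also have "\<dots> \<le> 12 / 1" using R1 r by (intro divide_left_mono) auto
      finally show ?thesis by simp
    qed
    have in1: "\<psi> x = 1 \<and> \<psi>' x = 0" if "\<bar>x - p\<bar> \<le> R" for x
      using cut_eq_1[of "(x - p) / R"] dcut_eq_0[of "(x - p) / R"] that R0 by (simp add: \<psi>_def \<psi>'_def)
    have out0: "\<psi> x = 0 \<and> \<psi>' x = 0" if "\<bar>x - p\<bar> \<ge> 2 * R" for x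
      using cut_eq_0[of "(x - p) / R"] that R0 by (simp add: \<psi>_def \<psi>'_def pos_le_divide_eq)
    define \<beta> where "\<beta> x = B x - \<rho> * (x - p)" for x
    define u1 where "u1 x = of_real (\<psi> x) * w1 x" for x
    define u2 where "u2 x = of_real (\<psi> x) * w2 x" for x
    define h1 where "h1 x = of_real (\<psi> x) * g1 x - of_real (\<psi>' x) * w1 x" for x
    define h2 where "h2 x = of_real (\<psi> x) * g2 x + of_real (\<psi>' x) * w2 x" for x
    have su: "dsys B (\<i> * of_real a) (- \<i> * of_real m) (- \<i> * of_real m) u1 u2 h1 h2"
      using dsys_cutoff[OF s0 d cont(1)] unfolding u1_def[abs_def] u2_def[abs_def] h1_def[abs_def] h2_def[abs_def] .
    \<comment> \<open>The deviation \<beta> from the linear potential is moved to the data; it is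
      multiplied by \<psi>, and on the support of \<psi> it is at most \<delta>.\<close>
    define k1 where "k1 x = h1 x - of_real (\<beta> x) * u1 x" for x
    define k2 where "k2 x = h2 x - of_real (\<beta> x) * u2 x" for x
    have sm: "dsys (\<lambda>x. \<rho> * (x - p)) (\<i> * of_real a) (- \<i> * of_real m) (- \<i> * of_real m) u1 u2 k1 k2"
      using su unfolding dsys_def k1_def k2_def \<beta>_def by (simp add: algebra_simps)
    note b1 = l2_bounded_mult[OF _ cont(2) \<psi>b] and b2 = l2_bounded_mult[OF _ cont(1) \<psi>'b]
    have lu: "l2 u1" "l2 u2" unfolding u1_def[abs_def] u2_def[abs_def] by (intro b1 l)+
    have lh: "l2 h1" "l2 h2" unfolding h1_def[abs_def] h2_def[abs_def] by (intro l2_diff l2_add b1 b2 l)+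
    have \<beta>u: "l2 (\<lambda>x. of_real (\<beta> x) * (of_real (\<psi> x) * w x))" "l2n (\<lambda>x. of_real (\<beta> x) * (of_real (\<psi> x) * w x)) \<le> \<delta> * l2n w" if "l2 w" for w :: "real \<Rightarrow> complex"
    proof -
      have \<delta>0: "\<delta> \<ge> 0" using Q0 by (simp add: \<delta>_def)
      have "continuous_on UNIV \<beta>" unfolding \<beta>_def[abs_def] by (intro continuous_intros B_cont)
      then have me: "(\<lambda>x. of_real (\<beta> x) * (of_real (\<psi> x) * w x)) \<in> borel_measurable borel"
        using borel_measurable_continuous_onI[of \<beta>] borel_measurable_continuous_onI[OF cont(2)] l2_meas[OF that] by simp
      have b: "norm (of_real (\<beta> x) * (of_real (\<psi> x) * w x)) \<le> \<delta> * norm (w x)" for x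
      proof (cases "\<bar>x - p\<bar> \<le> 2 * R")
        case True
        have "norm (of_real (\<beta> x) * (of_real (\<psi> x) * w x)) = \<bar>\<beta> x\<bar> * \<bar>\<psi> x\<bar> * norm (w x)" by (simp add: norm_mult)
        also have "\<dots> \<le> \<delta> * 1 * norm (w x)"
          using near[OF True] \<psi>b[of x] \<delta>0 by (intro mult_right_mono mult_mono) (auto simp: \<beta>_def)
        finally show ?thesis by simp
      next
        case False then show ?thesis using out0[of x] \<delta>0 by simp
      qed
      show "l2 (\<lambda>x. of_real (\<beta> x) * (of_real (\<psi> x) * w x))" by (rule l2_bound(1)[OF that me b \<delta>0])
      show "l2n (\<lambda>x. of_real (\<beta> x) * (of_real (\<psi> x) * w x)) \<le> \<delta> * l2n w" by (rule l2_bound(2)[OF that me b \<delta>0])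
    qed
    have lk: "l2 k1" "l2 k2" unfolding k1_def[abs_def] k2_def[abs_def] u1_def u2_def by (intro l2_diff lh \<beta>u(1) l)+
    have nu: "nrm u1 u2 \<le> Q * nrm k1 k2"
      unfolding Q_def
    proof (rule dsys_model_bound[OF pos(1) _ _ a _ c1_def order_refl _ sm lu lk])
      show "0 < \<rho>" "\<rho> \<le> \<rho>2'" using \<rho> pos by (auto simp: \<rho>2'_def)
      show "1 \<le> 2 * R" using R1 r by linarith
      have "(A + 1)\<^sup>2 \<le> 2 * \<rho>1 * real n" using n pos by (simp add: pos_divide_le_eq mult.commute)
      also have "\<dots> \<le> 2 * \<rho> * real n" using \<rho> by (intro mult_right_mono) auto
      finally show "(A + 1)\<^sup>2 \<le> m\<^sup>2 + 2 * \<rho> * real n" using zero_le_power2[of m] by linarith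
      show "u1 x = 0 \<and> u2 x = 0 \<and> k1 x = 0 \<and> k2 x = 0" if "\<bar>x - p\<bar> > 2 * R" for x
        using out0[of x] that by (simp add: u1_def u2_def k1_def k2_def h1_def h2_def)
    qed
    have tail: "l2n (\<lambda>x. of_real (\<psi>' x) * w x) \<le> 12 * l2n (far p R w)" if "l2 w" for w
    proof -
      have e: "of_real (\<psi>' x) * w x = of_real (\<psi>' x) * far p R w x" for x
        using in1[of x] by (auto simp: far_def)
      show ?thesis using b2(2)[OF l2_far(1)[OF that, of p R]] by (simp only: e)
    qed
    note G = l2n_le_nrm[OF l(3,4), folded G_def] and NN = l2n_le_nrm[OF l(1,2), folded N_def]
      and FF = l2n_le_nrm[OF l2_far(1)[OF l(1)] l2_far(1)[OF l(2)], of p R p R, folded F_def]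
    have \<delta>0: "\<delta> \<ge> 0" using Q0 by (simp add: \<delta>_def)
    have "l2n k1 \<le> l2n h1 + \<delta> * l2n w1" "l2n k2 \<le> l2n h2 + \<delta> * l2n w2"
      unfolding k1_def[abs_def] k2_def[abs_def] u1_def u2_def
      using l2n_triangle_diff[OF lh(1) \<beta>u(1)[OF l(1)]] l2n_triangle_diff[OF lh(2) \<beta>u(1)[OF l(2)]] \<beta>u(2)[OF l(1)] \<beta>u(2)[OF l(2)] by linarith+
    moreover have "l2n h1 \<le> 1 * l2n g1 + 12 * l2n (far p R w1)"
      unfolding h1_def[abs_def] using l2n_triangle_diff[OF b1(1)[OF l(3)] b2(1)[OF l(1)]] b1(2)[OF l(3)] tail[OF l(1)] by linarith
    moreover have "l2n h2 \<le> 1 * l2n g2 + 12 * l2n (far p R w2)"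
      unfolding h2_def[abs_def] using l2n_triangle[OF b1(1)[OF l(4)] b2(1)[OF l(2)]] b1(2)[OF l(4)] tail[OF l(2)] by linarith
    moreover have "\<delta> * l2n w1 \<le> \<delta> * N" "\<delta> * l2n w2 \<le> \<delta> * N" using NN \<delta>0 by (auto intro: mult_left_mono)
    ultimately have "l2n k1 \<le> G + 12 * F + \<delta> * N" "l2n k2 \<le> G + 12 * F + \<delta> * N"
      using G FF by simp_all
    then have nk: "nrm k1 k2 \<le> 2 * (G + 12 * F + \<delta> * N)"
      using nrm_le_add[OF lk] by simp
    have Nu: "N \<le> nrm u1 u2 + F"
    proof -
      have "N = nrm (\<lambda>x. u1 x + (w1 x - u1 x)) (\<lambda>x. u2 x + (w2 x - u2 x))" by (simp add: N_def)
      also have "\<dots> \<le> nrm u1 u2 + nrm (\<lambda>x. w1 x - u1 x) (\<lambda>x. w2 x - u2 x)"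
        by (intro nrm_triangle l2_diff l lu)
      also have "nrm (\<lambda>x. w1 x - u1 x) (\<lambda>x. w2 x - u2 x) \<le> F"
      proof -
        have d: "l2 (\<lambda>x. w1 x - u1 x)" "l2 (\<lambda>x. w2 x - u2 x)" by (intro l2_diff l lu)+
        have b: "norm (w x - of_real (\<psi> x) * w x) \<le> norm (far p R w x)" for w :: "real \<Rightarrow> complex" and x
        proof (cases "\<bar>x - p\<bar> \<le> R")
          case True then show ?thesis using in1[of x] by simp
        next
          case False
          have "w x - of_real (\<psi> x) * w x = of_real (1 - \<psi> x) * w x" by (simp add: algebra_simps)
          then have "norm (w x - of_real (\<psi> x) * w x) = \<bar>1 - \<psi> x\<bar> * norm (w x)" by (simp only: norm_mult norm_of_real)
          also have "\<dots> \<le> 1 * norm (w x)"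
            using cut_nonneg[of "(x - p) / R"] cut_le_1[of "(x - p) / R"] by (intro mult_right_mono) (auto simp: \<psi>_def)
          finally show ?thesis using False by (simp add: far_def)
        qed
        have "l2n (\<lambda>x. w1 x - u1 x) \<le> l2n (far p R w1)" "l2n (\<lambda>x. w2 x - u2 x) \<le> l2n (far p R w2)"
          by (rule l2n_mono[OF l2_far(1)[OF l(1)] l2_meas[OF d(1)]], simp only: u1_def b,
              rule l2n_mono[OF l2_far(1)[OF l(2)] l2_meas[OF d(2)]], simp only: u2_def b)
        then have "(nrm (\<lambda>x. w1 x - u1 x) (\<lambda>x. w2 x - u2 x))\<^sup>2 \<le> F\<^sup>2"
          unfolding F_def nrm_sq[OF d] nrm_sq[OF l2_far(1)[OF l(1)] l2_far(1)[OF l(2)]]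
          by (intro add_mono power_mono) auto
        then show ?thesis by (rule power2_le_imp_le) (simp add: F_def)
      qed
      finally show ?thesis by simp
    qed
    have "nrm u1 u2 \<le> Q * (2 * (G + 12 * F + \<delta> * N))" using nu mult_left_mono[OF nk, of Q] Q0 by linarith
    also have "\<dots> = 2 * Q * G + 24 * Q * F + N / 4" using Q0 by (simp add: \<delta>_def algebra_simps)
    finally have "N \<le> 2 * Q * G + (24 * Q + 1) * F + N / 4" using Nu by (simp add: algebra_simps)
    moreover have "(24 * Q + 1) * F \<le> (24 * Q + 1) * K * G + N / 4"
    proof -
      have "(24 * Q + 1) * F \<le> (24 * Q + 1) * (K * (G + N / r ^ (2 * J)))" using F Q0 by (intro mult_left_mono) auto
      also have "\<dots> = (24 * Q + 1) * K * G + ((24 * Q + 1) * (K * (1 / r ^ (2 * J)))) * N" by (simp add: algebra_simps add_divide_distrib)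
      also have "\<dots> \<le> (24 * Q + 1) * K * G + (1 / 4) * N"
        using small by (intro add_left_mono mult_right_mono) (auto simp: N_def)
      finally show ?thesis by simp
    qed
    ultimately have "N \<le> C * G" by (simp add: C_def algebra_simps)
    then show "nrm w1 w2 \<le> C * nrm g1 g2" by (simp add: N_def G_def)
  qed
  have R2: "rmin \<le> R" using R1 r by linarith
  have \<delta>1: "\<delta> > 0" using Q0 by (simp add: \<delta>_def)
  show ?thesis
    by (rule exI[of _ C], rule conjI[OF C0], rule exI[of _ R], rule conjI[OF R2], rule exI[of _ \<delta>], rule conjI[OF \<delta>1])
       (use main in blast)
qed

section \<open>The potential near the turning point\<close>

text \<open>A single constant C >= 1 serves all comparisons of the standing assumptions, and the
  derivatives are named so that their signs and bounds can be used directly.\<close>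

locale potential =
  fixes V V' V'' :: "real \<Rightarrow> real" and \<epsilon>0 M0 x0 M C :: real
  assumes V_deriv: "\<And>x. (V has_real_derivative V' x) (at x)"
    and V'_cont: "continuous_on UNIV V'"
    and \<epsilon>0: "0 < \<epsilon>0" "\<epsilon>0 < 1" and M0: "M0 > 0"
    and V'_bound: "\<And>x. \<bar>V' x\<bar> \<le> \<epsilon>0 * (V x)\<^sup>2 + M0"
    and V_lim: "filterlim V at_top at_top"
    and V_left: "\<And>x. x < 0 \<Longrightarrow> V x \<le> M"
    and x0: "x0 \<ge> 0" and C: "C \<ge> 1"
    and V'_pos: "\<And>x. x > x0 \<Longrightarrow> V' x > 0"
    and V'_upper: "\<And>x. x > x0 \<Longrightarrow> V' x \<le> C * (V x / x)"
    and V'_lower: "\<And>x. x > x0 \<Longrightarrow> V x / x \<le> C * V' x"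
    and V''_deriv: "\<And>x. x > x0 \<Longrightarrow> (V' has_real_derivative V'' x) (at x)"
    and V''_bound: "\<And>x. x > x0 \<Longrightarrow> \<bar>V'' x\<bar> \<le> C * (V' x / x)"

lemma potential_of_admissible:
  assumes "admissible_potential V"
  shows "\<exists>V'' \<epsilon>0 M0 x0 M C. potential V (deriv V) V'' \<epsilon>0 M0 x0 M C"
proof -
  have cd: "(f has_real_derivative deriv f x) (at x)" if "f C1_differentiable_on S" "x \<in> S" for f :: "real \<Rightarrow> real" and S x
    using that unfolding C1_differentiable_on_def
    by (auto simp: has_real_derivative_iff_has_vector_derivative[symmetric] DERIV_imp_deriv)
  from assms obtain \<epsilon>0 M0 M x0 where *: "V C1_differentiable_on UNIV" "0 < \<epsilon>0" "\<epsilon>0 < 1" "0 < M0"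
    "\<And>x. \<bar>deriv V x\<bar> \<le> \<epsilon>0 * \<bar>V x\<bar>\<^sup>2 + M0" "filterlim V at_top at_top" "\<And>x. x < 0 \<Longrightarrow> V x \<le> M"
    "x0 \<ge> 0" "deriv V C1_differentiable_on {x0<..}" "\<And>x. x > x0 \<Longrightarrow> 0 < deriv V x"
    "approx_on {x0<..} (deriv V) (\<lambda>x. V x / x)" "lesssim_on {x0<..} (\<lambda>x. \<bar>deriv (deriv V) x\<bar>) (\<lambda>x. deriv V x / x)"
    unfolding admissible_potential_def by blast
  obtain C1 where C1: "C1 > 0" "\<And>x. x > x0 \<Longrightarrow> deriv V x \<le> C1 * (V x / x)"
    using *(11) unfolding approx_on_def lesssim_on_def by auto
  obtain C2 where C2: "C2 > 0" "\<And>x. x > x0 \<Longrightarrow> V x / x \<le> C2 * deriv V x"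
    using *(11) unfolding approx_on_def lesssim_on_def by auto
  obtain C3 where C3: "C3 > 0" "\<And>x. x > x0 \<Longrightarrow> \<bar>deriv (deriv V) x\<bar> \<le> C3 * (deriv V x / x)"
    using *(12) unfolding lesssim_on_def by auto
  define C where "C = max 1 (max C1 (max C2 C3))"
  have CC: "C \<ge> 1" "C1 \<le> C" "C2 \<le> C" "C3 \<le> C" by (auto simp: C_def)
  have Vx: "V x / x \<ge> 0" if "x > x0" for x
  proof -
    have "0 < C1 * (V x / x)" using C1(2)[OF that] *(10)[OF that] by linarith
    then show ?thesis using zero_less_mult_pos[OF _ C1(1)] less_imp_le by blast
  qed
  have "continuous_on UNIV (deriv V)"
  proof -
    obtain D where D: "\<And>x. (V has_vector_derivative D x) (at x)" "continuous_on UNIV D"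
      using *(1) unfolding C1_differentiable_on_def by auto
    have "deriv V = D" using D(1) by (auto simp: has_real_derivative_iff_has_vector_derivative[symmetric] DERIV_imp_deriv)
    then show ?thesis using D(2) by simp
  qed
  moreover have "deriv V x \<le> C * (V x / x)" if "x > x0" for x
    using C1(2)[OF that] mult_right_mono[OF CC(2) Vx[OF that]] by linarith
  moreover have "V x / x \<le> C * deriv V x" if "x > x0" for x
    using C2(2)[OF that] mult_right_mono[OF CC(3) less_imp_le[OF *(10)[OF that]]] by linarith
  moreover have "\<bar>deriv (deriv V) x\<bar> \<le> C * (deriv V x / x)" if "x > x0" for x
  proof -
    have "deriv V x / x \<ge> 0" using *(10)[OF that] that *(8) by simp
    from mult_right_mono[OF CC(4) this] show ?thesis using C3(2)[OF that] by linarith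
  qed
  ultimately have "potential V (deriv V) (deriv (deriv V)) \<epsilon>0 M0 x0 M C"
    using * CC(1) cd[OF *(1)] cd[OF *(9)] by unfold_locales auto
  then show ?thesis by blast
qed

context potential
begin

lemma V_cont: "continuous_on A V"
  using V_deriv by (meson DERIV_isCont continuous_at_imp_continuous_on)

lemma V_bounded_left: "\<exists>K\<ge>0. \<forall>x\<le>X. V x \<le> K"
proof -
  have "compact (V ` {0..max 0 X})" by (intro compact_continuous_image V_cont) auto
  then have "bounded (V ` {0..max 0 X})" by (rule compact_imp_bounded)
  then obtain K where K: "\<forall>y\<in>V ` {0..max 0 X}. norm y \<le> K" unfolding bounded_iff by blast
  have "V x \<le> max 0 (max K M)" if "x \<le> X" for x
  proof (cases "x < 0")
    case True then show ?thesis using V_left[OF True] by simp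
  next
    case False
    then have "norm (V x) \<le> K" using K that by auto
    then show ?thesis by simp
  qed
  then show ?thesis by (intro exI[of _ "max 0 (max K M)"]) auto
qed

lemma V_pos: "x > x0 \<Longrightarrow> V x > 0"
  using V'_pos[of x] V'_upper[of x] C x0 by (smt (verit) divide_nonpos_pos mult_nonneg_nonpos)

lemma V_strict_mono: "x0 < x \<Longrightarrow> x < y \<Longrightarrow> V x < V y"
  by (rule DERIV_pos_imp_increasing[of x y V]) (use V_deriv V'_pos in force)+

text \<open>\<open>V' \<le> C * (V / x)\<close> makes \<open>ln V - C * ln x\<close> nonincreasing.
  The factor is 4^C, and the ratio 4 covers any two points of [p / 2, 2 p].\<close>

lemma V_doubling:
  assumes "x0 < x" "x \<le> y" "y \<le> 4 * x" shows "V y \<le> exp (C * ln 4) * V x"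
proof -
  have x: "x > 0" using assms(1) x0 by simp
  have "ln (V y) - C * ln y \<le> ln (V x) - C * ln x"
  proof (rule DERIV_nonpos_imp_nonincreasing[OF assms(2)])
    fix t assume t: "x \<le> t" "t \<le> y"
    have t0: "t > x0" "t > 0" using t assms x by auto
    have "((\<lambda>t. ln (V t) - C * ln t) has_real_derivative V' t / V t - C * (1 / t)) (at t)"
      using V_pos[OF t0(1)] t0 by (auto intro!: derivative_eq_intros V_deriv simp: divide_inverse)
    moreover have "V' t / V t - C * (1 / t) \<le> 0"
      using V'_upper[OF t0(1)] V_pos[OF t0(1)] t0 by (simp add: pos_divide_le_eq)
    ultimately show "\<exists>d. ((\<lambda>t. ln (V t) - C * ln t) has_real_derivative d) (at t) \<and> d \<le> 0" by blast
  qed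
  then have "ln (V y) \<le> ln (V x) + C * (ln y - ln x)" by (simp add: algebra_simps)
  also have "C * (ln y - ln x) \<le> C * ln 4"
  proof (rule mult_left_mono)
    have "ln y \<le> ln (4 * x)" using assms x by (subst ln_le_cancel_iff) auto
    then show "ln y - ln x \<le> ln 4" using x by (simp add: ln_mult)
  qed (use C in simp)
  finally have "ln (V y) \<le> ln (V x) + C * ln 4" by simp
  then have "exp (ln (V y)) \<le> exp (ln (V x) + C * ln 4)" by simp
  then show ?thesis using V_pos[OF assms(1)] V_pos[of y] assms by (simp add: exp_add mult.commute)
qed

text \<open>Once b exceeds a bound for \<open>V\<close> on the half-line up to max X x0, every
  solution lies to the right of it, where \<open>V\<close> is strictly increasing. The free X makes
  the turning point as large as desired.\<close>

lemma ex1_turning_point: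
  "\<exists>b0. \<forall>b\<ge>b0. (\<exists>!x. 0 < x \<and> V x = b) \<and> X < turning_point V b \<and> V (turning_point V b) = b"
proof -
  define Y where "Y = max X x0"
  obtain K where K: "\<And>x. x \<le> Y \<Longrightarrow> V x \<le> K" using V_bounded_left by blast
  have "(\<exists>!x. 0 < x \<and> V x = b) \<and> X < turning_point V b \<and> V (turning_point V b) = b" if b: "b \<ge> K + 1" for b
  proof -
    obtain z where z: "z \<ge> Y" "V z \<ge> b"
      using V_lim[unfolded filterlim_at_top, rule_format, of b] eventually_conj[OF _ eventually_ge_at_top[of Y]]
      by (metis (mono_tags, lifting) eventually_at_top_linorder order_refl)
    have "V Y \<le> b" using K[of Y] b by simp
    then obtain x where x: "Y \<le> x" "x \<le> z" "V x = b" using IVT'[of V Y b z] z V_cont by auto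
    have gt: "y > Y" if "V y = b" for y using K[of y] that b by force
    have "x > 0" using gt[OF x(3)] x0 by (simp add: Y_def)
    moreover have "y = x" if "V y = b" for y
      using gt[OF that] gt[OF x(3)] V_strict_mono[of x y] V_strict_mono[of y x] that x(3)
      by (cases x y rule: linorder_cases) (auto simp: Y_def)
    ultimately have ex: "\<exists>!x. 0 < x \<and> V x = b" using x(3) by blast
    then have t: "0 < turning_point V b \<and> V (turning_point V b) = b"
      unfolding turning_point_def by (rule theI')
    then show ?thesis using ex gt[of "turning_point V b"] by (simp add: Y_def)
  qed
  then show ?thesis by blast
qed

text \<open>Where V < 0 the shift by b >= 0 only enlarges |V - b|; elsewhere V is bounded on the
  half-line. So the shift keeps \<epsilon>0 and needs one constant M1 for all b.\<close>

lemma V'_bound_left: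
  "\<exists>M1\<ge>0. \<forall>b\<ge>0. \<forall>x\<le>Y. \<bar>V' x\<bar> \<le> \<epsilon>0 * (V x - b)\<^sup>2 + M1"
proof -
  obtain K where K: "K \<ge> 0" "\<And>x. x \<le> Y \<Longrightarrow> V x \<le> K" using V_bounded_left by blast
  have "\<bar>V' x\<bar> \<le> \<epsilon>0 * (V x - b)\<^sup>2 + (\<epsilon>0 * K\<^sup>2 + M0)" if "b \<ge> 0" "x \<le> Y" for b x
  proof -
    have "(V x)\<^sup>2 \<le> (V x - b)\<^sup>2 + K\<^sup>2"
    proof (cases "V x < 0")
      case True
      then have "(V x)\<^sup>2 \<le> (V x - b)\<^sup>2" using that by (subst abs_le_square_iff[symmetric]) auto
      then show ?thesis using zero_le_power2[of K] by linarith
    next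
      case False
      then have "(V x)\<^sup>2 \<le> K\<^sup>2" using K(2)[OF that(2)] by (intro power_mono) auto
      then show ?thesis using zero_le_power2[of "V x - b"] by linarith
    qed
    then have "\<epsilon>0 * (V x)\<^sup>2 \<le> \<epsilon>0 * ((V x - b)\<^sup>2 + K\<^sup>2)" using \<epsilon>0 by (intro mult_left_mono) auto
    then show ?thesis using V'_bound[of x] by (simp add: distrib_left)
  qed
  then show ?thesis using K(1) \<epsilon>0 M0 by (intro exI[of _ "\<epsilon>0 * K\<^sup>2 + M0"]) auto
qed

text \<open>Collects the losses on [p / 2, 2 p]: 4^C from doubling, powers of C from passing between
  V' and V / x and from the bound on V'', and factors 2 from comparing x with p.\<close>

definition L :: real where "L = 4 * C ^ 3 * exp (C * ln 4)"

lemma L_ge: "L \<ge> 4" "C \<le> L" "2 * C\<^sup>2 * exp (C * ln 4) \<le> L" "4 * C\<^sup>2 * exp (C * ln 4) \<le> L"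
proof -
  have K: "exp (C * ln 4) \<ge> 1" using C by simp
  have C2: "1 \<le> C\<^sup>2" using C by (simp add: one_le_power)
  have C3: "C\<^sup>2 \<le> C ^ 3" "C \<le> C ^ 3" "1 \<le> C ^ 3"
    using C power_increasing[of 2 3 C] power_increasing[of 1 3 C] by (auto simp: one_le_power)
  show 4: "4 * C\<^sup>2 * exp (C * ln 4) \<le> L" unfolding L_def using C3 K by (intro mult_right_mono) auto
  have "2 * C\<^sup>2 * exp (C * ln 4) \<le> 4 * C\<^sup>2 * exp (C * ln 4)" using C2 by (intro mult_right_mono) auto
  then show "2 * C\<^sup>2 * exp (C * ln 4) \<le> L" using 4 by (rule order_trans)
  have "4 * C ^ 3 * 1 \<le> L" unfolding L_def using K C3 C by (intro mult_left_mono) auto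
  then show "L \<ge> 4" "C \<le> L" using C3 by linarith+
qed

text \<open>Here \<open>p\<close> is the turning point, \<open>b = V p\<close> and \<open>\<rho> = V' p\<close>.\<close>

context
  fixes p :: real
  assumes p: "p > 2 * x0" "p > 0"
    and big: "\<And>x. x \<le> x0 \<Longrightarrow> V x \<le> V p / exp (C * ln 4)"
begin

lemma px0: "p > x0" "p / 2 > x0" using p x0 by auto

lemma slope_bounds: "V' p > 0" "V' p \<le> C * (V p / p)" "V p / p \<le> C * V' p"
  using V'_pos V'_upper V'_lower px0 by auto

text \<open>V' is exchanged for V / x, moved between x and p by doubling, and exchanged
  back.\<close>

lemma inside:
  assumes "p / 2 \<le> x" "x \<le> 2 * p"
  shows "V' p / L \<le> V' x" "\<bar>V'' x\<bar> \<le> L * V' p / p" "2 * (V' p / L) \<le> V' x"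
proof -
  let ?K = "exp (C * ln 4)"
  have x: "x > x0" "x > 0" using assms px0 p by auto
  have b0: "V p > 0" by (rule V_pos[OF px0(1)])
  have Vl: "V p \<le> ?K * V x"
  proof (cases "x \<le> p")
    case True then show ?thesis using V_doubling[of x p] x assms by auto
  next
    case False
    then have "V p \<le> V x" using V_strict_mono[of p x] px0 by simp
    also have "\<dots> \<le> ?K * V x" using V_pos[OF x(1)] C by simp
    finally show ?thesis .
  qed
  have Vu: "V x \<le> ?K * V p"
  proof (cases "x \<le> p")
    case True
    then have "V x \<le> V p" using V_strict_mono[of x p] x by (cases "x = p") auto
    also have "\<dots> \<le> ?K * V p" using b0 C by simp
    finally show ?thesis .
  next
    case False then show ?thesis using V_doubling[of p x] px0 assms by auto
  qed
  have "V' p \<le> C * (V p / p)" by (rule slope_bounds)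
  also have "\<dots> \<le> C * (?K * V x / (x / 2))"
    using Vl assms x p C b0 by (intro mult_left_mono frac_le) auto
  also have "\<dots> = 2 * C * ?K * (V x / x)" by simp
  also have "\<dots> \<le> 2 * C * ?K * (C * V' x)" using V'_lower[OF x(1)] C by (intro mult_left_mono) auto
  also have "\<dots> = (2 * C\<^sup>2 * ?K) * V' x" by (simp add: power2_eq_square)
  finally have e: "V' p \<le> (2 * C\<^sup>2 * ?K) * V' x" .
  also have "\<dots> \<le> L * V' x" using L_ge V'_pos[OF x(1)] by (intro mult_right_mono) auto
  finally show "V' p / L \<le> V' x" using L_ge(1) by (simp add: pos_divide_le_eq mult.commute)
  have "2 * V' p \<le> 2 * ((2 * C\<^sup>2 * ?K) * V' x)" using e by (rule mult_left_mono) simp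
  also have "\<dots> = (4 * C\<^sup>2 * ?K) * V' x" by simp
  also have "\<dots> \<le> L * V' x" using L_ge V'_pos[OF x(1)] by (intro mult_right_mono) auto
  finally show "2 * (V' p / L) \<le> V' x" using L_ge(1) by (simp add: pos_divide_le_eq mult.commute)
  have "V' x \<le> C * (V x / x)" by (rule V'_upper[OF x(1)])
  also have "\<dots> \<le> C * (?K * V p / (p / 2))"
    using Vu assms x p C V_pos[OF x(1)] by (intro mult_left_mono frac_le) auto
  also have "\<dots> = 2 * C * ?K * (V p / p)" by simp
  also have "\<dots> \<le> 2 * C * ?K * (C * V' p)" using slope_bounds C by (intro mult_left_mono) auto
  finally have u: "V' x \<le> 2 * C\<^sup>2 * ?K * V' p" by (simp add: power2_eq_square mult_ac)
  have "\<bar>V'' x\<bar> \<le> C * (V' x / x)" by (rule V''_bound[OF x(1)])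
  also have "\<dots> \<le> C * (2 * C\<^sup>2 * ?K * V' p / (p / 2))"
    using u assms x p C V'_pos[OF x(1)] slope_bounds(1) by (intro mult_left_mono frac_le) (auto simp: less_imp_le)
  also have "\<dots> = L * V' p / p" by (simp add: L_def power2_eq_square power3_eq_cube)
  finally show "\<bar>V'' x\<bar> \<le> L * V' p / p" .
qed

text \<open>One mean value point z of V serves all three parts: the two lower bounds come from V' z,
  and the error bound from the mean value inequality for V' between p and z.\<close>

lemma taylor:
  assumes "p / 2 \<le> x" "x \<le> 2 * p"
  shows "\<bar>V x - V p - V' p * (x - p)\<bar> \<le> L * V' p / p * (x - p)\<^sup>2" (is ?T)
    and "V' p / L * (x - p)\<^sup>2 \<le> (x - p) * (V x - V p)" (is ?S)
    and "2 * (V' p / L) * \<bar>x - p\<bar> \<le> \<bar>V x - V p\<bar>" (is ?U)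
proof -
  have "?T \<and> ?S \<and> ?U"
  proof (cases "x = p")
    case False
    define I where "I = {min x p..max x p}"
    have sub: "p / 2 \<le> t \<and> t \<le> 2 * p" if "t \<in> I" for t using that assms p by (auto simp: I_def)
    have "\<exists>z. z \<in> I \<and> V x - V p = (x - p) * V' z"
    proof (cases "x < p")
      case True
      from MVT2[OF True, of V V'] V_deriv obtain z where "x < z" "z < p" "V p - V x = (p - x) * V' z" by blast
      then show ?thesis using True by (intro exI[of _ z]) (auto simp: I_def algebra_simps)
    next
      case F: False
      then have "p < x" using False by simp
      from MVT2[OF this, of V V'] V_deriv obtain z where "p < z" "z < x" "V x - V p = (x - p) * V' z" by blast
      then show ?thesis by (intro exI[of _ z]) (auto simp: I_def)
    qed
    then obtain z where z: "z \<in> I" "V x - V p = (x - p) * V' z" by blast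
    have z': "p / 2 \<le> z" "z \<le> 2 * p" using sub z(1) by auto
    have "V' p / L * (x - p)\<^sup>2 \<le> V' z * (x - p)\<^sup>2" by (intro mult_right_mono inside(1) z') simp
    then have S: ?S by (simp add: z(2) power2_eq_square mult_ac)
    have "2 * (V' p / L) * \<bar>x - p\<bar> \<le> V' z * \<bar>x - p\<bar>" by (intro mult_right_mono inside(3) z') simp
    also have "\<dots> \<le> \<bar>V x - V p\<bar>" unfolding z(2) abs_mult by (simp add: mult.commute mult_right_mono)
    finally have U: ?U .
    have "norm (V' z - V' p) \<le> L * V' p / p * norm (z - p)"
    proof (rule field_differentiable_bound[of I V' V''])
      show "(V' has_field_derivative V'' t) (at t within I)" if "t \<in> I" for t
        by (rule has_field_derivative_at_within[OF V''_deriv]) (use sub[OF that] px0 in linarith)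
      show "norm (V'' t) \<le> L * V' p / p" if "t \<in> I" for t using inside(2)[of t] sub[OF that] by simp
    qed (use z(1) in \<open>auto simp: I_def\<close>)
    also have "\<dots> \<le> L * V' p / p * \<bar>x - p\<bar>"
      using z(1) L_ge slope_bounds p by (intro mult_left_mono) (auto simp: I_def)
    finally have "\<bar>x - p\<bar> * \<bar>V' z - V' p\<bar> \<le> \<bar>x - p\<bar> * (L * V' p / p * \<bar>x - p\<bar>)"
      by (intro mult_left_mono) auto
    moreover have "V x - V p - V' p * (x - p) = (x - p) * (V' z - V' p)" using z(2) by (simp add: algebra_simps)
    ultimately have ?T by (simp add: abs_mult power2_eq_square mult_ac)
    then show ?thesis using S U by blast
  qed simp
  then show ?T ?S ?U by blast+
qed

text \<open>Monotonicity carries the bounds at 2 p and p / 2 outwards. Left of \<open>x0\<close>,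
  where V may fail to be monotone, the assumption \<open>big\<close> keeps V x below V (p / 2),
  since the latter is at least V p / 4^C.\<close>

lemma outside:
  shows "x \<ge> 2 * p \<Longrightarrow> V x - V p \<ge> V' p * p / L" "x \<le> p / 2 \<Longrightarrow> V p - V x \<ge> V' p * p / L"
proof -
  assume x: "x \<ge> 2 * p"
  have "V (2 * p) \<le> V x" using V_strict_mono[of "2 * p" x] x p px0 by (cases "x = 2 * p") auto
  moreover have "V' p / L * p\<^sup>2 \<le> p * (V (2 * p) - V p)" using taylor(2)[of "2 * p"] p by simp
  then have "p * (V' p * p / L) \<le> p * (V (2 * p) - V p)" by (simp add: power2_eq_square mult_ac)
  then have "V' p * p / L \<le> V (2 * p) - V p" by (rule mult_left_le_imp_le) (rule p)
  ultimately show "V x - V p \<ge> V' p * p / L" by linarith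
next
  assume x: "x \<le> p / 2"
  have "V p / exp (C * ln 4) \<le> V (p / 2)"
    using V_doubling[of "p / 2" p] px0 p by (simp add: pos_divide_le_eq mult.commute)
  then have "V x \<le> V (p / 2)"
    using V_strict_mono[of x "p / 2"] big[of x] x by (cases "x \<le> x0"; cases "x = p / 2") auto
  moreover have "2 * (V' p / L) * \<bar>p / 2 - p\<bar> \<le> \<bar>V (p / 2) - V p\<bar>" using taylor(3)[of "p / 2"] p by simp
  moreover have "V (p / 2) < V p" using V_strict_mono[of "p / 2" p] px0 p by simp
  moreover have "\<bar>p / 2 - p\<bar> = p / 2" using p by simp
  ultimately show "V p - V x \<ge> V' p * p / L" by (simp add: mult_ac)
qed

text \<open>Written in the form that \<open>osc_estimate\<close> consumes. On [p / 2, 2 p] the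
  Taylor error gives L^2 / p; outside, the two terms on the left are bounded separately, with L / p
  and 2 / p.\<close>

lemma linearization: "\<bar>(V x - V p) - V' p * (x - p)\<bar> \<le> ((L\<^sup>2 + L + 2) / p) * ((x - p) * (V x - V p))"
proof -
  let ?S = "(x - p) * (V x - V p)"
  have rp: "V' p > 0" by (rule slope_bounds)
  consider "p / 2 \<le> x" "x \<le> 2 * p" | "x > 2 * p" | "x < p / 2" by linarith
  then show ?thesis
  proof cases
    case 1
    have S: "V' p / L * (x - p)\<^sup>2 \<le> ?S" by (rule taylor(2)[OF 1])
    have S0: "?S \<ge> 0" using S L_ge(1) rp by (smt (verit) divide_nonneg_pos mult_nonneg_nonneg zero_le_power2)
    have "\<bar>V x - V p - V' p * (x - p)\<bar> \<le> L * V' p / p * (x - p)\<^sup>2" by (rule taylor(1)[OF 1])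
    also have "\<dots> = (L\<^sup>2 / p) * (V' p / L * (x - p)\<^sup>2)" using L_ge(1) by (simp add: power2_eq_square)
    also have "\<dots> \<le> (L\<^sup>2 / p) * ?S" using S p by (intro mult_left_mono) auto
    also have "\<dots> \<le> ((L\<^sup>2 + L + 2) / p) * ?S" using S0 L_ge(1) p by (intro mult_right_mono divide_right_mono) auto
    finally show ?thesis .
  next
    case 2
    have B: "V x - V p \<ge> V' p * p / L" using outside(1)[of x] 2 by simp
    have B0: "V x - V p \<ge> 0" using B rp p L_ge(1) by (smt (verit) divide_nonneg_pos mult_nonneg_nonneg)
    have t: "x - p \<ge> p / 2" using 2 p by simp
    have 1: "V' p * (x - p) \<le> (L / p) * ?S"
    proof -
      have "V' p \<le> (L / p) * (V x - V p)" using B p L_ge(1) by (simp add: field_simps)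
      then have "V' p * (x - p) \<le> (L / p) * (V x - V p) * (x - p)" using t p by (intro mult_right_mono) auto
      then show ?thesis by (simp add: mult_ac)
    qed
    have 2: "V x - V p \<le> (2 / p) * ?S"
    proof -
      have "1 * (V x - V p) \<le> ((2 / p) * (x - p)) * (V x - V p)" using t p B0 by (intro mult_right_mono) (auto simp: field_simps)
      then show ?thesis by (simp only: mult_1_left mult.assoc)
    qed
    have 3: "V' p * (x - p) \<ge> 0" using rp t p by simp
    have 4: "(L / p) * ?S + (2 / p) * ?S \<le> ((L\<^sup>2 + L + 2) / p) * ?S"
    proof -
      have "L / p + 2 / p \<le> (L\<^sup>2 + L + 2) / p" using p by (simp add: add_divide_distrib)
      then have "(L / p + 2 / p) * ?S \<le> ((L\<^sup>2 + L + 2) / p) * ?S" using t p B0 by (intro mult_right_mono) auto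
      then show ?thesis by (simp only: distrib_right)
    qed
    show ?thesis using 1 2 3 4 B0 by linarith
  next
    case 3
    have B: "V p - V x \<ge> V' p * p / L" using outside(2)[of x] 3 by simp
    have B0: "V p - V x \<ge> 0" using B rp p L_ge(1) by (smt (verit) divide_nonneg_pos mult_nonneg_nonneg)
    have t: "p - x \<ge> p / 2" using 3 p by simp
    have S: "?S = (p - x) * (V p - V x)" by (simp add: algebra_simps)
    have 1: "V' p * (p - x) \<le> (L / p) * ?S"
    proof -
      have "V' p \<le> (L / p) * (V p - V x)" using B p L_ge(1) by (simp add: field_simps)
      then have "V' p * (p - x) \<le> (L / p) * (V p - V x) * (p - x)" using t p by (intro mult_right_mono) auto
      then show ?thesis unfolding S by (simp add: mult_ac)
    qed
    have 2: "V p - V x \<le> (2 / p) * ?S"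
    proof -
      have "1 * (V p - V x) \<le> ((2 / p) * (p - x)) * (V p - V x)" using t p B0 by (intro mult_right_mono) (auto simp: field_simps)
      then show ?thesis unfolding S by (simp only: mult_1_left mult.assoc)
    qed
    have 3: "V' p * (p - x) \<ge> 0" using rp t p by simp
    have 4: "(L / p) * ?S + (2 / p) * ?S \<le> ((L\<^sup>2 + L + 2) / p) * ?S"
    proof -
      have "L / p + 2 / p \<le> (L\<^sup>2 + L + 2) / p" using p by (simp add: add_divide_distrib)
      then have "(L / p + 2 / p) * ?S \<le> ((L\<^sup>2 + L + 2) / p) * ?S" unfolding S using t p B0 by (intro mult_right_mono) auto
      then show ?thesis by (simp only: distrib_right)
    qed
    have 5: "V' p * (x - p) = - (V' p * (p - x))" by (simp add: algebra_simps)
    show ?thesis using 1 2 3 4 B0 unfolding 5 by linarith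
  qed
qed

text \<open>Young's inequality, with \<eta> tuned so that \<epsilon>0 (1 + \<eta>) is the midpoint
  of \<epsilon>0 and 1. The additive constant grows with V p, so this gives integrability; uniform
  estimates rely on \<open>V'_bound_left\<close>.\<close>

lemma shifted_C1_potential:
  "\<exists>eps M1. C1_potential (\<lambda>x. V x - V p) V' eps M1"
proof -
  define \<eta> where "\<eta> = (1 - \<epsilon>0) / (2 * \<epsilon>0)"
  have \<eta>: "\<eta> > 0" "\<epsilon>0 * (1 + \<eta>) = (1 + \<epsilon>0) / 2" using \<epsilon>0 by (auto simp: \<eta>_def field_simps)
  have "C1_potential (\<lambda>x. V x - V p) V' ((1 + \<epsilon>0) / 2) (\<epsilon>0 * ((1 + 1 / \<eta>) * (V p)\<^sup>2) + M0)"
  proof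
    show "((\<lambda>x. V x - V p) has_real_derivative V' x) (at x)" for x
      using V_deriv[of x] by (auto intro!: derivative_eq_intros)
    fix x
    have "(V x)\<^sup>2 \<le> (1 + \<eta>) * (V x - V p)\<^sup>2 + (1 + 1 / \<eta>) * (V p)\<^sup>2"
    proof -
      have "0 \<le> (\<eta> * (V x - V p) - V p)\<^sup>2 / \<eta>" using \<eta> by simp
      also have "\<dots> = \<eta> * (V x - V p)\<^sup>2 - 2 * (V x - V p) * V p + (1 / \<eta>) * (V p)\<^sup>2"
        using \<eta>(1) by (simp add: power2_eq_square field_simps)
      finally show ?thesis by (simp add: power2_eq_square algebra_simps)
    qed
    then have "\<epsilon>0 * (V x)\<^sup>2 \<le> \<epsilon>0 * ((1 + \<eta>) * (V x - V p)\<^sup>2 + (1 + 1 / \<eta>) * (V p)\<^sup>2)"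
      using \<epsilon>0 by (intro mult_left_mono) auto
    also have "\<dots> = (\<epsilon>0 * (1 + \<eta>)) * (V x - V p)\<^sup>2 + \<epsilon>0 * ((1 + 1 / \<eta>) * (V p)\<^sup>2)" by (simp add: algebra_simps)
    finally show "\<bar>V' x\<bar> \<le> (1 + \<epsilon>0) / 2 * (V x - V p)\<^sup>2 + (\<epsilon>0 * ((1 + 1 / \<eta>) * (V p)\<^sup>2) + M0)"
      unfolding \<eta>(2) using V'_bound[of x] by simp
  qed (use \<epsilon>0 M0 \<eta> V'_cont in auto)
  then show ?thesis by blast
qed

text \<open>The gap comes from V' on [p / 2, 2 p] and from the square of V - V p elsewhere. Up to
  \<open>x0\<close> the slope may be negative and remove \<epsilon>0 of that square plus M1; half of
  the remaining 1 - \<epsilon>0 pays for M1 (\<open>b1\<close>), the other half yields the gap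
  (\<open>b2\<close>).\<close>

lemma shifted_wall:
  assumes left: "\<And>x. x \<le> x0 \<Longrightarrow> \<bar>V' x\<bar> \<le> \<epsilon>0 * (V x - V p)\<^sup>2 + M1"
    and b1: "M1 \<le> (1 - \<epsilon>0) / 2 * (V' p * p / L)\<^sup>2"
    and b2: "V' p / L \<le> (1 - \<epsilon>0) / 2 * (V' p * p / L)\<^sup>2"
  shows "\<exists>eps M1 c. wall (\<lambda>x. V x - V p) V' eps M1 c (2 * p) (sqrt (V' p / L))"
proof -
  obtain eps M where "C1_potential (\<lambda>x. V x - V p) V' eps M" using shifted_C1_potential by blast
  then interpret C1_potential "\<lambda>x. V x - V p" V' eps M .
  have rp: "V' p > 0" by (rule slope_bounds)
  have pos: "V' p * p / L > 0" using rp p L_ge by simp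
  have sq: "(V' p * p / L)\<^sup>2 \<le> (V x - V p)\<^sup>2" if "x \<ge> 2 * p \<or> x \<le> p / 2" for x
    using outside(1)[of x] outside(2)[of x] that pos by (subst abs_le_square_iff[symmetric]) auto
  have "wall (\<lambda>x. V x - V p) V' eps M (V' p * p / L) (2 * p) (sqrt (V' p / L))"
  proof unfold_locales
    show "V' p * p / L > 0" by (rule pos)
    show "x \<ge> 2 * p \<Longrightarrow> V' p * p / L \<le> V x - V p" for x by (rule outside(1))
    show "V x - V p \<le> - (V' p * p / L)" if "x \<le> - (2 * p)" for x using outside(2)[of x] that p by simp
    show "sqrt (V' p / L) > 0" using rp L_ge by simp
    fix x
    have q: "(1 - \<epsilon>0) / 2 * (V' p * p / L)\<^sup>2 \<le> (V' p * p / L)\<^sup>2" using \<epsilon>0 by (intro mult_left_le_one_le) auto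
    have g: "V' p / L \<le> (V x - V p)\<^sup>2 + V' x"
    proof (cases "p / 2 \<le> x \<and> x \<le> 2 * p")
      case True
      then show ?thesis using inside(1)[of x] zero_le_power2[of "V x - V p"] by linarith
    next
      case False
      then have s: "(V' p * p / L)\<^sup>2 \<le> (V x - V p)\<^sup>2" by (intro sq) auto
      show ?thesis
      proof (cases "x > x0")
        case True then show ?thesis using V'_pos[OF True] s b2 q by linarith
      next
        case False
        then have "- V' x \<le> \<epsilon>0 * (V x - V p)\<^sup>2 + M1" using left[of x] by linarith
        moreover have "(1 - \<epsilon>0) * (V' p * p / L)\<^sup>2 \<le> (1 - \<epsilon>0) * (V x - V p)\<^sup>2" using s \<epsilon>0 by (intro mult_left_mono) auto
        moreover have "(1 - \<epsilon>0) * (V' p * p / L)\<^sup>2 = (1 - \<epsilon>0) / 2 * (V' p * p / L)\<^sup>2 + (1 - \<epsilon>0) / 2 * (V' p * p / L)\<^sup>2" by simp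
        moreover have "(1 - \<epsilon>0) * (V x - V p)\<^sup>2 = (V x - V p)\<^sup>2 - \<epsilon>0 * (V x - V p)\<^sup>2" by (simp add: algebra_simps)
        ultimately show ?thesis using b1 b2 by linarith
      qed
    qed
    then show "(sqrt (V' p / L))\<^sup>2 \<le> (V x - V p)\<^sup>2 + V' x" using rp L_ge by simp
  qed
  then show ?thesis by blast
qed

end

end

section \<open>Resolvent norms for large \<open>b\<close>\<close>

context wall
begin

text \<open>Test pair (0, k): as \<open>L_+\<close> annihilates \<open>k\<close>, the data consist
  only of the coupling, of size m, and the shift, of size |a|.\<close>

lemma resolvent_norm_lower:
  assumes V: "\<And>x. V x = b + B x" and m: "m > 0"
    and surj: "dsys_surj B (\<i> * of_real a) (- \<i> * of_real m) (- \<i> * of_real m)"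
    and bound: "dsys_bound B (\<i> * of_real a) (- \<i> * of_real m) (- \<i> * of_real m) D" "D \<ge> 0"
  shows "1 / (m + \<bar>a\<bar>) \<le> resolvent_norm m V (Complex a b)"
proof -
  let ?RN = "resolvent_norm m V (Complex a b)"
  let ?g1 = "\<lambda>x. (- \<i> * of_real m) * kc x" and ?g2 = "\<lambda>x. (\<i> * of_real a) * kc x"
  have l0: "l2 (\<lambda>x::real. 0::complex)" by (simp add: l2_def)
  have l: "l2 ?g1" "l2 ?g2" by (intro l2_scale l2_k)+
  have s: "msys m a (\<lambda>x. 0) kc ?g1 ?g2"
    unfolding msys_def dsys_def using ac_const[of 0] ac_k by (simp add: algebra_simps)
  have "knorm \<le> nrm (\<lambda>x. 0) kc" unfolding knorm_def by (rule l2n_le_nrm(2)[OF l0 l2_k])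
  also have "\<dots> \<le> ?RN * nrm ?g1 ?g2" by (rule resolvent_bounds(3)[OF V surj bound s l0 l2_k l])
  finally have 1: "knorm \<le> ?RN * nrm ?g1 ?g2" .
  have RN: "?RN \<ge> 0"
  proof (rule ccontr)
    assume "\<not> ?RN \<ge> 0"
    then have "?RN * nrm ?g1 ?g2 \<le> 0" by (intro mult_nonpos_nonneg) auto
    then show False using 1 knorm_pos by linarith
  qed
  have "nrm ?g1 ?g2 \<le> l2n ?g1 + l2n ?g2" by (rule nrm_le_add[OF l])
  also have "\<dots> = (m + \<bar>a\<bar>) * knorm" unfolding l2n_scale knorm_def using m by (simp add: norm_mult distrib_right)
  finally have "knorm \<le> ?RN * ((m + \<bar>a\<bar>) * knorm)" using 1 mult_left_mono[OF _ RN] by (meson order_trans)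
  then have "1 * knorm \<le> (?RN * (m + \<bar>a\<bar>)) * knorm" by (simp add: mult_ac)
  then have "1 \<le> ?RN * (m + \<bar>a\<bar>)" by (rule mult_right_le_imp_le) (rule knorm_pos)
  then show ?thesis using m by (simp add: pos_divide_le_eq)
qed

text \<open>Continuation along s a for s from 0 to 1, starting from the unshifted system solved in
  \<open>dsys_surj_diag\<close>.\<close>

lemma dsys_surj_shift:
  assumes m: "m > 0" and D: "D > 0"
    and bound: "\<And>s. 0 \<le> s \<Longrightarrow> s \<le> 1 \<Longrightarrow> dsys_bound B (\<i> * of_real (s * a)) (- \<i> * of_real m) (- \<i> * of_real m) D"
  shows "dsys_surj B (\<i> * of_real a) (- \<i> * of_real m) (- \<i> * of_real m)"
proof -
  have "dsys_surj B (\<i> * of_real (1 * a)) (- \<i> * of_real m) (- \<i> * of_real m)"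
  proof (rule dsys_surj_continuation[where \<alpha> = "\<lambda>s. \<i> * of_real (s * a)" and L = "\<bar>a\<bar>", OF B_cont D _ bound])
    show "dsys_surj B (\<i> * of_real (0 * a)) (- \<i> * of_real m) (- \<i> * of_real m)"
      using dsys_surj_diag[OF m] by simp
    show "norm (\<i> * of_real (s * a) - \<i> * of_real (t * a)) \<le> \<bar>a\<bar> * \<bar>s - t\<bar>" for s t
    proof -
      have "\<i> * of_real (s * a) - \<i> * of_real (t * a) = \<i> * complex_of_real (a * (s - t))" by (simp add: algebra_simps)
      then show ?thesis by (simp only: norm_mult norm_ii norm_of_real abs_mult mult_1_left order_refl)
    qed
  qed
  then show ?thesis by simp
qed

lemma resolvent_small_shift:
  assumes V: "\<And>x. V x = b + B x" and m: "\<bar>a\<bar> < m"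
  shows "Complex a b \<in> resolvent_set (dirac m V)"
    "1 / (m + \<bar>a\<bar>) \<le> resolvent_norm m V (Complex a b)" "resolvent_norm m V (Complex a b) \<le> 1 / (m - \<bar>a\<bar>)"
proof -
  have m0: "m > 0" using m by linarith
  have bd: "dsys_bound B (\<i> * of_real a') (- \<i> * of_real m) (- \<i> * of_real m) (1 / (m - \<bar>a\<bar>))" if "\<bar>a'\<bar> \<le> \<bar>a\<bar>" for a'
    unfolding dsys_bound_def
  proof (intro allI impI)
    fix w1 w2 g1 g2 assume l: "l2 w1" "l2 w2" "l2 g1" "l2 g2"
      and s: "dsys B (\<i> * of_real a') (- \<i> * of_real m) (- \<i> * of_real m) w1 w2 g1 g2"
    have "(m - \<bar>a\<bar>) * nrm w1 w2 \<le> (m - \<bar>a'\<bar>) * nrm w1 w2" using that by (intro mult_right_mono) auto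
    also have "\<dots> \<le> nrm g1 g2" by (rule dsys_model_base[OF s l m0])
    finally show "nrm w1 w2 \<le> 1 / (m - \<bar>a\<bar>) * nrm g1 g2" using m by (simp add: pos_le_divide_eq mult.commute)
  qed
  have D: "1 / (m - \<bar>a\<bar>) > 0" using m by simp
  have "\<bar>s * a\<bar> \<le> \<bar>a\<bar>" if "0 \<le> s" "s \<le> 1" for s
    using that by (simp add: abs_mult mult_left_le_one_le)
  then have surj: "dsys_surj B (\<i> * of_real a) (- \<i> * of_real m) (- \<i> * of_real m)"
    by (intro dsys_surj_shift[OF m0 D] bd)
  show "Complex a b \<in> resolvent_set (dirac m V)" "resolvent_norm m V (Complex a b) \<le> 1 / (m - \<bar>a\<bar>)"
    using resolvent_bounds(1,2)[OF V surj bd[OF order_refl] less_imp_le[OF D]] .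
  show "1 / (m + \<bar>a\<bar>) \<le> resolvent_norm m V (Complex a b)"
    by (rule resolvent_norm_lower[OF V m0 surj bd[OF order_refl] less_imp_le[OF D]])
qed

text \<open>The norm is compared after scaling by exp (-a^2 / \<rho>), which is at least exp (-A^2)
  in the range considered. \<open>q0\<close> is half of that minimum; \<open>s1\<close> keeps the
  overlap above \<open>q0\<close>, and \<open>s2\<close> keeps the correction factor 1 + \<delta> at
  most 2.\<close>

lemma resolvent_large_gap:
  assumes V: "\<And>x. V x = b + B x" and m: "m > 0"
    and \<rho>: "\<rho> > 0" and \<eta>: "\<eta> \<ge> 0"
    and lin: "\<And>x. \<bar>B x - \<rho> * (x - p)\<bar> \<le> \<eta> * ((x - p) * B x)"
    and a: "\<bar>a\<bar> \<le> A * sqrt \<rho>" and q0: "q0 = exp (- A\<^sup>2) / 2"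
    and s1: "A * \<eta> / sqrt \<rho> \<le> q0" and s2: "4 * (m * ((2 + 1 / q0) / \<gamma>)) \<le> 1"
  shows "Complex a b \<in> resolvent_set (dirac m V)"
    "\<bar>m * resolvent_norm m V (Complex a b) * exp (- (a\<^sup>2 / \<rho>)) - 1\<bar>
       \<le> (A * \<eta> / sqrt \<rho> + 8 * (m * ((2 + 1 / q0) / \<gamma>))) / q0"
proof -
  define \<delta> where "\<delta> = 4 * (m * ((2 + 1 / q0) / \<gamma>))"
  define d where "d = A * \<eta> / sqrt \<rho>"
  have q0p: "q0 > 0" by (simp add: q0)
  have \<delta>: "0 \<le> \<delta>" "\<delta> \<le> 1" using s2 m q0p \<gamma> by (auto simp: \<delta>_def)
  \<comment> \<open>Stated for all shifts up to A sqrt \<rho>, since the continuation to a passes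
    through the smaller ones.\<close>
  have ov: "\<bar>overlap p a' - exp (- (a'\<^sup>2 / \<rho>))\<bar> \<le> d \<and> overlap p a' \<ge> q0" if a': "\<bar>a'\<bar> \<le> A * sqrt \<rho>" for a'
  proof -
    have "\<bar>overlap p a' - exp (- (a'\<^sup>2 / \<rho>))\<bar> \<le> \<bar>a'\<bar> * \<eta> / \<rho>" by (rule osc_estimate[OF \<rho> \<eta> lin])
    also have "\<dots> \<le> (A * sqrt \<rho>) * \<eta> / \<rho>" using a' \<eta> \<rho> by (intro divide_right_mono mult_right_mono) auto
    also have "\<dots> = d"
    proof -
      have "sqrt \<rho> / \<rho> = 1 / sqrt \<rho>" using \<rho> by (simp add: real_div_sqrt field_simps)
      then show ?thesis unfolding d_def by (metis (no_types, opaque_lifting) divide_inverse mult.assoc mult.commute mult_1)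
    qed
    finally have 1: "\<bar>overlap p a' - exp (- (a'\<^sup>2 / \<rho>))\<bar> \<le> d" .
    have "a'\<^sup>2 \<le> (A * sqrt \<rho>)\<^sup>2" using power_mono[OF a', of 2] by simp
    then have "a'\<^sup>2 / \<rho> \<le> A\<^sup>2" using \<rho> by (simp add: power_mult_distrib pos_divide_le_eq)
    then have "2 * q0 \<le> exp (- (a'\<^sup>2 / \<rho>))" by (simp add: q0)
    then show ?thesis using 1 s1 unfolding d_def[symmetric] by linarith
  qed
  have mono: "m * ((2 + 1 / q) / \<gamma>) \<le> m * ((2 + 1 / q0) / \<gamma>)" if "q \<ge> q0" for q
    using that q0p m \<gamma> by (intro mult_left_mono divide_right_mono add_left_mono divide_left_mono) auto
  have bd: "dsys_bound B (\<i> * of_real a') (- \<i> * of_real m) (- \<i> * of_real m) (1 / (m * overlap p a') * (1 + \<delta>))"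
    if a': "\<bar>a'\<bar> \<le> A * sqrt \<rho>" for a'
  proof -
    have q: "overlap p a' \<ge> q0" "overlap p a' > 0" using ov[OF a'] q0p by linarith+
    have "m * ((2 + 1 / overlap p a') / \<gamma>) \<le> 1 / 2" using mono[OF q(1)] s2 by linarith
    note b = dsys_bound_gap[OF m q(2) this]
    show ?thesis
      unfolding dsys_bound_def
    proof (intro allI impI)
      fix w1 w2 g1 g2 assume l: "l2 w1" "l2 w2" "l2 g1" "l2 g2"
        and s: "dsys B (\<i> * of_real a') (- \<i> * of_real m) (- \<i> * of_real m) w1 w2 g1 g2"
      have "nrm w1 w2 \<le> 1 / (m * overlap p a') * (1 + 4 * (m * ((2 + 1 / overlap p a') / \<gamma>))) * nrm g1 g2"
        using b l s unfolding dsys_bound_def by blast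
      also have "\<dots> \<le> 1 / (m * overlap p a') * (1 + \<delta>) * nrm g1 g2"
        using mono[OF q(1)] q m unfolding \<delta>_def by (intro mult_right_mono mult_left_mono) auto
      finally show "nrm w1 w2 \<le> 1 / (m * overlap p a') * (1 + \<delta>) * nrm g1 g2" .
    qed
  qed
  \<comment> \<open>Cruder than \<open>bd\<close>, but the same for all a', as the continuation
    requires.\<close>
  have D: "2 / (m * q0) > 0" using m q0p by simp
  have bdD: "dsys_bound B (\<i> * of_real a') (- \<i> * of_real m) (- \<i> * of_real m) (2 / (m * q0))"
    if a': "\<bar>a'\<bar> \<le> A * sqrt \<rho>" for a'
    unfolding dsys_bound_def
  proof (intro allI impI)
    fix w1 w2 g1 g2 assume l: "l2 w1" "l2 w2" "l2 g1" "l2 g2"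
      and s: "dsys B (\<i> * of_real a') (- \<i> * of_real m) (- \<i> * of_real m) w1 w2 g1 g2"
    have q: "overlap p a' \<ge> q0" "overlap p a' > 0" using ov[OF a'] q0p by linarith+
    have "nrm w1 w2 \<le> 1 / (m * overlap p a') * (1 + \<delta>) * nrm g1 g2"
      using bd[OF a'] l s unfolding dsys_bound_def by blast
    also have "\<dots> \<le> 1 / (m * q0) * 2 * nrm g1 g2"
      using q q0p m \<delta> by (intro mult_right_mono mult_mono divide_left_mono mult_left_mono mult_pos_pos) auto
    finally show "nrm w1 w2 \<le> 2 / (m * q0) * nrm g1 g2" by simp
  qed
  have "\<bar>s * a\<bar> \<le> A * sqrt \<rho>" if "0 \<le> s" "s \<le> 1" for s
    using that a mult_left_le_one_le[of "\<bar>a\<bar>" s] by (simp add: abs_mult)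
  then have surj: "dsys_surj B (\<i> * of_real a) (- \<i> * of_real m) (- \<i> * of_real m)"
    by (intro dsys_surj_shift[OF m D] bdD)
  define q where "q = overlap p a"
  define e where "e = exp (- (a\<^sup>2 / \<rho>))"
  define RN where "RN = resolvent_norm m V (Complex a b)"
  have q: "q \<ge> q0" "q > 0" "\<bar>q - e\<bar> \<le> d" using ov[OF a] q0p by (auto simp: q_def e_def)
  have e: "e > 0" "e \<le> 1" using \<rho> by (auto simp: e_def)
  have D': "1 / (m * q) * (1 + \<delta>) \<ge> 0" using m q \<delta> by simp
  note rb = resolvent_bounds[OF V surj bd[OF a] D'[unfolded q_def], folded RN_def q_def]
  show "Complex a b \<in> resolvent_set (dirac m V)" by (rule rb(1))
  have up: "m * RN * e - 1 \<le> (d + \<delta>) / q0"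
  proof -
    have "m * RN * e \<le> m * (1 / (m * q) * (1 + \<delta>)) * e"
      using rb(2) m e by (intro mult_right_mono mult_left_mono) auto
    also have "\<dots> = (e / q) * (1 + \<delta>)" using m by simp
    finally have "m * RN * e - 1 \<le> (e / q) * (1 + \<delta>) - 1" by simp
    also have "\<dots> = (e - q + e * \<delta>) / q" using q by (simp add: field_simps)
    also have "\<dots> \<le> (d + \<delta>) / q"
      using q e \<delta> mult_left_le_one_le[of \<delta> e] by (intro divide_right_mono) auto
    also have "\<dots> \<le> (d + \<delta>) / q0"
      using q q0p \<delta> by (intro divide_left_mono) auto
    finally show ?thesis .
  qed
  have lo: "1 - m * RN * e \<le> (d + \<delta>) / q0"
  proof -
    obtain w1 w2 g1 g2 where w: "msys m a w1 w2 g1 g2" "l2 w1" "l2 w2" "l2 g1" "l2 g2"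
      "nrm w1 w2 \<ge> knorm" "nrm g1 g2 \<le> m * (q + 2 * m / \<gamma>) * knorm"
      using gap_test_pair[OF m, of a p] unfolding q_def by blast
    have 1: "knorm \<le> RN * nrm g1 g2" using rb(3)[OF w(1-5)] w(6) by linarith
    have RN0: "RN \<ge> 0"
    proof (rule ccontr)
      assume "\<not> RN \<ge> 0"
      then have "RN * nrm g1 g2 \<le> 0" by (intro mult_nonpos_nonneg) auto
      then show False using 1 knorm_pos by linarith
    qed
    define Q where "Q = q + 2 * m / \<gamma>"
    have Q: "Q \<ge> q0" "Q > 0" using q m \<gamma> q0p by (auto simp: Q_def intro: add_increasing2 add_pos_nonneg)
    have "knorm \<le> RN * (m * Q * knorm)" using 1 mult_left_mono[OF w(7) RN0] unfolding Q_def by linarith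
    then have "1 * knorm \<le> (m * RN * Q) * knorm" by (simp add: mult_ac)
    then have "1 \<le> m * RN * Q" by (rule mult_right_le_imp_le) (rule knorm_pos)
    then have "1 / Q \<le> m * RN" using Q by (simp add: pos_divide_le_eq)
    then have "e / Q \<le> m * RN * e" using mult_right_mono[of "1 / Q" "m * RN" e] e by simp
    then have "1 - m * RN * e \<le> 1 - e / Q" by linarith
    also have "\<dots> = (q - e + 2 * m / \<gamma>) / Q" using Q(2) by (simp add: diff_divide_distrib[symmetric] Q_def diff_divide_eq_iff)
    also have "\<dots> \<le> (d + \<delta>) / Q"
    proof (rule divide_right_mono)
      have "2 * m / \<gamma> \<le> \<delta>"
      proof -
        have "\<delta> - 2 * m / \<gamma> = (6 * m + 4 * m / q0) / \<gamma>" by (simp add: \<delta>_def algebra_simps add_divide_distrib diff_divide_distrib)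
        moreover have "\<dots> \<ge> 0" using m q0p \<gamma> by simp
        ultimately show ?thesis by linarith
      qed
      then show "q - e + 2 * m / \<gamma> \<le> d + \<delta>" using q by linarith
    qed (use Q in simp)
    also have "\<dots> \<le> (d + \<delta>) / q0" using Q q0p \<delta> q by (intro divide_left_mono) auto
    finally show ?thesis .
  qed
  have "(d + \<delta>) / q0 \<le> (d + 2 * \<delta>) / q0" using \<delta> q0p by (intro divide_right_mono) auto
  then show "\<bar>m * resolvent_norm m V (Complex a b) * exp (- (a\<^sup>2 / \<rho>)) - 1\<bar>
       \<le> (A * \<eta> / sqrt \<rho> + 8 * (m * ((2 + 1 / q0) / \<gamma>))) / q0"
    using up lo unfolding RN_def[symmetric] e_def[symmetric] d_def[symmetric] by (simp add: \<delta>_def)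
qed

end

context potential
begin

abbreviation "tp \<equiv> turning_point V"
abbreviation "slope b \<equiv> V' (tp b)"

lemma eventually_turning_point: "\<forall>\<^sub>F b in at_top. (\<exists>!x. 0 < x \<and> V x = b) \<and> X < tp b \<and> V (tp b) = b"
  using ex1_turning_point[of X] unfolding eventually_at_top_linorder by blast

lemma tp_lim: "filterlim tp at_top at_top"
  unfolding filterlim_at_top
proof
  fix Z show "\<forall>\<^sub>F b in at_top. Z \<le> tp b"
    using eventually_turning_point[of Z] by eventually_elim simp
qed

text \<open>Bundles the assumptions made above on a fixed turning point, with a free lower bound X
  for further demands.\<close>

lemma eventually_center:
  "\<forall>\<^sub>F b in at_top. V (tp b) = b \<and> tp b > 2 * x0 \<and> tp b > X \<and> tp b > 1 \<and> (\<forall>x\<le>x0. V x \<le> V (tp b) / exp (C * ln 4))"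
proof -
  obtain K where K: "\<And>x. x \<le> x0 \<Longrightarrow> V x \<le> K" using V_bounded_left[of x0] by blast
  show ?thesis
    using eventually_turning_point[of "max 1 (max X (2 * x0))"] eventually_ge_at_top[of "K * exp (C * ln 4)"]
  proof eventually_elim
    case (elim b)
    then have "K \<le> b / exp (C * ln 4)" by (simp add: pos_le_divide_eq)
    then have "\<forall>x\<le>x0. V x \<le> b / exp (C * ln 4)" using K by (meson order_trans)
    then show ?case using elim by auto
  qed
qed

text \<open>V / x <= C V' at the turning point gives at least b / C, whether the slope grows, stays
  bounded or tends to 0. This makes the wall structure available in every case.\<close>

lemma slope_tp_lim: "filterlim (\<lambda>b. slope b * tp b) at_top at_top"
proof (rule filterlim_at_top_mono)
  show "filterlim (\<lambda>b. b * (1 / C)) at_top at_top"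
    by (rule filterlim_at_top_mult_tendsto_pos[OF tendsto_const _ filterlim_ident, of "1 / C", simplified mult.commute])
       (use C in auto)
  show "\<forall>\<^sub>F b in at_top. b * (1 / C) \<le> slope b * tp b"
    using eventually_center[of 0]
  proof eventually_elim
    case (elim b)
    then have x: "tp b > x0" using x0 by linarith
    have "b / tp b \<le> C * slope b" using V'_lower[OF x] elim by simp
    then show ?case using elim C by (simp add: field_simps)
  qed
qed

lemma eventually_wall:
  "\<forall>\<^sub>F b in at_top. \<exists>eps M1 c. wall (\<lambda>x. V x - b) V' eps M1 c (2 * tp b) (sqrt (slope b / L))"
proof -
  obtain M1 where M1: "M1 \<ge> 0" "\<And>b x. b \<ge> 0 \<Longrightarrow> x \<le> x0 \<Longrightarrow> \<bar>V' x\<bar> \<le> \<epsilon>0 * (V x - b)\<^sup>2 + M1"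
    using V'_bound_left[of x0] by blast
  \<comment> \<open>With Y the product of slope and turning point, the entries give Y <= Y^2 and
    then the hypotheses \<open>b1\<close> and \<open>b2\<close> of
    \<open>shifted_wall\<close>.\<close>
  define Z where "Z = max 1 (max (2 * M1 * L\<^sup>2 / (1 - \<epsilon>0)) (2 * L / (1 - \<epsilon>0)))"
  have "\<forall>\<^sub>F b in at_top. Z \<le> slope b * tp b" using slope_tp_lim unfolding filterlim_at_top by blast
  then show ?thesis
    using eventually_center[of 0] eventually_ge_at_top[of 0]
  proof eventually_elim
    case (elim b)
    have p: "tp b > 2 * x0" "tp b > 0" using elim by auto
    have big: "V x \<le> V (tp b) / exp (C * ln 4)" if "x \<le> x0" for x using elim that by blast
    have L0: "L > 0" using L_ge by linarith
    let ?Y = "slope b * tp b"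
    have Y: "1 \<le> ?Y" "2 * M1 * L\<^sup>2 / (1 - \<epsilon>0) \<le> ?Y" "2 * L / (1 - \<epsilon>0) \<le> ?Y" using elim(1) by (auto simp: Z_def)
    have Y2: "?Y \<le> ?Y\<^sup>2" using Y(1) mult_left_mono[of 1 ?Y ?Y] by (simp add: power2_eq_square)
    have b1: "M1 \<le> (1 - \<epsilon>0) / 2 * (slope b * tp b / L)\<^sup>2"
    proof -
      have "2 * M1 * L\<^sup>2 / (1 - \<epsilon>0) \<le> ?Y\<^sup>2" using Y(2) Y2 by linarith
      then show ?thesis using L0 \<epsilon>0 by (simp add: power_divide field_simps)
    qed
    have b2: "slope b / L \<le> (1 - \<epsilon>0) / 2 * (slope b * tp b / L)\<^sup>2"
    proof -
      have s: "slope b > 0" using V'_pos[of "tp b"] p x0 by linarith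
      have "slope b * (2 * L / (1 - \<epsilon>0)) \<le> slope b * ?Y" using Y(3) s by (intro mult_left_mono) auto
      also have "\<dots> \<le> (slope b * tp b) * (slope b * tp b)"
        using elim(2) s mult_left_mono[of 1 "tp b" "slope b"] by (simp add: mult_ac mult_left_mono)
      finally have "slope b * (2 * L / (1 - \<epsilon>0)) \<le> (slope b * tp b)\<^sup>2" by (simp only: power2_eq_square)
      then show ?thesis using L0 \<epsilon>0 by (simp add: power_divide power2_eq_square field_simps)
    qed
    have left: "\<bar>V' x\<bar> \<le> \<epsilon>0 * (V x - V (tp b))\<^sup>2 + M1" if "x \<le> x0" for x
      using M1(2)[of b x] that elim by simp
    show ?case using shifted_wall[OF p big left b1 b2] elim by simp
  qed
qed

lemma eventually_slope_pos: "\<forall>\<^sub>F b in at_top. slope b > 0"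
  using eventually_center[of 0] by eventually_elim (use V'_pos x0 in force)

text \<open>At a = 0 the upper bound from the cancelling cross terms and the lower bound from the
  test pair (0, k) coincide.\<close>

lemma resolvent_axis:
  assumes "m > 0"
  shows "\<forall>\<^sub>F b in at_top. Complex 0 b \<in> resolvent_set (dirac m V) \<and> resolvent_norm m V (Complex 0 b) = 1 / m"
  using eventually_wall
proof eventually_elim
  case (elim b)
  then obtain eps M1 c where "wall (\<lambda>x. V x - b) V' eps M1 c (2 * tp b) (sqrt (slope b / L))" by blast
  then interpret wall "\<lambda>x. V x - b" V' eps M1 c "2 * tp b" "sqrt (slope b / L)" .
  have "V x = b + (V x - b)" for x by simp
  from resolvent_small_shift[OF this, of 0 m] assms show ?case by (simp add: antisym)
qed

text \<open>A vanishing slope forces a to 0, and once |a| < m / 2 both 1 / (m - |a|) and 1 / (m +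
  |a|) deviate from 1 / m by a multiple of |a|, which is at most A times the root of the
  slope.\<close>

lemma resolvent_flat:
  assumes m: "m > 0" and lim: "(V' \<longlongrightarrow> 0) at_top" and a: "\<forall>\<^sub>F b in at_top. \<bar>a b\<bar> \<le> A * sqrt (slope b)"
  shows "\<forall>\<^sub>F b in at_top. Complex (a b) b \<in> resolvent_set (dirac m V) \<and>
      \<bar>m * resolvent_norm m V (Complex (a b) b) - 1\<bar> \<le> 2 / m * A * sqrt (slope b)"
    and "(a \<longlongrightarrow> 0) at_top"
proof -
  have "((\<lambda>b. slope b) \<longlongrightarrow> 0) at_top" using filterlim_compose[OF lim tp_lim] .
  then have "((\<lambda>b. A * sqrt (slope b)) \<longlongrightarrow> A * sqrt 0) at_top" by (intro tendsto_intros)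
  then have l0: "((\<lambda>b. A * sqrt (slope b)) \<longlongrightarrow> 0) at_top" by simp
  show a0: "(a \<longlongrightarrow> 0) at_top"
    by (rule Lim_null_comparison[OF _ l0]) (use a in simp)
  have "\<forall>\<^sub>F b in at_top. \<bar>a b\<bar> < m / 2"
    using tendstoD[OF a0, of "m / 2"] m by (simp add: dist_real_def)
  then show "\<forall>\<^sub>F b in at_top. Complex (a b) b \<in> resolvent_set (dirac m V) \<and>
      \<bar>m * resolvent_norm m V (Complex (a b) b) - 1\<bar> \<le> 2 / m * A * sqrt (slope b)"
    using eventually_wall a
  proof eventually_elim
    case (elim b)
    then obtain eps M1 c where "wall (\<lambda>x. V x - b) V' eps M1 c (2 * tp b) (sqrt (slope b / L))" by blast
    then interpret wall "\<lambda>x. V x - b" V' eps M1 c "2 * tp b" "sqrt (slope b / L)" .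
    have am: "\<bar>a b\<bar> < m" using elim m by linarith
    define RN where "RN = resolvent_norm m V (Complex (a b) b)"
    have "V x = b + (V x - b)" for x by simp
    note r = resolvent_small_shift[OF this am, folded RN_def]
    have "m * RN \<le> m * (1 / (m - \<bar>a b\<bar>))" using r(3) m by (intro mult_left_mono) auto
    then have "m * RN - 1 \<le> m * (1 / (m - \<bar>a b\<bar>)) - 1" by simp
    also have "\<dots> = \<bar>a b\<bar> / (m - \<bar>a b\<bar>)" using am by (simp add: field_simps)
    also have "\<dots> \<le> \<bar>a b\<bar> / (m / 2)" using elim m by (intro divide_left_mono mult_pos_pos) auto
    finally have 1: "m * RN - 1 \<le> 2 / m * \<bar>a b\<bar>" by (simp add: mult.commute)
    have "m * (1 / (m + \<bar>a b\<bar>)) \<le> m * RN" using r(2) m by (intro mult_left_mono) auto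
    then have "1 - m * RN \<le> 1 - m * (1 / (m + \<bar>a b\<bar>))" by simp
    also have "\<dots> = \<bar>a b\<bar> / (m + \<bar>a b\<bar>)" using m by (simp add: field_simps)
    also have "\<dots> \<le> \<bar>a b\<bar> / (m / 2)" using m by (intro divide_left_mono mult_pos_pos) auto
    finally have 2: "1 - m * RN \<le> 2 / m * \<bar>a b\<bar>" by (simp add: mult.commute)
    have "2 / m * \<bar>a b\<bar> \<le> 2 / m * (A * sqrt (slope b))" using elim m by (intro mult_left_mono) auto
    then have "\<bar>m * RN - 1\<bar> \<le> 2 / m * A * sqrt (slope b)" using 1 2 by (simp add: abs_le_iff mult.assoc)
    then show ?case using r(1) by (simp add: RN_def)
  qed
qed

text \<open>Both errors of \<open>resolvent_large_gap\<close> are at most multiples of slope^(-1/2):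
  the linearization constant H / p is at most H as p > 1, and the gap is the root of slope /
  L.\<close>

lemma resolvent_steep:
  assumes m: "m > 0" and A: "A \<ge> 0" and lim: "filterlim V' at_top at_top"
    and a: "\<forall>\<^sub>F b in at_top. \<bar>a b\<bar> \<le> A * sqrt (slope b)"
  shows "\<exists>K. \<forall>\<^sub>F b in at_top. Complex (a b) b \<in> resolvent_set (dirac m V) \<and>
      \<bar>m * resolvent_norm m V (Complex (a b) b) * exp (- ((a b)\<^sup>2 / slope b)) - 1\<bar> \<le> K / sqrt (slope b)"
proof -
  define H where "H = L\<^sup>2 + L + 2"
  define q0 where "q0 = exp (- A\<^sup>2) / 2"
  define S where "S = m * (2 + 1 / q0) * sqrt L"
  have q0: "q0 > 0" by (simp add: q0_def)
  have L0: "L > 0" using L_ge by linarith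
  have H0: "H \<ge> 0" using L0 by (simp add: H_def)
  have S0: "S \<ge> 0" using m q0 L0 by (simp add: S_def)
  have "filterlim slope at_top at_top" using filterlim_compose[OF lim tp_lim] .
  then have "filterlim (\<lambda>b. sqrt (slope b)) at_top at_top" by (rule filterlim_compose[OF sqrt_at_top])
  then have "\<forall>\<^sub>F b in at_top. max 1 (max (A * H / q0) (4 * S)) \<le> sqrt (slope b)"
    unfolding filterlim_at_top by blast
  then have "\<forall>\<^sub>F b in at_top. Complex (a b) b \<in> resolvent_set (dirac m V) \<and>
      \<bar>m * resolvent_norm m V (Complex (a b) b) * exp (- ((a b)\<^sup>2 / slope b)) - 1\<bar> \<le> ((A * H + 8 * S) / q0) / sqrt (slope b)"
    using eventually_wall a eventually_center[of 0]
  proof eventually_elim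
    case (elim b)
    then obtain eps M1 c where "wall (\<lambda>x. V x - b) V' eps M1 c (2 * tp b) (sqrt (slope b / L))" by blast
    then interpret wall "\<lambda>x. V x - b" V' eps M1 c "2 * tp b" "sqrt (slope b / L)" .
    let ?s = "sqrt (slope b)"
    have s: "?s \<ge> 1" "A * H / q0 \<le> ?s" "4 * S \<le> ?s" using elim(1) by auto
    have \<rho>: "slope b > 0" using s(1) by (metis less_le_trans real_sqrt_gt_0_iff zero_less_one)
    have p: "tp b > 2 * x0" "tp b > 0" "tp b > 1" using elim by auto
    have big: "V x \<le> V (tp b) / exp (C * ln 4)" if "x \<le> x0" for x using elim that by blast
    define \<eta> where "\<eta> = H / tp b"
    have \<eta>: "\<eta> \<ge> 0" "\<eta> \<le> H" using H0 p by (auto simp: \<eta>_def pos_divide_le_eq mult_left_mono[of 1 "tp b" H, simplified])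
    have lin: "\<bar>(V x - b) - slope b * (x - tp b)\<bar> \<le> \<eta> * ((x - tp b) * (V x - b))" for x
      using linearization[OF p(1,2) big, of x] elim by (simp add: \<eta>_def H_def)
    have \<eta>s: "A * \<eta> / ?s \<le> A * H / ?s" using \<eta> A s by (intro divide_right_mono mult_left_mono) auto
    have g: "m * ((2 + 1 / q0) / sqrt (slope b / L)) = S / ?s"
      using L0 \<rho> by (simp add: S_def real_sqrt_divide)
    have s1: "A * \<eta> / ?s \<le> q0"
    proof -
      have "A * H \<le> q0 * ?s" using s(2) q0 by (simp add: pos_divide_le_eq mult.commute)
      then have "A * H / ?s \<le> q0" using s(1) by (simp add: pos_divide_le_eq)
      then show ?thesis using \<eta>s by linarith
    qed
    have s2: "4 * (m * ((2 + 1 / q0) / sqrt (slope b / L))) \<le> 1"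
      unfolding g using s by (simp add: pos_divide_le_eq)
    have V: "V x = b + (V x - b)" for x by simp
    note r = resolvent_large_gap[OF V m \<rho> \<eta>(1) lin elim(3) q0_def s1 s2]
    have "(A * \<eta> / ?s + 8 * (m * ((2 + 1 / q0) / sqrt (slope b / L)))) / q0 \<le> (A * H / ?s + 8 * (S / ?s)) / q0"
      unfolding g using \<eta>s q0 by (intro divide_right_mono) auto
    also have "\<dots> = ((A * H + 8 * S) / q0) / ?s" by (simp add: add_divide_distrib mult.commute)
    finally show ?case using r by linarith
  qed
  then show ?thesis by blast
qed

text \<open>For turning points beyond a threshold X, V - b satisfies both hypotheses of
  \<open>order_one_bound\<close>: dominance of the square at distance r >= rmin, and closeness to
  the linear model within 2 R.\<close>

lemma resolvent_linear:
  assumes m: "m > 0" and A: "A \<ge> 0" and c: "c1 > 0" "\<forall>\<^sub>F x in at_top. c1 \<le> V' x \<and> V' x \<le> c2"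
    and a: "\<forall>\<^sub>F b in at_top. \<bar>a b\<bar> \<le> A"
  shows "\<exists>D>0. \<forall>\<^sub>F b in at_top. Complex (a b) b \<in> resolvent_set (dirac m V) \<and>
     1 / (m + A) \<le> resolvent_norm m V (Complex (a b) b) \<and> resolvent_norm m V (Complex (a b) b) \<le> D"
proof -
  have L0: "L > 0" using L_ge by linarith
  obtain Y0 where Y0: "\<And>x. x \<ge> Y0 \<Longrightarrow> c1 \<le> V' x \<and> V' x \<le> c2" using c(2) unfolding eventually_at_top_linorder by blast
  define Y where "Y = max Y0 x0"
  have Y: "\<And>x. x \<ge> Y \<Longrightarrow> c1 \<le> V' x \<and> V' x \<le> c2" "Y \<ge> 0" using Y0 x0 by (auto simp: Y_def)
  have c2: "c2 > 0" using Y(1)[of Y] c(1) by linarith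
  define \<kappa> where "\<kappa> = c1 / (2 * L)"
  have \<kappa>: "\<kappa> > 0" "c1 / L = 2 * \<kappa>" using c(1) L0 by (auto simp: \<kappa>_def)
  \<comment> \<open>Ensures c2 <= 3 (\<kappa> r)^2 for r >= rmin, so that (2 \<kappa> r)^2 minus
    |V'| still leaves (\<kappa> r)^2.\<close>
  define rmin where "rmin = max 1 (c2 / (3 * \<kappa>\<^sup>2))"
  obtain D R \<delta> where D: "D > 0" "R \<ge> rmin" "\<delta> > 0" and main: "\<And>B B' eps M1 \<rho> p a. C1_potential B B' eps M1 \<Longrightarrow> c1 \<le> \<rho> \<Longrightarrow> \<rho> \<le> c2 \<Longrightarrow> \<bar>a\<bar> \<le> A \<Longrightarrow>
     (\<And>r x. rmin \<le> r \<Longrightarrow> r \<le> R \<Longrightarrow> r \<le> \<bar>x - p\<bar> \<Longrightarrow> (\<kappa> * r)\<^sup>2 \<le> (B x)\<^sup>2 - \<bar>B' x\<bar>) \<Longrightarrow>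
     (\<And>x. \<bar>x - p\<bar> \<le> 2 * R \<Longrightarrow> \<bar>B x - \<rho> * (x - p)\<bar> \<le> \<delta>) \<Longrightarrow>
     dsys_bound B (\<i> * of_real a) (- \<i> * of_real m) (- \<i> * of_real m) D"
    using order_one_bound[OF m A c(1) \<kappa>(1), of rmin c2] by blast
  have R1: "R \<ge> 1" using D(2) by (simp add: rmin_def)
  obtain M1 where M1: "M1 \<ge> 0" "\<And>b x. b \<ge> 0 \<Longrightarrow> x \<le> Y \<Longrightarrow> \<bar>V' x\<bar> \<le> \<epsilon>0 * (V x - b)\<^sup>2 + M1"
    using V'_bound_left[of Y] by blast
  \<comment> \<open>In order: Y lies below p / 2; the ball of radius 2 R lies in [p / 2, 2 p]; the
    Taylor error on it is at most \<delta>; and left of Y the square outweighs M1 + (\<kappa>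
    R)^2.\<close>
  define X where "X = max (max (2 * Y) (4 * R)) (max (L * c2 * (2 * R)\<^sup>2 / \<delta>) ((M1 + (\<kappa> * R)\<^sup>2) / ((1 - \<epsilon>0) * (2 * \<kappa>)\<^sup>2)))"
  have "\<forall>\<^sub>F b in at_top. Complex (a b) b \<in> resolvent_set (dirac m V) \<and>
     1 / (m + A) \<le> resolvent_norm m V (Complex (a b) b) \<and> resolvent_norm m V (Complex (a b) b) \<le> D"
    using eventually_wall a eventually_center[of X] eventually_ge_at_top[of 0]
  proof eventually_elim
    case (elim b)
    then obtain eps M1' c where w: "wall (\<lambda>x. V x - b) V' eps M1' c (2 * tp b) (sqrt (slope b / L))" by blast
    then interpret W: wall "\<lambda>x. V x - b" V' eps M1' c "2 * tp b" "sqrt (slope b / L)" .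
    have p: "tp b > 2 * x0" "tp b > 0" "tp b > 1" "tp b > X" and Vb: "V (tp b) = b" using elim by auto
    have big: "V x \<le> V (tp b) / exp (C * ln 4)" if "x \<le> x0" for x using elim that by blast
    have X: "2 * Y < tp b" "4 * R < tp b" "L * c2 * (2 * R)\<^sup>2 / \<delta> < tp b"
      "(M1 + (\<kappa> * R)\<^sup>2) / ((1 - \<epsilon>0) * (2 * \<kappa>)\<^sup>2) < tp b" using p(4) by (auto simp: X_def)
    have \<rho>: "c1 \<le> slope b" "slope b \<le> c2" using Y(1)[of "tp b"] X(1) Y(2) by auto
    have \<rho>L: "2 * \<kappa> \<le> slope b / L" unfolding \<kappa>(2)[symmetric] using \<rho> L0 by (intro divide_right_mono) auto
    have far: "2 * \<kappa> * tp b \<le> \<bar>V x - b\<bar>" if "x \<ge> 2 * tp b \<or> x \<le> tp b / 2" for x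
    proof -
      have "2 * \<kappa> * tp b \<le> slope b / L * tp b" using \<rho>L p by (intro mult_right_mono) auto
      then show ?thesis using outside(1)[OF p(1,2) big, of x] outside(2)[OF p(1,2) big, of x] that Vb by auto
    qed
    have bd: "dsys_bound (\<lambda>x. V x - b) (\<i> * of_real a') (- \<i> * of_real m) (- \<i> * of_real m) D" if a': "\<bar>a'\<bar> \<le> A" for a'
    proof (rule main[OF wall.axioms(1)[OF w] \<rho> a'])
      fix r x assume r: "rmin \<le> r" "r \<le> R" "r \<le> \<bar>x - tp b\<bar>"
      have r1: "r \<ge> 1" "c2 / (3 * \<kappa>\<^sup>2) \<le> r" using r(1) by (auto simp: rmin_def)
      show "(\<kappa> * r)\<^sup>2 \<le> (V x - b)\<^sup>2 - \<bar>V' x\<bar>"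
      proof (cases "x \<ge> Y")
        case True
        have "2 * \<kappa> * r \<le> \<bar>V x - b\<bar>"
        proof (cases "tp b / 2 \<le> x \<and> x \<le> 2 * tp b")
          case True
          have "2 * \<kappa> * r \<le> slope b / L * \<bar>x - tp b\<bar>" using \<rho>L r r1 \<kappa> by (intro mult_mono) auto
          also have "\<dots> \<le> 2 * (slope b / L) * \<bar>x - tp b\<bar>" using \<rho>L \<kappa> by (intro mult_right_mono) auto
          also have "\<dots> \<le> \<bar>V x - b\<bar>" using taylor(3)[OF p(1,2) big, of x] True Vb by simp
          finally show ?thesis .
        next
          case False
          then have "2 * \<kappa> * tp b \<le> \<bar>V x - b\<bar>" by (intro far) auto
          moreover have "2 * \<kappa> * r \<le> 2 * \<kappa> * tp b" using r X(2) R1 \<kappa> by (intro mult_left_mono) auto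
          ultimately show ?thesis by linarith
        qed
        then have "(2 * \<kappa> * r)\<^sup>2 \<le> (V x - b)\<^sup>2" using \<kappa> r1 by (subst abs_le_square_iff[symmetric]) auto
        moreover have "c2 \<le> 3 * (\<kappa> * r)\<^sup>2"
        proof -
          have "c2 \<le> 3 * \<kappa>\<^sup>2 * r" using r1(2) \<kappa> by (simp add: pos_divide_le_eq mult.commute)
          also have "\<dots> \<le> 3 * \<kappa>\<^sup>2 * r\<^sup>2" using r1(1) by (intro mult_left_mono) (auto simp: power2_eq_square)
          finally show ?thesis by (simp add: power_mult_distrib)
        qed
        moreover have "\<bar>V' x\<bar> \<le> c2" using Y(1)[OF True] c(1) by auto
        moreover have "(2 * \<kappa> * r)\<^sup>2 = 4 * (\<kappa> * r)\<^sup>2" by (simp add: power_mult_distrib)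
        ultimately show ?thesis by linarith
      next
        \<comment> \<open>Left of Y the slope is not controlled by c2. There x is below p / 2, so V
          - b is of size p, and the quadratic bound on V' with uniform M1 suffices.\<close>
        case False
        then have "2 * \<kappa> * tp b \<le> \<bar>V x - b\<bar>" using X(1) by (intro far) auto
        then have "(2 * \<kappa> * tp b)\<^sup>2 \<le> (V x - b)\<^sup>2" using \<kappa> p by (subst abs_le_square_iff[symmetric]) auto
        then have 1: "(1 - \<epsilon>0) * (2 * \<kappa> * tp b)\<^sup>2 \<le> (1 - \<epsilon>0) * (V x - b)\<^sup>2" using \<epsilon>0 by (intro mult_left_mono) auto
        have 2: "\<bar>V' x\<bar> \<le> \<epsilon>0 * (V x - b)\<^sup>2 + M1" using M1(2)[of b x] False elim by simp
        have 3: "M1 + (\<kappa> * R)\<^sup>2 \<le> (1 - \<epsilon>0) * (2 * \<kappa> * tp b)\<^sup>2"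
        proof -
          have pos: "(1 - \<epsilon>0) * (2 * \<kappa>)\<^sup>2 > 0" using \<epsilon>0 \<kappa> by simp
          have "M1 + (\<kappa> * R)\<^sup>2 \<le> tp b * ((1 - \<epsilon>0) * (2 * \<kappa>)\<^sup>2)" using X(4) pos by (simp add: pos_divide_less_eq)
          also have "\<dots> \<le> (tp b)\<^sup>2 * ((1 - \<epsilon>0) * (2 * \<kappa>)\<^sup>2)"
            using p(3) pos by (intro mult_right_mono) (auto simp: power2_eq_square)
          finally show ?thesis by (simp add: power_mult_distrib mult_ac)
        qed
        have 4: "(\<kappa> * r)\<^sup>2 \<le> (\<kappa> * R)\<^sup>2" using r r1 \<kappa> by (intro power_mono mult_left_mono) auto
        have "(1 - \<epsilon>0) * (V x - b)\<^sup>2 = (V x - b)\<^sup>2 - \<epsilon>0 * (V x - b)\<^sup>2" by (simp add: algebra_simps)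
        then show ?thesis using 1 2 3 4 by linarith
      qed
    next
      fix x assume x: "\<bar>x - tp b\<bar> \<le> 2 * R"
      then have "tp b / 2 \<le> x" "x \<le> 2 * tp b" using X(2) by (auto simp: abs_le_iff)
      from taylor(1)[OF p(1,2) big this] have "\<bar>V x - b - slope b * (x - tp b)\<bar> \<le> L * slope b / tp b * (x - tp b)\<^sup>2"
        using Vb by simp
      also have "\<dots> \<le> L * c2 / tp b * (2 * R)\<^sup>2"
      proof (rule mult_mono)
        show "L * slope b / tp b \<le> L * c2 / tp b" using \<rho> L0 p by (intro divide_right_mono mult_left_mono) auto
        show "(x - tp b)\<^sup>2 \<le> (2 * R)\<^sup>2" using x R1 by (subst abs_le_square_iff[symmetric]) auto
      qed (use L0 c2 p in auto)
      also have "\<dots> \<le> \<delta>"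
      proof -
        have "L * c2 * (2 * R)\<^sup>2 \<le> \<delta> * tp b" using X(3) D(3) by (simp add: pos_divide_less_eq mult.commute)
        then show ?thesis using p by (simp add: pos_divide_le_eq)
      qed
      finally show "\<bar>V x - b - slope b * (x - tp b)\<bar> \<le> \<delta>" .
    qed
    have V: "V x = b + (V x - b)" for x by simp
    have "\<bar>s * a b\<bar> \<le> A" if "0 \<le> s" "s \<le> 1" for s
      using that elim(2) mult_left_le_one_le[of "\<bar>a b\<bar>" s] by (simp add: abs_mult)
    then have surj: "dsys_surj (\<lambda>x. V x - b) (\<i> * of_real (a b)) (- \<i> * of_real m) (- \<i> * of_real m)"
      by (intro W.dsys_surj_shift[OF m D(1)] bd)
    note r = W.resolvent_bounds(1,2)[OF V surj bd[OF elim(2)] less_imp_le[OF D(1)]]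
      W.resolvent_norm_lower[OF V m surj bd[OF elim(2)] less_imp_le[OF D(1)]]
    have "1 / (m + A) \<le> 1 / (m + \<bar>a b\<bar>)" using elim(2) m by (intro divide_left_mono mult_pos_pos) auto
    then show ?case using r by linarith
  qed
  then show ?thesis using D(1) by blast
qed

end

section \<open>The asymptotic statements\<close>

theorem corollary2p9:
  fixes m :: real and V a :: "real \<Rightarrow> real"
  assumes "m > 0"
    and "admissible_potential V"
    and "(\<lambda>b. a b * deriv V (turning_point V b) powr (-1/2)) \<in> O[at_top](\<lambda>_. 1)"
  shows
    "(\<forall>\<^sub>F b in at_top. \<exists>!x. 0 < x \<and> V x = b) \<and>
     \<comment> \<open>(i)\<close>
     ((\<forall>\<^sub>F b in at_top. Complex 0 b \<in> resolvent_set (dirac m V)) \<and>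
      (\<exists>r \<in> O[at_top](\<lambda>b. turning_point V b powr (-1/2) + b powr (-1/2)).
         \<forall>\<^sub>F b in at_top. resolvent_norm m V (Complex 0 b) = 1 / m * (1 + r b))) \<and>
     \<comment> \<open>(ii)\<close>
     (filterlim (deriv V) at_top at_top \<longrightarrow>
        ((\<forall>\<^sub>F b in at_top. Complex (a b) b \<in> resolvent_set (dirac m V)) \<and>
         (\<exists>r \<in> O[at_top](\<lambda>b. turning_point V b powr (-1/2)).
          \<exists>s \<in> O[at_top](\<lambda>b. deriv V (turning_point V b) powr (-1/2)).
            \<forall>\<^sub>F b in at_top. resolvent_norm m V (Complex (a b) b) =
              1 / m * exp ((a b)\<^sup>2 / deriv V (turning_point V b)) * (1 + r b + s b))) \<and>
        (\<forall>\<epsilon>>0. \<forall>c :: real \<Rightarrow> real.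
           (\<forall>\<^sub>F b in at_top. (c b)\<^sup>2 = deriv V (turning_point V b) * ln (m / \<epsilon>)) \<longrightarrow>
           (\<forall>\<^sub>F b in at_top. Complex (c b) b \<in> resolvent_set (dirac m V)) \<and>
           (\<exists>r \<in> O[at_top](\<lambda>b. turning_point V b powr (-1/2)).
            \<exists>s \<in> O[at_top](\<lambda>b. deriv V (turning_point V b) powr (-1/2)).
              \<forall>\<^sub>F b in at_top. resolvent_norm m V (Complex (c b) b) = 1 / \<epsilon> * (1 + r b + s b)))) \<and>
     \<comment> \<open>(iii)\<close>
     (deriv V \<in> \<Theta>[at_top](\<lambda>_. 1) \<longrightarrow>
        (\<forall>\<^sub>F b in at_top. Complex (a b) b \<in> resolvent_set (dirac m V)) \<and>
        (\<lambda>b. resolvent_norm m V (Complex (a b) b)) \<in> \<Theta>[at_top](\<lambda>_. 1) \<and>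
        a \<in> O[at_top](\<lambda>_. 1)) \<and>
     \<comment> \<open>(iv)\<close>
     ((deriv V \<longlongrightarrow> 0) at_top \<longrightarrow>
        (\<forall>\<^sub>F b in at_top. Complex (a b) b \<in> resolvent_set (dirac m V)) \<and>
        (\<exists>r \<in> O[at_top](\<lambda>b. b powr (-1/2)).
         \<exists>s \<in> O[at_top](\<lambda>b. deriv V (turning_point V b) powr (1/2)).
           \<forall>\<^sub>F b in at_top. resolvent_norm m V (Complex (a b) b) = 1 / m * (1 + r b + s b)) \<and>
        a \<in> o[at_top](\<lambda>_. 1))"
proof -
  note m = assms(1) and a_O = assms(3)
  obtain V'' \<epsilon>0 M0 x0 M C where "potential V (deriv V) V'' \<epsilon>0 M0 x0 M C"
    using potential_of_admissible[OF assms(2)] by blast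
  then interpret potential V "deriv V" V'' \<epsilon>0 M0 x0 M C .
  have powr_half: "x powr (-1/2) = 1 / sqrt x" if "x > 0" for x :: real
    using that powr_minus_divide[of x "1/2"] by (simp add: powr_half_sqrt)
  have zero: "(\<lambda>b. 0) \<in> O[at_top](f)" for f :: "real \<Rightarrow> real" by simp
  obtain A where A: "A > 0" and aA: "\<forall>\<^sub>F b in at_top. \<bar>a b\<bar> \<le> A * sqrt (slope b)"
  proof -
    obtain A where A: "A > 0" "\<forall>\<^sub>F b in at_top. norm (a b * slope b powr (-1/2)) \<le> A * norm (1::real)"
      using landau_o.bigE[OF a_O] by blast
    have "\<forall>\<^sub>F b in at_top. \<bar>a b\<bar> \<le> A * sqrt (slope b)"
      using A(2) eventually_slope_pos
    proof eventually_elim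
      case (elim b)
      then have "\<bar>a b\<bar> / sqrt (slope b) \<le> A" using powr_half[of "slope b"] by (simp add: abs_mult)
      then show ?case using elim(2) by (simp add: pos_divide_le_eq)
    qed
    then show ?thesis using that A(1) by blast
  qed
  have turning: "\<forall>\<^sub>F b in at_top. \<exists>!x. 0 < x \<and> V x = b"
    using eventually_turning_point[of 0] by (rule eventually_mono) blast

  have i: "(\<forall>\<^sub>F b in at_top. Complex 0 b \<in> resolvent_set (dirac m V)) \<and>
      (\<exists>r \<in> O[at_top](\<lambda>b. tp b powr (-1/2) + b powr (-1/2)).
         \<forall>\<^sub>F b in at_top. resolvent_norm m V (Complex 0 b) = 1 / m * (1 + r b))"
  proof
    show "\<forall>\<^sub>F b in at_top. Complex 0 b \<in> resolvent_set (dirac m V)"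
      using resolvent_axis[OF m] by (rule eventually_mono) blast
    show "\<exists>r \<in> O[at_top](\<lambda>b. tp b powr (-1/2) + b powr (-1/2)).
         \<forall>\<^sub>F b in at_top. resolvent_norm m V (Complex 0 b) = 1 / m * (1 + r b)"
      \<comment> \<open>Witness r = 0, since the norm is eventually exactly 1 / m.\<close>
      by (rule bexI[OF _ zero], use resolvent_axis[OF m] in \<open>rule eventually_mono\<close>) simp
  qed

  have steep: "(\<forall>\<^sub>F b in at_top. Complex (c b) b \<in> resolvent_set (dirac m V)) \<and>
      (\<lambda>b. m * resolvent_norm m V (Complex (c b) b) * exp (- ((c b)\<^sup>2 / slope b)) - 1) \<in> O[at_top](\<lambda>b. slope b powr (-1/2))"
    if lim: "filterlim (deriv V) at_top at_top" and c: "A' \<ge> 0" "\<forall>\<^sub>F b in at_top. \<bar>c b\<bar> \<le> A' * sqrt (slope b)" for c A'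
  proof -
    obtain K where K: "\<forall>\<^sub>F b in at_top. Complex (c b) b \<in> resolvent_set (dirac m V) \<and>
        \<bar>m * resolvent_norm m V (Complex (c b) b) * exp (- ((c b)\<^sup>2 / slope b)) - 1\<bar> \<le> K / sqrt (slope b)"
      using resolvent_steep[OF m c(1) lim c(2)] by blast
    have "\<forall>\<^sub>F b in at_top. norm (m * resolvent_norm m V (Complex (c b) b) * exp (- ((c b)\<^sup>2 / slope b)) - 1)
        \<le> K * norm (slope b powr (-1/2))"
      using K eventually_slope_pos
    proof eventually_elim
      case (elim b)
      then show ?case using powr_half[of "slope b"] by simp
    qed
    then have "(\<lambda>b. m * resolvent_norm m V (Complex (c b) b) * exp (- ((c b)\<^sup>2 / slope b)) - 1) \<in> O[at_top](\<lambda>b. slope b powr (-1/2))"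
      by (rule bigoI)
    moreover have "\<forall>\<^sub>F b in at_top. Complex (c b) b \<in> resolvent_set (dirac m V)"
      using K by (rule eventually_mono) blast
    ultimately show ?thesis by blast
  qed

  have ii1: "(\<forall>\<^sub>F b in at_top. Complex (a b) b \<in> resolvent_set (dirac m V)) \<and>
         (\<exists>r \<in> O[at_top](\<lambda>b. tp b powr (-1/2)). \<exists>s \<in> O[at_top](\<lambda>b. slope b powr (-1/2)).
            \<forall>\<^sub>F b in at_top. resolvent_norm m V (Complex (a b) b) =
              1 / m * exp ((a b)\<^sup>2 / slope b) * (1 + r b + s b))"
    if lim: "filterlim (deriv V) at_top at_top"
  proof
    note st = steep[OF lim less_imp_le[OF A] aA]
    then show "\<forall>\<^sub>F b in at_top. Complex (a b) b \<in> resolvent_set (dirac m V)" by blast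
    \<comment> \<open>The relative deviation itself serves as s, with r = 0; its order is the
      content of \<open>steep\<close>.\<close>
    have "resolvent_norm m V (Complex (a b) b) = 1 / m * exp ((a b)\<^sup>2 / slope b) *
         (1 + 0 + (m * resolvent_norm m V (Complex (a b) b) * exp (- ((a b)\<^sup>2 / slope b)) - 1))" for b
      using m by (simp add: exp_minus field_simps)
    then show "\<exists>r \<in> O[at_top](\<lambda>b. tp b powr (-1/2)). \<exists>s \<in> O[at_top](\<lambda>b. slope b powr (-1/2)).
            \<forall>\<^sub>F b in at_top. resolvent_norm m V (Complex (a b) b) =
              1 / m * exp ((a b)\<^sup>2 / slope b) * (1 + r b + s b)"
      by - (rule bexI[OF _ zero], rule bexI[OF _ conjunct2[OF st]], rule always_eventually, blast)
  qed

  have ii2: "(\<forall>\<^sub>F b in at_top. Complex (c b) b \<in> resolvent_set (dirac m V)) \<and>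
           (\<exists>r \<in> O[at_top](\<lambda>b. tp b powr (-1/2)). \<exists>s \<in> O[at_top](\<lambda>b. slope b powr (-1/2)).
              \<forall>\<^sub>F b in at_top. resolvent_norm m V (Complex (c b) b) = 1 / \<epsilon> * (1 + r b + s b))"
    if lim: "filterlim (deriv V) at_top at_top" and \<epsilon>: "\<epsilon> > 0"
      and c: "\<forall>\<^sub>F b in at_top. (c b)\<^sup>2 = slope b * ln (m / \<epsilon>)" for \<epsilon> c
  proof -
    \<comment> \<open>For \<epsilon> > m the condition on c would make a square negative as soon as
      the slope is positive, so a curve satisfying it exists only for \<epsilon> <= m.\<close>
    have l0: "ln (m / \<epsilon>) \<ge> 0"
    proof (rule ccontr)
      assume "\<not> ln (m / \<epsilon>) \<ge> 0"
      then have neg: "ln (m / \<epsilon>) < 0" by linarith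
      have "\<forall>\<^sub>F b :: real in at_top. False"
        using c eventually_slope_pos
      proof eventually_elim
        case (elim b)
        have "(c b)\<^sup>2 < 0" unfolding elim(1) by (rule mult_pos_neg[OF elim(2) neg])
        then show ?case by simp
      qed
      then show False by simp
    qed
    have "\<forall>\<^sub>F b in at_top. \<bar>c b\<bar> \<le> sqrt (ln (m / \<epsilon>)) * sqrt (slope b)"
      using c
    proof eventually_elim
      case (elim b)
      have "\<bar>c b\<bar> = sqrt ((c b)\<^sup>2)" by simp
      also have "\<dots> = sqrt (ln (m / \<epsilon>)) * sqrt (slope b)" unfolding elim by (simp add: real_sqrt_mult mult.commute)
      finally show ?case by simp
    qed
    note st = steep[OF lim real_sqrt_ge_zero[OF l0] this]
    have "\<forall>\<^sub>F b in at_top. resolvent_norm m V (Complex (c b) b) = 1 / \<epsilon> *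
         (1 + 0 + (m * resolvent_norm m V (Complex (c b) b) * exp (- ((c b)\<^sup>2 / slope b)) - 1))"
      using c eventually_slope_pos
    proof eventually_elim
      case (elim b)
      then have "exp (- ((c b)\<^sup>2 / slope b)) = \<epsilon> / m"
        using m \<epsilon> by (simp add: exp_minus)
      then show ?case using m \<epsilon> by simp
    qed
    then show ?thesis
      by - (rule conjI[OF conjunct1[OF st]], rule bexI[OF _ zero], rule bexI[OF _ conjunct2[OF st]])
  qed

  have iii: "(\<forall>\<^sub>F b in at_top. Complex (a b) b \<in> resolvent_set (dirac m V)) \<and>
        (\<lambda>b. resolvent_norm m V (Complex (a b) b)) \<in> \<Theta>[at_top](\<lambda>_. 1) \<and> a \<in> O[at_top](\<lambda>_. 1)"
    if th: "deriv V \<in> \<Theta>[at_top](\<lambda>_. 1)"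
  proof -
    obtain c2 where c2: "c2 > 0" "\<forall>\<^sub>F x in at_top. norm (deriv V x) \<le> c2 * norm (1::real)"
      using landau_o.bigE[OF bigthetaD1[OF th]] by blast
    obtain c1 where c1: "c1 > 0" "\<forall>\<^sub>F x in at_top. norm (deriv V x) \<ge> c1 * norm (1::real)"
      using landau_omega.bigE[OF bigthetaD2[OF th]] by blast
    have c12: "\<forall>\<^sub>F x in at_top. c1 \<le> deriv V x \<and> deriv V x \<le> c2"
      using c1(2) c2(2) eventually_gt_at_top[of x0] by eventually_elim (use V'_pos in force)
    have "\<forall>\<^sub>F b in at_top. slope b \<le> c2"
      using eventually_compose_filterlim[OF c12 tp_lim] by (rule eventually_mono) blast
    then have aB: "\<forall>\<^sub>F b in at_top. \<bar>a b\<bar> \<le> A * sqrt c2"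
      using aA
    proof eventually_elim
      case (elim b)
      have "A * sqrt (slope b) \<le> A * sqrt c2" using A elim(1) by (intro mult_left_mono) auto
      then show ?case using elim(2) by linarith
    qed
    have B0: "A * sqrt c2 \<ge> 0" using A c2 by simp
    obtain D where D: "D > 0" and ev: "\<forall>\<^sub>F b in at_top. Complex (a b) b \<in> resolvent_set (dirac m V) \<and>
       1 / (m + A * sqrt c2) \<le> resolvent_norm m V (Complex (a b) b) \<and> resolvent_norm m V (Complex (a b) b) \<le> D"
      using resolvent_linear[OF m B0 c1(1) c12 aB] by blast
    have E0: "1 / (m + A * sqrt c2) > 0" using m B0 by simp
    have "(\<lambda>b. resolvent_norm m V (Complex (a b) b)) \<in> O[at_top](\<lambda>_. 1)"
    proof (rule bigoI[where c = D])
      show "\<forall>\<^sub>F b in at_top. norm (resolvent_norm m V (Complex (a b) b)) \<le> D * norm (1::real)"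
        using ev
      proof eventually_elim
        case (elim b)
        have "resolvent_norm m V (Complex (a b) b) \<ge> 0" using elim E0 by linarith
        then show ?case using elim by simp
      qed
    qed
    moreover have "(\<lambda>b. resolvent_norm m V (Complex (a b) b)) \<in> \<Omega>[at_top](\<lambda>_. 1)"
    proof (rule landau_omega.bigI[OF E0])
      show "\<forall>\<^sub>F b in at_top. norm (resolvent_norm m V (Complex (a b) b)) \<ge> 1 / (m + A * sqrt c2) * norm (1::real)"
        using ev
      proof eventually_elim
        case (elim b)
        have "resolvent_norm m V (Complex (a b) b) \<ge> 0" using elim E0 by linarith
        then show ?case using elim by simp
      qed
    qed
    moreover have "a \<in> O[at_top](\<lambda>_. 1)"
      by (rule bigoI[where c = "A * sqrt c2"], use aB in eventually_elim) auto
    moreover have "\<forall>\<^sub>F b in at_top. Complex (a b) b \<in> resolvent_set (dirac m V)"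
      using ev by (rule eventually_mono) blast
    ultimately show ?thesis by (auto intro: bigthetaI)
  qed

  have iv: "(\<forall>\<^sub>F b in at_top. Complex (a b) b \<in> resolvent_set (dirac m V)) \<and>
        (\<exists>r \<in> O[at_top](\<lambda>b. b powr (-1/2)). \<exists>s \<in> O[at_top](\<lambda>b. slope b powr (1/2)).
           \<forall>\<^sub>F b in at_top. resolvent_norm m V (Complex (a b) b) = 1 / m * (1 + r b + s b)) \<and>
        a \<in> o[at_top](\<lambda>_. 1)"
    if lim: "(deriv V \<longlongrightarrow> 0) at_top"
  proof (intro conjI)
    note fl = resolvent_flat[OF m lim aA]
    show "\<forall>\<^sub>F b in at_top. Complex (a b) b \<in> resolvent_set (dirac m V)"
      using fl(1) by (rule eventually_mono) blast
    show "a \<in> o[at_top](\<lambda>_. 1)" by (rule smalloI_tendsto) (use fl(2) in auto)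
    have s: "(\<lambda>b. m * resolvent_norm m V (Complex (a b) b) - 1) \<in> O[at_top](\<lambda>b. slope b powr (1/2))"
    proof (rule bigoI[where c = "2 / m * A"])
      show "\<forall>\<^sub>F b in at_top. norm (m * resolvent_norm m V (Complex (a b) b) - 1) \<le> 2 / m * A * norm (slope b powr (1/2))"
        using fl(1) eventually_slope_pos by eventually_elim (simp add: powr_half_sqrt)
    qed
    have "resolvent_norm m V (Complex (a b) b) = 1 / m * (1 + 0 + (m * resolvent_norm m V (Complex (a b) b) - 1))" for b
      using m by simp
    then show "\<exists>r \<in> O[at_top](\<lambda>b. b powr (-1/2)). \<exists>s \<in> O[at_top](\<lambda>b. slope b powr (1/2)).
           \<forall>\<^sub>F b in at_top. resolvent_norm m V (Complex (a b) b) = 1 / m * (1 + r b + s b)"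
      by - (rule bexI[OF _ zero], rule bexI[OF _ s], rule always_eventually, blast)
  qed

  show ?thesis using turning i ii1 ii2 iii iv by blast
qed

end
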